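(* Let $A$ be a mixed Hodge diagram. If the first obstruction $\theta_3\in\mathrm{Harr}^{3,-1}_{\mathrm{DB}}(H^*(A))$ to formality of $A$ is trivial, then $H^*_{\mathrm{DB}}(A)$ is a split square-zero extension of $\mathrm{Hdg}^*(A)$; that is, the surjective algebra map $\pi:H^*_{\mathrm{DB}}(A)\to\mathrm{Hdg}^*(A)$, whose kernel $JH^*(A)$ is a square-zero ideal, admits a right inverse which is a morphism of algebras.
   Context: **Mixed Hodge complexes.** Let $\Bbbk\subset\mathbb R$ be a subfield. $\mathsf{MHS}$ is the category of (finite-dimensional) $\Bbbk$-mixed Hodge structures. Filtrations on complexes are exhaustive and Hausdorff, also on cohomology. A filtration $W$ is regular if for each degree $n$ some $W_kA^n=0$; biregular if in each degree some step is $0$ and some step is everything. A filtered complex is $d$-strict if $d(W_kA)=W_kA\cap \mathrm{Im}\,d$ for all $k$. A filtered quasi-isomorphism is a filtered map inducing quasi-isomorphisms on all $Gr^W_k$. A $\Bbbk$-mixed Hodge complex $A$ of length $s$ consists of a filtered cochain complex $(A_\Bbbk,W)$ over $\Bbbk$, a bifiltered complex $(A_{\mathbb C},W,F)$ over $\mathbb C$, filtered complexes $(A_i,W)$ over $\mathbb C$ for $1\le i\le s-1$ and, setting $A_0=A_\Bbbk\otimes\mathbb C$, $A_s=A_{\mathbb C}$, filtered quasi-isomorphisms (comparison morphisms) $\varphi_{q\pm1,q}:A_{q\pm1}\to A_q$ for $q$ odd, i.e. $A_0\to A_1\leftarrow A_2\to\cdots A_s$, such that: (1) $W$ is increasing and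 regular, $F$ is decreasing and biregular, $H^*(A_\Bbbk)$ has finite type; (2) $(A_{\mathbb C},W)$, $(A_{\mathbb C},F)$, $(Gr^W_kA_{\mathbb C},F)$ and $(Gr_F^pA_{\mathbb C},W)$ are $d$-strict for all $k,p$; (3) $F$ and the comparison isomorphisms induce on $H^n(Gr^W_pA_\Bbbk)$ a pure Hodge structure of weight $p$. Quasi-isomorphisms are morphisms inducing isomorphisms on cohomology. A mixed Hodge diagram is a commutative monoid in mixed Hodge complexes for the componentwise tensor product (components are filtered cdga's, comparison morphisms are algebra maps). **Deligne–Beilinson cohomology.** We take $s$ even (if $s$ is odd, insert an identity as last comparison morphism). For $p\in\mathbb Z$ the complex $C_{\mathrm{DB}}(A,p)$ has in degree $n$ the elements $((a_i)_{\mathrm{bot}},(a_q)_{\mathrm{top}})$ with $a_0=a_\Bbbk\in(2\pi i)^pW_{2p}A_\Bbbk^{2p+n}$, $a_s=a_{\mathbb C}\in F^pW_{2p}A_{\mathbb C}^{2p+n}$, $a_i\in W_{2p}A_i^{2p+n}$ for even $0<i<s$, and $a_q\in W_{2p}A_q^{2p+n-1}$ for odd $q$; the differential is the shifted mapping cone differential of $(a_i)\mapsto(\varphi_{q-1,q}(a_{q-1})-\varphi_{q+1,q}(a_{q+1}))_q$, i.e. its top component is $\varphi_{q-1,q}(a_{q-1})-\varphi_{q+1,q}(a_{q+1})-da_q$. $H^n_{\mathrm{DB}}(A,p)$ is its cohomology and $H_{\mathrm{DB}}^*(A)=\bigoplus_pH_{\mathrm{DB}}^*(A,p)$. For $\alpha\in[0,1]$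 (with $\alpha\in\Bbbk$) there is a product on the complexes with bottom components $a_ib_i$ and top components $\alpha(a_q\varphi_{q-1,q}(b_{q-1})+(-1)^{|a|}\varphi_{q+1,q}(a_{q+1})b_q)+(1-\alpha)(a_q\varphi_{q+1,q}(b_{q+1})+(-1)^{|a|}\varphi_{q-1,q}(a_{q-1})b_q)$; all $\alpha$ induce the same associative graded-commutative product on $H^*_{\mathrm{DB}}(A)$. Identify $H^*(A_{\mathbb C})=H^*(A_\Bbbk)\otimes\mathbb C$ via the comparison morphisms and put $\mathrm{Hdg}^{m}(A,p)=(2\pi i)^pW_{2p}H^{m}(A_\Bbbk)\cap F^pW_{2p}H^{m}(A_{\mathbb C})$, $\mathrm{Hdg}^*(A)=\bigoplus_p\mathrm{Hdg}^{2p+*}(A,p)$ (an algebra under the product of $H^*(A_\Bbbk)$), $J^pH^m(A)=W_{2p}H^m(A_{\mathbb C})/((2\pi i)^pW_{2p}H^m(A_\Bbbk)+F^pW_{2p}H^m(A_{\mathbb C}))$, $JH^*(A)=\bigoplus_pJ^pH^{2p+*-1}(A)$. There is an exact sequence $0\to JH^*(A)\to H^*_{\mathrm{DB}}(A)\xrightarrow{\pi}\mathrm{Hdg}^*(A)\to0$, with $\pi$ induced by taking the cohomology class of the bottom components, exhibiting $H^*_{\mathrm{DB}}(A)$ as a square-zero extension. **The obstruction $\theta_3$.** A $C_\infty$-mixed Hodge diagram is a mixed Hodge complex with $C_\infty$-structures $m^\Bbbk$ on $A_\Bbbk$ and $m^i$ on $A_i$ preserving $W$, $m^{\mathbb C}$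 on $A_{\mathbb C}$ preserving $W$ and $F$, and $C_\infty$-morphisms extending the comparison morphisms whose components preserve $W$; $\infty$-morphisms are collections of filtration-preserving $C_\infty$-morphisms on components commuting with the comparison $\infty$-morphisms, and are $\infty$-quasi-isomorphisms if their linear part is a quasi-isomorphism. For a graded commutative algebra $H$ in $\mathsf{MHS}$, let $C^n(H)=\mathrm{Hom}_\Bbbk(H^{\otimes n}/\mathrm{Sh},H)$ ($\mathrm{Sh}$ = sum of images of shuffle products), with the Harrison differential $\delta f(x_1,\dots,x_{n+1})=x_1f(x_2,\dots,x_{n+1})+\sum_{i=1}^n(-1)^if(\dots,x_ix_{i+1},\dots)+(-1)^{n+1}f(x_1,\dots,x_n)x_{n+1}$ (with Koszul signs) and induced filtrations $W,F$. $\mathrm{Harr}_{\mathrm{DB}}^{*}(H)$ is the cohomology of the (shifted) cone of $W_0C^*(H)\oplus W_0F^0(C^*(H)\otimes\mathbb C)\to W_0(C^*(H)\otimes\mathbb C)$, $(f,g)\mapsto f-g$; a class in $\mathrm{Harr}^{k,n}_{\mathrm{DB}}(H)$ is represented by $(f_\Bbbk,f_{\mathbb C},h)$ of arities $k,k,k-1$ and homological degree $n$. Up to quasi-isomorphism $A$ has length 1, and there is a $C_\infty$-mixed Hodge diagram quasi-isomorphic to $A$ with underlying mixed Hodge complex $H^*(A)$, with $H^*(A_{\mathbb C})=H^*(A_\Bbbk)\otimes\mathbb C$ and comparison $C_\infty$-morphism $\hat\varphi$ satisfying $\hat\varphi_1=\mathrm{id}$. Then $\theta_3=[m_3^\Bbbk,m_3^{\mathbb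 C},\hat\varphi_2]\in\mathrm{Harr}_{\mathrm{DB}}^{3,-1}(H^*(A))$, independent of choices. *)

theory Defs
  imports Complex_Main "HOL-Library.Function_Algebras" "HOL-Library.Product_Plus"
    "HOL-Library.Set_Algebras"
begin

text \<open>
  Conventions. Graded vector spaces are families \<open>V :: int \<Rightarrow> 'a set\<close> of linear subspaces of one
  ambient complex vector space; no relation between the members of the family is assumed, so the
  same vector may lie in several degrees.  Therefore homogeneous elements are fed to multilinear
  operations as pairs (degree, vector), and a family of operations of all arities (a C-infinity
  structure, say) is one function on lists of such pairs, the arity being the length of the list.
  Quotients are taken as sets of cosets \<open>x +o B\<close>; sums of subspaces and of cosets are the \<open>+\<close> of
  \<^theory>\<open>HOL-Library.Set_Algebras\<close>.
\<close>

section \<open>Linear algebra over a subfield of the reals and over the complex numbers\<close>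

class complex_vector = ab_group_add +
  fixes scaleC :: "complex \<Rightarrow> 'a \<Rightarrow> 'a" (infixr "*\<^sub>C" 75)
  assumes scaleC_add_right: "c *\<^sub>C (x + y) = c *\<^sub>C x + c *\<^sub>C y"
    and scaleC_add_left: "(c + d) *\<^sub>C x = c *\<^sub>C x + d *\<^sub>C x"
    and scaleC_scaleC: "c *\<^sub>C d *\<^sub>C x = (c * d) *\<^sub>C x"
    and scaleC_one: "1 *\<^sub>C x = x"

lemma vector_space_scaleC: "vector_space (scaleC :: complex \<Rightarrow> 'a \<Rightarrow> 'a::complex_vector)"
  by unfold_locales (simp_all add: scaleC_add_right scaleC_add_left scaleC_scaleC scaleC_one)

definition real_subfield :: "complex set \<Rightarrow> bool" where
  "real_subfield K \<longleftrightarrow> K \<subseteq> \<real> \<and> 0 \<in> K \<and> 1 \<in> K \<and>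
     (\<forall>x\<in>K. \<forall>y\<in>K. x + y \<in> K \<and> x * y \<in> K) \<and> (\<forall>x\<in>K. - x \<in> K \<and> inverse x \<in> K)"

definition subspace_over :: "complex set \<Rightarrow> 'a::complex_vector set \<Rightarrow> bool" where
  "subspace_over K S \<longleftrightarrow> 0 \<in> S \<and> (\<forall>x\<in>S. \<forall>y\<in>S. x + y \<in> S) \<and> (\<forall>c\<in>K. \<forall>x\<in>S. c *\<^sub>C x \<in> S)"

definition span_over :: "complex set \<Rightarrow> 'a::complex_vector set \<Rightarrow> 'a set" where
  "span_over K S = {(\<Sum>a\<in>t. c a *\<^sub>C a) | t c. finite t \<and> t \<subseteq> S \<and> c ` t \<subseteq> K}"

definition indep_over :: "complex set \<Rightarrow> 'a::complex_vector set \<Rightarrow> bool" where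
  "indep_over K S \<longleftrightarrow> (\<forall>t c. finite t \<and> t \<subseteq> S \<and> c ` t \<subseteq> K \<and> (\<Sum>a\<in>t. c a *\<^sub>C a) = 0
     \<longrightarrow> (\<forall>a\<in>t. c a = 0))"

text \<open>
  \<open>R\<close> is a \<open>K\<close>-structure on the complex vector space \<open>V\<close>: the canonical map from the tensor product
  of \<open>R\<close> with the complex numbers over \<open>K\<close> to \<open>V\<close> is bijective (surjectivity is the span condition,
  injectivity the preservation of linear independence).
\<close>

definition K_structure :: "complex set \<Rightarrow> 'a::complex_vector set \<Rightarrow> 'a set \<Rightarrow> bool" where
  "K_structure K V R \<longleftrightarrow> subspace_over K R \<and> span_over UNIV R = V \<and>
     (\<forall>S\<subseteq>R. indep_over K S \<longrightarrow> indep_over UNIV S)"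

definition conjugate_wrt :: "'a::complex_vector set \<Rightarrow> 'a \<Rightarrow> 'a \<Rightarrow> bool" where
  "conjugate_wrt R x x' \<longleftrightarrow> (\<exists>t c. finite t \<and> t \<subseteq> R \<and>
     x = (\<Sum>a\<in>t. c a *\<^sub>C a) \<and> x' = (\<Sum>a\<in>t. cnj (c a) *\<^sub>C a))"

definition linear_between ::
  "'a::complex_vector set \<Rightarrow> 'b::complex_vector set \<Rightarrow> ('a \<Rightarrow> 'b) \<Rightarrow> bool" where
  "linear_between V V' f \<longleftrightarrow> (\<forall>x\<in>V. f x \<in> V' \<and> (\<forall>c. f (c *\<^sub>C x) = c *\<^sub>C f x)) \<and>
     (\<forall>x\<in>V. \<forall>y\<in>V. f (x + y) = f x + f y)"

text \<open>\<open>f\<close> induces a bijection from \<open>Z / B\<close> to \<open>Z' / B'\<close>.\<close>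

definition quotient_iso ::
  "('a::complex_vector \<Rightarrow> 'b::complex_vector) \<Rightarrow> 'a set \<Rightarrow> 'a set \<Rightarrow> 'b set \<Rightarrow> 'b set \<Rightarrow> bool" where
  "quotient_iso f Z B Z' B' \<longleftrightarrow> f ` Z \<subseteq> Z' \<and> f ` B \<subseteq> B' \<and>
     (\<forall>x\<in>Z. f x \<in> B' \<longrightarrow> x \<in> B) \<and> (\<forall>y\<in>Z'. \<exists>x\<in>Z. f x - y \<in> B')"

section \<open>Filtered complexes\<close>

type_synonym 'a graded = "int \<Rightarrow> 'a set"
type_synonym 'a filtered = "int \<Rightarrow> int \<Rightarrow> 'a set"  \<comment> \<open>filtration index first, degree second\<close>

definition cocycles :: "'a::complex_vector graded \<Rightarrow> (int \<Rightarrow> 'a \<Rightarrow> 'a) \<Rightarrow> 'a graded" where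
  "cocycles V d n = {x \<in> V n. d n x = 0}"

definition coboundaries :: "'a::complex_vector graded \<Rightarrow> (int \<Rightarrow> 'a \<Rightarrow> 'a) \<Rightarrow> 'a graded" where
  "coboundaries V d n = d (n - 1) ` V (n - 1)"

definition cochain_complex :: "'a::complex_vector graded \<Rightarrow> (int \<Rightarrow> 'a \<Rightarrow> 'a) \<Rightarrow> bool" where
  "cochain_complex V d \<longleftrightarrow> (\<forall>n. subspace_over UNIV (V n) \<and> linear_between (V n) (V (n + 1)) (d n)
     \<and> (\<forall>x\<in>V n. d (n + 1) (d n x) = 0))"

text \<open>Increasing filtrations, exhaustive and Hausdorff both on the complex and on cohomology.\<close>

definition filtered_complex ::
  "'a::complex_vector graded \<Rightarrow> (int \<Rightarrow> 'a \<Rightarrow> 'a) \<Rightarrow> 'a filtered \<Rightarrow> bool" where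
  "filtered_complex V d G \<longleftrightarrow> cochain_complex V d \<and>
     (\<forall>k n. subspace_over UNIV (G k n) \<and> G k n \<subseteq> G (k + 1) n \<and> d n ` G k n \<subseteq> G k (n + 1)) \<and>
     (\<forall>n. (\<Union>k. G k n) = V n \<and> (\<Inter>k. G k n) = {0}) \<and>
     (\<forall>n. (\<Union>k. G k n \<inter> cocycles V d n + coboundaries V d n) = cocycles V d n \<and>
          (\<Inter>k. G k n \<inter> cocycles V d n + coboundaries V d n) = coboundaries V d n)"

text \<open>
  The next two define the cocycles and coboundaries of the \<open>k\<close>-th graded piece, as subspaces of
  \<open>G k n\<close>: the cohomology of the graded piece is their quotient.
\<close>

definition gr_cocycles :: "(int \<Rightarrow> 'a::complex_vector \<Rightarrow> 'a) \<Rightarrow> 'a filtered \<Rightarrow> 'a filtered" where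
  "gr_cocycles d G k n = {x \<in> G k n. d n x \<in> G (k - 1) (n + 1)}"

definition gr_coboundaries :: "(int \<Rightarrow> 'a::complex_vector \<Rightarrow> 'a) \<Rightarrow> 'a filtered \<Rightarrow> 'a filtered" where
  "gr_coboundaries d G k n = d (n - 1) ` G k (n - 1) + G (k - 1) n"

definition filtered_quasi_iso ::
  "'a::complex_vector graded \<Rightarrow> (int \<Rightarrow> 'a \<Rightarrow> 'a) \<Rightarrow> 'a filtered \<Rightarrow>
   'b::complex_vector graded \<Rightarrow> (int \<Rightarrow> 'b \<Rightarrow> 'b) \<Rightarrow> 'b filtered \<Rightarrow> (int \<Rightarrow> 'a \<Rightarrow> 'b) \<Rightarrow> bool" where
  "filtered_quasi_iso V d G V' d' G' f \<longleftrightarrow>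
     (\<forall>n. linear_between (V n) (V' n) (f n) \<and> (\<forall>x\<in>V n. f (n + 1) (d n x) = d' n (f n x))) \<and>
     (\<forall>k n. f n ` G k n \<subseteq> G' k n \<and>
        quotient_iso (f n) (gr_cocycles d G k n) (gr_coboundaries d G k n)
                           (gr_cocycles d' G' k n) (gr_coboundaries d' G' k n))"

text \<open>
  Strictness of the differential of the quotient complex \<open>X / E\<close> for the filtration with steps
  \<open>(G k + E) / E\<close>, written in terms of preimages in \<open>X\<close>.
\<close>

definition strict_mod ::
  "(int \<Rightarrow> 'a::complex_vector \<Rightarrow> 'a) \<Rightarrow> 'a graded \<Rightarrow> 'a filtered \<Rightarrow> 'a graded \<Rightarrow> bool" where
  "strict_mod d X G E \<longleftrightarrow> (\<forall>k n. d n ` G k n + E (n + 1) =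
     (G k (n + 1) + E (n + 1)) \<inter> (d n ` X n + E (n + 1)))"

section \<open>Mixed Hodge complexes and mixed Hodge diagrams\<close>

text \<open>
  For a diagram of length \<open>s = len A\<close>, \<open>cpt A i\<close> (for \<open>i \<le> s\<close>) is the \<open>i\<close>-th complex; the component
  over \<open>K\<close> is given by the \<open>K\<close>-structure \<open>rat A\<close> on \<open>cpt A 0\<close>, which is its complexification.  The
  weight filtration is \<open>wt A i k n\<close> (filtration index \<open>k\<close>, degree \<open>n\<close>); over \<open>K\<close> it is
  \<open>wt A 0 k n \<inter> rat A n\<close>.  \<open>hdg A p n\<close> is the decreasing filtration \<open>F\<close> of the last component.
  \<open>cmp A r q\<close> is the comparison morphism from component \<open>r\<close> to component \<open>q\<close>.  Values for
  indices outside these ranges are irrelevant.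
\<close>

record 'a mhc =
  len :: nat
  cpt :: "nat \<Rightarrow> 'a graded"
  rat :: "'a graded"
  wt :: "nat \<Rightarrow> 'a filtered"
  hdg :: "'a filtered"
  dif :: "nat \<Rightarrow> int \<Rightarrow> 'a \<Rightarrow> 'a"
  cmp :: "nat \<Rightarrow> nat \<Rightarrow> int \<Rightarrow> 'a \<Rightarrow> 'a"

definition arrows :: "nat \<Rightarrow> (nat \<times> nat) set" where
  "arrows s = {(r, q). odd q \<and> q \<le> s \<and> r \<le> s \<and> (q = r + 1 \<or> r = q + 1)}"

definition cocyc :: "('a::complex_vector, 'z) mhc_scheme \<Rightarrow> nat \<Rightarrow> 'a graded" where
  "cocyc A i = cocycles (cpt A i) (dif A i)"

definition cobd :: "('a::complex_vector, 'z) mhc_scheme \<Rightarrow> nat \<Rightarrow> 'a graded" where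
  "cobd A i = coboundaries (cpt A i) (dif A i)"

text \<open>
  The identification of a class in \<open>Z 0 / B 0\<close> with one in \<open>Z s / B s\<close> through the zigzag of
  comparison morphisms, on representatives (degree \<open>n\<close>).
\<close>

definition corresponds ::
  "('a::complex_vector, 'z) mhc_scheme \<Rightarrow> int \<Rightarrow> (nat \<Rightarrow> 'a set) \<Rightarrow> (nat \<Rightarrow> 'a set) \<Rightarrow> 'a \<Rightarrow> 'a \<Rightarrow> bool"
  where
  "corresponds A n Z B x y \<longleftrightarrow> (\<exists>z. z 0 = x \<and> z (len A) = y \<and> (\<forall>i\<le>len A. z i \<in> Z i) \<and>
     (\<forall>(r, q)\<in>arrows (len A). cmp A r q n (z r) - z q \<in> B q))"

text \<open>
  Purity of weight \<open>p\<close> of the degree \<open>n\<close> cohomology of the \<open>p\<close>-th weight graded piece: the induced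
  filtration \<open>F\<close> and its conjugate are \<open>p\<close>-opposed.  \<open>FH a\<close> and \<open>FbarH a\<close> are the preimages of the
  filtration steps in the cocycles of the graded piece.
\<close>

definition pure_graded_cohomology :: "('a::complex_vector, 'z) mhc_scheme \<Rightarrow> int \<Rightarrow> int \<Rightarrow> bool" where
  "pure_graded_cohomology A p n \<longleftrightarrow>
    (let s = len A;
         Z = (\<lambda>i. gr_cocycles (dif A i) (wt A i) p n);
         B = (\<lambda>i. gr_coboundaries (dif A i) (wt A i) p n);
         FH = (\<lambda>a. hdg A a n \<inter> Z s + B s);
         FbarH = (\<lambda>a. {y'. \<exists>y\<in>FH a. \<exists>x x'. corresponds A n Z B x y \<and>
                    conjugate_wrt (rat A n) x x' \<and> corresponds A n Z B x' y'})
     in \<forall>a. FH a + FbarH (p + 1 - a) = Z s \<and> FH a \<inter> FbarH (p + 1 - a) = B s)"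

definition mixed_hodge_complex ::
  "complex set \<Rightarrow> ('a::complex_vector, 'z) mhc_scheme \<Rightarrow> bool" where
  "mixed_hodge_complex K A \<longleftrightarrow>
    (let s = len A; V = cpt A s; d = dif A s; W = wt A s; F = hdg A in
     1 \<le> s \<and>
     (\<forall>i\<le>s. filtered_complex (cpt A i) (dif A i) (wt A i) \<and> (\<forall>n. \<exists>k. wt A i k n = {0})) \<and>
     (\<forall>n. K_structure K (cpt A 0 n) (rat A n) \<and> dif A 0 n ` rat A n \<subseteq> rat A (n + 1)) \<and>
     (\<forall>k n. span_over UNIV (wt A 0 k n \<inter> rat A n) = wt A 0 k n) \<and>
     filtered_complex V d (\<lambda>p. F (- p)) \<and>
     (\<forall>n. (\<exists>p. F p n = {0}) \<and> (\<exists>p. F p n = V n)) \<and>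
     (\<forall>n. \<exists>S. finite S \<and> S \<subseteq> cocycles (rat A) (dif A 0) n \<and>
        cocycles (rat A) (dif A 0) n \<subseteq> span_over K S + coboundaries (rat A) (dif A 0) n) \<and>
     (\<forall>(r, q)\<in>arrows s. filtered_quasi_iso (cpt A r) (dif A r) (wt A r)
        (cpt A q) (dif A q) (wt A q) (cmp A r q)) \<and>
     strict_mod d V W (\<lambda>n. {0}) \<and>
     strict_mod d V F (\<lambda>n. {0}) \<and>
     (\<forall>k. strict_mod d (W k) (\<lambda>p n. F p n \<inter> W k n) (W (k - 1))) \<and>
     (\<forall>p. strict_mod d (F p) (\<lambda>k n. W k n \<inter> F p n) (F (p + 1))) \<and>
     (\<forall>p n. pure_graded_cohomology A p n))"

record 'a mhd = "'a mhc" +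
  mul :: "nat \<Rightarrow> int \<Rightarrow> int \<Rightarrow> 'a \<Rightarrow> 'a \<Rightarrow> 'a"
  unt :: "nat \<Rightarrow> 'a"

definition sgn_pow :: "int \<Rightarrow> 'a::complex_vector \<Rightarrow> 'a" where
  "sgn_pow e x = (if even e then x else - x)"

definition cdga :: "'a::complex_vector graded \<Rightarrow> (int \<Rightarrow> 'a \<Rightarrow> 'a) \<Rightarrow>
    (int \<Rightarrow> int \<Rightarrow> 'a \<Rightarrow> 'a \<Rightarrow> 'a) \<Rightarrow> 'a \<Rightarrow> bool" where
  "cdga V d \<mu> u \<longleftrightarrow> cochain_complex V d \<and>
     (\<forall>a b. \<forall>x\<in>V a. linear_between (V b) (V (a + b)) (\<mu> a b x)) \<and>
     (\<forall>a b. \<forall>y\<in>V b. linear_between (V a) (V (a + b)) (\<lambda>x. \<mu> a b x y)) \<and>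
     (\<forall>a b c. \<forall>x\<in>V a. \<forall>y\<in>V b. \<forall>z\<in>V c.
        \<mu> (a + b) c (\<mu> a b x y) z = \<mu> a (b + c) x (\<mu> b c y z)) \<and>
     (\<forall>a b. \<forall>x\<in>V a. \<forall>y\<in>V b. \<mu> a b x y = sgn_pow (a * b) (\<mu> b a y x) \<and>
        d (a + b) (\<mu> a b x y) = \<mu> (a + 1) b (d a x) y + sgn_pow a (\<mu> a (b + 1) x (d b y))) \<and>
     u \<in> V 0 \<and> d 0 u = 0 \<and> (\<forall>a. \<forall>x\<in>V a. \<mu> 0 a u x = x)"

definition mixed_hodge_diagram :: "complex set \<Rightarrow> 'a::complex_vector mhd \<Rightarrow> bool" where
  "mixed_hodge_diagram K A \<longleftrightarrow> mixed_hodge_complex K A \<and>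
     (\<forall>i\<le>len A. cdga (cpt A i) (dif A i) (mul A i) (unt A i) \<and> unt A i \<in> wt A i 0 0 \<and>
        (\<forall>k l a b. \<forall>x\<in>wt A i k a. \<forall>y\<in>wt A i l b. mul A i a b x y \<in> wt A i (k + l) (a + b))) \<and>
     unt A 0 \<in> rat A 0 \<and>
     (\<forall>a b. \<forall>x\<in>rat A a. \<forall>y\<in>rat A b. mul A 0 a b x y \<in> rat A (a + b)) \<and>
     unt A (len A) \<in> hdg A 0 0 \<and>
     (\<forall>p q a b. \<forall>x\<in>hdg A p a. \<forall>y\<in>hdg A q b. mul A (len A) a b x y \<in> hdg A (p + q) (a + b)) \<and>
     (\<forall>(r, q)\<in>arrows (len A). cmp A r q 0 (unt A r) = unt A q \<and>
        (\<forall>a b. \<forall>x\<in>cpt A r a. \<forall>y\<in>cpt A r b. cmp A r q (a + b) (mul A r a b x y) =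
           mul A q a b (cmp A r q a x) (cmp A r q b y)))"

text \<open>Insertion of identities as last comparison morphisms, up to total length \<open>L \<ge> len A\<close>.\<close>

definition pad_mhc :: "nat \<Rightarrow> ('a, 'z) mhc_scheme \<Rightarrow> ('a, 'z) mhc_scheme" where
  "pad_mhc L A = A\<lparr> len := L,
     cpt := (\<lambda>i. cpt A (min i (len A))),
     wt := (\<lambda>i. wt A (min i (len A))),
     dif := (\<lambda>i. dif A (min i (len A))),
     cmp := (\<lambda>r q n x. if r \<le> len A \<and> q \<le> len A then cmp A r q n x else x) \<rparr>"

definition pad_mhd :: "nat \<Rightarrow> 'a mhd \<Rightarrow> 'a mhd" where
  "pad_mhd L A = (pad_mhc L A)\<lparr> mul := (\<lambda>i. mul A (min i (len A))),
     unt := (\<lambda>i. unt A (min i (len A))) \<rparr>"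

definition even_length :: "'a mhd \<Rightarrow> 'a mhd" where
  "even_length A = (if even (len A) then A else pad_mhd (len A + 1) A)"

section \<open>Deligne--Beilinson cohomology and Hodge classes\<close>

text \<open>
  In this section \<open>len A\<close> is even.  A cochain is a function \<open>a\<close> on the indices \<open>i \<le> len A\<close>
  (and zero beyond): \<open>a i\<close> is a bottom component for even \<open>i\<close> and a top component for odd \<open>i\<close>.
\<close>

definition tate :: "int \<Rightarrow> complex" where
  "tate p = (2 * complex_of_real pi * \<i>) powi p"

definition db_cochains :: "'a::complex_vector mhd \<Rightarrow> int \<Rightarrow> int \<Rightarrow> (nat \<Rightarrow> 'a) set" where
  "db_cochains A p n = {a.
     a 0 \<in> (\<lambda>x. tate p *\<^sub>C x) ` (wt A 0 (2 * p) (2 * p + n) \<inter> rat A (2 * p + n)) \<and>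
     a (len A) \<in> hdg A p (2 * p + n) \<inter> wt A (len A) (2 * p) (2 * p + n) \<and>
     (\<forall>i. even i \<and> 0 < i \<and> i < len A \<longrightarrow> a i \<in> wt A i (2 * p) (2 * p + n)) \<and>
     (\<forall>q. odd q \<and> q < len A \<longrightarrow> a q \<in> wt A q (2 * p) (2 * p + n - 1)) \<and>
     (\<forall>i > len A. a i = 0)}"

definition db_diff ::
  "'a::complex_vector mhd \<Rightarrow> int \<Rightarrow> int \<Rightarrow> (nat \<Rightarrow> 'a) \<Rightarrow> (nat \<Rightarrow> 'a)" where
  "db_diff A p n a = (\<lambda>i.
     if i > len A then 0
     else if even i then dif A i (2 * p + n) (a i)
     else cmp A (i - 1) i (2 * p + n) (a (i - 1)) - cmp A (i + 1) i (2 * p + n) (a (i + 1))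
          - dif A i (2 * p + n - 1) (a i))"

definition db_mult :: "real \<Rightarrow> 'a::complex_vector mhd \<Rightarrow> int \<Rightarrow> int \<Rightarrow> int \<Rightarrow> int \<Rightarrow>
    (nat \<Rightarrow> 'a) \<Rightarrow> (nat \<Rightarrow> 'a) \<Rightarrow> (nat \<Rightarrow> 'a)" where
  "db_mult \<alpha> A p n p' n' a b = (\<lambda>i.
     let m = 2 * p + n; m' = 2 * p' + n' in
     if i > len A then 0
     else if even i then mul A i m m' (a i) (b i)
     else complex_of_real \<alpha> *\<^sub>C
            (mul A i (m - 1) m' (a i) (cmp A (i - 1) i m' (b (i - 1)))
             + sgn_pow n (mul A i m (m' - 1) (cmp A (i + 1) i m (a (i + 1))) (b i)))
        + complex_of_real (1 - \<alpha>) *\<^sub>C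
            (mul A i (m - 1) m' (a i) (cmp A (i + 1) i m' (b (i + 1)))
             + sgn_pow n (mul A i m (m' - 1) (cmp A (i - 1) i m (a (i - 1))) (b i))))"

definition db_unit :: "'a::complex_vector mhd \<Rightarrow> nat \<Rightarrow> 'a" where
  "db_unit A = (\<lambda>i. if even i \<and> i \<le> len A then unt A i else 0)"

definition db_cocycles :: "'a::complex_vector mhd \<Rightarrow> int \<Rightarrow> int \<Rightarrow> (nat \<Rightarrow> 'a) set" where
  "db_cocycles A p n = {a \<in> db_cochains A p n. db_diff A p n a = 0}"

definition db_coboundaries :: "'a::complex_vector mhd \<Rightarrow> int \<Rightarrow> int \<Rightarrow> (nat \<Rightarrow> 'a) set" where
  "db_coboundaries A p n = db_diff A p (n - 1) ` db_cochains A p (n - 1)"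

text \<open>
  Algebras over \<open>K\<close> bigraded by the pair \<open>(p, n)\<close>; elements are cosets and addition is the
  elementwise sum of cosets.
\<close>

record 'x bigraded_algebra =
  piece :: "int \<Rightarrow> int \<Rightarrow> 'x set"
  scal :: "int \<Rightarrow> int \<Rightarrow> complex \<Rightarrow> 'x \<Rightarrow> 'x"
  times_of :: "int \<Rightarrow> int \<Rightarrow> int \<Rightarrow> int \<Rightarrow> 'x \<Rightarrow> 'x \<Rightarrow> 'x"
  unit_of :: 'x

definition bigraded_algebra_hom :: "complex set \<Rightarrow> 'x::plus bigraded_algebra \<Rightarrow>
    'y::plus bigraded_algebra \<Rightarrow> (int \<Rightarrow> int \<Rightarrow> 'x \<Rightarrow> 'y) \<Rightarrow> bool" where
  "bigraded_algebra_hom K P Q f \<longleftrightarrow>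
     (\<forall>p n. \<forall>x\<in>piece P p n. f p n x \<in> piece Q p n \<and>
        (\<forall>c\<in>K. f p n (scal P p n c x) = scal Q p n c (f p n x)) \<and>
        (\<forall>y\<in>piece P p n. f p n (x + y) = f p n x + f p n y)) \<and>
     (\<forall>p n p' n'. \<forall>x\<in>piece P p n. \<forall>y\<in>piece P p' n'.
        f (p + p') (n + n') (times_of P p n p' n' x y) =
        times_of Q p n p' n' (f p n x) (f p' n' y)) \<and>
     f 0 0 (unit_of P) = unit_of Q"

definition H_DB :: "real \<Rightarrow> 'a::complex_vector mhd \<Rightarrow> (nat \<Rightarrow> 'a) set bigraded_algebra" where
  "H_DB \<alpha> A = \<lparr>
     piece = (\<lambda>p n. (\<lambda>z. z +o db_coboundaries A p n) ` db_cocycles A p n),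
     scal = (\<lambda>p n c X. (\<lambda>z i. c *\<^sub>C z i) ` X + db_coboundaries A p n),
     times_of = (\<lambda>p n p' n' X Y. \<Union>a\<in>X. \<Union>b\<in>Y.
        db_mult \<alpha> A p n p' n' a b +o db_coboundaries A (p + p') (n + n')),
     unit_of = db_unit A +o db_coboundaries A 0 0 \<rparr>"

text \<open>
  The following three are the preimages, in the cocycles of the last component, of
  \<open>(2 \<pi> i)\<^sup>p W\<^sub>2\<^sub>p H\<^sup>m(A\<^sub>K)\<close>, \<open>F\<^sup>p H\<^sup>m(A\<^sub>C)\<close> and \<open>W\<^sub>k H\<^sup>m(A\<^sub>C)\<close> (where \<open>H\<^sup>m(A\<^sub>K)\<close> is carried into
  \<open>H\<^sup>m(A\<^sub>C)\<close> by the comparison isomorphisms).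
\<close>

definition rat_classes :: "('a::complex_vector, 'z) mhc_scheme \<Rightarrow> int \<Rightarrow> int \<Rightarrow> 'a set" where
  "rat_classes A p m = {y. \<exists>x \<in> wt A 0 (2 * p) m \<inter> rat A m. dif A 0 m x = 0 \<and>
     corresponds A m (\<lambda>i. cocyc A i m) (\<lambda>i. cobd A i m) (tate p *\<^sub>C x) y}"

definition F_classes :: "('a::complex_vector, 'z) mhc_scheme \<Rightarrow> int \<Rightarrow> int \<Rightarrow> 'a set" where
  "F_classes A p m = hdg A p m \<inter> cocyc A (len A) m + cobd A (len A) m"

definition W_classes :: "('a::complex_vector, 'z) mhc_scheme \<Rightarrow> int \<Rightarrow> int \<Rightarrow> 'a set" where
  "W_classes A k m = wt A (len A) k m \<inter> cocyc A (len A) m + cobd A (len A) m"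

definition Hdg :: "'a::complex_vector mhd \<Rightarrow> 'a set bigraded_algebra" where
  "Hdg A = (let s = len A in \<lparr>
     piece = (\<lambda>p n. (\<lambda>y. y +o cobd A s (2 * p + n)) `
        (rat_classes A p (2 * p + n) \<inter>
         (F_classes A p (2 * p + n) \<inter> W_classes A (2 * p) (2 * p + n)))),
     scal = (\<lambda>p n c X. (\<lambda>y. c *\<^sub>C y) ` X + cobd A s (2 * p + n)),
     times_of = (\<lambda>p n p' n' X Y. \<Union>x\<in>X. \<Union>y\<in>Y.
        mul A s (2 * p + n) (2 * p' + n') x y +o cobd A s (2 * (p + p') + (n + n'))),
     unit_of = unt A s +o cobd A s 0 \<rparr>)"

text \<open>
  The map \<open>\<pi>\<close> to Hodge classes: in the cohomology of the last component the classes of all bottom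
  components of a cocycle are identified with the class of \<open>a (len A)\<close>.
\<close>

definition db_proj :: "'a::complex_vector mhd \<Rightarrow> int \<Rightarrow> int \<Rightarrow> (nat \<Rightarrow> 'a) set \<Rightarrow> 'a set" where
  "db_proj A p n X = (\<lambda>a. a (len A)) ` X + cobd A (len A) (2 * p + n)"

text \<open>\<open>J_den\<close> is the preimage of the denominator in the definition of the intermediate Jacobian.\<close>

definition J_den :: "'a::complex_vector mhd \<Rightarrow> int \<Rightarrow> int \<Rightarrow> 'a set" where
  "J_den A p m = rat_classes A p m + F_classes A p m \<inter> W_classes A (2 * p) m"

definition JH :: "'a::complex_vector mhd \<Rightarrow> int \<Rightarrow> int \<Rightarrow> 'a set set" where
  "JH A p n = (\<lambda>y. y +o J_den A p (2 * p + n - 1)) ` W_classes A (2 * p) (2 * p + n - 1)"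

text \<open>
  The inclusion of \<open>JH\<close>: a class of the last component is represented by a cocycle of weight \<open>2 p\<close>
  and sent by the last comparison morphism to the last top component.
\<close>

definition J_incl :: "'a::complex_vector mhd \<Rightarrow> int \<Rightarrow> int \<Rightarrow> 'a set \<Rightarrow> (nat \<Rightarrow> 'a) set" where
  "J_incl A p n X = (let s = len A; m = 2 * p + n - 1 in
     \<Union>y \<in> X \<inter> wt A s (2 * p) m.
       (\<lambda>i. if i = s - 1 then cmp A s (s - 1) m y else 0) +o db_coboundaries A p n)"

definition db_kernel :: "real \<Rightarrow> 'a::complex_vector mhd \<Rightarrow> int \<Rightarrow> int \<Rightarrow> (nat \<Rightarrow> 'a) set set" where
  "db_kernel \<alpha> A p n =
     {X \<in> piece (H_DB \<alpha> A) p n. db_proj A p n X = cobd A (len A) (2 * p + n)}"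

definition split_square_zero_extension ::
  "complex set \<Rightarrow> real \<Rightarrow> 'a::complex_vector mhd \<Rightarrow> bool" where
  "split_square_zero_extension K \<alpha> A \<longleftrightarrow>
     bigraded_algebra_hom K (H_DB \<alpha> A) (Hdg A) (db_proj A) \<and>
     (\<forall>p n. db_proj A p n ` piece (H_DB \<alpha> A) p n = piece (Hdg A) p n) \<and>
     (\<forall>p n. bij_betw (J_incl A p n) (JH A p n) (db_kernel \<alpha> A p n) \<and>
        (\<forall>X\<in>JH A p n. \<forall>Y\<in>JH A p n. J_incl A p n (X + Y) = J_incl A p n X + J_incl A p n Y) \<and>
        (\<forall>c\<in>K. \<forall>X\<in>JH A p n.
           J_incl A p n ((\<lambda>y. c *\<^sub>C y) ` X + J_den A p (2 * p + n - 1)) =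
           scal (H_DB \<alpha> A) p n c (J_incl A p n X))) \<and>
     (\<forall>p n p' n'. \<forall>X\<in>db_kernel \<alpha> A p n. \<forall>Y\<in>db_kernel \<alpha> A p' n'.
        times_of (H_DB \<alpha> A) p n p' n' X Y = db_coboundaries A (p + p') (n + n')) \<and>
     (\<exists>\<sigma>. bigraded_algebra_hom K (Hdg A) (H_DB \<alpha> A) \<sigma> \<and>
        (\<forall>p n. \<forall>x\<in>piece (Hdg A) p n. db_proj A p n (\<sigma> p n x) = x))"

section \<open>C-infinity algebras and morphisms\<close>

type_synonym 'a hlist = "(int \<times> 'a) list"

definition homog :: "'a graded \<Rightarrow> 'a hlist set" where
  "homog V = {xs. \<forall>(n, x)\<in>set xs. x \<in> V n}"

definition deg :: "'a hlist \<Rightarrow> int" where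
  "deg xs = sum_list (map fst xs)"

text \<open>
  The parameter \<open>e\<close> encodes the degrees of the operations: the operation of arity \<open>r\<close> has degree
  \<open>e - r\<close>, so \<open>e = 2\<close> for the structure maps of an A-infinity algebra and \<open>e = 1\<close> for the
  components of an A-infinity morphism.
\<close>

definition maps_into ::
  "'a graded \<Rightarrow> 'b graded \<Rightarrow> int \<Rightarrow> ('a hlist \<Rightarrow> 'b) \<Rightarrow> bool" where
  "maps_into V V' e f \<longleftrightarrow>
     (\<forall>xs\<in>homog V. xs \<noteq> [] \<longrightarrow> f xs \<in> V' (deg xs + e - int (length xs)))"

definition multilinear ::
  "'a::complex_vector graded \<Rightarrow> 'b::complex_vector graded \<Rightarrow> int \<Rightarrow> ('a hlist \<Rightarrow> 'b) \<Rightarrow> bool" where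
  "multilinear V V' e f \<longleftrightarrow> maps_into V V' e f \<and>
     (\<forall>us\<in>homog V. \<forall>vs\<in>homog V. \<forall>n. \<forall>x\<in>V n. \<forall>y\<in>V n. \<forall>c.
        f (us @ (n, x + y) # vs) = f (us @ (n, x) # vs) + f (us @ (n, y) # vs) \<and>
        f (us @ (n, c *\<^sub>C x) # vs) = c *\<^sub>C f (us @ (n, x) # vs))"

text \<open>The operations send \<open>G k\<^sub>1 \<otimes> \<dots> \<otimes> G k\<^sub>r\<close> to \<open>G' (k\<^sub>1 + \<dots> + k\<^sub>r)\<close>.\<close>

definition filtration_preserving :: "'a filtered \<Rightarrow> 'b filtered \<Rightarrow> int \<Rightarrow> ('a hlist \<Rightarrow> 'b) \<Rightarrow> bool" where
  "filtration_preserving G G' e f \<longleftrightarrow>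
     (\<forall>ts. ts \<noteq> [] \<and> (\<forall>(k, n, x)\<in>set ts. x \<in> G k n) \<longrightarrow>
        f (map snd ts) \<in> G' (sum_list (map fst ts)) (deg (map snd ts) + e - int (length ts)))"

text \<open>
  The terms of the shuffle product of two tensors, each with the exponent of its sign: the sign of
  the permutation times the Koszul sign (computed with the unshifted degrees).
\<close>

fun signed_shuffles :: "'a hlist \<Rightarrow> 'a hlist \<Rightarrow> (int \<times> 'a hlist) list" where
  "signed_shuffles [] ys = [(0, ys)]"
| "signed_shuffles (x # xs) [] = [(0, x # xs)]"
| "signed_shuffles (x # xs) (y # ys) =
     map (\<lambda>(e, zs). (e, x # zs)) (signed_shuffles xs (y # ys)) @
     map (\<lambda>(e, zs). (e + fst y * deg (x # xs) + int (length (x # xs)), y # zs))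
       (signed_shuffles (x # xs) ys)"

definition vanishes_on_shuffles ::
  "'a graded \<Rightarrow> ('a hlist \<Rightarrow> 'b::complex_vector) \<Rightarrow> bool" where
  "vanishes_on_shuffles V f \<longleftrightarrow> (\<forall>xs\<in>homog V. \<forall>ys\<in>homog V. xs \<noteq> [] \<and> ys \<noteq> [] \<longrightarrow>
     (\<Sum>(e, zs)\<leftarrow>signed_shuffles xs ys. sgn_pow e (f zs)) = 0)"

text \<open>
  \<open>insert_op f m xs\<close> is the sum of \<open>(-1)\<^sup>r\<^sup>+\<^sup>s\<^sup>t f (1\<^sup>r \<otimes> m\<^sub>s \<otimes> 1\<^sup>t)\<close> over \<open>r + s + t = length xs\<close>, \<open>s \<ge> 1\<close>,
  evaluated on \<open>xs\<close> with the Koszul sign of moving \<open>m\<^sub>s\<close> (of degree \<open>2 - s\<close>) past the first \<open>r\<close>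
  arguments.
\<close>

definition insert_op ::
  "('a hlist \<Rightarrow> 'b::complex_vector) \<Rightarrow> ('a hlist \<Rightarrow> 'a) \<Rightarrow> 'a hlist \<Rightarrow> 'b" where
  "insert_op f m xs = (\<Sum>r<length xs. \<Sum>s=1..length xs - r.
     let us = take r xs; ys = take s (drop r xs); vs = drop (r + s) xs in
     sgn_pow (int r + int s * int (length vs) + int s * deg us)
       (f (us @ (deg ys + 2 - int s, m ys) # vs)))"

text \<open>
  For a decomposition of a list into \<open>r\<close> blocks of lengths \<open>i\<^sub>1, \<dots>, i\<^sub>r\<close>: the exponent
  \<open>\<Sum>\<^sub>j (r - j) (i\<^sub>j - 1)\<close> plus that of the Koszul sign of \<open>f\<^sub>i\<^sub>1 \<otimes> \<dots> \<otimes> f\<^sub>i\<^sub>r\<close> (degrees \<open>1 - i\<^sub>j\<close>).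
\<close>

fun block_exp :: "'a hlist list \<Rightarrow> int" where
  "block_exp [] = 0"
| "block_exp (ys # yss) = int (length yss) * (int (length ys) - 1)
     + deg ys * (\<Sum>zs\<leftarrow>yss. 1 - int (length zs)) + block_exp yss"

text \<open>
  \<open>compose_op g f xs\<close> is the signed sum of \<open>g\<^sub>r (f\<^sub>i\<^sub>1 \<otimes> \<dots> \<otimes> f\<^sub>i\<^sub>r)\<close>: the composition of A-infinity
  morphisms, and the right-hand side of the A-infinity morphism relation if \<open>g\<close> is a structure.
\<close>

definition compose_op ::
  "('b hlist \<Rightarrow> 'c::complex_vector) \<Rightarrow> ('a hlist \<Rightarrow> 'b) \<Rightarrow> 'a hlist \<Rightarrow> 'c" where
  "compose_op g f xs = (\<Sum>yss \<in> {yss. concat yss = xs \<and> [] \<notin> set yss}.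
     sgn_pow (block_exp yss) (g (map (\<lambda>ys. (deg ys + 1 - int (length ys), f ys)) yss)))"

definition Cinf_algebra :: "'a::complex_vector graded \<Rightarrow> ('a hlist \<Rightarrow> 'a) \<Rightarrow> bool" where
  "Cinf_algebra V m \<longleftrightarrow> (\<forall>n. subspace_over UNIV (V n)) \<and>
     multilinear V V 2 m \<and> vanishes_on_shuffles V m \<and>
     (\<forall>xs\<in>homog V. xs \<noteq> [] \<longrightarrow> insert_op m m xs = 0)"

definition Cinf_morphism :: "'a::complex_vector graded \<Rightarrow> ('a hlist \<Rightarrow> 'a) \<Rightarrow>
    'b::complex_vector graded \<Rightarrow> ('b hlist \<Rightarrow> 'b) \<Rightarrow> ('a hlist \<Rightarrow> 'b) \<Rightarrow> bool" where
  "Cinf_morphism V m V' m' f \<longleftrightarrow> multilinear V V' 1 f \<and> vanishes_on_shuffles V f \<and>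
     (\<forall>xs\<in>homog V. xs \<noteq> [] \<longrightarrow> insert_op f m xs = compose_op m' f xs)"

section \<open>C-infinity mixed Hodge diagrams\<close>

text \<open>
  \<open>opr D i\<close> is the C-infinity structure of component \<open>i\<close> and \<open>hmor D r q\<close> the C-infinity morphism
  extending \<open>cmp D r q\<close>.  The C-infinity structure over \<open>K\<close> is the restriction of \<open>opr D 0\<close> to
  \<open>rat D\<close>.
\<close>

record 'a cinf = "'a mhc" +
  opr :: "nat \<Rightarrow> 'a hlist \<Rightarrow> 'a"
  hmor :: "nat \<Rightarrow> nat \<Rightarrow> 'a hlist \<Rightarrow> 'a"

definition Cinf_mixed_hodge_diagram :: "complex set \<Rightarrow> 'a::complex_vector cinf \<Rightarrow> bool" where
  "Cinf_mixed_hodge_diagram K D \<longleftrightarrow> mixed_hodge_complex K D \<and>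
     (\<forall>i\<le>len D. Cinf_algebra (cpt D i) (opr D i) \<and>
        (\<forall>n. \<forall>x\<in>cpt D i n. opr D i [(n, x)] = dif D i n x) \<and>
        filtration_preserving (wt D i) (wt D i) 2 (opr D i)) \<and>
     maps_into (rat D) (rat D) 2 (opr D 0) \<and>
     filtration_preserving (hdg D) (hdg D) 2 (opr D (len D)) \<and>
     (\<forall>(r, q)\<in>arrows (len D).
        Cinf_morphism (cpt D r) (opr D r) (cpt D q) (opr D q) (hmor D r q) \<and>
        (\<forall>n. \<forall>x\<in>cpt D r n. hmor D r q [(n, x)] = cmp D r q n x) \<and>
        filtration_preserving (wt D r) (wt D q) 1 (hmor D r q))"

definition inf_morphism ::
  "'a::complex_vector cinf \<Rightarrow> 'b::complex_vector cinf \<Rightarrow> (nat \<Rightarrow> 'a hlist \<Rightarrow> 'b) \<Rightarrow> bool" where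
  "inf_morphism D E g \<longleftrightarrow> len D = len E \<and>
     (\<forall>i\<le>len D. Cinf_morphism (cpt D i) (opr D i) (cpt E i) (opr E i) (g i) \<and>
        filtration_preserving (wt D i) (wt E i) 1 (g i)) \<and>
     maps_into (rat D) (rat E) 1 (g 0) \<and>
     filtration_preserving (hdg D) (hdg E) 1 (g (len D)) \<and>
     (\<forall>(r, q)\<in>arrows (len D). \<forall>xs\<in>homog (cpt D r). xs \<noteq> [] \<longrightarrow>
        compose_op (hmor E r q) (g r) xs = compose_op (g q) (hmor D r q) xs)"

definition inf_quasi_iso ::
  "'a::complex_vector cinf \<Rightarrow> 'b::complex_vector cinf \<Rightarrow> (nat \<Rightarrow> 'a hlist \<Rightarrow> 'b) \<Rightarrow> bool" where
  "inf_quasi_iso D E g \<longleftrightarrow> inf_morphism D E g \<and>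
     (\<forall>n. quotient_iso (\<lambda>x. g 0 [(n, x)])
        (cocycles (rat D) (dif D 0) n) (coboundaries (rat D) (dif D 0) n)
        (cocycles (rat E) (dif E 0) n) (coboundaries (rat E) (dif E 0) n)) \<and>
     (\<forall>i\<le>len D. \<forall>n. quotient_iso (\<lambda>x. g i [(n, x)])
        (cocyc D i n) (cobd D i n) (cocyc E i n) (cobd E i n))"

text \<open>One step, in either direction, of a zigzag of infinity-quasi-isomorphisms.\<close>

definition quasi_iso_step ::
  "complex set \<Rightarrow> 'a::complex_vector cinf \<Rightarrow> 'b::complex_vector cinf \<Rightarrow> bool" where
  "quasi_iso_step K D E \<longleftrightarrow> Cinf_mixed_hodge_diagram K D \<and> Cinf_mixed_hodge_diagram K E \<and>
     ((\<exists>g. inf_quasi_iso D E g) \<or> (\<exists>g. inf_quasi_iso E D g))"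

definition Cinf_of_mhd :: "'a::complex_vector mhd \<Rightarrow> 'a cinf" where
  "Cinf_of_mhd A = \<lparr> len = len A, cpt = cpt A, rat = rat A, wt = wt A, hdg = hdg A, dif = dif A,
     cmp = cmp A,
     opr = (\<lambda>i xs. case xs of [(n, x)] \<Rightarrow> dif A i n x
                     | [(n, x), (m, y)] \<Rightarrow> mul A i n m x y | _ \<Rightarrow> 0),
     hmor = (\<lambda>r q xs. case xs of [(n, x)] \<Rightarrow> cmp A r q n x | _ \<Rightarrow> 0) \<rparr>"

definition pad_cinf :: "nat \<Rightarrow> 'a::complex_vector cinf \<Rightarrow> 'a cinf" where
  "pad_cinf L D = (pad_mhc L D)\<lparr> opr := (\<lambda>i. opr D (min i (len D))),
     hmor := (\<lambda>r q xs. if r \<le> len D \<and> q \<le> len D then hmor D r q xs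
                       else (case xs of [(n, x)] \<Rightarrow> x | _ \<Rightarrow> 0)) \<rparr>"

section \<open>Harrison cohomology and the first obstruction\<close>

text \<open>
  A graded commutative algebra in mixed Hodge structures: underlying complex spaces, \<open>K\<close>-structure,
  weight and Hodge filtration, product.
\<close>

record 'a mhs_algebra =
  hsp :: "'a graded"
  hrat :: "'a graded"
  hwt :: "'a filtered"
  hhdg :: "'a filtered"
  hmul :: "int \<Rightarrow> int \<Rightarrow> 'a \<Rightarrow> 'a \<Rightarrow> 'a"

text \<open>
  \<open>H\<close> is the cohomology algebra of \<open>A\<close> with its mixed Hodge structure: \<open>\<kappa> n\<close> takes a cocycle of the
  last component to its class, identifying \<open>hsp H n\<close> with cocycles modulo coboundaries.
\<close>

definition is_cohomology ::
  "'a::complex_vector mhd \<Rightarrow> (int \<Rightarrow> 'a \<Rightarrow> 'b::complex_vector) \<Rightarrow> 'b mhs_algebra \<Rightarrow> bool" where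
  "is_cohomology A \<kappa> H \<longleftrightarrow>
    (let s = len A; Z = cocyc A s in
     (\<forall>n. linear_between (Z n) (hsp H n) (\<kappa> n) \<and> \<kappa> n ` Z n = hsp H n \<and>
        {x \<in> Z n. \<kappa> n x = 0} = cobd A s n) \<and>
     (\<forall>n. hrat H n = \<kappa> n ` {y. \<exists>x\<in>cocycles (rat A) (dif A 0) n.
        corresponds A n (\<lambda>i. cocyc A i n) (\<lambda>i. cobd A i n) x y}) \<and>
     (\<forall>k n. hwt H k n = \<kappa> n ` (wt A s k n \<inter> Z n)) \<and>
     (\<forall>p n. hhdg H p n = \<kappa> n ` (hdg A p n \<inter> Z n)) \<and>
     (\<forall>a b. \<forall>x\<in>Z a. \<forall>y\<in>Z b. hmul H a b (\<kappa> a x) (\<kappa> b y) = \<kappa> (a + b) (mul A s a b x y)))"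

text \<open>
  \<open>D\<close> is a C-infinity mixed Hodge diagram of length one with underlying mixed Hodge complex \<open>H\<close>
  (zero differential, identity as comparison isomorphism), extending the product of \<open>H\<close>.
\<close>

definition Cinf_structure_on :: "complex set \<Rightarrow> 'a::complex_vector mhs_algebra \<Rightarrow> 'a cinf \<Rightarrow> bool" where
  "Cinf_structure_on K H D \<longleftrightarrow> Cinf_mixed_hodge_diagram K D \<and> len D = 1 \<and> rat D = hrat H \<and>
     hdg D = hhdg H \<and>
     (\<forall>i\<le>1. cpt D i = hsp H \<and> wt D i = hwt H \<and> (\<forall>n. \<forall>x\<in>hsp H n. dif D i n x = 0) \<and>
        (\<forall>a b. \<forall>x\<in>hsp H a. \<forall>y\<in>hsp H b. opr D i [(a, x), (b, y)] = hmul H a b x y)) \<and>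
     (\<forall>n. \<forall>x\<in>hsp H n. cmp D 0 1 n x = x)"

definition arity_part :: "'a graded \<Rightarrow> nat \<Rightarrow> ('a hlist \<Rightarrow> 'b::zero) \<Rightarrow> 'a hlist \<Rightarrow> 'b" where
  "arity_part V k f = (\<lambda>xs. if length xs = k \<and> xs \<in> homog V then f xs else 0)"

text \<open>
  Harrison cochains of arity \<open>k\<close> and degree \<open>e\<close> with complex coefficients, extended by zero to
  lists that do not denote a \<open>k\<close>-fold tensor.  Cochains over \<open>K\<close> are those preserving \<open>hrat H\<close>.
\<close>

definition harr_cochains ::
  "'a::complex_vector mhs_algebra \<Rightarrow> nat \<Rightarrow> int \<Rightarrow> ('a hlist \<Rightarrow> 'a) set" where
  "harr_cochains H k e = {f. multilinear (hsp H) (hsp H) (e + int k) f \<and>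
     vanishes_on_shuffles (hsp H) f \<and> arity_part (hsp H) k f = f}"

definition harr_W0 ::
  "'a::complex_vector mhs_algebra \<Rightarrow> nat \<Rightarrow> int \<Rightarrow> ('a hlist \<Rightarrow> 'a) set" where
  "harr_W0 H k e = {f \<in> harr_cochains H k e. filtration_preserving (hwt H) (hwt H) (e + int k) f}"

definition harr_W0_rat ::
  "'a::complex_vector mhs_algebra \<Rightarrow> nat \<Rightarrow> int \<Rightarrow> ('a hlist \<Rightarrow> 'a) set" where
  "harr_W0_rat H k e = {f \<in> harr_W0 H k e. maps_into (hrat H) (hrat H) (e + int k) f}"

definition harr_W0_F0 ::
  "'a::complex_vector mhs_algebra \<Rightarrow> nat \<Rightarrow> int \<Rightarrow> ('a hlist \<Rightarrow> 'a) set" where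
  "harr_W0_F0 H k e = {f \<in> harr_W0 H k e. filtration_preserving (hhdg H) (hhdg H) (e + int k) f}"

text \<open>
  The Harrison differential on cochains of arity \<open>k\<close> and degree \<open>e\<close>; the only Koszul sign comes from
  moving \<open>f\<close> past \<open>x\<^sub>1\<close>.
\<close>

definition harr_diff :: "'a::complex_vector mhs_algebra \<Rightarrow> nat \<Rightarrow> int \<Rightarrow>
    ('a hlist \<Rightarrow> 'a) \<Rightarrow> ('a hlist \<Rightarrow> 'a)" where
  "harr_diff H k e f = arity_part (hsp H) (k + 1) (\<lambda>xs.
     sgn_pow (e * fst (hd xs)) (hmul H (fst (hd xs)) (deg (tl xs) + e) (snd (hd xs)) (f (tl xs)))
     + (\<Sum>i=1..k. let x = xs ! (i - 1); y = xs ! i in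
          sgn_pow (int i)
            (f (take (i - 1) xs @ (fst x + fst y, hmul H (fst x) (fst y) (snd x) (snd y))
                # drop (i + 1) xs)))
     + sgn_pow (int k + 1)
         (hmul H (deg (butlast xs) + e) (fst (last xs)) (f (butlast xs)) (snd (last xs))))"

type_synonym 'a harr_triple = "('a hlist \<Rightarrow> 'a) \<times> ('a hlist \<Rightarrow> 'a) \<times> ('a hlist \<Rightarrow> 'a)"

definition harr_db_cochains ::
  "'a::complex_vector mhs_algebra \<Rightarrow> nat \<Rightarrow> int \<Rightarrow> 'a harr_triple set" where
  "harr_db_cochains H k e = harr_W0_rat H k e \<times> harr_W0_F0 H k e \<times> harr_W0 H (k - 1) e"

definition harr_db_diff ::
  "'a::complex_vector mhs_algebra \<Rightarrow> nat \<Rightarrow> int \<Rightarrow> 'a harr_triple \<Rightarrow> 'a harr_triple" where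
  "harr_db_diff H k e = (\<lambda>(f, g, h).
     (harr_diff H k e f, harr_diff H k e g, f - g - harr_diff H (k - 1) e h))"

text \<open>Arities are at least \<open>2\<close> here (only arities \<open>2\<close> and \<open>3\<close> matter for the first obstruction).\<close>

definition harr_db_coboundaries ::
  "'a::complex_vector mhs_algebra \<Rightarrow> nat \<Rightarrow> int \<Rightarrow> 'a harr_triple set" where
  "harr_db_coboundaries H k e = harr_db_diff H (k - 1) e ` harr_db_cochains H (k - 1) e"

definition Harr_DB ::
  "'a::complex_vector mhs_algebra \<Rightarrow> nat \<Rightarrow> int \<Rightarrow> 'a harr_triple set set" where
  "Harr_DB H k e = (\<lambda>z. z +o harr_db_coboundaries H k e) `
     {z \<in> harr_db_cochains H k e. harr_db_diff H k e z = 0}"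

text \<open>The first obstruction, as an element of \<open>Harr_DB H 3 (- 1)\<close>; the zero class is the coset of
  coboundaries itself.\<close>

definition theta3 :: "'a::complex_vector mhs_algebra \<Rightarrow> 'a cinf \<Rightarrow> 'a harr_triple set" where
  "theta3 H D = (arity_part (hsp H) 3 (opr D 0), arity_part (hsp H) 3 (opr D 1),
     arity_part (hsp H) 2 (hmor D 0 1)) +o harr_db_coboundaries H 3 (- 1)"

end

theory Submission
  imports Defs
begin

text \<open>
  A section of \<open>\<pi>\<close> that is a morphism of algebras amounts to a family \<open>S\<close> of subgroups of the
  Deligne--Beilinson cocycles that contains the coboundaries, is closed under products, and maps
  isomorphically, modulo coboundaries, onto the Hodge classes.  Such a family can be transported along a
  map of Deligne--Beilinson complexes that induces an isomorphism on cohomology and is multiplicative up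
  to coboundaries.  An infinity-quasi-isomorphism of C-infinity mixed Hodge diagrams gives such a map: its
  linear part is strict for \<open>W\<close> and \<open>F\<close>, as a morphism of mixed Hodge structures on cohomology, and its
  quadratic part is the homotopy for the product; the higher components play no role.

  It remains to split the model with underlying complex \<open>H = H\<^sup>*(A)\<close>.  There all differentials vanish and
  the comparison morphism is the identity, but its quadratic component \<open>\<phi>\<close> enters the product.  A cocycle
  has one bottom component \<open>x\<close>, repeated, and only the sum \<open>T\<close> of its top components matters.  Triviality of the
  obstruction gives \<open>\<phi> = f - g - \<delta>e\<close> with \<open>f\<close> defined over \<open>K\<close> and \<open>g\<close> preserving \<open>F\<close>, and the cocycles with
  \<open>T - e(x)\<close> in \<open>(2 \<pi> i)\<^sup>p W\<^sub>2\<^sub>p H\<^sub>K + F\<^sup>p \<inter> W\<^sub>2\<^sub>p\<close> form the required family.  The unit is preserved because an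
  idempotent lift of the unit differs from it by an element of square zero.
\<close>

section \<open>Subgroups, quotients and descent to the subfield\<close>

text \<open>In the model the extension is governed by one bilinear map. Hodge classes
  \<open>x\<close> and \<open>y\<close>, lifted with zero top components, have a product whose top
  component is \<open>\<phi>(x, y)\<close>, to be read in the intermediate Jacobian. Both classes
  are rational and lie in \<open>F\<close>, so \<open>f(x, y)\<close> and \<open>g(x, y)\<close>
  fall into the denominator of the Jacobian. There \<open>\<phi>\<close> agrees with
  \<open>- \<delta>e\<close>, which is why lifting \<open>x\<close> with top component
  \<open>e(x)\<close> is multiplicative.

  The obstacle is to carry this back to \<open>A\<close>. Deligne--Beilinson cochains involve the
  filtration steps of weight \<open>2 p\<close> and Hodge index \<open>p\<close>, whereas the
  quasi-isomorphisms of the zigzag are isomorphisms on unfiltered cohomology only. The gap is closed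
  by proving that the cohomology of a mixed Hodge complex carries a mixed Hodge structure and that
  injective morphisms of such structures are strict.

  A second obstacle is the length. The model has length one, the zigzag has length \<open>L\<close>,
  and \<open>A\<close> has its own. Diagrams are therefore compared after padding to an even length,
  and a separate transfer relates the lengths \<open>N\<close> and \<open>N + 2\<close>.\<close>

interpretation scaleC: vector_space "scaleC :: complex \<Rightarrow> 'a \<Rightarrow> 'a::complex_vector"
  by (rule vector_space_scaleC)

definition add_subgroup :: "'a::ab_group_add set \<Rightarrow> bool" where
  "add_subgroup S \<longleftrightarrow> 0 \<in> S \<and> (\<forall>x\<in>S. \<forall>y\<in>S. x - y \<in> S)"

lemma mem_eq: "x \<in> S ==> y = x ==> y \<in> S"
  by simp

lemma add_subgroupI:
  "0 \<in> S ==> (\<And>x y. x \<in> S ==> y \<in> S ==> x - y \<in> S) ==> add_subgroup S"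
  by (auto simp: add_subgroup_def)

lemma grp_zero: "add_subgroup S ==> 0 \<in> S"
  and grp_diff: "add_subgroup S ==> x \<in> S ==> y \<in> S ==> x - y \<in> S"
  by (auto simp: add_subgroup_def)

lemma grp_minus: "add_subgroup S ==> x \<in> S ==> - x \<in> S"
  using grp_diff[of S 0 x] grp_zero by auto

lemma grp_add: "add_subgroup S ==> x \<in> S ==> y \<in> S ==> x + y \<in> S"
  using grp_diff[of S x "- y"] grp_minus[of S y] by auto

lemma grp_Int: "add_subgroup S ==> add_subgroup T ==> add_subgroup (S \<inter> T)"
  by (auto simp: add_subgroup_def)

lemma grp_plus: "add_subgroup S ==> add_subgroup T ==> add_subgroup (S + T)"
proof (rule add_subgroupI)
  assume S: "add_subgroup S" and T: "add_subgroup T"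
  show "0 \<in> S + T" using set_plus_intro[OF grp_zero[OF S] grp_zero[OF T]] by simp
  fix x y assume "x \<in> S + T" "y \<in> S + T"
  then obtain a b a' b' where *: "x = a + b" "y = a' + b'" "a \<in> S" "b \<in> T" "a' \<in> S" "b' \<in> T"
    by (auto elim!: set_plus_elim)
  have eq: "x - y = (a - a') + (b - b')" using * by simp
  show "x - y \<in> S + T" unfolding eq by (intro set_plus_intro grp_diff[OF S] grp_diff[OF T] *)
qed

lemma plus_memI: "a \<in> S ==> x - a \<in> T ==> x \<in> S + T" for x :: "'a::ab_group_add"
  using set_plus_intro[of a S "x - a" T] by simp

lemma plus_memE:
  fixes x :: "'a::ab_group_add"
  assumes "x \<in> S + T" obtains a b where "a \<in> S" "b \<in> T" "x = a + b" "x - a = b" "x - b = a"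
  using assms by (auto elim!: set_plus_elim)

lemma subset_plus1: "add_subgroup T ==> S \<subseteq> S + T"
  using plus_memI grp_zero by (metis diff_self subsetI)

lemma subset_plus2: "add_subgroup S ==> T \<subseteq> S + T"
  using subset_plus1 by (metis add.commute)

lemma grp_sgn: "add_subgroup S ==> x \<in> S ==> sgn_pow e x \<in> S"
  by (auto simp: sgn_pow_def grp_minus)

lemma csub_grp: "subspace_over UNIV S ==> add_subgroup S"
  unfolding subspace_over_def add_subgroup_def
  by (metis UNIV_I diff_conv_add_uminus scaleC.scale_minus_left scaleC.scale_one)

lemma csub_scale: "subspace_over UNIV S ==> x \<in> S ==> c *\<^sub>C x \<in> S"
  by (auto simp: subspace_over_def)

lemma real_subfieldD:
  assumes "real_subfield K"
  shows "0 \<in> K" "1 \<in> K" "x \<in> K ==> y \<in> K ==> x + y \<in> K" "x \<in> K ==> y \<in> K ==> x * y \<in> K"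
    "x \<in> K ==> - x \<in> K" "x \<in> K ==> inverse x \<in> K" "x \<in> K ==> cnj x = x"
    "x \<in> K ==> y \<in> K ==> x / y \<in> K"
  using assms by (auto simp: real_subfield_def divide_inverse Reals_cnj_iff)

lemma ksub_grp: "real_subfield K ==> subspace_over K S ==> add_subgroup S"
  unfolding subspace_over_def add_subgroup_def
  by (metis real_subfieldD(2,5) diff_conv_add_uminus scaleC.scale_minus_left scaleC.scale_one)

lemma ksub_scale: "subspace_over K S ==> c \<in> K ==> x \<in> S ==> c *\<^sub>C x \<in> S"
  by (auto simp: subspace_over_def)

lemma ksub_sum:
  assumes "subspace_over K S" "\<And>a. a \<in> t ==> f a \<in> S"
  shows "sum f t \<in> S"
  using assms(2)
proof (induction t rule: infinite_finite_induct)
  case (insert x F)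
  then show ?case using assms(1) by (auto simp: subspace_over_def)
qed (use assms(1) in \<open>auto simp: subspace_over_def\<close>)

lemma indep_overD:
  assumes "indep_over UNIV S" "finite S" "(\<Sum>a\<in>S. c a *\<^sub>C a) = 0" "a \<in> S"
  shows "c a = 0"
  using assms(1)[unfolded indep_over_def, rule_format, of S c] assms(2-) by simp

lemma span_overI:
  "finite t ==> t \<subseteq> S ==> c ` t \<subseteq> K ==> x = (\<Sum>a\<in>t. c a *\<^sub>C a) ==> x \<in> span_over K S"
  unfolding span_over_def by blast

lemma span_over_minimal:
  assumes "subspace_over K T" "S \<subseteq> T"
  shows "span_over K S \<subseteq> T"
  unfolding span_over_def
proof clarify
  fix t c assume "t \<subseteq> S" "c ` t \<subseteq> K"
  then show "(\<Sum>a\<in>t. c a *\<^sub>C a) \<in> T"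
    using assms by (intro ksub_sum[OF assms(1)] ksub_scale[OF assms(1)]) auto
qed

lemma span_over_UNIV: "span_over UNIV S = scaleC.span S"
  unfolding span_over_def scaleC.span_explicit by auto

lemma lin_mem: "linear_between V V' f ==> x \<in> V ==> f x \<in> V'"
  and lin_scale: "linear_between V V' f ==> x \<in> V ==> f (c *\<^sub>C x) = c *\<^sub>C f x"
  and lin_add: "linear_between V V' f ==> x \<in> V ==> y \<in> V ==> f (x + y) = f x + f y"
  by (auto simp: linear_between_def)

lemma lin_zero: "linear_between V V' f ==> subspace_over UNIV V ==> f 0 = 0"
  using lin_scale[of V V' f 0 0] by (auto simp: subspace_over_def)

lemma lin_minus: "linear_between V V' f ==> x \<in> V ==> f (- x) = - f x"
  using lin_scale[of V V' f x "-1"] by simp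

lemma lin_diff: "linear_between V V' f ==> subspace_over UNIV V ==> x \<in> V ==> y \<in> V ==> f (x - y) = f x - f y"
  using lin_add[of V V' f x "- y"] lin_minus[of V V' f y] grp_minus[OF csub_grp, of V y] by simp

lemma lin_sgn: "linear_between V V' f ==> x \<in> V ==> f (sgn_pow e x) = sgn_pow e (f x)"
  using lin_minus[of V V' f x] by (auto simp: sgn_pow_def)

lemma lin_image_grp:
  assumes "linear_between V V' f" "subspace_over UNIV V" "add_subgroup S" "S \<subseteq> V"
  shows "add_subgroup (f ` S)"
proof (rule add_subgroupI)
  show "0 \<in> f ` S" using lin_zero[OF assms(1,2)] grp_zero[OF assms(3)] by force
  fix x y assume "x \<in> f ` S" "y \<in> f ` S"
  then obtain a b where "x = f a" "y = f b" "a \<in> S" "b \<in> S" by auto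
  then show "x - y \<in> f ` S" using lin_diff[OF assms(1,2), of a b] assms(4) grp_diff[OF assms(3), of a b]
    by (metis image_eqI subsetD)
qed

lemma quotient_isoI:
  assumes "\<And>x. x \<in> Z ==> f x \<in> Z'" "\<And>x. x \<in> B ==> f x \<in> B'"
    "\<And>x. x \<in> Z ==> f x \<in> B' ==> x \<in> B" "\<And>y. y \<in> Z' ==> \<exists>x\<in>Z. f x - y \<in> B'"
  shows "quotient_iso f Z B Z' B'"
  using assms by (auto simp: quotient_iso_def)

lemma quotient_isoD:
  assumes "quotient_iso f Z B Z' B'"
  shows "x \<in> Z ==> f x \<in> Z'" "x \<in> B ==> f x \<in> B'"
    "x \<in> Z ==> f x \<in> B' ==> x \<in> B" "y \<in> Z' ==> \<exists>x\<in>Z. f x - y \<in> B'"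
  using assms by (auto simp: quotient_iso_def)

section \<open>Descent of linear relations from the complex numbers to the subfield\<close>

lemma dependent_over_solve:
  assumes K: "real_subfield K" and t: "finite t" "\<not> indep_over K t"
  obtains b e where "b \<in> t" "e ` (t - {b}) \<subseteq> K" "b = (\<Sum>a\<in>t - {b}. e a *\<^sub>C a)"
proof -
  obtain t' c b where c: "finite t'" "t' \<subseteq> t" "c ` t' \<subseteq> K" "(\<Sum>a\<in>t'. c a *\<^sub>C a) = 0" "b \<in> t'" "c b \<noteq> 0"
    using t unfolding indep_over_def by blast
  define c' where "c' a = (if a \<in> t' then c a else 0)" for a
  have s: "(\<Sum>a\<in>t. c' a *\<^sub>C a) = 0"
    using c t by (subst sum.mono_neutral_right[of t t']) (auto simp: c'_def)
  have b: "b \<in> t" "c' b \<noteq> 0" using c by (auto simp: c'_def)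
  have c'K: "c' a \<in> K" for a using c real_subfieldD(1)[OF K] by (auto simp: c'_def)
  have "c' b *\<^sub>C b + (\<Sum>a\<in>t - {b}. c' a *\<^sub>C a) = 0" using s b t by (simp add: sum.remove)
  then have "c' b *\<^sub>C b = - (\<Sum>a\<in>t - {b}. c' a *\<^sub>C a)" by (simp add: eq_neg_iff_add_eq_0)
  then have "inverse (c' b) *\<^sub>C (c' b *\<^sub>C b) = inverse (c' b) *\<^sub>C - (\<Sum>a\<in>t - {b}. c' a *\<^sub>C a)" by simp
  then have "b = (\<Sum>a\<in>t - {b}. (- (inverse (c' b) * c' a)) *\<^sub>C a)"
    using b by (simp add: scaleC.scale_sum_right sum_negf)
  moreover have "(\<lambda>a. - (inverse (c' b) * c' a)) ` (t - {b}) \<subseteq> K"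
    using c'K real_subfieldD[OF K] by auto
  ultimately show ?thesis using that b by blast
qed

lemma sum_eliminate:
  assumes "finite t" "b \<in> t" "b = (\<Sum>a\<in>t - {b}. e a *\<^sub>C a)"
  shows "(\<Sum>a\<in>t. c a *\<^sub>C a) = (\<Sum>a\<in>t - {b}. (c a + c b * e a) *\<^sub>C a)"
proof -
  have "(\<Sum>a\<in>t. c a *\<^sub>C a) = c b *\<^sub>C b + (\<Sum>a\<in>t - {b}. c a *\<^sub>C a)"
    using assms by (simp add: sum.remove)
  also have "c b *\<^sub>C b = (\<Sum>a\<in>t - {b}. (c b * e a) *\<^sub>C a)"
    using arg_cong[OF assms(3), of "\<lambda>z. c b *\<^sub>C z"]
    unfolding scaleC.scale_sum_right scaleC_scaleC .
  finally show ?thesis by (simp add: scaleC.scale_left_distrib sum.distrib)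
qed

lemma eq_add_shift: "x = u + a + b ==> x - u = a + b" for x :: "'a::ab_group_add"
  by simp

text \<open>A complex relation between \<open>x\<close> and a finite set \<open>t\<close> forces a
  relation over \<open>K\<close>, because a \<open>K_structure\<close> keeps independence. That
  relation either yields \<open>x\<close> directly or allows an element of \<open>t\<close> to be
  eliminated, so induction on the size of \<open>t\<close> applies. The lemma later turns complex
  primitives of rational cocycles into rational ones.\<close>

lemma K_structure_descent:
  assumes K: "real_subfield K" and R: "K_structure K V R" and S: "S \<subseteq> R"
    and x: "x \<in> R" "x \<in> span_over UNIV S"
  shows "x \<in> span_over K S"
proof -
  have main: "x \<in> span_over K S" if "finite t" "t \<subseteq> S" "x = (\<Sum>a\<in>t. c a *\<^sub>C a)" for t c
    using that
  proof (induction "card t" arbitrary: t c rule: less_induct)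
    case less
    show ?case
    proof (cases "x \<in> t")
      case True
      have "x = (\<Sum>a\<in>{x}. 1 *\<^sub>C a)" by simp
      moreover have "finite {x}" "{x} \<subseteq> S" "(\<lambda>a. 1) ` {x} \<subseteq> K"
        using True less.prems real_subfieldD(2)[OF K] by auto
      ultimately show ?thesis by (intro span_overI)
    next
      case False
      have "\<not> indep_over UNIV (insert x t)"
      proof
        assume i: "indep_over UNIV (insert x t)"
        let ?c = "\<lambda>a. if a = x then -1 else c a"
        have "(\<Sum>a\<in>insert x t. ?c a *\<^sub>C a) = - x + (\<Sum>a\<in>t. ?c a *\<^sub>C a)"
          using False less.prems by simp
        also have "(\<Sum>a\<in>t. ?c a *\<^sub>C a) = (\<Sum>a\<in>t. c a *\<^sub>C a)"
          using False by (intro sum.cong) auto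
        finally have s0: "(\<Sum>a\<in>insert x t. ?c a *\<^sub>C a) = 0" unfolding less.prems(3)[symmetric] by simp
        have "?c x = 0" by (rule indep_overD[OF i]) (use less.prems(1) s0 in auto)
        then show False by simp
      qed
      then have "\<not> indep_over K (insert x t)"
        using R S x(1) less.prems(2) unfolding K_structure_def by (meson insert_subset subset_trans)
      then obtain b e where b: "b \<in> insert x t" "e ` (insert x t - {b}) \<subseteq> K"
        "b = (\<Sum>a\<in>insert x t - {b}. e a *\<^sub>C a)"
        using dependent_over_solve[OF K, of "insert x t"] less.prems(1) by (metis finite_insert)
      show ?thesis
      proof (cases "b = x")
        case True
        then have "insert x t - {b} = t" using False by auto
        then have "x = (\<Sum>a\<in>t. e a *\<^sub>C a)" "e ` t \<subseteq> K" using b(2,3) True by metis+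
        then show ?thesis by (intro span_overI[OF less.prems(1,2)])
      next
        case bx: False
        then have bt: "b \<in> t" using b by auto
        have ins: "insert x t - {b} = insert x (t - {b})" using bx by auto
        have b': "b = e x *\<^sub>C x + (\<Sum>a\<in>t - {b}. e a *\<^sub>C a)"
          using trans[OF b(3)[unfolded ins] sum.insert] less.prems(1) False by (metis Diff_iff finite_Diff)
        let ?T = "t - {b}"
        \<comment> \<open>The \<open>K\<close>-relation expresses \<open>b\<close> through
          \<open>x\<close> and the other elements, so \<open>x\<close> reappears on the right with
          coefficient \<open>c b * e x\<close>. Whether this coefficient equals 1 decides between
          shortening the complex expression and solving the \<open>K\<close>-relation for
          \<open>x\<close>.\<close>
        have "x = c b *\<^sub>C b + (\<Sum>a\<in>?T. c a *\<^sub>C a)"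
          unfolding less.prems(3) using less.prems(1) bt by (rule sum.remove)
        also have "c b *\<^sub>C b = (c b * e x) *\<^sub>C x + (\<Sum>a\<in>?T. (c b * e a) *\<^sub>C a)"
          using arg_cong[OF b', of "\<lambda>z. c b *\<^sub>C z"]
          unfolding scaleC.scale_right_distrib scaleC.scale_sum_right scaleC_scaleC .
        finally have "x - (c b * e x) *\<^sub>C x = (\<Sum>a\<in>?T. (c b * e a) *\<^sub>C a) + (\<Sum>a\<in>?T. c a *\<^sub>C a)"
          by (rule eq_add_shift)
        then have eq: "(1 - c b * e x) *\<^sub>C x = (\<Sum>a\<in>?T. (c b * e a + c a) *\<^sub>C a)"
          unfolding scaleC.scale_left_distrib sum.distrib scaleC.scale_left_diff_distrib scaleC.scale_one .
        have card: "card ?T < card t" using less.prems bt by (metis card_Diff1_less)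
        show ?thesis
        proof (cases "1 - c b * e x = 0")
          case False
          have "inverse (1 - c b * e x) *\<^sub>C ((1 - c b * e x) *\<^sub>C x) = x" using False by simp
          then have "x = inverse (1 - c b * e x) *\<^sub>C ((1 - c b * e x) *\<^sub>C x)" by (rule sym)
          also have "\<dots> = (\<Sum>a\<in>?T. (inverse (1 - c b * e x) * (c b * e a + c a)) *\<^sub>C a)"
            unfolding eq by (simp add: scaleC.scale_sum_right)
          finally have *: "x = (\<Sum>a\<in>?T. (inverse (1 - c b * e x) * (c b * e a + c a)) *\<^sub>C a)" .
          show ?thesis by (rule less.hyps[OF card _ _ *]) (use less.prems(1,2) in auto)
        next
          \<comment> \<open>The complex expression has become vacuous, but now \<open>e x\<close> is
            nonzero and the \<open>K\<close>-relation itself can be solved for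
            \<open>x\<close>.\<close>
          case True
          then have ex: "e x \<noteq> 0" by auto
          have "e x *\<^sub>C x = b - (\<Sum>a\<in>?T. e a *\<^sub>C a)" using b' by (metis eq_diff_eq)
          then have "inverse (e x) *\<^sub>C (e x *\<^sub>C x) = inverse (e x) *\<^sub>C b - inverse (e x) *\<^sub>C (\<Sum>a\<in>?T. e a *\<^sub>C a)"
            by (simp add: scaleC.scale_right_diff_distrib)
          then have "x = inverse (e x) *\<^sub>C b + (\<Sum>a\<in>?T. (- (inverse (e x) * e a)) *\<^sub>C a)"
            using ex by (simp add: scaleC.scale_sum_right sum_negf)
          also have "\<dots> = (\<Sum>a\<in>t. (if a = b then inverse (e x) else - (inverse (e x) * e a)) *\<^sub>C a)"
            using less.prems(1) bt by (subst sum.remove[of t b]) (auto intro!: sum.cong)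
          finally have "x = (\<Sum>a\<in>t. (if a = b then inverse (e x) else - (inverse (e x) * e a)) *\<^sub>C a)" .
          moreover have "(\<lambda>a. if a = b then inverse (e x) else - (inverse (e x) * e a)) ` t \<subseteq> K"
            using b(2) bx False real_subfieldD[OF K] unfolding ins by auto
          ultimately show ?thesis by (intro span_overI[OF less.prems(1,2)])
        qed
      qed
    qed
  qed
  from x(2) obtain t c where "finite t" "t \<subseteq> S" "x = (\<Sum>a\<in>t. c a *\<^sub>C a)"
    unfolding span_over_def by blast
  then show ?thesis by (rule main)
qed

subsection \<open>Complex conjugation\<close>

text \<open>Conjugation is well defined: eliminating a member through a \<open>K\<close>-relation
  commutes with conjugating the coefficients, since the elements of \<open>K\<close> are real, and
  for an independent family all coefficients vanish.\<close>

lemma conjugate_sum_zero: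
  assumes K: "real_subfield K" and R: "K_structure K V R"
  shows "finite t ==> t \<subseteq> R ==> (\<Sum>a\<in>t. c a *\<^sub>C a) = 0 ==> (\<Sum>a\<in>t. cnj (c a) *\<^sub>C a) = 0"
proof (induction "card t" arbitrary: t c rule: less_induct)
  case less
  show ?case
  proof (cases "indep_over K t")
    case True
    then have "indep_over UNIV t" using R less.prems unfolding K_structure_def by blast
    then have "\<forall>a\<in>t. c a = 0" using indep_overD less.prems by blast
    then show ?thesis by simp
  next
    case False
    then obtain b e where b: "b \<in> t" "e ` (t - {b}) \<subseteq> K" "b = (\<Sum>a\<in>t - {b}. e a *\<^sub>C a)"
      using dependent_over_solve[OF K less.prems(1)] by metis
    have "(\<Sum>a\<in>t - {b}. (c a + c b * e a) *\<^sub>C a) = 0"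
      using sum_eliminate[OF less.prems(1) b(1,3)] less.prems(3) by simp
    moreover have "card (t - {b}) < card t" using less.prems b by (metis card_Diff1_less)
    ultimately have z: "(\<Sum>a\<in>t - {b}. cnj (c a + c b * e a) *\<^sub>C a) = 0"
      using less.hyps[of "t - {b}" "\<lambda>a. c a + c b * e a"] less.prems by auto
    have "(\<Sum>a\<in>t. cnj (c a) *\<^sub>C a) = (\<Sum>a\<in>t - {b}. (cnj (c a) + cnj (c b) * e a) *\<^sub>C a)"
      using sum_eliminate[OF less.prems(1) b(1,3), of "\<lambda>a. cnj (c a)"] by simp
    also have "\<dots> = (\<Sum>a\<in>t - {b}. cnj (c a + c b * e a) *\<^sub>C a)"
    proof (intro sum.cong refl)
      fix a assume "a \<in> t - {b}"
      then have "cnj (e a) = e a" using b(2) real_subfieldD(7)[OF K] by blast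
      then show "(cnj (c a) + cnj (c b) * e a) *\<^sub>C a = cnj (c a + c b * e a) *\<^sub>C a" by simp
    qed
    finally show ?thesis using z by simp
  qed
qed

lemma conjugateE:
  assumes "conjugate_wrt R x x'"
  obtains t c where "finite t" "t \<subseteq> R" "x = (\<Sum>a\<in>t. c a *\<^sub>C a)" "x' = (\<Sum>a\<in>t. cnj (c a) *\<^sub>C a)"
  using assms unfolding conjugate_wrt_def by - (elim exE conjE, rule that)

lemma conjugateI:
  "finite t ==> t \<subseteq> R ==> x = (\<Sum>a\<in>t. c a *\<^sub>C a) ==> x' = (\<Sum>a\<in>t. cnj (c a) *\<^sub>C a) ==> conjugate_wrt R x x'"
  unfolding conjugate_wrt_def by (intro exI conjI)

lemma span_overE:
  assumes "x \<in> span_over K S"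
  obtains t c where "finite t" "t \<subseteq> S" "c ` t \<subseteq> K" "x = (\<Sum>a\<in>t. c a *\<^sub>C a)"
  using assms unfolding span_over_def by - (elim CollectE exE conjE, rule that)

lemma conj_diff:
  assumes "conjugate_wrt R x x'" "conjugate_wrt R y y'"
  shows "conjugate_wrt R (x - y) (x' - y')"
proof -
  obtain t c where t: "finite t" "t \<subseteq> R" "x = (\<Sum>a\<in>t. c a *\<^sub>C a)" "x' = (\<Sum>a\<in>t. cnj (c a) *\<^sub>C a)"
    using assms(1) by (rule conjugateE)
  obtain s e where s: "finite s" "s \<subseteq> R" "y = (\<Sum>a\<in>s. e a *\<^sub>C a)" "y' = (\<Sum>a\<in>s. cnj (e a) *\<^sub>C a)"
    using assms(2) by (rule conjugateE)
  let ?c = "\<lambda>a. (if a \<in> t then c a else 0) - (if a \<in> s then e a else 0)"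
  \<comment> \<open>Both families are extended by zero to the union of their supports. The auxiliary
    \<open>g\<close> is the identity for the elements themselves and \<open>cnj\<close> for their
    conjugates.\<close>
  have 1: "(\<Sum>a\<in>t. g (c a) *\<^sub>C a) = (\<Sum>a\<in>t \<union> s. g (if a \<in> t then c a else 0) *\<^sub>C a)"
    if "g 0 = 0" for g :: "complex \<Rightarrow> complex"
    using t(1) s(1) that by (intro sum.mono_neutral_cong_left) auto
  have 2: "(\<Sum>a\<in>s. g (e a) *\<^sub>C a) = (\<Sum>a\<in>t \<union> s. g (if a \<in> s then e a else 0) *\<^sub>C a)"
    if "g 0 = 0" for g :: "complex \<Rightarrow> complex"
    using t(1) s(1) that by (intro sum.mono_neutral_cong_left) auto
  have "x - y = (\<Sum>a\<in>t \<union> s. ?c a *\<^sub>C a)"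
    unfolding t(3) s(3) 1[of "\<lambda>z. z", OF refl] 2[of "\<lambda>z. z", OF refl]
      scaleC.scale_left_diff_distrib sum_subtractf ..
  moreover have "x' - y' = (\<Sum>a\<in>t \<union> s. cnj (?c a) *\<^sub>C a)"
    unfolding t(4) s(4) 1[of cnj, OF complex_cnj_zero] 2[of cnj, OF complex_cnj_zero]
      scaleC.scale_left_diff_distrib sum_subtractf complex_cnj_diff ..
  moreover have "finite (t \<union> s)" "t \<union> s \<subseteq> R" using t s by auto
  ultimately show ?thesis by (intro conjugateI)
qed

lemma conj_zero: "conjugate_wrt R 0 0"
  by (rule conjugateI[of "{}"]) auto

lemma conj_add:
  assumes "conjugate_wrt R x x'" "conjugate_wrt R y y'"
  shows "conjugate_wrt R (x + y) (x' + y')"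
  using conj_diff[OF assms(1) conj_diff[OF conj_zero assms(2)]] by simp

lemma conj_single: "r \<in> R ==> conjugate_wrt R (c *\<^sub>C r) (cnj c *\<^sub>C r)"
  by (rule conjugateI[of "{r}" _ _ "\<lambda>_. c"]) auto

lemma conj_sym: "conjugate_wrt R x x' ==> conjugate_wrt R x' x"
proof -
  assume "conjugate_wrt R x x'"
  then obtain t c where t: "finite t" "t \<subseteq> R" "x = (\<Sum>a\<in>t. c a *\<^sub>C a)" "x' = (\<Sum>a\<in>t. cnj (c a) *\<^sub>C a)"
    by (rule conjugateE)
  then show "conjugate_wrt R x' x" by (intro conjugateI[of t _ _ "\<lambda>a. cnj (c a)"]) auto
qed

lemma conj_unique:
  assumes "real_subfield K" "K_structure K V R" "conjugate_wrt R x x'" "conjugate_wrt R x x''"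
  shows "x' = x''"
proof -
  have "conjugate_wrt R 0 (x' - x'')" using conj_diff[OF assms(3,4)] by simp
  then obtain t c where "finite t" "t \<subseteq> R" "0 = (\<Sum>a\<in>t. c a *\<^sub>C a)" "x' - x'' = (\<Sum>a\<in>t. cnj (c a) *\<^sub>C a)"
    by (rule conjugateE)
  then have "x' - x'' = 0" using conjugate_sum_zero[OF assms(1,2), of t c] by metis
  then show ?thesis by simp
qed

lemma conj_exists:
  assumes "x \<in> span_over UNIV T" "T \<subseteq> R"
  shows "\<exists>x'\<in>span_over UNIV T. conjugate_wrt R x x'"
proof -
  obtain t c where t: "finite t" "t \<subseteq> T" "c ` t \<subseteq> UNIV" "x = (\<Sum>a\<in>t. c a *\<^sub>C a)"
    using assms(1) by (rule span_overE)
  have "conjugate_wrt R x (\<Sum>a\<in>t. cnj (c a) *\<^sub>C a)"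
    by (rule conjugateI[OF t(1) _ t(4) refl]) (use t(2) assms(2) in auto)
  moreover have "(\<Sum>a\<in>t. cnj (c a) *\<^sub>C a) \<in> span_over UNIV T"
    using t(1,2) by (intro span_overI) auto
  ultimately show ?thesis by blast
qed

lemma conj_linear:
  assumes f: "linear_between V V' f" and R: "R \<subseteq> V" "f ` R \<subseteq> R'" and V: "subspace_over UNIV V"
    and x: "conjugate_wrt R x x'"
  shows "conjugate_wrt R' (f x) (f x')"
proof -
  obtain t c where t: "finite t" "t \<subseteq> R" "x = (\<Sum>a\<in>t. c a *\<^sub>C a)" "x' = (\<Sum>a\<in>t. cnj (c a) *\<^sub>C a)"
    using x by (rule conjugateE)
  have "conjugate_wrt R' (f (\<Sum>a\<in>t. c a *\<^sub>C a)) (f (\<Sum>a\<in>t. cnj (c a) *\<^sub>C a))"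
    using t(1,2)
  proof (induction t rule: finite_induct)
    case empty
    then show ?case using lin_zero[OF f V] conj_zero by auto
  next
    case (insert a t)
    have V1: "(\<Sum>a\<in>t. e a *\<^sub>C a) \<in> V" for e
      using insert.prems R by (intro ksub_sum[OF V] ksub_scale[OF V]) auto
    have a: "a \<in> V" "e *\<^sub>C a \<in> V" "f a \<in> R'" for e
      using insert.prems R csub_scale[OF V] by auto
    have "f (\<Sum>a\<in>insert a t. e a *\<^sub>C a) = e a *\<^sub>C f a + f (\<Sum>a\<in>t. e a *\<^sub>C a)" for e
      using insert.hyps lin_add[OF f a(2) V1] lin_scale[OF f a(1)] by simp
    then show ?case using insert.IH insert.prems conj_add[OF conj_single[OF a(3)]] by simp
  qed
  then show ?thesis using t by simp
qed

section \<open>Filtered quasi-isomorphisms\<close>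

locale filtered_cx =
  fixes V :: "'a::complex_vector graded" and d :: "int \<Rightarrow> 'a \<Rightarrow> 'a" and G :: "'a filtered"
  assumes filtered: "filtered_complex V d G"
begin

lemma csub_V: "subspace_over UNIV (V n)" and lin_d: "linear_between (V n) (V (n + 1)) (d n)"
  and d_d: "x \<in> V n ==> d (n + 1) (d n x) = 0"
  using filtered by (auto simp: filtered_complex_def cochain_complex_def)

lemma csub_G: "subspace_over UNIV (G k n)" and G_Suc: "G k n \<subseteq> G (k + 1) n"
  and d_G: "x \<in> G k n ==> d n x \<in> G k (n + 1)" and Union_G: "(\<Union>k. G k n) = V n"
  using filtered by (auto simp: filtered_complex_def image_subset_iff)

lemmas grp_V = csub_grp[OF csub_V] and grp_G = csub_grp[OF csub_G]
lemmas V_zero = grp_zero[OF grp_V] and V_diff = grp_diff[OF grp_V] and V_add = grp_add[OF grp_V]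
  and V_minus = grp_minus[OF grp_V] and V_scale = csub_scale[OF csub_V]
lemmas G_zero = grp_zero[OF grp_G] and G_diff = grp_diff[OF grp_G] and G_add = grp_add[OF grp_G]
  and G_minus = grp_minus[OF grp_G] and G_scale = csub_scale[OF csub_G]
lemmas d_V = lin_mem[OF lin_d] and d_add = lin_add[OF lin_d] and d_scale = lin_scale[OF lin_d]
  and d_diff = lin_diff[OF lin_d csub_V] and d_minus = lin_minus[OF lin_d]
  and d_zero = lin_zero[OF lin_d csub_V]

lemma G_V: "x \<in> G k n ==> x \<in> V n" using Union_G by blast

lemma V_G: "x \<in> V n ==> \<exists>k. x \<in> G k n" using Union_G by blast

lemma G_mono: "j \<le> k ==> x \<in> G j n ==> x \<in> G k n"
proof (induction k rule: int_ge_induct)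
  case (step i)
  then show ?case using G_Suc by blast
qed simp

text \<open>Regularity provides the base case for an induction over all integers: every step below a
  vanishing one vanishes too, by monotonicity.\<close>

lemma regular_induct:
  assumes "\<exists>k0. G k0 n = {0}" and zero: "\<And>k. G k n = {0} ==> P k" and step: "\<And>k. P (k - 1) ==> P k"
  shows "P k"
proof -
  obtain k0 where k0: "G k0 n = {0}" using assms(1) by blast
  show ?thesis
  proof (cases "k \<le> k0")
    case True
    then have "G k n = {0}" using G_mono[of k k0 _ n] k0 G_zero[of k n] by blast
    then show ?thesis by (rule zero)
  next
    case False
    then have "k0 \<le> k" by simp
    then show ?thesis
    proof (induction k rule: int_ge_induct)
      case base
      then show ?case using zero k0 by blast
    next
      case (step i)
      then show ?case using assms(3)[of "i + 1"] by simp
    qed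
  qed
qed

lemma d_V': "x \<in> V (n - 1) ==> d (n - 1) x \<in> V n" using d_V[of x "n - 1"] by simp
lemma d_G': "x \<in> G k (n - 1) ==> d (n - 1) x \<in> G k n" using d_G[of x k "n - 1"] by simp
lemma d_d': "x \<in> V (n - 1) ==> d n (d (n - 1) x) = 0" using d_d[of x "n - 1"] by simp

lemma grp_cocycles: "add_subgroup (cocycles V d n)"
  by (rule add_subgroupI) (auto simp: cocycles_def V_zero d_zero V_diff d_diff)

lemma grp_dG: "add_subgroup (d (n - 1) ` G k (n - 1))"
  by (rule lin_image_grp[OF lin_d csub_V grp_G]) (auto simp: G_V)

lemma grp_coboundaries: "add_subgroup (coboundaries V d n)"
  unfolding coboundaries_def by (rule lin_image_grp[OF lin_d csub_V grp_V]) auto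

lemma coboundaries_cocycles: "coboundaries V d n \<subseteq> cocycles V d n"
  by (auto simp: coboundaries_def cocycles_def d_V' d_d')

lemma dG_coboundaries: "d (n - 1) ` G k (n - 1) \<subseteq> coboundaries V d n"
  by (auto simp: coboundaries_def G_V)

lemma dG_G: "d (n - 1) ` G k (n - 1) \<subseteq> G k n \<inter> cocycles V d n"
  by (auto simp: d_G' cocycles_def d_V' d_d' G_V)

lemma grp_gr_cocycles: "add_subgroup (gr_cocycles d G k n)"
  by (rule add_subgroupI) (auto simp: gr_cocycles_def G_zero G_diff d_zero d_diff G_V)

lemma grp_gr_coboundaries: "add_subgroup (gr_coboundaries d G k n)"
  unfolding gr_coboundaries_def by (rule grp_plus[OF grp_dG grp_G])

lemma gr_coboundariesI: "y \<in> G k (n - 1) ==> x - d (n - 1) y \<in> G (k - 1) n ==> x \<in> gr_coboundaries d G k n"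
  unfolding gr_coboundaries_def by (rule plus_memI) auto

lemma gr_coboundariesE:
  assumes "x \<in> gr_coboundaries d G k n"
  obtains y w where "y \<in> G k (n - 1)" "w \<in> G (k - 1) n" "x = d (n - 1) y + w"
  using assms unfolding gr_coboundaries_def by (auto elim!: plus_memE)

lemma gr_coboundaries_cocycles: "gr_coboundaries d G k n \<subseteq> gr_cocycles d G k n"
proof
  fix x assume "x \<in> gr_coboundaries d G k n"
  then obtain y w where *: "y \<in> G k (n - 1)" "w \<in> G (k - 1) n" "x = d (n - 1) y + w"
    by (rule gr_coboundariesE)
  have w: "w \<in> G k n" using G_mono[OF _ *(2), of k] by simp
  have "d n x = d n w" using * d_d'[of y n] d_add[of "d (n - 1) y" n w] G_V d_V' by auto
  then show "x \<in> gr_cocycles d G k n"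
    using * w G_add[OF d_G' w] d_G[OF *(2)] by (auto simp: gr_cocycles_def)
qed

end

locale filtered_map = X: filtered_cx V d G + Y: filtered_cx V' d' G'
  for V :: "'a::complex_vector graded" and d G
    and V' :: "'b::complex_vector graded" and d' G' +
  fixes f :: "int \<Rightarrow> 'a \<Rightarrow> 'b"
  assumes quasi_iso: "filtered_quasi_iso V d G V' d' G' f"
    and reg: "\<exists>k. G k n = {0}" and reg': "\<exists>k. G' k n = {0}"
begin

lemma lin_f: "linear_between (V n) (V' n) (f n)"
  and f_d: "x \<in> V n ==> f (n + 1) (d n x) = d' n (f n x)"
  and f_G: "x \<in> G k n ==> f n x \<in> G' k n"
  and gr_iso: "quotient_iso (f n) (gr_cocycles d G k n) (gr_coboundaries d G k n)
                           (gr_cocycles d' G' k n) (gr_coboundaries d' G' k n)"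
  using quasi_iso by (auto simp: filtered_quasi_iso_def image_subset_iff)

lemmas f_V = lin_mem[OF lin_f] and f_add = lin_add[OF lin_f] and f_scale = lin_scale[OF lin_f]
  and f_diff = lin_diff[OF lin_f X.csub_V] and f_minus = lin_minus[OF lin_f]
  and f_zero = lin_zero[OF lin_f X.csub_V]

lemma f_d': "x \<in> V (n - 1) ==> f n (d (n - 1) x) = d' (n - 1) (f (n - 1) x)"
  using f_d[of x "n - 1"] by simp

text \<open>The injectivity half of the five lemma for the inclusion of \<open>G (k - 1)\<close> in
  \<open>G k\<close> with quotient the graded piece. Injectivity on the graded piece in degree
  \<open>n\<close> and surjectivity in degree \<open>n - 1\<close> reduce the claim from
  \<open>k\<close> to \<open>k - 1\<close>.\<close>

lemma inj_G:
  "x \<in> G k n ==> d n x = 0 ==> y \<in> G' k (n - 1) ==> f n x = d' (n - 1) y ==>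
    x \<in> d (n - 1) ` G k (n - 1)"
proof (induction k arbitrary: x y rule: X.regular_induct[where n = n, OF reg, case_names zero step])
  case (zero k)
  then show ?case using X.G_zero X.d_zero by force
next
  case (step k)
  have xz: "x \<in> gr_cocycles d G k n" using step.prems X.G_zero by (auto simp: gr_cocycles_def)
  have "f n x \<in> gr_coboundaries d' G' k n"
    using step.prems Y.G_zero by (intro Y.gr_coboundariesI[of y]) auto
  then have "x \<in> gr_coboundaries d G k n" using quotient_isoD(3)[OF gr_iso xz] by simp
  then obtain u v where uv: "u \<in> G k (n - 1)" "v \<in> G (k - 1) n" "x = d (n - 1) u + v"
    by (rule X.gr_coboundariesE)
  have mem: "u \<in> V (n - 1)" "d (n - 1) u \<in> V n" "v \<in> V n" "y \<in> V' (n - 1)" "f (n - 1) u \<in> V' (n - 1)"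
    using uv X.G_V X.d_V' Y.G_V step.prems f_V by auto
  have dv: "d n v = 0" using step.prems(2) uv(3) X.d_add[OF mem(2,3)] X.d_d'[OF mem(1)] by simp
  have fv: "f n v = d' (n - 1) (y - f (n - 1) u)"
    using step.prems(4) f_add[OF mem(2,3)] f_d'[OF mem(1)] Y.d_diff[OF mem(4,5)] uv(3)
    by (simp add: algebra_simps)
  \<comment> \<open>This primitive of \<open>f n v\<close> need not have weight
    \<open>k - 1\<close>. It is a graded cocycle, hence lifts along \<open>f\<close> up to a graded
    boundary; subtracting the differential of the lift \<open>z\<close> leaves the primitive
    \<open>- q\<close>, which does.\<close>
  have "y - f (n - 1) u \<in> gr_cocycles d' G' k (n - 1)"
    using step.prems(3) uv f_G Y.G_diff fv[symmetric] f_G[OF uv(2)] by (auto simp: gr_cocycles_def)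
  then obtain z where z: "z \<in> gr_cocycles d G k (n - 1)"
    "f (n - 1) z - (y - f (n - 1) u) \<in> gr_coboundaries d' G' k (n - 1)"
    using quotient_isoD(4)[OF gr_iso] by blast
  have zG: "z \<in> G k (n - 1)" "d (n - 1) z \<in> G (k - 1) n" using z(1) by (auto simp: gr_cocycles_def)
  have zV: "z \<in> V (n - 1)" "d (n - 1) z \<in> V n" using zG X.G_V by auto
  obtain p q where pq: "p \<in> G' k (n - 1 - 1)" "q \<in> G' (k - 1) (n - 1)"
    "f (n - 1) z - (y - f (n - 1) u) = d' (n - 1 - 1) p + q"
    using Y.gr_coboundariesE[OF z(2)] by metis
  have pqV: "p \<in> V' (n - 1 - 1)" "q \<in> V' (n - 1)" "d' (n - 1 - 1) p \<in> V' (n - 1)"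
    "f (n - 1) z \<in> V' (n - 1)" "y - f (n - 1) u \<in> V' (n - 1)"
    using Y.G_V[OF pq(1)] Y.G_V[OF pq(2)] Y.d_V'[OF Y.G_V[OF pq(1)]] f_V[OF zV(1)] Y.V_diff[OF mem(4,5)]
    by blast+
  have "d' (n - 1) (f (n - 1) z - (y - f (n - 1) u)) = d' (n - 1) q"
    using pq(3) Y.d_add[OF pqV(3,2)] Y.d_d'[OF pqV(1)] by simp
  then have "f n (v - d (n - 1) z) = d' (n - 1) (- q)"
    unfolding f_diff[OF mem(3) zV(2)] fv f_d'[OF zV(1)] Y.d_diff[OF pqV(4,5)] Y.d_minus[OF pqV(2)]
    by (metis minus_diff_eq)
  moreover have "v - d (n - 1) z \<in> G (k - 1) n" "d n (v - d (n - 1) z) = 0"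
    using uv zG X.G_diff X.d_diff[OF mem(3) zV(2)] dv X.d_d'[OF zV(1)] by auto
  ultimately have "v - d (n - 1) z \<in> d (n - 1) ` G (k - 1) (n - 1)"
    using step.IH Y.G_minus[OF pq(2)] by blast
  then obtain w where w: "w \<in> G (k - 1) (n - 1)" "v - d (n - 1) z = d (n - 1) w" by blast
  have wG: "w \<in> G k (n - 1)" using X.G_mono[OF _ w(1), of k] by simp
  have "x = d (n - 1) (u + z + w)"
    using uv(3) w(2) X.d_add X.G_V wG zV mem X.V_add by (simp add: algebra_simps)
  then show ?case using X.G_add[OF X.G_add[OF uv(1) zG(1)] wG] by blast
qed

text \<open>Lift \<open>y\<close> modulo lower weight, then correct twice. \<open>inj_G\<close> in
  degree \<open>n + 1\<close> makes the lift a cocycle by subtracting some \<open>w\<close> of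
  weight \<open>k - 1\<close>, and the remaining error \<open>v - f n w\<close> is a cocycle of
  weight \<open>k - 1\<close>, to which the induction applies.\<close>

lemma surj_G:
  "y \<in> G' k n ==> d' n y = 0 ==>
    \<exists>x\<in>G k n. d n x = 0 \<and> f n x - y \<in> d' (n - 1) ` G' k (n - 1)"
proof (induction k arbitrary: y rule: Y.regular_induct[where n = n, OF reg', case_names zero step])
  case (zero k)
  have "f n 0 - y = d' (n - 1) 0" using zero f_zero Y.d_zero by auto
  then show ?case using X.G_zero X.d_zero Y.G_zero by blast
next
  case (step k)
  have "y \<in> gr_cocycles d' G' k n" using step.prems Y.G_zero by (auto simp: gr_cocycles_def)
  then obtain x where x: "x \<in> gr_cocycles d G k n" "f n x - y \<in> gr_coboundaries d' G' k n"
    using quotient_isoD(4)[OF gr_iso] by blast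
  have xG: "x \<in> G k n" "d n x \<in> G (k - 1) (n + 1)" using x(1) by (auto simp: gr_cocycles_def)
  have xV: "x \<in> V n" "f n x \<in> V' n" "y \<in> V' n" "d n x \<in> V (n + 1)" using xG X.G_V f_V step.prems Y.G_V by auto
  obtain u v where uv: "u \<in> G' k (n - 1)" "v \<in> G' (k - 1) n" "f n x - y = d' (n - 1) u + v"
    using Y.gr_coboundariesE[OF x(2)] by metis
  have uvV: "u \<in> V' (n - 1)" "d' (n - 1) u \<in> V' n" "v \<in> V' n" using uv Y.G_V Y.d_V' by auto
  have dv: "d' n v = d' n (f n x)"
    using arg_cong[OF uv(3), of "d' n"] Y.d_add[OF uvV(2,3)] Y.d_diff[OF xV(2,3)] Y.d_d'[OF uvV(1)] step.prems(2)
    by simp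
  have "d n x \<in> d (n + 1 - 1) ` G (k - 1) (n + 1 - 1)"
    using xG(2) X.d_d[OF xV(1)] uv(2) f_d[OF xV(1)] dv
    by (intro inj_G[where y = v]) auto
  then obtain w where w: "w \<in> G (k - 1) n" "d n x = d n w" by auto
  have wG: "w \<in> G k n" "w \<in> V n" using X.G_mono[OF _ w(1), of k] X.G_V[OF w(1)] by auto
  have "v - f n w \<in> G' (k - 1) n" using uv(2) f_G[OF w(1)] Y.G_diff by auto
  moreover have "d' n (v - f n w) = 0"
    using Y.d_diff[OF uvV(3) f_V[OF wG(2)]] dv f_d[OF wG(2)] f_d[OF xV(1)] w(2) by simp
  ultimately obtain x2 where x2: "x2 \<in> G (k - 1) n" "d n x2 = 0"
    "f n x2 - (v - f n w) \<in> d' (n - 1) ` G' (k - 1) (n - 1)" using step.IH by blast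
  then obtain u' where u': "u' \<in> G' (k - 1) (n - 1)" "f n x2 - (v - f n w) = d' (n - 1) u'" by blast
  have x2G: "x2 \<in> G k n" "x2 \<in> V n" using X.G_mono[OF _ x2(1), of k] X.G_V[OF x2(1)] by auto
  have u'G: "u' \<in> G' k (n - 1)" "u' \<in> V' (n - 1)" using Y.G_mono[OF _ u'(1), of k] Y.G_V[OF u'(1)] by auto
  have "f n (x - w - x2) - y = (f n x - y) - (f n x2 - (v - f n w)) - v"
    using f_diff[OF X.V_diff[OF xV(1) wG(2)] x2G(2)] f_diff[OF xV(1) wG(2)] by simp
  also have "\<dots> = d' (n - 1) (u - u')"
    unfolding uv(3) u'(2) Y.d_diff[OF uvV(1) u'G(2)] by simp
  finally have "f n (x - w - x2) - y = d' (n - 1) (u - u')" .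
  moreover have "x - w - x2 \<in> G k n" "d n (x - w - x2) = 0"
    using X.G_diff xG wG x2G X.d_diff[OF X.V_diff[OF xV(1) wG(2)] x2G(2)] X.d_diff[OF xV(1) wG(2)] w(2) x2(2)
    by auto
  moreover have "u - u' \<in> G' k (n - 1)" using uv(1) u'G Y.G_diff by blast
  ultimately show ?case by blast
qed

lemma iso_G: "quotient_iso (f n) (G k n \<inter> cocycles V d n) (d (n - 1) ` G k (n - 1))
   (G' k n \<inter> cocycles V' d' n) (d' (n - 1) ` G' k (n - 1))"
proof (rule quotient_isoI)
  show "f n x \<in> G' k n \<inter> cocycles V' d' n" if "x \<in> G k n \<inter> cocycles V d n" for x
    using that f_G f_V f_d[symmetric] f_zero by (auto simp: cocycles_def)
  show "f n x \<in> d' (n - 1) ` G' k (n - 1)" if "x \<in> d (n - 1) ` G k (n - 1)" for x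
    using that f_d' X.G_V f_G by auto
  show "x \<in> d (n - 1) ` G k (n - 1)"
    if "x \<in> G k n \<inter> cocycles V d n" "f n x \<in> d' (n - 1) ` G' k (n - 1)" for x
    using that inj_G by (auto simp: cocycles_def)
  show "\<exists>x\<in>G k n \<inter> cocycles V d n. f n x - y \<in> d' (n - 1) ` G' k (n - 1)"
    if "y \<in> G' k n \<inter> cocycles V' d' n" for y
    using surj_G[of y k n] that by (auto simp: cocycles_def X.G_V)
qed

text \<open>By exhaustiveness a cocycle and a primitive of its image lie in steps of the same index,
  where \<open>inj_G\<close> and \<open>surj_G\<close> apply.\<close>

lemma iso_total: "quotient_iso (f n) (cocycles V d n) (coboundaries V d n)
   (cocycles V' d' n) (coboundaries V' d' n)"
proof (rule quotient_isoI)
  show "f n x \<in> cocycles V' d' n" if "x \<in> cocycles V d n" for x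
    using that f_V f_d[symmetric] f_zero by (auto simp: cocycles_def)
  show "f n x \<in> coboundaries V' d' n" if "x \<in> coboundaries V d n" for x
    using that f_d' f_V by (auto simp: coboundaries_def)
  show "x \<in> coboundaries V d n" if x: "x \<in> cocycles V d n" "f n x \<in> coboundaries V' d' n" for x
  proof -
    obtain y where y: "y \<in> V' (n - 1)" "f n x = d' (n - 1) y" using x by (auto simp: coboundaries_def)
    obtain k l where kl: "x \<in> G k n" "y \<in> G' l (n - 1)"
      using X.V_G Y.V_G y x by (metis (no_types, lifting) cocycles_def mem_Collect_eq)
    have "x \<in> d (n - 1) ` G (max k l) (n - 1)"
      using inj_G[of x "max k l" n y] X.G_mono[OF _ kl(1), of "max k l"] Y.G_mono[OF _ kl(2), of "max k l"] x y
      by (auto simp: cocycles_def)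
    then show ?thesis using X.dG_coboundaries by blast
  qed
  show "\<exists>x\<in>cocycles V d n. f n x - y \<in> coboundaries V' d' n" if y: "y \<in> cocycles V' d' n" for y
  proof -
    obtain k where "y \<in> G' k n" using Y.V_G y by (auto simp: cocycles_def)
    then show ?thesis using surj_G[of y k n] y Y.dG_coboundaries X.G_V by (fastforce simp: cocycles_def)
  qed
qed

text \<open>Strictness says that the cohomology of each step injects into the total cohomology, and
  this is invariant under the isomorphisms \<open>iso_G\<close> and \<open>iso_total\<close>. A
  mixed Hodge complex has it as an axiom on its last component; this lemma carries it to the
  others.\<close>

lemma strict_iff: "(\<forall>k n. G k n \<inter> coboundaries V d n \<subseteq> d (n - 1) ` G k (n - 1)) \<longleftrightarrow>
  (\<forall>k n. G' k n \<inter> coboundaries V' d' n \<subseteq> d' (n - 1) ` G' k (n - 1))"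
proof (intro iffI allI subsetI)
  fix k n x
  assume *: "\<forall>k n. G' k n \<inter> coboundaries V' d' n \<subseteq> d' (n - 1) ` G' k (n - 1)"
    and x: "x \<in> G k n \<inter> coboundaries V d n"
  then have "f n x \<in> G' k n \<inter> coboundaries V' d' n"
    using f_G quotient_isoD(2)[OF iso_total] by blast
  then have "f n x \<in> d' (n - 1) ` G' k (n - 1)" using * by blast
  moreover have "x \<in> G k n \<inter> cocycles V d n" using x X.coboundaries_cocycles by blast
  ultimately show "x \<in> d (n - 1) ` G k (n - 1)" using quotient_isoD(3)[OF iso_G] by blast
next
  fix k n y
  assume *: "\<forall>k n. G k n \<inter> coboundaries V d n \<subseteq> d (n - 1) ` G k (n - 1)"
    and y: "y \<in> G' k n \<inter> coboundaries V' d' n"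
  then have "y \<in> G' k n \<inter> cocycles V' d' n" using Y.coboundaries_cocycles by blast
  then obtain x where x: "x \<in> G k n \<inter> cocycles V d n" "f n x - y \<in> d' (n - 1) ` G' k (n - 1)"
    using quotient_isoD(4)[OF iso_G] by blast
  have "f n x - y + y \<in> coboundaries V' d' n"
    using x(2) y Y.dG_coboundaries grp_add[OF Y.grp_coboundaries] by blast
  then have "x \<in> coboundaries V d n" using quotient_isoD(3)[OF iso_total] x(1) by auto
  then have "x \<in> d (n - 1) ` G k (n - 1)" using * x(1) by blast
  then have "f n x \<in> d' (n - 1) ` G' k (n - 1)" using quotient_isoD(2)[OF iso_G] by blast
  then have "f n x - (f n x - y) \<in> d' (n - 1) ` G' k (n - 1)" using x(2) grp_diff[OF Y.grp_dG] by blast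
  then show "y \<in> d' (n - 1) ` G' k (n - 1)" by simp
qed

end

section \<open>Strictness of injective morphisms\<close>

text \<open>A mixed Hodge structure on \<open>Z / B\<close>, with every subspace replaced by its
  preimage in \<open>Z\<close>. The conditions \<open>split\<close> and \<open>direct\<close> say
  that \<open>F\<close> and \<open>G\<close> induce \<open>k\<close>-opposed filtrations on the
  graded piece of weight \<open>k\<close>.\<close>

locale opposed_filtrations =
  fixes Z B :: "'a::ab_group_add set" and W F G :: "int \<Rightarrow> 'a set"
  assumes grp: "add_subgroup Z" "add_subgroup B" "\<And>k. add_subgroup (W k)" "\<And>p. add_subgroup (F p)"
      "\<And>q. add_subgroup (G q)"
    and B_W: "B \<subseteq> W k" and B_F: "B \<subseteq> F p" and W_Z: "W k \<subseteq> Z" and F_Z: "F p \<subseteq> Z"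
    and W_Suc: "W k \<subseteq> W (k + 1)" and W_exhaustive: "x \<in> Z ==> \<exists>k. x \<in> W k" and W_regular: "\<exists>k. W k \<subseteq> B"
    and F_lower: "\<exists>p. F p \<subseteq> B" and F_upper: "\<exists>p. Z \<subseteq> F p" and F_Suc: "F (p + 1) \<subseteq> F p"
    and G_Suc: "G (q + 1) \<subseteq> G q"
    and split: "x \<in> W k ==> \<exists>u v. u \<in> F p \<and> u \<in> W k \<and> v \<in> G (k + 1 - p) \<and> v \<in> W k \<and> x - u - v \<in> W (k - 1)"
    and direct: "u \<in> F p ==> u \<in> W k ==> v \<in> G (k + 1 - p) ==> v \<in> W k ==> u - v \<in> W (k - 1) ==> u \<in> W (k - 1)"
begin

lemma W_mono: "j \<le> k ==> x \<in> W j ==> x \<in> W k"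
proof (induction k rule: int_ge_induct)
  case (step i)
  then show ?case using W_Suc by blast
qed simp

lemma F_mono: "p \<le> q ==> x \<in> F q ==> x \<in> F p"
proof (induction q rule: int_ge_induct)
  case (step i)
  then show ?case using F_Suc by blast
qed simp

end

text \<open>
  The filtrations \<open>G\<close> play the role of the complex conjugate of \<open>F\<close>.
\<close>

locale opposed_morphism = X: opposed_filtrations Z B W F G + Y: opposed_filtrations Z' B' W' F' G'
  for Z B :: "'a::ab_group_add set" and W F G and Z' B' :: "'b::ab_group_add set" and W' F' G' +
  fixes f :: "'a \<Rightarrow> 'b"
  assumes f_diff: "x \<in> Z ==> y \<in> Z ==> f (x - y) = f x - f y"
    and f_W: "x \<in> W k ==> f x \<in> W' k" and f_F: "x \<in> F p ==> f x \<in> F' p"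
    and G_Z: "G q \<subseteq> Z" and f_G: "x \<in> G q ==> f x \<in> G' q"
    and f_inj: "x \<in> Z ==> f x \<in> B' ==> x \<in> B"
begin

text \<open>The pair \<open>a\<close>, \<open>b\<close> represents a class of Hodge type
  \<open>(p, m - p)\<close> in weight \<open>m\<close>. It is rectified weight by weight: both
  members are modified so that they agree modulo \<open>W k\<close> for smaller and smaller
  \<open>k\<close>, while the index of \<open>G\<close> is lowered along with \<open>k\<close>.
  Opposedness in the target pushes the image of the first member down at the same time, until it
  lies in \<open>B'\<close>.\<close>

lemma gr_injective_pure:
  assumes a: "a \<in> F p" "a \<in> W m" "b \<in> G (m - p)" "b \<in> W m" "a - b \<in> W (m - 1)" "f a \<in> W' (m - 1)"
  shows "a \<in> W (m - 1)"
proof -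
  have ind: "k \<le> m - 1 ==> \<exists>a' b'. a' \<in> F p \<and> b' \<in> G (k + 1 - p) \<and> a' - a \<in> W (m - 1) \<and> a' - b' \<in> W k \<and> f a' \<in> W' k" for k
  proof (induction k rule: int_le_induct)
    case base
    have "a - a \<in> W (m - 1)" using grp_zero[OF X.grp(3)] by simp
    then show ?case using a by (intro exI[of _ a] exI[of _ b]) simp
  next
    case (step k)
    then obtain a' b' where ab: "a' \<in> F p" "b' \<in> G (k + 1 - p)" "a' - a \<in> W (m - 1)" "a' - b' \<in> W k" "f a' \<in> W' k"
      by blast
    \<comment> \<open>The discrepancy is divided between the two members. The index
      \<open>k + 1 - p\<close> of \<open>G\<close> is exactly the one opposed to \<open>p\<close> in
      weight \<open>k\<close>.\<close>
    obtain u v where uv: "u \<in> F p" "u \<in> W k" "v \<in> G (k + 1 - p)" "v \<in> W k" "a' - b' - u - v \<in> W (k - 1)"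
      using X.split[OF ab(4), of p] by blast
    let ?a = "a' - u" and ?b = "b' + v"
    have 1: "?a \<in> F p" "?b \<in> G (k + 1 - p)" using ab uv grp_diff[OF X.grp(4)] grp_add[OF X.grp(5)] by auto
    have 2: "?a - ?b \<in> W (k - 1)" using uv(5) by (simp add: algebra_simps)
    have Z: "?a \<in> Z" "?b \<in> Z" "a' \<in> Z" "u \<in> Z" using 1 ab uv X.F_Z G_Z by blast+
    have "f ?a = f a' - f u" using f_diff Z by blast
    then have 3: "f ?a \<in> W' k" using ab(5) f_W[OF uv(2)] grp_diff[OF Y.grp(3)] by simp
    have 4: "f ?a - f ?b \<in> W' (k - 1)" using f_W[OF 2] f_diff[OF Z(1,2)] by simp
    have "f ?b = f ?a - (f ?a - f ?b)" by simp
    then have "f ?b \<in> W' k" using grp_diff[OF Y.grp(3) 3 Y.W_mono[OF _ 4, of k]] by simp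
    then have "f ?a \<in> W' (k - 1)" using Y.direct[OF f_F[OF 1(1)] 3 f_G[OF 1(2)] _ 4] by blast
    moreover have "?a - a \<in> W (m - 1)"
    proof -
      have "u \<in> W (m - 1)" using X.W_mono[OF _ uv(2), of "m - 1"] step.hyps by simp
      then show ?thesis by (rule mem_eq[OF grp_diff[OF X.grp(3) ab(3)]]) simp
    qed
    moreover have "?b \<in> G (k - 1 + 1 - p)" using 1(2) X.G_Suc[of "k - p"] by (auto simp: algebra_simps)
    ultimately show ?case using 1 2 by blast
  qed
  obtain k0 where k0: "W' k0 \<subseteq> B'" using Y.W_regular by blast
  obtain a' where a': "a' \<in> F p" "a' - a \<in> W (m - 1)" "f a' \<in> W' (min k0 (m - 1))"
    using ind[OF min.cobounded2[of k0 "m - 1"]] by blast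
  \<comment> \<open>Regularity ends the descent: the image has become a boundary, so injectivity on
    cohomology makes \<open>a'\<close> a boundary, and \<open>a\<close> differs from it by lower
    weight.\<close>
  have "f a' \<in> B'" using k0 Y.W_mono[OF _ a'(3), of k0] by auto
  then have "a' \<in> W (m - 1)" using f_inj a'(1) X.F_Z X.B_W by blast
  then have "a' - (a' - a) \<in> W (m - 1)" using a'(2) grp_diff[OF X.grp(3)] by blast
  then show ?thesis by simp
qed

text \<open>The Hodge index of a representative of \<open>x\<close> modulo \<open>W (m - 1)\<close>
  is raised until the representative lies in \<open>B\<close>. Passing from \<open>p\<close> to
  \<open>p + 1\<close> removes the component of type \<open>(p, m - p)\<close>, which
  \<open>gr_injective_pure\<close> shows to be of lower weight.\<close>

lemma gr_injective:
  assumes x: "x \<in> W m" "f x \<in> W' (m - 1)"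
  shows "x \<in> W (m - 1)"
proof -
  obtain p0 where p0: "Z \<subseteq> F p0" using X.F_upper by blast
  obtain p1 where p1: "F p1 \<subseteq> B" using X.F_lower by blast
  have ind: "p0 \<le> p ==> \<exists>y. y \<in> F p \<and> y \<in> W m \<and> x - y \<in> W (m - 1)" for p
  proof (induction p rule: int_ge_induct)
    case base
    then show ?case using x p0 X.W_Z grp_zero[OF X.grp(3)] by (intro exI[of _ x]) auto
  next
    case (step p)
    then obtain y where y: "y \<in> F p" "y \<in> W m" "x - y \<in> W (m - 1)" by blast
    obtain u v where "u \<in> F (p + 1) \<and> u \<in> W m \<and> v \<in> G (m + 1 - (p + 1)) \<and> v \<in> W m \<and> y - u - v \<in> W (m - 1)"
      using X.split[OF y(2), of "p + 1"] by blast
    then have uv: "u \<in> F (p + 1)" "u \<in> W m" "v \<in> G (m - p)" "v \<in> W m" "y - u - v \<in> W (m - 1)" by auto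
    have Z: "x \<in> Z" "y \<in> Z" "u \<in> Z" "v \<in> Z" "y - u \<in> Z" "x - y \<in> Z" using x y uv X.W_Z grp_diff[OF X.grp(1)] by blast+
    have "f y = f x - f (x - y)" using f_diff[OF Z(1) Z(6)] by simp
    then have fy: "f y \<in> W' (m - 1)" using x(2) f_W[OF y(3)] grp_diff[OF Y.grp(3)] by simp
    have fuv: "f (y - u - v) = f y - f u - f v" using f_diff Z by simp
    have "f u - (- f v) = f y - f (y - u - v)" using fuv by simp
    then have "f u - (- f v) \<in> W' (m - 1)" using fy f_W[OF uv(5)] grp_diff[OF Y.grp(3)] by simp
    moreover have "- f v \<in> G' (m + 1 - (p + 1))" "- f v \<in> W' m"
      using grp_minus[OF Y.grp(5) f_G[OF uv(3)]] grp_minus[OF Y.grp(3) f_W[OF uv(4)]] by auto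
    ultimately have fu: "f u \<in> W' (m - 1)" using Y.direct[OF f_F[OF uv(1)] f_W[OF uv(2)]] by blast
    have 1: "y - u \<in> F p" "y - u \<in> W m" "f (y - u) \<in> W' (m - 1)"
      using grp_diff[OF X.grp(4) y(1)] grp_diff[OF X.grp(3) y(2) uv(2)] X.F_Suc uv(1)
        grp_diff[OF Y.grp(3) fy fu] f_diff[OF Z(2,3)] by auto
    have "y - u \<in> W (m - 1)" using gr_injective_pure[OF 1(1,2) uv(3,4,5) 1(3)] .
    then have "(x - y) + (y - u) \<in> W (m - 1)" using y(3) grp_add[OF X.grp(3)] by blast
    then show ?case using uv by (intro exI[of _ u]) simp
  qed
  then obtain y where y: "y \<in> F (max p0 p1)" "x - y \<in> W (m - 1)"
    using ind[OF max.cobounded1[of p0 p1]] by blast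
  have "y \<in> W (m - 1)" using X.F_mono[OF _ y(1), of p1] p1 X.B_W by auto
  then have "(x - y) + y \<in> W (m - 1)" using y(2) grp_add[OF X.grp(3)] by blast
  then show ?thesis by simp
qed

lemma strict_W:
  assumes "x \<in> Z" "f x \<in> W' k" shows "x \<in> W k"
proof -
  obtain m where m: "x \<in> W m" using X.W_exhaustive assms(1) by blast
  have main: "x \<in> W k" if "k \<le> m" "x \<in> W m" for m using that
  proof (induction m rule: int_ge_induct)
    case (step i)
    then show ?case using gr_injective[of x "i + 1"] Y.W_mono[OF _ assms(2), of i] by auto
  qed simp
  show ?thesis using main[of "max k m"] X.W_mono[OF _ m, of "max k m"] by simp
qed

text \<open>Induction on the weight of \<open>x\<close>. Split off a part \<open>u\<close> in
  \<open>F p\<close>; the image of the rest lies in \<open>F' p\<close> and is congruent to an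
  element of the opposed step of \<open>G'\<close>, so its weight drops by \<open>direct\<close>,
  and the weight of the rest itself drops by \<open>strict_W\<close>.\<close>

lemma strict_F:
  assumes "x \<in> Z" "f x \<in> F' p" shows "x \<in> F p"
proof -
  obtain m where m: "x \<in> W m" using X.W_exhaustive assms(1) by blast
  obtain k where k: "W k \<subseteq> B" using X.W_regular by blast
  have main: "k \<le> m ==> x \<in> W m ==> f x \<in> F' p ==> x \<in> F p" for m x
  proof (induction m arbitrary: x rule: int_ge_induct)
    case base
    then show ?case using k X.B_F by blast
  next
    case (step i)
    obtain u v where "u \<in> F p \<and> u \<in> W (i + 1) \<and> v \<in> G (i + 1 + 1 - p) \<and> v \<in> W (i + 1) \<and> x - u - v \<in> W (i + 1 - 1)"
      using X.split[OF step.prems(1), of p] by blast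
    then have uv: "u \<in> F p" "u \<in> W (i + 1)" "v \<in> G (i + 1 + 1 - p)" "v \<in> W (i + 1)" "x - u - v \<in> W i" by auto
    have Z: "x \<in> Z" "u \<in> Z" "v \<in> Z" "x - u \<in> Z" using step.prems uv X.W_Z grp_diff[OF X.grp(1)] by blast+
    have xu: "f (x - u) = f x - f u" using f_diff Z by simp
    have 1: "f (x - u) \<in> F' p" "f (x - u) \<in> W' (i + 1)"
      using step.prems uv xu f_F f_W grp_diff[OF Y.grp(4)] grp_diff[OF Y.grp(3)] by auto
    have "f (x - u) - f v \<in> W' (i + 1 - 1)" using f_W[OF uv(5)] f_diff[OF Z(4,3)] by simp
    then have "f (x - u) \<in> W' (i + 1 - 1)" using Y.direct[OF 1 f_G[OF uv(3)] f_W[OF uv(4)]] by blast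
    then have "x - u \<in> W i" using strict_W[OF Z(4)] by simp
    then have "x - u \<in> F p" using step.IH 1 by blast
    then have "(x - u) + u \<in> F p" using uv(1) grp_add[OF X.grp(4)] by blast
    then show ?case by simp
  qed
  show ?thesis using main[of "max k m"] X.W_mono[OF _ m, of "max k m"] assms by simp
qed

end

section \<open>Mixed Hodge complexes\<close>

lemma set_plus_zero [simp]: "S + {0} = S" for S :: "'a::ab_group_add set"
  by (auto simp: set_plus_def)

lemma arrows_le: "(r, q) \<in> arrows s ==> r \<le> s \<and> q \<le> s"
  by (auto simp: arrows_def)

text \<open>Indexing the arrows by the link between \<open>i\<close> and \<open>Suc i\<close>, which
  points right for even \<open>i\<close> and left for odd \<open>i\<close>, makes induction along
  the zigzag possible.\<close>

lemma arrows_ball: "(\<forall>(r, q)\<in>arrows s. P r q) \<longleftrightarrow> (\<forall>i<s. if even i then P i (Suc i) else P (Suc i) i)"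
proof (intro iffI allI impI)
  fix i assume "\<forall>(r, q)\<in>arrows s. P r q" "i < s"
  then show "if even i then P i (Suc i) else P (Suc i) i" by (auto simp: arrows_def)
next
  assume *: "\<forall>i<s. if even i then P i (Suc i) else P (Suc i) i"
  have "P r q" if "(r, q) \<in> arrows s" for r q
    using that *[rule_format, of r] *[rule_format, of q] by (auto simp: arrows_def)
  then show "\<forall>(r, q)\<in>arrows s. P r q" by blast
qed

definition zlink :: "('a::complex_vector, 'z) mhc_scheme \<Rightarrow> int \<Rightarrow> (nat \<Rightarrow> 'a set) \<Rightarrow> nat \<Rightarrow> 'a \<Rightarrow> 'a \<Rightarrow> bool" where
  "zlink A n B i a b \<longleftrightarrow> (if even i then cmp A i (Suc i) n a - b \<in> B (Suc i) else cmp A (Suc i) i n b - a \<in> B i)"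

definition zchain :: "('a::complex_vector, 'z) mhc_scheme \<Rightarrow> int \<Rightarrow> (nat \<Rightarrow> 'a set) \<Rightarrow> (nat \<Rightarrow> 'a set) \<Rightarrow> (nat \<Rightarrow> 'a) \<Rightarrow> bool" where
  "zchain A n Z B z \<longleftrightarrow> (\<forall>i\<le>len A. z i \<in> Z i) \<and> (\<forall>i<len A. zlink A n B i (z i) (z (Suc i)))"

lemma corresponds_iff_zchain:
  "corresponds A n Z B x y \<longleftrightarrow> (\<exists>z. zchain A n Z B z \<and> z 0 = x \<and> z (len A) = y)"
  unfolding corresponds_def zchain_def arrows_ball zlink_def by auto

lemma zchain_mono:
  assumes "zchain A n Z B z" "\<And>i. i \<le> len A ==> Z i \<subseteq> Z' i" "\<And>i. i \<le> len A ==> B i \<subseteq> B' i"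
  shows "zchain A n Z' B' z"
  unfolding zchain_def
proof (intro conjI allI impI)
  fix i assume "i \<le> len A"
  then show "z i \<in> Z' i" using assms(1) assms(2)[of i] unfolding zchain_def by blast
next
  fix i assume "i < len A"
  then have "zlink A n B i (z i) (z (Suc i))" "B i \<subseteq> B' i" "B (Suc i) \<subseteq> B' (Suc i)"
    using assms unfolding zchain_def by auto
  then show "zlink A n B' i (z i) (z (Suc i))" unfolding zlink_def by (auto split: if_splits)
qed

lemma corr_mono:
  assumes "corresponds A n Z B x y" "\<And>i. i \<le> len A ==> Z i \<subseteq> Z' i" "\<And>i. i \<le> len A ==> B i \<subseteq> B' i"
  shows "corresponds A n Z' B' x y"
proof -
  obtain z where z: "zchain A n Z B z" "z 0 = x" "z (len A) = y"
    using assms(1) unfolding corresponds_iff_zchain by blast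
  have "zchain A n Z' B' z" by (rule zchain_mono[OF z(1)]) (use assms(2,3) in auto)
  then show ?thesis using z unfolding corresponds_iff_zchain by blast
qed

lemma corr_mem: "corresponds A n Z B x y ==> x \<in> Z 0 \<and> y \<in> Z (len A)"
  by (auto simp: corresponds_def)

text \<open>Purity is kept apart in \<open>mhc_pure\<close>: the present locale is also instantiated
  with padded diagrams, for which purity is not checked again.\<close>

locale mhc_core =
  fixes K :: "complex set" and A :: "('a::complex_vector, 'z) mhc_scheme"
  assumes K: "real_subfield K"
    and len_pos: "1 \<le> len A"
    and filt: "i \<le> len A ==> filtered_complex (cpt A i) (dif A i) (wt A i)"
    and reg: "i \<le> len A ==> \<exists>k. wt A i k n = {0}"
    and K_str: "K_structure K (cpt A 0 n) (rat A n)"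
    and rat_dif: "dif A 0 n ` rat A n \<subseteq> rat A (n + 1)"
    and wt_span: "span_over UNIV (wt A 0 k n \<inter> rat A n) = wt A 0 k n"
    and hdg_filt: "filtered_complex (cpt A (len A)) (dif A (len A)) (\<lambda>p. hdg A (- p))"
    and hdg_low: "\<exists>p. hdg A p n = {0}" and hdg_up: "\<exists>p. hdg A p n = cpt A (len A) n"
    and qi: "(r, q) \<in> arrows (len A) ==> filtered_quasi_iso (cpt A r) (dif A r) (wt A r)
        (cpt A q) (dif A q) (wt A q) (cmp A r q)"
    and W_str: "strict_mod (dif A (len A)) (cpt A (len A)) (wt A (len A)) (\<lambda>n. {0})"
    and gr_str: "strict_mod (dif A (len A)) (wt A (len A) k)
        (\<lambda>p n. hdg A p n \<inter> wt A (len A) k n) (wt A (len A) (k - 1))"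

lemma mhc_core_if_mixed_hodge_complex:
  "real_subfield K ==> mixed_hodge_complex K A ==> mhc_core K A"
  unfolding mixed_hodge_complex_def Let_def
  by (intro mhc_core.intro) (blast | auto)+

context mhc_core
begin

lemma cx: "i \<le> len A ==> filtered_cx (cpt A i) (dif A i) (wt A i)"
  by (rule filtered_cx.intro) (rule filt)

lemma hdg_cx: "filtered_cx (cpt A (len A)) (dif A (len A)) (\<lambda>p. hdg A (- p))"
  by (rule filtered_cx.intro) (rule hdg_filt)

lemma fm: "(r, q) \<in> arrows (len A) ==> filtered_map (cpt A r) (dif A r) (wt A r)
        (cpt A q) (dif A q) (wt A q) (cmp A r q)"
  using arrows_le[of r q "len A"]
  by (intro filtered_map.intro filtered_map_axioms.intro cx qi reg) auto

lemmas csub_V = filtered_cx.csub_V[OF cx] and csub_W = filtered_cx.csub_G[OF cx]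
  and grp_V = filtered_cx.grp_V[OF cx] and grp_W = filtered_cx.grp_G[OF cx]
  and V_zero = filtered_cx.V_zero[OF cx] and V_diff = filtered_cx.V_diff[OF cx] and V_add = filtered_cx.V_add[OF cx]
  and V_minus = filtered_cx.V_minus[OF cx] and V_scale = filtered_cx.V_scale[OF cx]
  and W_zero = filtered_cx.G_zero[OF cx] and W_diff = filtered_cx.G_diff[OF cx] and W_add = filtered_cx.G_add[OF cx]
  and W_minus = filtered_cx.G_minus[OF cx] and W_scale = filtered_cx.G_scale[OF cx]
  and lin_d = filtered_cx.lin_d[OF cx] and d_d = filtered_cx.d_d[OF cx] and d_d' = filtered_cx.d_d'[OF cx]
  and d_V = filtered_cx.d_V[OF cx] and d_V' = filtered_cx.d_V'[OF cx]
  and d_W = filtered_cx.d_G[OF cx] and d_W' = filtered_cx.d_G'[OF cx]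
  and d_add = filtered_cx.d_add[OF cx] and d_diff = filtered_cx.d_diff[OF cx] and d_minus = filtered_cx.d_minus[OF cx]
  and d_zero = filtered_cx.d_zero[OF cx] and d_scale = filtered_cx.d_scale[OF cx]
  and W_V = filtered_cx.G_V[OF cx] and V_W = filtered_cx.V_G[OF cx] and W_mono = filtered_cx.G_mono[OF cx]
  and grp_dW = filtered_cx.grp_dG[OF cx]

lemma grp_Z: "i \<le> len A ==> add_subgroup (cocyc A i n)"
  and grp_B: "i \<le> len A ==> add_subgroup (cobd A i n)"
  and B_Z: "i \<le> len A ==> cobd A i n \<subseteq> cocyc A i n"
  and dW_B: "i \<le> len A ==> dif A i (n - 1) ` wt A i k (n - 1) \<subseteq> cobd A i n"
  and dW_WZ: "i \<le> len A ==> dif A i (n - 1) ` wt A i k (n - 1) \<subseteq> wt A i k n \<inter> cocyc A i n"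
  unfolding cocyc_def cobd_def
  using filtered_cx.grp_cocycles[OF cx] filtered_cx.grp_coboundaries[OF cx]
    filtered_cx.coboundaries_cocycles[OF cx] filtered_cx.dG_coboundaries[OF cx] filtered_cx.dG_G[OF cx] by blast+

lemma Z_V: "cocyc A i n \<subseteq> cpt A i n" by (auto simp: cocyc_def cocycles_def)

lemma ZI: "x \<in> cpt A i n ==> dif A i n x = 0 ==> x \<in> cocyc A i n"
  and Z_d: "x \<in> cocyc A i n ==> dif A i n x = 0"
  by (auto simp: cocyc_def cocycles_def)

lemma BI: "y \<in> cpt A i (n - 1) ==> x = dif A i (n - 1) y ==> x \<in> cobd A i n"
  by (auto simp: cobd_def coboundaries_def)

lemma BE: assumes "x \<in> cobd A i n" obtains y where "y \<in> cpt A i (n - 1)" "x = dif A i (n - 1) y"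
  using assms by (auto simp: cobd_def coboundaries_def)

lemma csub_F: "subspace_over UNIV (hdg A p n)"
  and F_d: "x \<in> hdg A p n ==> dif A (len A) n x \<in> hdg A p (n + 1)"
  and F_d': "x \<in> hdg A p (n - 1) ==> dif A (len A) (n - 1) x \<in> hdg A p n"
  and F_V: "x \<in> hdg A p n ==> x \<in> cpt A (len A) n"
  and F_antimono: "p \<le> p' ==> x \<in> hdg A p' n ==> x \<in> hdg A p n"
  using filtered_cx.csub_G[OF hdg_cx, of "- p"] filtered_cx.d_G[OF hdg_cx, of x "- p"]
    filtered_cx.d_G'[OF hdg_cx, of x "- p"]
    filtered_cx.G_V[OF hdg_cx, of x "- p"] filtered_cx.G_mono[OF hdg_cx, of "- p'" "- p"] by auto

lemmas grp_F = csub_grp[OF csub_F]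
lemmas F_zero = grp_zero[OF grp_F] and F_diff = grp_diff[OF grp_F] and F_add = grp_add[OF grp_F]
  and F_scale = csub_scale[OF csub_F]

lemma cmp_lin: "(r, q) \<in> arrows (len A) ==> linear_between (cpt A r n) (cpt A q n) (cmp A r q n)"
  by (rule filtered_map.lin_f[OF fm])

lemmas cmp_V = filtered_map.f_V[OF fm] and cmp_W = filtered_map.f_G[OF fm] and cmp_d = filtered_map.f_d[OF fm]
  and cmp_d' = filtered_map.f_d'[OF fm] and cmp_diff = filtered_map.f_diff[OF fm] and cmp_add = filtered_map.f_add[OF fm]
  and cmp_zero = filtered_map.f_zero[OF fm] and cmp_minus = filtered_map.f_minus[OF fm]
  and cmp_scale = filtered_map.f_scale[OF fm]

subsection \<open>The zigzag of comparison morphisms\<close>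

text \<open>Subquotients of the components on which every comparison morphism is an isomorphism.
  Four instances share the chain arguments below: full cohomology, cohomology of a weight step,
  cohomology of a graded piece, and cohomology modulo a weight step.\<close>

definition zig_family :: "int \<Rightarrow> (nat \<Rightarrow> 'a set) \<Rightarrow> (nat \<Rightarrow> 'a set) \<Rightarrow> bool" where
  "zig_family n Z B \<longleftrightarrow>
     (\<forall>i\<le>len A. add_subgroup (Z i) \<and> add_subgroup (B i) \<and> B i \<subseteq> Z i \<and> Z i \<subseteq> cpt A i n) \<and>
     (\<forall>(r, q)\<in>arrows (len A). quotient_iso (cmp A r q n) (Z r) (B r) (Z q) (B q))"

lemma zig_familyI:
  assumes "\<And>i. i \<le> len A ==> add_subgroup (Z i)" "\<And>i. i \<le> len A ==> add_subgroup (B i)"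
    "\<And>i. i \<le> len A ==> B i \<subseteq> Z i" "\<And>i. i \<le> len A ==> Z i \<subseteq> cpt A i n"
    "\<And>r q. (r, q) \<in> arrows (len A) ==> quotient_iso (cmp A r q n) (Z r) (B r) (Z q) (B q)"
  shows "zig_family n Z B"
  unfolding zig_family_def using assms by blast

lemma zig_familyD:
  assumes "zig_family n Z B"
  shows "i \<le> len A ==> add_subgroup (Z i)" "i \<le> len A ==> add_subgroup (B i)"
    "i \<le> len A ==> B i \<subseteq> Z i" "i \<le> len A ==> Z i \<subseteq> cpt A i n"
    "(r, q) \<in> arrows (len A) ==> quotient_iso (cmp A r q n) (Z r) (B r) (Z q) (B q)"
  using assms unfolding zig_family_def by blast+

lemma arrow_even: "i < len A ==> even i ==> (i, Suc i) \<in> arrows (len A)"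
  and arrow_odd: "i < len A ==> odd i ==> (Suc i, i) \<in> arrows (len A)"
  by (auto simp: arrows_def)

lemma zlink_up:
  assumes Z: "zig_family n Z B" and i: "i < len A" and a: "a \<in> Z i"
  shows "\<exists>b\<in>Z (Suc i). zlink A n B i a b"
proof (cases "even i")
  case True
  let ?b = "cmp A i (Suc i) n a"
  have "?b \<in> Z (Suc i)" using quotient_isoD(1)[OF zig_familyD(5)[OF Z arrow_even[OF i True]] a] .
  moreover have "zlink A n B i a ?b" using True grp_zero zig_familyD(2)[OF Z, of "Suc i"] i by (simp add: zlink_def)
  ultimately show ?thesis by blast
next
  case False
  then show ?thesis using quotient_isoD(4)[OF zig_familyD(5)[OF Z arrow_odd[OF i False]] a] by (simp add: zlink_def)
qed

lemma zlink_down: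
  assumes Z: "zig_family n Z B" and i: "i < len A" and b: "b \<in> Z (Suc i)"
  shows "\<exists>a\<in>Z i. zlink A n B i a b"
proof (cases "odd i")
  case True
  let ?a = "cmp A (Suc i) i n b"
  have "?a \<in> Z i" using quotient_isoD(1)[OF zig_familyD(5)[OF Z arrow_odd[OF i True]] b] .
  moreover have "zlink A n B i ?a b" using True grp_zero zig_familyD(2)[OF Z, of i] i by (simp add: zlink_def)
  ultimately show ?thesis by blast
next
  case False
  then have "even i" by simp
  then show ?thesis using quotient_isoD(4)[OF zig_familyD(5)[OF Z arrow_even[OF i]] b] by (simp add: zlink_def)
qed

lemma zlink_iff:
  assumes Z: "zig_family n Z B" and i: "i < len A" and ab: "a \<in> Z i" "b \<in> Z (Suc i)" "zlink A n B i a b"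
  shows "a \<in> B i \<longleftrightarrow> b \<in> B (Suc i)"
proof -
  have *: "a \<in> B r \<longleftrightarrow> b \<in> B q" if "(r, q) \<in> arrows (len A)" "a \<in> Z r" "b \<in> Z q" "cmp A r q n a - b \<in> B q" for r q a b
  proof -
    have g: "add_subgroup (B q)" using zig_familyD(2)[OF Z] arrows_le[OF that(1)] by blast
    have "cmp A r q n a \<in> B q \<longleftrightarrow> b \<in> B q"
    proof
      assume "cmp A r q n a \<in> B q"
      then have "cmp A r q n a - (cmp A r q n a - b) \<in> B q" using grp_diff[OF g] that(4) by blast
      then show "b \<in> B q" by simp
    next
      assume "b \<in> B q"
      then have "(cmp A r q n a - b) + b \<in> B q" using grp_add[OF g] that(4) by blast
      then show "cmp A r q n a \<in> B q" by simp
    qed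
    then show ?thesis using quotient_isoD(2,3)[OF zig_familyD(5)[OF Z that(1)]] that(2) by blast
  qed
  show ?thesis
  proof (cases "even i")
    case True
    then show ?thesis using *[OF arrow_even[OF i True] ab(1,2)] ab(3) by (simp add: zlink_def)
  next
    case False
    then show ?thesis using *[OF arrow_odd[OF i False] ab(2,1)] ab(3) by (simp add: zlink_def)
  qed
qed

lemma zlink_diff:
  assumes Z: "zig_family n Z B" and i: "i < len A" and ab: "a \<in> Z i" "b \<in> Z (Suc i)" "zlink A n B i a b"
    and ab': "a' \<in> Z i" "b' \<in> Z (Suc i)" "zlink A n B i a' b'"
  shows "zlink A n B i (a - a') (b - b')"
proof -
  have V: "a \<in> cpt A i n" "a' \<in> cpt A i n" "b \<in> cpt A (Suc i) n" "b' \<in> cpt A (Suc i) n"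
    using ab ab' zig_familyD(4)[OF Z, of i] zig_familyD(4)[OF Z, of "Suc i"] i by auto
  show ?thesis
  proof (cases "even i")
    case True
    have "(cmp A i (Suc i) n a - b) - (cmp A i (Suc i) n a' - b') \<in> B (Suc i)"
      using ab(3) ab'(3) True grp_diff[OF zig_familyD(2)[OF Z]] i by (simp add: zlink_def)
    then have "cmp A i (Suc i) n (a - a') - (b - b') \<in> B (Suc i)"
      by (rule mem_eq) (simp add: cmp_diff[OF arrow_even[OF i True] V(1,2)])
    then show ?thesis using True by (simp add: zlink_def)
  next
    case False
    have "(cmp A (Suc i) i n b - a) - (cmp A (Suc i) i n b' - a') \<in> B i"
      using ab(3) ab'(3) False grp_diff[OF zig_familyD(2)[OF Z]] i by (simp add: zlink_def)
    then have "cmp A (Suc i) i n (b - b') - (a - a') \<in> B i"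
      by (rule mem_eq) (simp add: cmp_diff[OF arrow_odd[OF i False] V(3,4)])
    then show ?thesis using False by (simp add: zlink_def)
  qed
qed

text \<open>A link can be continued in either direction, by applying the comparison morphism or by
  lifting along it. The chain is built to the right of \<open>j\<close> first and then to the
  left.\<close>

lemma zchain_extend:
  assumes Z: "zig_family n Z B" and j: "j \<le> len A" "a \<in> Z j"
  shows "\<exists>z. zchain A n Z B z \<and> z j = a"
proof -
  have up: "j \<le> m ==> m \<le> len A ==>
     \<exists>z. z j = a \<and> (\<forall>i. j \<le> i \<and> i \<le> m \<longrightarrow> z i \<in> Z i) \<and> (\<forall>i. j \<le> i \<and> i < m \<longrightarrow> zlink A n B i (z i) (z (Suc i)))" for m
  proof (induction m rule: dec_induct)
    case base
    then show ?case using j by (intro exI[of _ "\<lambda>_. a"]) auto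
  next
    case (step m)
    then obtain z where z: "z j = a" "\<forall>i. j \<le> i \<and> i \<le> m \<longrightarrow> z i \<in> Z i"
      "\<forall>i. j \<le> i \<and> i < m \<longrightarrow> zlink A n B i (z i) (z (Suc i))" by auto
    obtain b where b: "b \<in> Z (Suc m)" "zlink A n B m (z m) b"
      using zlink_up[OF Z, of m "z m"] z(2) step by auto
    show ?case using z b step.hyps by (intro exI[of _ "z(Suc m := b)"]) (auto simp: le_Suc_eq less_Suc_eq)
  qed
  have down: "u \<le> j ==>
     \<exists>z. z j = a \<and> (\<forall>i. u \<le> i \<and> i \<le> len A \<longrightarrow> z i \<in> Z i) \<and> (\<forall>i. u \<le> i \<and> i < len A \<longrightarrow> zlink A n B i (z i) (z (Suc i)))" for u
  proof (induction u rule: inc_induct)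
    case base
    then show ?case using up[of "len A"] j by auto
  next
    case (step u)
    then obtain z where z: "z j = a" "\<forall>i. Suc u \<le> i \<and> i \<le> len A \<longrightarrow> z i \<in> Z i"
      "\<forall>i. Suc u \<le> i \<and> i < len A \<longrightarrow> zlink A n B i (z i) (z (Suc i))" by auto
    have u: "u < len A" using step.hyps j by simp
    obtain b where b: "b \<in> Z u" "zlink A n B u b (z (Suc u))"
      using zlink_down[OF Z u, of "z (Suc u)"] z(2) u by auto
    have "\<And>i. u \<le> i ==> i \<noteq> u ==> Suc u \<le> i" by simp
    then show ?case using z b step.hyps by (intro exI[of _ "z(u := b)"]) auto
  qed
  show ?thesis using down[of 0] unfolding zchain_def by auto
qed

lemma zchain_iff0:
  assumes Z: "zig_family n Z B" and z: "zchain A n Z B z"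
  shows "i \<le> len A ==> z i \<in> B i \<longleftrightarrow> z 0 \<in> B 0"
proof (induction i)
  case (Suc i)
  then show ?case using zlink_iff[OF Z, of i "z i" "z (Suc i)"] z unfolding zchain_def by auto
qed simp

lemma zchain_diff:
  assumes Z: "zig_family n Z B" and z: "zchain A n Z B z" "zchain A n Z B z'"
  shows "zchain A n Z B (\<lambda>i. z i - z' i)"
  using z zlink_diff[OF Z] grp_diff[OF zig_familyD(1)[OF Z]] unfolding zchain_def by simp

lemma corr_ex_right: "zig_family n Z B ==> x \<in> Z 0 ==> \<exists>y. corresponds A n Z B x y"
  using zchain_extend[of n Z B 0 x] unfolding corresponds_iff_zchain by blast

lemma corr_ex_left: "zig_family n Z B ==> y \<in> Z (len A) ==> \<exists>x. corresponds A n Z B x y"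
  using zchain_extend[of n Z B "len A" y] unfolding corresponds_iff_zchain by blast

lemma corr_iff: "zig_family n Z B ==> corresponds A n Z B x y ==> x \<in> B 0 \<longleftrightarrow> y \<in> B (len A)"
  using zchain_iff0[of n Z B _ "len A"] unfolding corresponds_iff_zchain by blast

lemma corr_diff: "zig_family n Z B ==> corresponds A n Z B x y ==> corresponds A n Z B x' y' ==>
    corresponds A n Z B (x - x') (y - y')"
  using zchain_diff unfolding corresponds_iff_zchain by fast

text \<open>A chain that is zero before the last place is admissible, because either
  \<open>b\<close> or its image under the last comparison morphism is a boundary. Together with
  \<open>corr_diff\<close> this allows the right member of a correspondence to be changed by
  boundaries.\<close>

lemma corr_boundary:
  assumes Z: "zig_family n Z B" and b: "b \<in> B (len A)"
  shows "corresponds A n Z B 0 b"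
proof -
  let ?z = "\<lambda>i. if i = len A then b else 0"
  have "?z i \<in> Z i" if "i \<le> len A" for i
    using zig_familyD(3)[OF Z that] b grp_zero[OF zig_familyD(1)[OF Z that]] by auto
  moreover have "zlink A n B i (?z i) (?z (Suc i))" if i: "i < len A" for i
  proof (cases "even i")
    case True
    have "- ?z (Suc i) \<in> B (Suc i)"
      using grp_minus[OF zig_familyD(2)[OF Z, of "Suc i"]] grp_zero[OF zig_familyD(2)[OF Z, of "Suc i"]] b i by auto
    then show ?thesis using True i cmp_zero[OF arrow_even[OF i True]] by (auto simp: zlink_def)
  next
    case False
    have "?z (Suc i) \<in> B (Suc i)" using grp_zero[OF zig_familyD(2)[OF Z, of "Suc i"]] b i by auto
    then have "cmp A (Suc i) i n (?z (Suc i)) \<in> B i"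
      using quotient_isoD(2)[OF zig_familyD(5)[OF Z arrow_odd[OF i False]]] by blast
    then show ?thesis using False i by (auto simp: zlink_def)
  qed
  ultimately have "zchain A n Z B ?z" by (auto simp: zchain_def)
  then show ?thesis unfolding corresponds_iff_zchain using len_pos by (intro exI[of _ ?z]) auto
qed

lemma corr_modify:
  assumes Z: "zig_family n Z B" and c: "corresponds A n Z B x y" and y: "y - y' \<in> B (len A)"
  shows "corresponds A n Z B x y'"
  using corr_diff[OF Z c corr_boundary[OF Z y]] by simp

lemma corr_unique:
  assumes Z: "zig_family n Z B" and c: "corresponds A n Z B x y" "corresponds A n Z B x y'"
  shows "y - y' \<in> B (len A)"
  using corr_iff[OF Z corr_diff[OF Z c]] grp_zero[OF zig_familyD(2)[OF Z, of 0]] by simp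

abbreviation "ZB n x y \<equiv> corresponds A n (\<lambda>i. cocyc A i n) (\<lambda>i. cobd A i n) x y"

lemma zig_total: "zig_family n (\<lambda>i. cocyc A i n) (\<lambda>i. cobd A i n)"
  using filtered_map.iso_total[OF fm] by (intro zig_familyI grp_Z grp_B B_Z Z_V) (auto simp: cocyc_def cobd_def)

lemma zig_W: "zig_family n (\<lambda>i. wt A i k n \<inter> cocyc A i n) (\<lambda>i. dif A i (n - 1) ` wt A i k (n - 1))"
  using filtered_map.iso_G[OF fm]
  by (intro zig_familyI grp_Int grp_W grp_Z grp_dW dW_WZ le_infI2 Z_V) (auto simp: cocyc_def)

lemma zig_gr: "zig_family n (\<lambda>i. gr_cocycles (dif A i) (wt A i) k n) (\<lambda>i. gr_coboundaries (dif A i) (wt A i) k n)"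
  using filtered_map.gr_iso[OF fm] filtered_cx.grp_gr_cocycles[OF cx] filtered_cx.grp_gr_coboundaries[OF cx]
    filtered_cx.gr_coboundaries_cocycles[OF cx] W_V
  by (intro zig_familyI) (auto simp: gr_cocycles_def)

text \<open>Preimage in the cocycles of a step of the weight filtration on the cohomology of
  component \<open>i\<close>.\<close>

definition wcl :: "nat \<Rightarrow> int \<Rightarrow> int \<Rightarrow> 'a set" where
  "wcl i k n = wt A i k n \<inter> cocyc A i n + cobd A i n"

lemma grp_wcl: "i \<le> len A ==> add_subgroup (wcl i k n)"
  unfolding wcl_def by (intro grp_plus grp_Int grp_W grp_Z grp_B)

lemma B_wcl: "i \<le> len A ==> cobd A i n \<subseteq> wcl i k n"
  unfolding wcl_def by (intro subset_plus2 grp_Int grp_W grp_Z)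

lemma WZ_wcl: "i \<le> len A ==> wt A i k n \<inter> cocyc A i n \<subseteq> wcl i k n"
  unfolding wcl_def by (intro subset_plus1 grp_B)

lemma wcl_Z: "i \<le> len A ==> wcl i k n \<subseteq> cocyc A i n"
  unfolding wcl_def using grp_add[OF grp_Z, of i] B_Z[of i n] by (auto elim!: plus_memE)

lemma wclI: "w \<in> wt A i k n ==> w \<in> cocyc A i n ==> x - w \<in> cobd A i n ==> x \<in> wcl i k n"
  unfolding wcl_def by (rule plus_memI) auto

lemma wclE:
  assumes "x \<in> wcl i k n"
  obtains w b where "w \<in> wt A i k n" "w \<in> cocyc A i n" "b \<in> cobd A i n" "x = w + b"
  using assms unfolding wcl_def by (auto elim!: plus_memE)

lemma W_classes_wcl: "W_classes A k n = wcl (len A) k n"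
  by (simp add: W_classes_def wcl_def)

text \<open>The comparison isomorphisms are strict for the weight on cohomology because they are
  isomorphisms both on the whole cohomology and on the cohomology of the subcomplex of weight
  \<open>k\<close>.\<close>

lemma zig_wcl: "zig_family n (\<lambda>i. cocyc A i n) (\<lambda>i. wcl i k n)"
proof (rule zig_familyI)
  fix r q assume rq: "(r, q) \<in> arrows (len A)"
  note le = arrows_le[OF rq]
  note tot = zig_familyD(5)[OF zig_total rq] and W = zig_familyD(5)[OF zig_W rq]
  show "quotient_iso (cmp A r q n) (cocyc A r n) (wcl r k n) (cocyc A q n) (wcl q k n)"
  proof (rule quotient_isoI)
    fix x assume "x \<in> cocyc A r n" then show "cmp A r q n x \<in> cocyc A q n" by (rule quotient_isoD(1)[OF tot])
  next
    fix x assume "x \<in> wcl r k n"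
    then obtain w b where x: "w \<in> wt A r k n" "w \<in> cocyc A r n" "b \<in> cobd A r n" "x = w + b" by (rule wclE)
    have "w \<in> cpt A r n" "b \<in> cpt A r n" using x Z_V B_Z le by blast+
    then have "cmp A r q n x - cmp A r q n w = cmp A r q n b" using cmp_add[OF rq] x(4) by simp
    then show "cmp A r q n x \<in> wcl q k n"
      using quotient_isoD(1)[OF W, of w k] quotient_isoD(2)[OF tot x(3)] x by (intro wclI[of "cmp A r q n w"]) auto
  next
    fix x assume x: "x \<in> cocyc A r n" "cmp A r q n x \<in> wcl q k n"
    obtain w' b where w': "w' \<in> wt A q k n" "w' \<in> cocyc A q n" "b \<in> cobd A q n" "cmp A r q n x = w' + b"
      using x(2) by (rule wclE)
    obtain w where w: "w \<in> wt A r k n" "w \<in> cocyc A r n" "cmp A r q n w - w' \<in> dif A q (n - 1) ` wt A q k (n - 1)"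
      using quotient_isoD(4)[OF W, of w' k] w' by blast
    have V: "x \<in> cpt A r n" "w \<in> cpt A r n" using x w Z_V by blast+
    have "b - (cmp A r q n w - w') \<in> cobd A q n"
      using w'(3) w(3) dW_B le grp_diff[OF grp_B] by blast
    then have "cmp A r q n (x - w) \<in> cobd A q n" by (rule mem_eq) (simp add: cmp_diff[OF rq V] w'(4))
    then have "x - w \<in> cobd A r n" using quotient_isoD(3)[OF tot] grp_diff[OF grp_Z] x(1) w(2) le by blast
    then show "x \<in> wcl r k n" using w by (intro wclI[of w])
  next
    fix y assume "y \<in> cocyc A q n"
    then show "\<exists>x\<in>cocyc A r n. cmp A r q n x - y \<in> wcl q k n"
      using quotient_isoD(4)[OF tot] B_wcl le by blast
  qed
qed (auto intro: grp_Z grp_wcl wcl_Z Z_V[THEN subsetD] dest: wcl_Z[THEN subsetD])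

lemma corr_total_wcl: "ZB n x y ==> corresponds A n (\<lambda>i. cocyc A i n) (\<lambda>i. wcl i k n) x y"
  by (erule corr_mono) (use B_wcl in auto)

lemma zchain_wcl_iff:
  assumes "zchain A n (\<lambda>i. cocyc A i n) (\<lambda>i. cobd A i n) z" "i \<le> len A" "j \<le> len A"
  shows "z i \<in> wcl i k n \<longleftrightarrow> z j \<in> wcl j k n"
proof -
  have "zchain A n (\<lambda>i. cocyc A i n) (\<lambda>i. wcl i k n) z" by (rule zchain_mono[OF assms(1)]) (use B_wcl in auto)
  then show ?thesis using zchain_iff0[OF zig_wcl] assms(2,3) by blast
qed

subsection \<open>Strictness\<close>

lemma W_strict_last: "wt A (len A) k n \<inter> cobd A (len A) n \<subseteq> dif A (len A) (n - 1) ` wt A (len A) k (n - 1)"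
proof -
  have "dif A (len A) (n - 1) ` wt A (len A) k (n - 1) + {0} =
    (wt A (len A) k (n - 1 + 1) + {0}) \<inter> (dif A (len A) (n - 1) ` cpt A (len A) (n - 1) + {0})"
    using W_str unfolding strict_mod_def by blast
  then show ?thesis unfolding cobd_def coboundaries_def set_plus_zero diff_add_cancel by blast
qed

text \<open>Propagated by \<open>strict_iff\<close> from the last component, where it is an axiom,
  backwards along the zigzag.\<close>

lemma W_strict: "i \<le> len A ==> x \<in> wt A i k n ==> x \<in> cobd A i n ==> x \<in> dif A i (n - 1) ` wt A i k (n - 1)"
proof -
  let ?P = "\<lambda>i. \<forall>k n. wt A i k n \<inter> coboundaries (cpt A i) (dif A i) n \<subseteq> dif A i (n - 1) ` wt A i k (n - 1)"
  have "i \<le> len A ==> ?P i" for i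
  proof (induction i rule: inc_induct)
    case base
    then show ?case using W_strict_last unfolding cobd_def by blast
  next
    case (step i)
    show ?case
    proof (cases "even i")
      case True
      then show ?thesis using filtered_map.strict_iff[OF fm[OF arrow_even[OF step.hyps(2)]]] step.IH by blast
    next
      case False
      then show ?thesis using filtered_map.strict_iff[OF fm[OF arrow_odd[OF step.hyps(2)]]] step.IH by blast
    qed
  qed
  then show "i \<le> len A ==> x \<in> wt A i k n ==> x \<in> cobd A i n ==> x \<in> dif A i (n - 1) ` wt A i k (n - 1)"
    unfolding cobd_def by blast
qed

lemma gr_strict:
  assumes "x \<in> hdg A p n" "x \<in> wt A (len A) k n" "y \<in> wt A (len A) k (n - 1)"
    "x - dif A (len A) (n - 1) y \<in> wt A (len A) (k - 1) n"
  obtains u where "u \<in> hdg A p (n - 1)" "u \<in> wt A (len A) k (n - 1)"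
    "x - dif A (len A) (n - 1) u \<in> wt A (len A) (k - 1) n"
proof -
  let ?d = "dif A (len A) (n - 1)" and ?E = "wt A (len A) (k - 1) n"
  have "?d ` (hdg A p (n - 1) \<inter> wt A (len A) k (n - 1)) + wt A (len A) (k - 1) (n - 1 + 1) =
    (hdg A p (n - 1 + 1) \<inter> wt A (len A) k (n - 1 + 1) + wt A (len A) (k - 1) (n - 1 + 1)) \<inter>
    (?d ` wt A (len A) k (n - 1) + wt A (len A) (k - 1) (n - 1 + 1))"
    using gr_str[of k] unfolding strict_mod_def by blast
  then have gr_eq: "?d ` (hdg A p (n - 1) \<inter> wt A (len A) k (n - 1)) + ?E =
    (hdg A p n \<inter> wt A (len A) k n + ?E) \<inter> (?d ` wt A (len A) k (n - 1) + ?E)"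
    unfolding diff_add_cancel .
  have "x \<in> hdg A p n \<inter> wt A (len A) k n + ?E"
    by (rule plus_memI[of x]) (use assms W_zero in auto)
  moreover have "x \<in> ?d ` wt A (len A) k (n - 1) + ?E"
    by (rule plus_memI[of "?d y"]) (use assms in auto)
  ultimately have "x \<in> ?d ` (hdg A p (n - 1) \<inter> wt A (len A) k (n - 1)) + ?E"
    using gr_eq by blast
  then show ?thesis using that by (auto elim!: plus_memE)
qed

text \<open>Induction on the weight. Strictness for \<open>W\<close> supplies some primitive of
  weight \<open>k\<close>; strictness for \<open>F\<close> on the graded piece replaces it by one in
  \<open>F\<close>, up to an error of weight \<open>k - 1\<close>.\<close>

lemma FW_strict:
  "x \<in> hdg A p n ==> x \<in> wt A (len A) k n ==> x \<in> cobd A (len A) n ==>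
    x \<in> dif A (len A) (n - 1) ` (hdg A p (n - 1) \<inter> wt A (len A) k (n - 1))"
proof (induction k arbitrary: x rule: filtered_cx.regular_induct[OF cx[OF order_refl], where n = n, OF reg[OF order_refl], case_names zero step])
  case (zero k)
  then show ?case using F_zero W_zero d_zero by (intro image_eqI[of _ _ 0]) auto
next
  case (step k)
  let ?d = "dif A (len A) (n - 1)"
  obtain y where y: "y \<in> wt A (len A) k (n - 1)" "x = ?d y" using W_strict step.prems by blast
  have z: "x - ?d y \<in> wt A (len A) (k - 1) n" using y W_zero by simp
  obtain u where u: "u \<in> hdg A p (n - 1)" "u \<in> wt A (len A) k (n - 1)" "x - ?d u \<in> wt A (len A) (k - 1) n"
    by (rule gr_strict[OF step.prems(1,2) y(1) z])
  have 1: "x - ?d u \<in> hdg A p n" by (rule F_diff[OF step.prems(1) F_d'[OF u(1)]])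
  have 2: "x - ?d u \<in> cobd A (len A) n"
    by (rule grp_diff[OF grp_B[OF order_refl] step.prems(3) BI[OF F_V[OF u(1)] refl]])
  obtain v where v: "v \<in> hdg A p (n - 1)" "v \<in> wt A (len A) (k - 1) (n - 1)" "x - ?d u = ?d v"
    using step.IH[OF 1 u(3) 2] by auto
  have vk: "v \<in> wt A (len A) k (n - 1)" using W_mono[OF _ _ v(2), of k] by simp
  have "x = ?d u + ?d v" by (simp add: v(3)[symmetric])
  also have "\<dots> = ?d (u + v)" using d_add[of "len A" u "n - 1" v] F_V[OF u(1)] F_V[OF v(1)] by simp
  finally have "x = ?d (u + v)" .
  then show ?case using F_add[OF u(1) v(1)] W_add[OF _ u(2) vk] by blast
qed

text \<open>A representative in \<open>F\<close> of weight \<open>m + 1\<close> differs from one of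
  weight \<open>k\<close> by a boundary of weight \<open>m + 1\<close>, and \<open>gr_strict\<close>
  moves its primitive into \<open>F\<close> modulo weight \<open>m\<close>. Subtracting that
  differential lowers the weight without leaving \<open>F\<close>, so membership in both filtrations
  of cohomology is realised by a single representative.\<close>

lemma FW_class:
  assumes "f \<in> hdg A p n" "f \<in> cocyc A (len A) n" "f \<in> wcl (len A) k n"
  obtains f' where "f' \<in> hdg A p n" "f' \<in> wt A (len A) k n" "f' \<in> cocyc A (len A) n" "f - f' \<in> cobd A (len A) n"
proof -
  let ?d = "dif A (len A) (n - 1)"
  have main: "k \<le> m ==> f \<in> hdg A p n ==> f \<in> cocyc A (len A) n ==> f \<in> wcl (len A) k n ==> f \<in> wt A (len A) m n
     ==> \<exists>f'. f' \<in> hdg A p n \<and> f' \<in> wt A (len A) k n \<and> f' \<in> cocyc A (len A) n \<and> f - f' \<in> cobd A (len A) n" for m f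
  proof (induction m arbitrary: f rule: int_ge_induct)
    case base
    then show ?case using grp_zero[OF grp_B] by (intro exI[of _ f]) auto
  next
    case (step m)
    obtain w b where w: "w \<in> wt A (len A) k n" "w \<in> cocyc A (len A) n" "b \<in> cobd A (len A) n" "f = w + b"
      using step.prems(3) by (rule wclE)
    have wm: "w \<in> wt A (len A) m n" "w \<in> wt A (len A) (m + 1) n"
      using W_mono[OF _ _ w(1)] step.hyps by auto
    have "b = f - w" using w(4) by simp
    then have "b \<in> wt A (len A) (m + 1) n" using W_diff step.prems(4) wm(2) by auto
    then obtain y where y: "y \<in> wt A (len A) (m + 1) (n - 1)" "b = ?d y" using W_strict w(3) by blast
    have wy: "f - ?d y \<in> wt A (len A) (m + 1 - 1) n" using w(4) y(2) wm(1) by simp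
    obtain u where u: "u \<in> hdg A p (n - 1)" "u \<in> wt A (len A) (m + 1) (n - 1)" "f - ?d u \<in> wt A (len A) (m + 1 - 1) n"
      by (rule gr_strict[OF step.prems(1,4) y(1) wy])
    have du: "?d u \<in> cobd A (len A) n" using BI F_V u by blast
    have "f - ?d u \<in> hdg A p n" "f - ?d u \<in> cocyc A (len A) n" "f - ?d u \<in> wcl (len A) k n" "f - ?d u \<in> wt A (len A) m n"
      using step.prems u F_d' F_diff du subsetD[OF B_Z[OF order_refl] du] grp_diff[OF grp_Z[OF order_refl]]
        subsetD[OF B_wcl[OF order_refl] du] grp_diff[OF grp_wcl[OF order_refl]] by auto
    then obtain f' where f': "f' \<in> hdg A p n" "f' \<in> wt A (len A) k n" "f' \<in> cocyc A (len A) n" "f - ?d u - f' \<in> cobd A (len A) n"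
      using step.IH by blast
    have "f - f' \<in> cobd A (len A) n" by (rule mem_eq[OF grp_add[OF grp_B[OF order_refl] f'(4) du]]) auto
    then show ?case using f' by blast
  qed
  obtain m where m: "f \<in> wt A (len A) m n" using V_W[of "len A" f n] Z_V assms(2) by blast
  show ?thesis using main[of "max k m" f] assms W_mono[OF _ _ m, of "max k m"] that by auto
qed

lemma F_classesE:
  assumes "y \<in> F_classes A p n"
  obtains f where "f \<in> hdg A p n" "f \<in> cocyc A (len A) n" "y - f \<in> cobd A (len A) n"
  using assms unfolding F_classes_def by (auto elim!: plus_memE)

lemma F_classesI: "f \<in> hdg A p n ==> f \<in> cocyc A (len A) n ==> y - f \<in> cobd A (len A) n ==> y \<in> F_classes A p n"
  unfolding F_classes_def by (rule plus_memI) auto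

lemma grp_F_classes: "add_subgroup (F_classes A p n)"
  unfolding F_classes_def by (intro grp_plus grp_Int grp_F grp_Z grp_B) auto

lemma B_F_classes: "cobd A (len A) n \<subseteq> F_classes A p n"
  unfolding F_classes_def by (intro subset_plus2 grp_Int grp_F grp_Z) auto

lemma F_classes_Z: "F_classes A p n \<subseteq> cocyc A (len A) n"
  unfolding F_classes_def using grp_add[OF grp_Z, of "len A"] B_Z[of "len A" n] by (auto elim!: plus_memE)

lemma FW_classesE:
  assumes "y \<in> F_classes A p n" "y \<in> wcl (len A) k n"
  obtains f where "f \<in> hdg A p n" "f \<in> wt A (len A) k n" "f \<in> cocyc A (len A) n" "y - f \<in> cobd A (len A) n"
proof -
  obtain f where f: "f \<in> hdg A p n" "f \<in> cocyc A (len A) n" "y - f \<in> cobd A (len A) n"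
    using assms(1) by (rule F_classesE)
  have "f \<in> wcl (len A) k n"
    by (rule mem_eq[OF grp_diff[OF grp_wcl[OF order_refl] assms(2)], of "y - f"]) (use f(3) B_wcl in auto)
  then obtain f' where f': "f' \<in> hdg A p n" "f' \<in> wt A (len A) k n" "f' \<in> cocyc A (len A) n" "f - f' \<in> cobd A (len A) n"
    using FW_class[OF f(1,2)] by blast
  have "y - f' \<in> cobd A (len A) n" by (rule mem_eq[OF grp_add[OF grp_B[OF order_refl] f(3) f'(4)]]) auto
  then show ?thesis using that f' by blast
qed

text \<open>The differential of \<open>u\<close> is exact, lies in \<open>F\<close> and has weight
  \<open>k - 1\<close>, so \<open>FW_strict\<close> finds a correction of weight
  \<open>k - 1\<close> inside \<open>F\<close>. This is the degeneration of the weight spectral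
  sequence with \<open>F\<close> carried along.\<close>

lemma gr_lift:
  assumes "u \<in> hdg A p n" "u \<in> wt A (len A) k n" "dif A (len A) n u \<in> wt A (len A) (k - 1) (n + 1)"
  obtains u' where "u' \<in> hdg A p n" "u' \<in> wt A (len A) k n" "u' \<in> cocyc A (len A) n" "u - u' \<in> wt A (len A) (k - 1) n"
proof -
  have "dif A (len A) n u \<in> cobd A (len A) (n + 1)" by (rule BI[of u]) (use F_V assms in auto)
  then obtain v where v: "v \<in> hdg A p n" "v \<in> wt A (len A) (k - 1) n" "dif A (len A) n u = dif A (len A) n v"
    using FW_strict[OF F_d[OF assms(1)] assms(3)] by auto
  have vk: "v \<in> wt A (len A) k n" using W_mono[OF _ _ v(2), of k] by simp
  have uv: "u \<in> cpt A (len A) n" "v \<in> cpt A (len A) n" using F_V assms(1) v(1) by auto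
  have "u - v \<in> cocyc A (len A) n"
    using V_diff[OF order_refl uv] d_diff[OF order_refl uv] v(3) by (intro ZI) auto
  then show ?thesis
    using that[of "u - v"] F_diff[OF assms(1) v(1)] W_diff[OF order_refl assms(2) vk] v(2) by simp
qed

subsection \<open>The subfield structure\<close>

lemma R_ksub: "subspace_over K (rat A n)" using K_str by (auto simp: K_structure_def)

lemma R_V: "rat A n \<subseteq> cpt A 0 n"
  using K_str[of n] scaleC.span_superset[of "rat A n"] by (simp add: K_structure_def span_over_UNIV)

lemma wt_ksub: "i \<le> len A ==> subspace_over K (wt A i k n)"
  using csub_W by (auto simp: subspace_over_def)

lemma span_R: "span_over UNIV (rat A n) = cpt A 0 n" using K_str by (auto simp: K_structure_def)

lemma d_span_descent:
  assumes T: "T \<subseteq> cpt A 0 (n - 1)" and w: "w \<in> span_over UNIV T"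
  shows "dif A 0 (n - 1) w \<in> span_over UNIV (dif A 0 (n - 1) ` T)"
proof -
  let ?d = "dif A 0 (n - 1)"
  let ?U = "{w \<in> cpt A 0 (n - 1). ?d w \<in> scaleC.span (?d ` T)}"
  have "subspace_over UNIV ?U"
    unfolding subspace_over_def using V_zero[of 0] V_add[of 0] V_scale[of 0] d_zero[of 0 "n - 1"] d_add[of 0 _ "n - 1"]
      d_scale[of 0 _ "n - 1"] scaleC.span_zero scaleC.span_add scaleC.span_scale by auto
  moreover have "T \<subseteq> ?U" using T scaleC.span_superset[of "?d ` T"] by auto
  ultimately show ?thesis using span_over_minimal[of UNIV ?U T] w unfolding span_over_UNIV by blast
qed

lemma ksub_image_R:
  assumes "subspace_over K T" "T \<subseteq> cpt A 0 (n - 1)"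
  shows "subspace_over K (dif A 0 (n - 1) ` T)"
  unfolding subspace_over_def
proof (intro conjI ballI)
  show "0 \<in> dif A 0 (n - 1) ` T" using assms d_zero[of 0 "n - 1"] by (force simp: subspace_over_def)
next
  fix x y assume "x \<in> dif A 0 (n - 1) ` T" "y \<in> dif A 0 (n - 1) ` T"
  then obtain a b where "a \<in> T" "b \<in> T" "x = dif A 0 (n - 1) a" "y = dif A 0 (n - 1) b" by blast
  then show "x + y \<in> dif A 0 (n - 1) ` T" using assms d_add[of 0 a "n - 1" b] subsetD[OF assms(2), of a] subsetD[OF assms(2), of b]
    by (intro image_eqI[of _ _ "a + b"]) (auto simp: subspace_over_def)
next
  fix c x assume "c \<in> K" "x \<in> dif A 0 (n - 1) ` T"
  then obtain a where "a \<in> T" "x = dif A 0 (n - 1) a" by blast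
  then show "c *\<^sub>C x \<in> dif A 0 (n - 1) ` T" using assms d_scale[of 0 a "n - 1" c] \<open>c \<in> K\<close>
    by (intro image_eqI[of _ _ "c *\<^sub>C a"]) (auto simp: subspace_over_def)
qed

lemma rat_dif': "x \<in> rat A (n - 1) ==> dif A 0 (n - 1) x \<in> rat A n"
  using rat_dif[of "n - 1"] by auto

text \<open>The rational elements of weight \<open>k\<close> span the complex step, so
  \<open>x\<close> is a complex combination of differentials of such elements, and descent brings
  the coefficients into \<open>K\<close>.\<close>

lemma rat_strict:
  assumes "x \<in> rat A n" "x \<in> dif A 0 (n - 1) ` wt A 0 k (n - 1)"
  obtains r where "r \<in> wt A 0 k (n - 1)" "r \<in> rat A (n - 1)" "x = dif A 0 (n - 1) r"
proof -
  let ?T = "wt A 0 k (n - 1) \<inter> rat A (n - 1)"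
  have "x \<in> span_over UNIV (dif A 0 (n - 1) ` ?T)"
    using assms(2) d_span_descent[of ?T n] wt_span[of k "n - 1"] R_V by blast
  then have "x \<in> span_over K (dif A 0 (n - 1) ` ?T)"
    by (intro K_structure_descent[OF K K_str _ assms(1)]) (use rat_dif' in auto)
  moreover have "subspace_over K (dif A 0 (n - 1) ` ?T)"
    using wt_ksub[of 0 k "n - 1"] R_ksub[of "n - 1"] R_V[of "n - 1"]
    by (intro ksub_image_R) (auto simp: subspace_over_def)
  ultimately have "x \<in> dif A 0 (n - 1) ` ?T" using span_over_minimal[OF _ order_refl] by blast
  then show ?thesis using that by blast
qed

text \<open>Adding back the differential of \<open>v\<close> writes the rational \<open>x\<close> as
  a complex combination of rational elements of weight \<open>k\<close> and differentials of
  rational elements. Descent turns it into a combination over \<open>K\<close>, from which a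
  rational replacement of \<open>v\<close> is read off.\<close>

lemma rat_weight:
  assumes x: "x \<in> rat A n" "v \<in> cpt A 0 (n - 1)" "x - dif A 0 (n - 1) v \<in> wt A 0 k n"
  obtains r where "r \<in> rat A (n - 1)" "x - dif A 0 (n - 1) r \<in> wt A 0 k n" "x - dif A 0 (n - 1) r \<in> rat A n"
proof -
  let ?d = "dif A 0 (n - 1)"
  let ?T = "wt A 0 k n \<inter> rat A n" and ?D = "?d ` rat A (n - 1)"
  have "x - ?d v \<in> scaleC.span (?T \<union> ?D)"
    using x(3) wt_span[of k n] scaleC.span_mono[of ?T "?T \<union> ?D"] unfolding span_over_UNIV by blast
  moreover have "?d v \<in> scaleC.span (?T \<union> ?D)"
    using d_span_descent[of "rat A (n - 1)" n v] R_V span_R[of "n - 1"] x(2) scaleC.span_mono[of ?D "?T \<union> ?D"]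
    unfolding span_over_UNIV by blast
  ultimately have "x \<in> scaleC.span (?T \<union> ?D)"
    using scaleC.span_add[of "x - ?d v" _ "?d v"] by simp
  then have 1: "x \<in> span_over K (?T \<union> ?D)"
    by (intro K_structure_descent[OF K K_str _ x(1)]) (use rat_dif' in \<open>auto simp: span_over_UNIV\<close>)
  have kT: "subspace_over K ?T" using wt_ksub[of 0 k n] R_ksub[of n] by (auto simp: subspace_over_def)
  have kD: "subspace_over K ?D" by (rule ksub_image_R[OF R_ksub R_V])
  have "subspace_over K (?T + ?D)"
    unfolding subspace_over_def
  proof (intro conjI ballI)
    show "0 \<in> ?T + ?D" by (rule grp_zero[OF grp_plus[OF ksub_grp[OF K kT] ksub_grp[OF K kD]]])
    show "x + y \<in> ?T + ?D" if "x \<in> ?T + ?D" "y \<in> ?T + ?D" for x y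
      using grp_add[OF grp_plus[OF ksub_grp[OF K kT] ksub_grp[OF K kD]]] that by blast
    show "c *\<^sub>C x \<in> ?T + ?D" if c: "c \<in> K" and x: "x \<in> ?T + ?D" for c x
    proof -
      obtain a b where "a \<in> ?T" "b \<in> ?D" "x = a + b" using x by (rule plus_memE)
      then show ?thesis
        using set_plus_intro[OF ksub_scale[OF kT c] ksub_scale[OF kD c], of a b] by (simp add: scaleC_add_right)
    qed
  qed
  moreover have "?T \<union> ?D \<subseteq> ?T + ?D"
    by (rule Un_least[OF subset_plus1[OF ksub_grp[OF K kD]] subset_plus2[OF ksub_grp[OF K kT]]])
  ultimately have "span_over K (?T \<union> ?D) \<subseteq> ?T + ?D" by (rule span_over_minimal)
  then have "x \<in> ?T + ?D" using 1 by (rule subsetD)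
  then obtain a b where ab: "a \<in> ?T" "b \<in> ?D" "x = a + b" by (rule plus_memE)
  then obtain r where r: "r \<in> rat A (n - 1)" "b = ?d r" by blast
  have "x - ?d r = a" using ab(3) r(2) by simp
  then show ?thesis using that[of r] r(1) ab(1) by simp
qed

subsection \<open>Conjugation on cohomology\<close>

lemma conj_W: "w \<in> wt A 0 k n ==> \<exists>w'\<in>wt A 0 k n. conjugate_wrt (rat A n) w w'"
  using conj_exists[of w "wt A 0 k n \<inter> rat A n" "rat A n"] wt_span[of k n] by auto

lemma conj_V: "w \<in> cpt A 0 n ==> \<exists>w'\<in>cpt A 0 n. conjugate_wrt (rat A n) w w'"
  using conj_exists[of w "rat A n" "rat A n"] span_R[of n] by auto

lemma conj_d: "conjugate_wrt (rat A n) x x' ==> conjugate_wrt (rat A (n + 1)) (dif A 0 n x) (dif A 0 n x')"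
  by (rule conj_linear[OF lin_d R_V rat_dif csub_V]) auto

lemma conj_d': "conjugate_wrt (rat A (n - 1)) x x' ==> conjugate_wrt (rat A n) (dif A 0 (n - 1) x) (dif A 0 (n - 1) x')"
  using conj_d[of "n - 1"] by simp

lemmas conj_uniq = conj_unique[OF K K_str]

lemma conj_Z: "conjugate_wrt (rat A n) x x' ==> x \<in> cocyc A 0 n ==> x' \<in> cocyc A 0 n"
proof (rule ZI)
  assume x: "conjugate_wrt (rat A n) x x'" "x \<in> cocyc A 0 n"
  then show "x' \<in> cpt A 0 n" using conj_V[of x n] Z_V conj_uniq by blast
  show "dif A 0 n x' = 0" using conj_uniq[OF conj_d[OF x(1)], of 0] Z_d[OF x(2)] conj_zero[of "rat A (n + 1)"] by simp
qed

lemma conj_dW_plus: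
  assumes T: "\<And>w. w \<in> T ==> \<exists>w'\<in>T. conjugate_wrt (rat A n) w w'"
    and S: "\<And>w. w \<in> S ==> \<exists>w'\<in>S. conjugate_wrt (rat A (n - 1)) w w'"
    and x: "conjugate_wrt (rat A n) x x'" "v \<in> S" "w \<in> T" "x = dif A 0 (n - 1) v + w"
  obtains v' w' where "v' \<in> S" "w' \<in> T" "conjugate_wrt (rat A n) w w'" "x' = dif A 0 (n - 1) v' + w'"
proof -
  obtain v' where v': "v' \<in> S" "conjugate_wrt (rat A (n - 1)) v v'" using S x(2) by blast
  obtain w' where w': "w' \<in> T" "conjugate_wrt (rat A n) w w'" using T x(3) by blast
  have "conjugate_wrt (rat A n) x (dif A 0 (n - 1) v' + w')"
    unfolding x(4) by (rule conj_add[OF conj_d'[OF v'(2)] w'(2)])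
  then show ?thesis using that v' w' conj_uniq[OF x(1)] by blast
qed

text \<open>The weight filtration is defined over \<open>K\<close>, so a decomposition into a
  cocycle of weight \<open>k\<close> and a boundary can be conjugated term by term.\<close>

lemma conj_wcl:
  assumes "conjugate_wrt (rat A n) x x'" "x \<in> wcl 0 k n"
  shows "x' \<in> wcl 0 k n"
proof -
  obtain w b where w: "w \<in> wt A 0 k n" "w \<in> cocyc A 0 n" "b \<in> cobd A 0 n" "x = w + b"
    using assms(2) by (rule wclE)
  obtain v where v: "v \<in> cpt A 0 (n - 1)" "b = dif A 0 (n - 1) v" using w(3) by (rule BE)
  have "x = dif A 0 (n - 1) v + w" using w v by simp
  then obtain v' w' where "v' \<in> cpt A 0 (n - 1)" "w' \<in> wt A 0 k n" "conjugate_wrt (rat A n) w w'" "x' = dif A 0 (n - 1) v' + w'"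
    using conj_dW_plus[OF conj_W conj_V assms(1) v(1) w(1)] by blast
  then show ?thesis using conj_Z w(2) by (intro wclI[of w']) (auto intro: BI)
qed

lemma conj_gr:
  assumes "conjugate_wrt (rat A n) x x'" "x \<in> gr_coboundaries (dif A 0) (wt A 0) k n"
  shows "x' \<in> gr_coboundaries (dif A 0) (wt A 0) k n"
proof -
  obtain v w where v: "v \<in> wt A 0 k (n - 1)" "w \<in> wt A 0 (k - 1) n" "x = dif A 0 (n - 1) v + w"
    by (rule filtered_cx.gr_coboundariesE[OF cx assms(2)]) auto
  obtain v' w' where "v' \<in> wt A 0 k (n - 1)" "w' \<in> wt A 0 (k - 1) n" "x' = dif A 0 (n - 1) v' + w'"
    using conj_dW_plus[OF conj_W conj_W assms(1) v] by blast
  then show ?thesis by (intro filtered_cx.gr_coboundariesI[OF cx, of 0 v']) auto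
qed

text \<open>The complex conjugate of the Hodge filtration on cohomology: a class is carried to
  component 0, conjugated with respect to the \<open>K\<close>-structure and carried back.\<close>

definition conj_classes :: "int \<Rightarrow> int \<Rightarrow> 'a set" where
  "conj_classes q n = {y'. \<exists>y x x'. y \<in> F_classes A q n \<and> ZB n x y \<and> conjugate_wrt (rat A n) x x' \<and> ZB n x' y'}"

lemma conj_classesI:
  "y \<in> F_classes A q n ==> ZB n x y ==> conjugate_wrt (rat A n) x x' ==> ZB n x' y' ==> y' \<in> conj_classes q n"
  unfolding conj_classes_def by blast

lemma conj_classesE:
  assumes "y' \<in> conj_classes q n"
  obtains y x x' where "y \<in> F_classes A q n" "ZB n x y" "conjugate_wrt (rat A n) x x'" "ZB n x' y'"
  using assms unfolding conj_classes_def by blast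

abbreviation "WB k n x y \<equiv> corresponds A n (\<lambda>i. wt A i k n \<inter> cocyc A i n) (\<lambda>i. dif A i (n - 1) ` wt A i k (n - 1)) x y"

lemma WB_ZB: "WB k n x y ==> ZB n x y"
  by (erule corr_mono) (use dW_B in auto)

lemma WB_gr: "WB k n x y ==>
  corresponds A n (\<lambda>i. gr_cocycles (dif A i) (wt A i) k n) (\<lambda>i. gr_coboundaries (dif A i) (wt A i) k n) x y"
proof (erule corr_mono)
  fix i assume i: "i \<le> len A"
  show "wt A i k n \<inter> cocyc A i n \<subseteq> gr_cocycles (dif A i) (wt A i) k n"
    using W_zero[OF i] by (auto simp: gr_cocycles_def Z_d)
  show "dif A i (n - 1) ` wt A i k (n - 1) \<subseteq> gr_coboundaries (dif A i) (wt A i) k n"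
    using W_zero[OF i] by (auto intro!: filtered_cx.gr_coboundariesI[OF cx[OF i]])
qed

text \<open>Both passages through the zigzag can be made with cocycles of weight \<open>k\<close> by
  \<open>zig_W\<close>, and conjugation in component 0 keeps the weight.\<close>

lemma conj_lift:
  assumes "y \<in> wt A (len A) k n" "y \<in> cocyc A (len A) n"
  obtains x x' v where "WB k n x y" "conjugate_wrt (rat A n) x x'" "WB k n x' v"
proof -
  obtain x where x: "WB k n x y" using corr_ex_left[OF zig_W, of y k n] assms by blast
  have xW: "x \<in> wt A 0 k n" "x \<in> cocyc A 0 n" using corr_mem[OF x] by auto
  obtain x' where x': "x' \<in> wt A 0 k n" "conjugate_wrt (rat A n) x x'" using conj_W[OF xW(1)] by blast
  have "x' \<in> cocyc A 0 n" using conj_Z[OF x'(2) xW(2)] .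
  then obtain v where "WB k n x' v" using corr_ex_right[OF zig_W, of x' k n] x' by blast
  then show ?thesis using that x x' by blast
qed

lemma gr_coboundary_cocycle:
  assumes "u \<in> gr_coboundaries (dif A i) (wt A i) k n" "u \<in> cocyc A i n" "i \<le> len A"
  shows "u \<in> wcl i (k - 1) n"
proof -
  obtain v w where v: "v \<in> wt A i k (n - 1)" "w \<in> wt A i (k - 1) n" "u = dif A i (n - 1) v + w"
    by (rule filtered_cx.gr_coboundariesE[OF cx assms(1)]) (use assms in auto)
  have b: "dif A i (n - 1) v \<in> cobd A i n" by (rule BI[OF W_V[OF assms(3) v(1)] refl])
  have "w = u - dif A i (n - 1) v" using v(3) by simp
  then have "w \<in> cocyc A i n" using grp_diff[OF grp_Z] B_Z b assms by blast
  then show ?thesis using v b by (intro wclI[of w]) auto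
qed

end

locale mhc_pure = mhc_core +
  assumes pure: "pure_graded_cohomology A p n"
begin

text \<open>The theorem that the cohomology of a mixed Hodge complex is a mixed Hodge structure.
  Purity speaks of classes of graded pieces; \<open>gr_lift\<close>, \<open>FW_classesE\<close> and
  \<open>conj_lift\<close> connect them with genuine cocycles. In both halves the conclusion comes
  from \<open>gr_coboundary_cocycle\<close>, by which a cocycle that is a graded coboundary has
  weight \<open>k - 1\<close> on cohomology.\<close>

lemma opposed: "opposed_filtrations (cocyc A (len A) n) (cobd A (len A) n) (\<lambda>k. wcl (len A) k n)
   (\<lambda>p. F_classes A p n) (\<lambda>q. conj_classes q n)"
proof (rule opposed_filtrations.intro)
  let ?s = "len A"
  let ?Zg = "\<lambda>k i. gr_cocycles (dif A i) (wt A i) k n" and ?Bg = "\<lambda>k i. gr_coboundaries (dif A i) (wt A i) k n"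
  have s: "?s \<le> ?s" by simp
  show "add_subgroup (cocyc A ?s n)" "add_subgroup (cobd A ?s n)" using grp_Z grp_B by auto
  show "add_subgroup (wcl ?s k n)" for k using grp_wcl by simp
  show "add_subgroup (F_classes A p n)" for p by (rule grp_F_classes)
  show "add_subgroup (conj_classes q n)" for q
  proof (rule add_subgroupI)
    have "ZB n 0 0" by (rule corr_boundary[OF zig_total grp_zero[OF grp_B[OF s]]])
    then show "0 \<in> conj_classes q n" by (intro conj_classesI[OF grp_zero[OF grp_F_classes] _ conj_zero])
    fix a b assume "a \<in> conj_classes q n" "b \<in> conj_classes q n"
    then obtain y x x' z w w' where *: "y \<in> F_classes A q n" "ZB n x y" "conjugate_wrt (rat A n) x x'" "ZB n x' a"
      "z \<in> F_classes A q n" "ZB n w z" "conjugate_wrt (rat A n) w w'" "ZB n w' b"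
      by (elim conj_classesE)
    show "a - b \<in> conj_classes q n"
      by (rule conj_classesI[OF grp_diff[OF grp_F_classes *(1,5)] corr_diff[OF zig_total *(2,6)]
            conj_diff[OF *(3,7)] corr_diff[OF zig_total *(4,8)]])
  qed
  show "cobd A ?s n \<subseteq> wcl ?s k n" for k using B_wcl by simp
  show "cobd A ?s n \<subseteq> F_classes A p n" for p by (rule B_F_classes)
  show "wcl ?s k n \<subseteq> cocyc A ?s n" for k using wcl_Z by simp
  show "F_classes A p n \<subseteq> cocyc A ?s n" for p by (rule F_classes_Z)
  show "wcl ?s k n \<subseteq> wcl ?s (k + 1) n" for k
    using W_mono[of ?s k "k + 1"] by (auto elim!: wclE intro!: wclI)
  show "\<exists>k. x \<in> wcl ?s k n" if "x \<in> cocyc A ?s n" for x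
    using V_W[of ?s x n] WZ_wcl[OF s] that Z_V by blast
  show "\<exists>k. wcl ?s k n \<subseteq> cobd A ?s n"
  proof -
    obtain k where k: "wt A ?s k n = {0}" using reg[OF s] by blast
    have "wcl ?s k n \<subseteq> cobd A ?s n" using k by (auto elim!: wclE)
    then show ?thesis by blast
  qed
  show "\<exists>p. F_classes A p n \<subseteq> cobd A ?s n"
  proof -
    obtain p where p: "hdg A p n = {0}" using hdg_low by blast
    have "F_classes A p n \<subseteq> cobd A ?s n" using p by (auto elim!: F_classesE)
    then show ?thesis by blast
  qed
  show "\<exists>p. cocyc A ?s n \<subseteq> F_classes A p n"
  proof -
    obtain p where p: "hdg A p n = cpt A ?s n" using hdg_up by blast
    have "cocyc A ?s n \<subseteq> F_classes A p n"
      using p Z_V grp_zero[OF grp_B[OF s]] by (auto intro!: F_classesI)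
    then show ?thesis by blast
  qed
  show F_Suc: "F_classes A (p + 1) n \<subseteq> F_classes A p n" for p
    using F_antimono[of p "p + 1"] by (auto elim!: F_classesE intro!: F_classesI)
  show "conj_classes (q + 1) n \<subseteq> conj_classes q n" for q
    using F_Suc by (auto elim!: conj_classesE intro!: conj_classesI)

  \<comment> \<open>Copies of the sets that are local to \<open>pure_graded_cohomology\<close>, so
    that purity can be quoted as two equations.\<close>
  define FH where "FH k a = hdg A a n \<inter> ?Zg k ?s + ?Bg k ?s" for k a
  define Fb where "Fb k a = {y'. \<exists>y\<in>FH k a. \<exists>x x'. corresponds A n (?Zg k) (?Bg k) x y \<and>
                    conjugate_wrt (rat A n) x x' \<and> corresponds A n (?Zg k) (?Bg k) x' y'}" for k a
  have pure': "FH k a + Fb k (k + 1 - a) = ?Zg k ?s" "FH k a \<inter> Fb k (k + 1 - a) = ?Bg k ?s" for k a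
    using pure[of k n] unfolding pure_graded_cohomology_def Let_def FH_def Fb_def by auto
  have Zg_Int: "wt A ?s k n \<inter> cocyc A ?s n \<subseteq> ?Zg k ?s" for k
    using W_zero[OF s] by (auto simp: gr_cocycles_def Z_d)

  show "\<exists>u v. u \<in> F_classes A p n \<and> u \<in> wcl ?s k n \<and> v \<in> conj_classes (k + 1 - p) n \<and> v \<in> wcl ?s k n \<and> x - u - v \<in> wcl ?s (k - 1) n"
    if x: "x \<in> wcl ?s k n" for x k p
  proof -
    have lift: "\<exists>u'. u' \<in> hdg A a n \<and> u' \<in> wt A ?s k n \<and> u' \<in> cocyc A ?s n \<and> u - u' \<in> ?Bg k ?s" if uFH: "u \<in> FH k a" for a u
    proof -
      obtain u1 b where "u1 \<in> hdg A a n \<inter> ?Zg k ?s" "b \<in> ?Bg k ?s" "u = u1 + b"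
        using uFH unfolding FH_def by (rule plus_memE)
      then have u1: "u1 \<in> hdg A a n" "u1 \<in> ?Zg k ?s" "b \<in> ?Bg k ?s" "u = u1 + b" by auto
      obtain u' where u': "u' \<in> hdg A a n" "u' \<in> wt A ?s k n" "u' \<in> cocyc A ?s n" "u1 - u' \<in> wt A ?s (k - 1) n"
        using gr_lift[OF u1(1), of k] u1(2) by (auto simp: gr_cocycles_def)
      have "u1 - u' \<in> ?Bg k ?s"
        using u'(4) W_zero[OF s] d_zero[OF s] by (intro filtered_cx.gr_coboundariesI[OF cx[OF s], of 0]) auto
      then have "u - u' \<in> ?Bg k ?s"
        by (rule mem_eq[OF grp_add[OF filtered_cx.grp_gr_coboundaries[OF cx[OF s]] _ u1(3)]]) (simp add: u1(4))
      then show ?thesis using u' by blast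
    qed
    obtain w b where w: "w \<in> wt A ?s k n" "w \<in> cocyc A ?s n" "b \<in> cobd A ?s n" "x = w + b" using x by (rule wclE)
    have "w \<in> FH k p + Fb k (k + 1 - p)" unfolding pure'(1) using Zg_Int w by blast
    then obtain u v where uv: "u \<in> FH k p" "v \<in> Fb k (k + 1 - p)" "w = u + v" by (rule plus_memE)
    obtain u' where u': "u' \<in> hdg A p n" "u' \<in> wt A ?s k n" "u' \<in> cocyc A ?s n" "u - u' \<in> ?Bg k ?s" using lift uv(1) by blast
    obtain y xx xx' where y: "y \<in> FH k (k + 1 - p)" "corresponds A n (?Zg k) (?Bg k) xx y"
      "conjugate_wrt (rat A n) xx xx'" "corresponds A n (?Zg k) (?Bg k) xx' v" using uv(2) unfolding Fb_def by blast
    obtain y' where y': "y' \<in> hdg A (k + 1 - p) n" "y' \<in> wt A ?s k n" "y' \<in> cocyc A ?s n" "y - y' \<in> ?Bg k ?s"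
      using lift y(1) by blast
    obtain z z' v' where z: "WB k n z y'" "conjugate_wrt (rat A n) z z'" "WB k n z' v'"
      by (rule conj_lift[OF y'(2,3)])
    \<comment> \<open>The conjugate supplied by purity and the conjugate of the lifted cocycle come
      from different chains. These chains end in \<open>y\<close> and \<open>y'\<close>, which agree
      in the cohomology of the graded piece, so the conjugates agree there as well.\<close>
    have "xx - z \<in> ?Bg k 0" using corr_iff[OF zig_gr corr_diff[OF zig_gr y(2) WB_gr[OF z(1)]]] y'(4) by simp
    then have "xx' - z' \<in> ?Bg k 0" using conj_gr[OF conj_diff[OF y(3) z(2)]] by simp
    then have vv': "v - v' \<in> ?Bg k ?s" using corr_iff[OF zig_gr corr_diff[OF zig_gr y(4) WB_gr[OF z(3)]]] by simp
    have v'W: "v' \<in> wt A ?s k n" "v' \<in> cocyc A ?s n" using corr_mem[OF z(3)] by auto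
    have "y' \<in> F_classes A (k + 1 - p) n" using y' grp_zero[OF grp_B[OF s]] by (auto intro: F_classesI)
    then have "v' \<in> conj_classes (k + 1 - p) n" by (rule conj_classesI[OF _ WB_ZB[OF z(1)] z(2) WB_ZB[OF z(3)]])
    moreover have "v' \<in> wcl ?s k n" "u' \<in> wcl ?s k n" using v'W u' WZ_wcl[OF s] by blast+
    moreover have "u' \<in> F_classes A p n" using u' grp_zero[OF grp_B[OF s]] by (auto intro: F_classesI)
    moreover have "x - u' - v' \<in> wcl ?s (k - 1) n"
    proof -
      have "(u - u') + (v - v') \<in> ?Bg k ?s"
        using grp_add[OF filtered_cx.grp_gr_coboundaries[OF cx[OF s]]] u' vv' by blast
      then have "w - u' - v' \<in> ?Bg k ?s" by (rule mem_eq) (simp add: uv(3))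
      moreover have "w - u' - v' \<in> cocyc A ?s n" using w u' v'W grp_diff[OF grp_Z[OF s]] by blast
      ultimately have "w - u' - v' \<in> wcl ?s (k - 1) n" using gr_coboundary_cocycle by blast
      moreover have "b \<in> wcl ?s (k - 1) n" using w(3) B_wcl by blast
      ultimately have "(w - u' - v') + b \<in> wcl ?s (k - 1) n" using grp_add[OF grp_wcl[OF s]] by blast
      then show ?thesis by (rule mem_eq) (simp add: w(4))
    qed
    ultimately show ?thesis by blast
  qed

  show "u \<in> wcl ?s (k - 1) n"
    if u: "u \<in> F_classes A p n" "u \<in> wcl ?s k n" and v: "v \<in> conj_classes (k + 1 - p) n" "v \<in> wcl ?s k n"
      and uv: "u - v \<in> wcl ?s (k - 1) n" for u v k p
  proof -
    obtain u' where u': "u' \<in> hdg A p n" "u' \<in> wt A ?s k n" "u' \<in> cocyc A ?s n" "u - u' \<in> cobd A ?s n"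
      by (rule FW_classesE[OF u])
    obtain y x x' where y: "y \<in> F_classes A (k + 1 - p) n" "ZB n x y" "conjugate_wrt (rat A n) x x'" "ZB n x' v"
      using v(1) by (rule conj_classesE)
    have "x' \<in> wcl 0 k n" using corr_iff[OF zig_wcl corr_total_wcl[OF y(4)]] v(2) by blast
    then have "x \<in> wcl 0 k n" using conj_wcl conj_sym[OF y(3)] by blast
    then have "y \<in> wcl ?s k n" using corr_iff[OF zig_wcl corr_total_wcl[OF y(2)]] by blast
    then obtain y' where y': "y' \<in> hdg A (k + 1 - p) n" "y' \<in> wt A ?s k n" "y' \<in> cocyc A ?s n" "y - y' \<in> cobd A ?s n"
      using FW_classesE[OF y(1)] by blast
    obtain z z' v' where z: "WB k n z y'" "conjugate_wrt (rat A n) z z'" "WB k n z' v'"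
      by (rule conj_lift[OF y'(2,3)])
    have "x - z \<in> cobd A 0 n" using corr_iff[OF zig_total corr_diff[OF zig_total y(2) WB_ZB[OF z(1)]]] y'(4) by simp
    then obtain e where e: "e \<in> cpt A 0 (n - 1)" "x - z = dif A 0 (n - 1) e" by (rule BE)
    obtain e' where e': "e' \<in> cpt A 0 (n - 1)" "conjugate_wrt (rat A (n - 1)) e e'" using conj_V[OF e(1)] by blast
    have "conjugate_wrt (rat A n) (x - z) (dif A 0 (n - 1) e')" unfolding e(2) by (rule conj_d'[OF e'(2)])
    then have "x' - z' = dif A 0 (n - 1) e'" by (rule conj_uniq[OF conj_diff[OF y(3) z(2)]])
    then have "x' - z' \<in> cobd A 0 n" by (rule BI[OF e'(1)])
    then have vv': "v - v' \<in> cobd A ?s n" using corr_iff[OF zig_total corr_diff[OF zig_total y(4) WB_ZB[OF z(3)]]] by simp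
    have v'W: "v' \<in> wt A ?s k n" "v' \<in> cocyc A ?s n" using corr_mem[OF z(3)] by auto
    have "(u - v) - (u - u') + (v - v') \<in> wcl ?s (k - 1) n"
      by (intro grp_add[OF grp_wcl[OF s]] grp_diff[OF grp_wcl[OF s]] uv
          subsetD[OF B_wcl[OF s] u'(4)] subsetD[OF B_wcl[OF s] vv'])
    then have uv': "u' - v' \<in> wcl ?s (k - 1) n" by (rule mem_eq) simp
    obtain w b where w: "w \<in> wt A ?s (k - 1) n" "w \<in> cocyc A ?s n" "b \<in> cobd A ?s n" "u' - v' = w + b" using uv' by (rule wclE)
    have wk: "w \<in> wt A ?s k n" using W_mono[OF s _ w(1), of k] by simp
    \<comment> \<open>The boundary \<open>b\<close> has weight \<open>k\<close>, so strictness gives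
      it a primitive of weight \<open>k\<close>. This makes \<open>u' - v'\<close> a graded
      coboundary, and purity can be applied to \<open>u'\<close>.\<close>
    have "b = u' - v' - w" using w(4) by simp
    then have "b \<in> wt A ?s k n" using W_diff[OF s] u'(2) v'W(1) wk by blast
    then obtain c where c: "c \<in> wt A ?s k (n - 1)" "b = dif A ?s (n - 1) c" using W_strict[OF s] w(3) by blast
    have uvB: "v' - u' \<in> ?Bg k ?s"
    proof -
      have "u' - v' - dif A ?s (n - 1) c = w" using w(4) c(2) by simp
      then have "u' - v' \<in> ?Bg k ?s"
        using w(1) by (intro filtered_cx.gr_coboundariesI[OF cx[OF s] c(1)]) simp
      then have "- (u' - v') \<in> ?Bg k ?s" by (rule grp_minus[OF filtered_cx.grp_gr_coboundaries[OF cx[OF s]]])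
      then show ?thesis by simp
    qed
    have inFH: "a \<in> FH k q" if "a \<in> hdg A q n" "a \<in> wt A ?s k n" "a \<in> cocyc A ?s n" for a q
      unfolding FH_def using that Zg_Int grp_zero[OF filtered_cx.grp_gr_coboundaries[OF cx[OF s]]]
      by (intro plus_memI[of a]) auto
    have "corresponds A n (?Zg k) (?Bg k) z' u'" by (rule corr_modify[OF zig_gr WB_gr[OF z(3)] uvB])
    then have "u' \<in> Fb k (k + 1 - p)" unfolding Fb_def using inFH[OF y'(1-3)] WB_gr[OF z(1)] z(2) by blast
    then have "u' \<in> ?Bg k ?s" using pure'(2)[of k p] inFH[OF u'(1-3)] by blast
    then have "u' \<in> wcl ?s (k - 1) n" using gr_coboundary_cocycle u'(3) by blast
    then have "u' + (u - u') \<in> wcl ?s (k - 1) n"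
      by (intro grp_add[OF grp_wcl[OF s]] subsetD[OF B_wcl[OF s] u'(4)])
    then show ?thesis by simp
  qed
qed

end

subsection \<open>Quasi-isomorphisms are strict\<close>

text \<open>Modelled on the linear part of \<open>inf_quasi_iso\<close>: isomorphisms are required
  on unfiltered cohomology alone, and their compatibility with the filtrations is what has to be
  proved.\<close>

locale mhc_map = X: mhc_pure K D + Y: mhc_pure K E
  for K and D :: "('a::complex_vector, 'z) mhc_scheme" and E :: "('b::complex_vector, 'y) mhc_scheme" +
  fixes g :: "nat \<Rightarrow> int \<Rightarrow> 'a \<Rightarrow> 'b"
  assumes len_eq: "len E = len D"
    and g_lin: "i \<le> len D ==> linear_between (cpt D i n) (cpt E i n) (g i n)"
    and g_d: "i \<le> len D ==> x \<in> cpt D i n ==> g i (n + 1) (dif D i n x) = dif E i n (g i n x)"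
    and g_W: "i \<le> len D ==> x \<in> wt D i k n ==> g i n x \<in> wt E i k n"
    and g_R: "x \<in> rat D n ==> g 0 n x \<in> rat E n"
    and g_F: "x \<in> hdg D p n ==> g (len D) n x \<in> hdg E p n"
    and g_cmp: "(r, q) \<in> arrows (len D) ==> x \<in> cpt D r n ==> cmp E r q n (g r n x) = g q n (cmp D r q n x)"
    and g_iso: "i \<le> len D ==> quotient_iso (g i n) (cocyc D i n) (cobd D i n) (cocyc E i n) (cobd E i n)"
    and g_iso_rat: "quotient_iso (g 0 n)
        (cocycles (rat D) (dif D 0) n) (coboundaries (rat D) (dif D 0) n)
        (cocycles (rat E) (dif E 0) n) (coboundaries (rat E) (dif E 0) n)"
begin

lemma g_diff: "i \<le> len D ==> x \<in> cpt D i n ==> y \<in> cpt D i n ==> g i n (x - y) = g i n x - g i n y"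
  using lin_diff[OF g_lin X.csub_V] by blast

lemma g_add: "i \<le> len D ==> x \<in> cpt D i n ==> y \<in> cpt D i n ==> g i n (x + y) = g i n x + g i n y"
  using lin_add[OF g_lin] by blast

lemma g_d': "i \<le> len D ==> x \<in> cpt D i (n - 1) ==> g i n (dif D i (n - 1) x) = dif E i (n - 1) (g i (n - 1) x)"
  using g_d[of i x "n - 1"] by simp

lemma g_wcl: "i \<le> len D ==> x \<in> X.wcl i k n ==> g i n x \<in> Y.wcl i k n"
proof -
  assume i: "i \<le> len D" and x: "x \<in> X.wcl i k n"
  obtain w b where w: "w \<in> wt D i k n" "w \<in> cocyc D i n" "b \<in> cobd D i n" "x = w + b" using x by (rule X.wclE)
  have V: "w \<in> cpt D i n" "b \<in> cpt D i n" using w X.Z_V subsetD[OF X.B_Z[OF i]] by blast+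
  have eq: "g i n x - g i n w = g i n b" using g_add[OF i V] w(4) by simp
  show ?thesis
    by (rule Y.wclI[OF g_W[OF i w(1)] quotient_isoD(1)[OF g_iso[OF i] w(2)]])
      (simp add: eq quotient_isoD(2)[OF g_iso[OF i] w(3)])
qed

lemma g_ZB:
  assumes "X.ZB n x y" shows "Y.ZB n (g 0 n x) (g (len D) n y)"
proof -
  obtain z where z: "zchain D n (\<lambda>i. cocyc D i n) (\<lambda>i. cobd D i n) z" "z 0 = x" "z (len D) = y"
    using assms unfolding corresponds_iff_zchain by blast
  let ?z = "\<lambda>i. g i n (z i)"
  have zZ: "z i \<in> cocyc D i n" if "i \<le> len D" for i using z(1) that unfolding zchain_def by blast
  have "zlink E n (\<lambda>i. cobd E i n) i (?z i) (?z (Suc i))" if i: "i < len D" for i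
  proof -
    have l: "zlink D n (\<lambda>i. cobd D i n) i (z i) (z (Suc i))" using z(1) i unfolding zchain_def by blast
    have le: "i \<le> len D" "Suc i \<le> len D" using i by auto
    have V: "z i \<in> cpt D i n" "z (Suc i) \<in> cpt D (Suc i) n" using zZ[OF le(1)] zZ[OF le(2)] X.Z_V by blast+
    show ?thesis
    proof (cases "even i")
      case True
      note ar = X.arrow_even[OF i True]
      have "g (Suc i) n (cmp D i (Suc i) n (z i) - z (Suc i)) \<in> cobd E (Suc i) n"
        using l True by (intro quotient_isoD(2)[OF g_iso[OF le(2)]]) (simp add: zlink_def)
      then show ?thesis using True
        by (simp add: zlink_def g_cmp[OF ar V(1)] g_diff[OF le(2) X.cmp_V[OF ar V(1)] V(2)])
    next
      case False
      note ar = X.arrow_odd[OF i False]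
      have "g i n (cmp D (Suc i) i n (z (Suc i)) - z i) \<in> cobd E i n"
        using l False by (intro quotient_isoD(2)[OF g_iso[OF le(1)]]) (simp add: zlink_def)
      then show ?thesis using False
        by (simp add: zlink_def g_cmp[OF ar V(2)] g_diff[OF le(1) X.cmp_V[OF ar V(2)] V(1)])
    qed
  qed
  then have "zchain E n (\<lambda>i. cocyc E i n) (\<lambda>i. cobd E i n) ?z"
    using zZ quotient_isoD(1)[OF g_iso] unfolding zchain_def len_eq by blast
  then show ?thesis unfolding corresponds_iff_zchain len_eq using z(2,3) by blast
qed

lemma g_F_classes: "y \<in> F_classes D p n ==> g (len D) n y \<in> F_classes E p n"
proof -
  assume "y \<in> F_classes D p n"
  then obtain f where f: "f \<in> hdg D p n" "f \<in> cocyc D (len D) n" "y - f \<in> cobd D (len D) n" by (rule X.F_classesE)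
  have "y - f \<in> cocyc D (len D) n" using X.B_Z f(3) by blast
  then have V: "y - f \<in> cpt D (len D) n" "f \<in> cpt D (len D) n" using f(2) X.Z_V by blast+
  have "g (len D) n ((y - f) + f) = g (len D) n (y - f) + g (len D) n f" using g_add[OF order_refl V] .
  then have eq: "g (len D) n y - g (len D) n f = g (len D) n (y - f)" by simp
  show ?thesis
    by (rule Y.F_classesI[OF g_F[OF f(1)]])
      (use quotient_isoD(1)[OF g_iso[OF order_refl] f(2)] quotient_isoD(2)[OF g_iso[OF order_refl] f(3)] eq len_eq in auto)
qed

text \<open>A linear map that respects the \<open>K\<close>-structures commutes with
  conjugation.\<close>

lemma g_conj_classes: "y \<in> X.conj_classes q n ==> g (len D) n y \<in> Y.conj_classes q n"
proof -
  assume "y \<in> X.conj_classes q n"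
  then obtain u x x' where u: "u \<in> F_classes D q n" "X.ZB n x u" "conjugate_wrt (rat D n) x x'" "X.ZB n x' y"
    by (rule X.conj_classesE)
  have "conjugate_wrt (rat E n) (g 0 n x) (g 0 n x')"
    by (rule conj_linear[OF g_lin X.R_V _ X.csub_V u(3)]) (use g_R in auto)
  then show ?thesis by (rule Y.conj_classesI[OF g_F_classes[OF u(1)] g_ZB[OF u(2)] _ g_ZB[OF u(4)]])
qed

lemma opposed_map: "opposed_morphism (cocyc D (len D) n) (cobd D (len D) n) (\<lambda>k. X.wcl (len D) k n)
   (\<lambda>p. F_classes D p n) (\<lambda>q. X.conj_classes q n)
   (cocyc E (len E) n) (cobd E (len E) n) (\<lambda>k. Y.wcl (len E) k n)
   (\<lambda>p. F_classes E p n) (\<lambda>q. Y.conj_classes q n) (g (len D) n)"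
proof (intro opposed_morphism.intro opposed_morphism_axioms.intro X.opposed Y.opposed)
  show "g (len D) n (x - y) = g (len D) n x - g (len D) n y" if "x \<in> cocyc D (len D) n" "y \<in> cocyc D (len D) n" for x y
    using that X.Z_V by (intro g_diff) auto
  show "g (len D) n x \<in> Y.wcl (len E) k n" if "x \<in> X.wcl (len D) k n" for x k
    using g_wcl[OF order_refl that] len_eq by simp
  show "X.conj_classes q n \<subseteq> cocyc D (len D) n" for q
    by (auto elim!: X.conj_classesE dest: corr_mem)
  show "x \<in> cobd D (len D) n" if "x \<in> cocyc D (len D) n" "g (len D) n x \<in> cobd E (len E) n" for x
    using quotient_isoD(3)[OF g_iso[OF order_refl] that(1)] that(2) len_eq by simp
qed (auto intro: g_F_classes g_conj_classes)

text \<open>Hodge theory is available on the last component. For the others, the class is followed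
  along the zigzag to the last component, where \<open>strict_W\<close> applies, and back; the image
  chain has to match only modulo the weight step.\<close>

lemma strict_wcl:
  assumes i: "i \<le> len D" and x: "x \<in> cocyc D i n" "g i n x \<in> Y.wcl i k n"
  shows "x \<in> X.wcl i k n"
proof -
  obtain z where z: "zchain D n (\<lambda>i. cocyc D i n) (\<lambda>i. cobd D i n) z" "z i = x"
    using X.zchain_extend[OF X.zig_total i x(1)] by blast
  have zZ: "z j \<in> cocyc D j n" if "j \<le> len D" for j using z(1) that unfolding zchain_def by blast
  have gz: "zlink E n (\<lambda>i. Y.wcl i k n) j (g j n (z j)) (g (Suc j) n (z (Suc j)))" if j: "j < len D" for j
  proof -
    have l: "zlink D n (\<lambda>i. cobd D i n) j (z j) (z (Suc j))" using z(1) j unfolding zchain_def by blast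
    have le: "j \<le> len D" "Suc j \<le> len D" using j by auto
    have V: "z j \<in> cpt D j n" "z (Suc j) \<in> cpt D (Suc j) n" using zZ[OF le(1)] zZ[OF le(2)] X.Z_V by blast+
    show ?thesis
    proof (cases "even j")
      case True
      note ar = X.arrow_even[OF j True]
      have "g (Suc j) n (cmp D j (Suc j) n (z j) - z (Suc j)) \<in> Y.wcl (Suc j) k n"
        using l True by (intro subsetD[OF Y.B_wcl] quotient_isoD(2)[OF g_iso[OF le(2)]]) (auto simp: zlink_def len_eq le)
      then show ?thesis using True
        by (simp add: zlink_def g_cmp[OF ar V(1)] g_diff[OF le(2) X.cmp_V[OF ar V(1)] V(2)])
    next
      case False
      note ar = X.arrow_odd[OF j False]
      have "g j n (cmp D (Suc j) j n (z (Suc j)) - z j) \<in> Y.wcl j k n"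
        using l False by (intro subsetD[OF Y.B_wcl] quotient_isoD(2)[OF g_iso[OF le(1)]]) (auto simp: zlink_def len_eq le)
      then show ?thesis using False
        by (simp add: zlink_def g_cmp[OF ar V(2)] g_diff[OF le(1) X.cmp_V[OF ar V(2)] V(1)])
    qed
  qed
  have gz': "zchain E n (\<lambda>i. cocyc E i n) (\<lambda>i. Y.wcl i k n) (\<lambda>i. g i n (z i))"
    using zZ quotient_isoD(1)[OF g_iso] gz unfolding zchain_def len_eq by blast
  have "g i n (z i) \<in> Y.wcl i k n" using x(2) z(2) by simp
  then have "g (len D) n (z (len D)) \<in> Y.wcl (len D) k n"
    using Y.zchain_iff0[OF Y.zig_wcl gz', of i] Y.zchain_iff0[OF Y.zig_wcl gz', of "len D"] i len_eq by simp
  then have "z (len D) \<in> X.wcl (len D) k n"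
    using opposed_morphism.strict_W[OF opposed_map zZ[OF order_refl], of k] len_eq by simp
  then show ?thesis using X.zchain_wcl_iff[OF z(1) i order_refl] z(2) by blast
qed

lemma strict_F_classes:
  assumes "x \<in> cocyc D (len D) n" "g (len D) n x \<in> F_classes E p n"
  shows "x \<in> F_classes D p n"
  by (rule opposed_morphism.strict_F[OF opposed_map assms])

text \<open>Strictness on cohomology moves a preimage of a class into weight \<open>k\<close>, and
  strictness of the differentials makes exactness hold within weight \<open>k\<close>.\<close>

lemma iso_W:
  assumes i: "i \<le> len D"
  shows "quotient_iso (g i n) (wt D i k n \<inter> cocyc D i n) (dif D i (n - 1) ` wt D i k (n - 1))
    (wt E i k n \<inter> cocyc E i n) (dif E i (n - 1) ` wt E i k (n - 1))"
proof (rule quotient_isoI)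
  have iE: "i \<le> len E" using i len_eq by simp
  show "g i n x \<in> wt E i k n \<inter> cocyc E i n" if "x \<in> wt D i k n \<inter> cocyc D i n" for x
    using that g_W[OF i] quotient_isoD(1)[OF g_iso[OF i]] by blast
  show "g i n x \<in> dif E i (n - 1) ` wt E i k (n - 1)" if x: "x \<in> dif D i (n - 1) ` wt D i k (n - 1)" for x
    using x g_d'[OF i X.W_V[OF i]] g_W[OF i] by auto
  show "x \<in> dif D i (n - 1) ` wt D i k (n - 1)"
    if x: "x \<in> wt D i k n \<inter> cocyc D i n" "g i n x \<in> dif E i (n - 1) ` wt E i k (n - 1)" for x
  proof -
    have "g i n x \<in> cobd E i n" using x(2) Y.dW_B[OF iE] by blast
    then have "x \<in> cobd D i n" using quotient_isoD(3)[OF g_iso[OF i]] x(1) by blast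
    then show ?thesis using X.W_strict[OF i] x(1) by blast
  qed
  show "\<exists>x\<in>wt D i k n \<inter> cocyc D i n. g i n x - y \<in> dif E i (n - 1) ` wt E i k (n - 1)"
    if y: "y \<in> wt E i k n \<inter> cocyc E i n" for y
  proof -
    obtain x where x: "x \<in> cocyc D i n" "g i n x - y \<in> cobd E i n"
      using quotient_isoD(4)[OF g_iso[OF i]] y by blast
    have "g i n x \<in> Y.wcl i k n" by (rule Y.wclI[of y]) (use y x(2) in auto)
    then have "x \<in> X.wcl i k n" by (rule strict_wcl[OF i x(1)])
    then obtain w b where w: "w \<in> wt D i k n" "w \<in> cocyc D i n" "b \<in> cobd D i n" "x = w + b" by (rule X.wclE)
    have V: "w \<in> cpt D i n" "b \<in> cpt D i n" using w X.Z_V subsetD[OF X.B_Z[OF i]] by blast+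
    have "(g i n x - y) - g i n b \<in> cobd E i n"
      by (rule grp_diff[OF Y.grp_B[OF iE] x(2) quotient_isoD(2)[OF g_iso[OF i] w(3)]])
    then have "g i n w - y \<in> cobd E i n" by (rule mem_eq) (simp add: g_add[OF i V] w(4))
    moreover have "g i n w - y \<in> wt E i k n" using Y.W_diff[OF iE] g_W[OF i w(1)] y by blast
    ultimately have "g i n w - y \<in> dif E i (n - 1) ` wt E i k (n - 1)" using Y.W_strict[OF iE] by blast
    then show ?thesis using w by blast
  qed
qed

text \<open>The same pattern with two filtrations: \<open>FW_classesE\<close> gives a representative
  in both at once, and \<open>FW_strict\<close> a primitive in both.\<close>

lemma iso_F:
  "quotient_iso (g (len D) n) (hdg D p n \<inter> wt D (len D) k n \<inter> cocyc D (len D) n)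
     (dif D (len D) (n - 1) ` (hdg D p (n - 1) \<inter> wt D (len D) k (n - 1)))
     (hdg E p n \<inter> wt E (len D) k n \<inter> cocyc E (len D) n)
     (dif E (len D) (n - 1) ` (hdg E p (n - 1) \<inter> wt E (len D) k (n - 1)))"
proof (rule quotient_isoI)
  let ?s = "len D"
  have s: "?s \<le> ?s" by simp
  show "g ?s n x \<in> hdg E p n \<inter> wt E ?s k n \<inter> cocyc E ?s n" if "x \<in> hdg D p n \<inter> wt D ?s k n \<inter> cocyc D ?s n" for x
    using that g_W[OF s] g_F quotient_isoD(1)[OF g_iso[OF s]] by blast
  show "g ?s n x \<in> dif E ?s (n - 1) ` (hdg E p (n - 1) \<inter> wt E ?s k (n - 1))"
    if x: "x \<in> dif D ?s (n - 1) ` (hdg D p (n - 1) \<inter> wt D ?s k (n - 1))" for x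
    using x g_d'[OF s X.W_V[OF s]] g_W[OF s] g_F by auto
  show "x \<in> dif D ?s (n - 1) ` (hdg D p (n - 1) \<inter> wt D ?s k (n - 1))"
    if x: "x \<in> hdg D p n \<inter> wt D ?s k n \<inter> cocyc D ?s n"
      "g ?s n x \<in> dif E ?s (n - 1) ` (hdg E p (n - 1) \<inter> wt E ?s k (n - 1))" for x
  proof -
    have "g ?s n x \<in> cobd E ?s n" using x(2) Y.dW_B[of ?s n k] len_eq by auto
    then have "x \<in> cobd D ?s n" using quotient_isoD(3)[OF g_iso[OF s]] x(1) by blast
    then show ?thesis using X.FW_strict x(1) by blast
  qed
  show "\<exists>x\<in>hdg D p n \<inter> wt D ?s k n \<inter> cocyc D ?s n.
      g ?s n x - y \<in> dif E ?s (n - 1) ` (hdg E p (n - 1) \<inter> wt E ?s k (n - 1))"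
    if y: "y \<in> hdg E p n \<inter> wt E ?s k n \<inter> cocyc E ?s n" for y
  proof -
    obtain x where x: "x \<in> cocyc D ?s n" "g ?s n x - y \<in> cobd E ?s n"
      using quotient_isoD(4)[OF g_iso[OF s]] y by blast
    have "g ?s n x \<in> Y.wcl ?s k n" by (rule Y.wclI[of y]) (use y x(2) in auto)
    then have xW: "x \<in> X.wcl ?s k n" by (rule strict_wcl[OF s x(1)])
    have "g ?s n x \<in> F_classes E p n" by (rule Y.F_classesI[of y]) (use y x(2) len_eq in auto)
    then have "x \<in> F_classes D p n" by (rule strict_F_classes[OF x(1)])
    then obtain f where f: "f \<in> hdg D p n" "f \<in> wt D ?s k n" "f \<in> cocyc D ?s n" "x - f \<in> cobd D ?s n"
      using xW by (rule X.FW_classesE)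
    have V: "x \<in> cpt D ?s n" "f \<in> cpt D ?s n" using x(1) f(3) X.Z_V by blast+
    have "add_subgroup (cobd E ?s n)" using Y.grp_B[of ?s n] len_eq by simp
    then have "(g ?s n x - y) - g ?s n (x - f) \<in> cobd E ?s n"
      by (rule grp_diff[OF _ x(2) quotient_isoD(2)[OF g_iso[OF s] f(4)]])
    then have gB: "g ?s n f - y \<in> cobd E ?s n" by (rule mem_eq) (simp add: g_diff[OF s V])
    have "g ?s n f - y \<in> wt E ?s k n" using Y.W_diff[of ?s] g_W[OF s f(2)] y len_eq by auto
    moreover have "g ?s n f - y \<in> hdg E p n" using Y.F_diff g_F[OF f(1)] y by blast
    ultimately have "g ?s n f - y \<in> dif E ?s (n - 1) ` (hdg E p (n - 1) \<inter> wt E ?s k (n - 1))"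
      using Y.FW_strict[of "g ?s n f - y" p n k] gB len_eq by simp
    then show ?thesis using f by blast
  qed
qed

text \<open>A rational preimage exists by assumption and has weight \<open>k\<close> on complex
  cohomology by strictness. \<open>rat_weight\<close> and \<open>rat_strict\<close> then provide a
  representative and a primitive that are rational and of weight \<open>k\<close>
  simultaneously.\<close>

lemma iso_R:
  "quotient_iso (g 0 n) (wt D 0 k n \<inter> rat D n \<inter> cocyc D 0 n) (dif D 0 (n - 1) ` (wt D 0 k (n - 1) \<inter> rat D (n - 1)))
     (wt E 0 k n \<inter> rat E n \<inter> cocyc E 0 n) (dif E 0 (n - 1) ` (wt E 0 k (n - 1) \<inter> rat E (n - 1)))"
proof (rule quotient_isoI)
  have 0: "0 \<le> len D" "0 \<le> len E" by auto
  show "g 0 n x \<in> wt E 0 k n \<inter> rat E n \<inter> cocyc E 0 n" if "x \<in> wt D 0 k n \<inter> rat D n \<inter> cocyc D 0 n" for x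
    using that g_W[OF 0(1)] g_R quotient_isoD(1)[OF g_iso[OF 0(1)]] by blast
  show "g 0 n x \<in> dif E 0 (n - 1) ` (wt E 0 k (n - 1) \<inter> rat E (n - 1))"
    if x: "x \<in> dif D 0 (n - 1) ` (wt D 0 k (n - 1) \<inter> rat D (n - 1))" for x
    using x g_d'[OF 0(1) X.W_V[OF 0(1)]] g_W[OF 0(1)] g_R by auto
  show "x \<in> dif D 0 (n - 1) ` (wt D 0 k (n - 1) \<inter> rat D (n - 1))"
    if x: "x \<in> wt D 0 k n \<inter> rat D n \<inter> cocyc D 0 n" "g 0 n x \<in> dif E 0 (n - 1) ` (wt E 0 k (n - 1) \<inter> rat E (n - 1))" for x
  proof -
    have "g 0 n x \<in> cobd E 0 n" using x(2) Y.dW_B[OF 0(2), of n k] by auto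
    then have "x \<in> cobd D 0 n" using quotient_isoD(3)[OF g_iso[OF 0(1)]] x(1) by blast
    then have "x \<in> dif D 0 (n - 1) ` wt D 0 k (n - 1)" using X.W_strict[OF 0(1)] x(1) by blast
    then obtain r where "r \<in> wt D 0 k (n - 1)" "r \<in> rat D (n - 1)" "x = dif D 0 (n - 1) r"
      using X.rat_strict x(1) by blast
    then show ?thesis by blast
  qed
  show "\<exists>x\<in>wt D 0 k n \<inter> rat D n \<inter> cocyc D 0 n. g 0 n x - y \<in> dif E 0 (n - 1) ` (wt E 0 k (n - 1) \<inter> rat E (n - 1))"
    if y: "y \<in> wt E 0 k n \<inter> rat E n \<inter> cocyc E 0 n" for y
  proof -
    have "y \<in> cocycles (rat E) (dif E 0) n" using y Y.Z_d by (auto simp: cocycles_def)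
    then obtain x where "x \<in> cocycles (rat D) (dif D 0) n" "g 0 n x - y \<in> coboundaries (rat E) (dif E 0) n"
      using quotient_isoD(4)[OF g_iso_rat] by blast
    then obtain e where x: "x \<in> rat D n" "dif D 0 n x = 0" and e: "e \<in> rat E (n - 1)" "g 0 n x - y = dif E 0 (n - 1) e"
      by (auto simp: cocycles_def coboundaries_def)
    have xV: "x \<in> cpt D 0 n" using x(1) X.R_V by blast
    have xZ: "x \<in> cocyc D 0 n" using X.ZI[OF xV x(2)] .
    have "g 0 n x \<in> Y.wcl 0 k n"
      by (rule Y.wclI[of y]) (use y Y.BI[OF subsetD[OF Y.R_V e(1)] e(2)] in auto)
    then have "x \<in> X.wcl 0 k n" by (rule strict_wcl[OF 0(1) xZ])
    then obtain w b where w: "w \<in> wt D 0 k n" "w \<in> cocyc D 0 n" "b \<in> cobd D 0 n" "x = w + b" by (rule X.wclE)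
    obtain v where v: "v \<in> cpt D 0 (n - 1)" "b = dif D 0 (n - 1) v" using w(3) by (rule X.BE)
    have "x - dif D 0 (n - 1) v \<in> wt D 0 k n" using w(1,4) v(2) by simp
    then obtain r where r: "r \<in> rat D (n - 1)" "x - dif D 0 (n - 1) r \<in> wt D 0 k n" "x - dif D 0 (n - 1) r \<in> rat D n"
      using X.rat_weight[OF x(1) v(1)] by blast
    let ?x = "x - dif D 0 (n - 1) r"
    have rV: "r \<in> cpt D 0 (n - 1)" "dif D 0 (n - 1) r \<in> cpt D 0 n" using r(1) X.R_V X.d_V' by blast+
    have "dif D 0 n ?x = 0" using X.d_diff[OF 0(1) xV rV(2)] X.d_d'[OF 0(1) rV(1)] x(2) by simp
    then have xZ': "?x \<in> cocyc D 0 n" using X.V_diff[OF 0(1) xV rV(2)] by (intro X.ZI)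
    have ge: "g 0 (n - 1) r \<in> rat E (n - 1)" using g_R r(1) by blast
    have eV: "e \<in> cpt E 0 (n - 1)" "g 0 (n - 1) r \<in> cpt E 0 (n - 1)" using e(1) ge Y.R_V by blast+
    have "g 0 n ?x - y = (g 0 n x - y) - g 0 n (dif D 0 (n - 1) r)" using g_diff[OF 0(1) xV rV(2)] by simp
    also have "\<dots> = dif E 0 (n - 1) (e - g 0 (n - 1) r)"
      using e(2) g_d'[OF 0(1) rV(1)] Y.d_diff[OF 0(2) eV] by simp
    finally have eq: "g 0 n ?x - y = dif E 0 (n - 1) (e - g 0 (n - 1) r)" .
    have "g 0 n ?x - y \<in> cobd E 0 n" by (rule Y.BI[OF Y.V_diff[OF 0(2) eV] eq])
    moreover have "g 0 n ?x - y \<in> wt E 0 k n" using Y.W_diff[OF 0(2)] g_W[OF 0(1) r(2)] y by blast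
    ultimately have "g 0 n ?x - y \<in> dif E 0 (n - 1) ` wt E 0 k (n - 1)" using Y.W_strict[OF 0(2)] by blast
    moreover have "g 0 n ?x - y \<in> rat E n"
      using grp_diff[OF ksub_grp[OF Y.K Y.R_ksub]] g_R[OF r(3)] y by blast
    ultimately obtain u where "u \<in> wt E 0 k (n - 1)" "u \<in> rat E (n - 1)" "g 0 n ?x - y = dif E 0 (n - 1) u"
      using Y.rat_strict by blast
    then show ?thesis using r xZ' by blast
  qed
qed

end

section \<open>Deligne--Beilinson complexes\<close>

declare One_nat_def [simp del]

text \<open>
  The complexes are indexed here by the total degree \<open>m = 2 p + n\<close> of the bottom components.
\<close>

definition dbX :: "'a::complex_vector mhd \<Rightarrow> int \<Rightarrow> nat \<Rightarrow> int \<Rightarrow> 'a set" where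
  "dbX B p i m = (if i = 0 then (\<lambda>x. tate p *\<^sub>C x) ` (wt B 0 (2 * p) m \<inter> rat B m)
     else if i = len B then hdg B p m \<inter> wt B i (2 * p) m else wt B i (2 * p) m)"

definition dbC :: "'a::complex_vector mhd \<Rightarrow> int \<Rightarrow> int \<Rightarrow> (nat \<Rightarrow> 'a) set" where
  "dbC B p m = {a. (\<forall>i\<le>len B. a i \<in> dbX B p i (if even i then m else m - 1)) \<and> (\<forall>i>len B. a i = 0)}"

definition dbD :: "'a::complex_vector mhd \<Rightarrow> int \<Rightarrow> (nat \<Rightarrow> 'a) \<Rightarrow> nat \<Rightarrow> 'a" where
  "dbD B m a = (\<lambda>i. if i > len B then 0
     else if even i then dif B i m (a i)
     else cmp B (i - 1) i m (a (i - 1)) - cmp B (Suc i) i m (a (Suc i)) - dif B i (m - 1) (a i))"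

definition dZ :: "'a::complex_vector mhd \<Rightarrow> int \<Rightarrow> int \<Rightarrow> (nat \<Rightarrow> 'a) set" where
  "dZ B p m = {a \<in> dbC B p m. dbD B m a = 0}"

definition dB :: "'a::complex_vector mhd \<Rightarrow> int \<Rightarrow> int \<Rightarrow> (nat \<Rightarrow> 'a) set" where
  "dB B p m = dbD B (m - 1) ` dbC B p (m - 1)"

definition mk_cochain :: "'a::complex_vector mhd \<Rightarrow> (nat \<Rightarrow> 'a) \<Rightarrow> (nat \<Rightarrow> 'a) \<Rightarrow> nat \<Rightarrow> 'a" where
  "mk_cochain B u t = (\<lambda>i. if i > len B then 0 else if even i then u i else t i)"

lemma tate_nonzero: "tate p \<noteq> 0" by (simp add: tate_def power_int_eq_0_iff)

lemma tate_add: "tate (p + q) = tate p * tate q"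
  by (simp add: tate_def power_int_add)

locale even_core = mhc_core K B for K and B :: "'a::complex_vector mhd" +
  assumes even_len: "even (len B)"
begin

abbreviation "N \<equiv> len B"

lemma len2: "2 \<le> N"
proof -
  have "N \<noteq> 1" using even_len by auto
  then show ?thesis using len_pos by simp
qed

lemma db_diff_eq: "db_diff B p n = dbD B (2 * p + n)"
  unfolding db_diff_def dbD_def Suc_eq_plus1 ..

lemma db_cochains_eq: "db_cochains B p n = dbC B p (2 * p + n)"
proof -
  have "a \<in> db_cochains B p n \<longleftrightarrow> a \<in> dbC B p (2 * p + n)" for a
  proof
    assume a: "a \<in> db_cochains B p n"
    have "a i \<in> dbX B p i (if even i then 2 * p + n else 2 * p + n - 1)" if "i \<le> N" for i
      using a that len2 even_len
      by (cases "i = N"; cases "i = 0"; cases "even i") (auto simp: db_cochains_def dbX_def)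
    then show "a \<in> dbC B p (2 * p + n)" using a by (auto simp: dbC_def db_cochains_def)
  next
    assume a: "a \<in> dbC B p (2 * p + n)"
    have *: "a i \<in> dbX B p i (if even i then 2 * p + n else 2 * p + n - 1)" if "i \<le> N" for i
      using a that by (auto simp: dbC_def)
    have "a i \<in> wt B i (2 * p) (2 * p + n)" if "even i" "0 < i" "i < N" for i
      using *[of i] that by (auto simp: dbX_def)
    moreover have "a q \<in> wt B q (2 * p) (2 * p + n - 1)" if "odd q" "q < N" for q
    proof -
      have "q \<noteq> 0" using that by (cases q) auto
      then show ?thesis using *[of q] that by (auto simp: dbX_def)
    qed
    moreover have "a 0 \<in> (\<lambda>x. tate p *\<^sub>C x) ` (wt B 0 (2 * p) (2 * p + n) \<inter> rat B (2 * p + n))"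
      using *[of 0] by (simp add: dbX_def)
    moreover have "a N \<in> hdg B p (2 * p + n) \<inter> wt B N (2 * p) (2 * p + n)"
      using *[of "N"] even_len len2 by (auto simp: dbX_def)
    ultimately show "a \<in> db_cochains B p n" using a by (auto simp: db_cochains_def dbC_def)
  qed
  then show ?thesis by blast
qed

lemma db_cocycles_eq: "db_cocycles B p n = dZ B p (2 * p + n)"
  by (simp add: db_cocycles_def dZ_def db_cochains_eq db_diff_eq)

lemma db_coboundaries_eq: "db_coboundaries B p n = dB B p (2 * p + n)"
proof -
  have "2 * p + (n - 1) = 2 * p + n - 1" by simp
  then show ?thesis by (simp only: db_coboundaries_def dB_def db_cochains_eq db_diff_eq)
qed

lemma odd_lt: "odd q ==> q \<le> N ==> q < N" using even_len by (metis le_neq_implies_less)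

lemma arrow_left: "odd q ==> q < N ==> (q - 1, q) \<in> arrows N"
  and arrow_right: "odd q ==> q < N ==> (Suc q, q) \<in> arrows N"
  by (cases q; auto simp: arrows_def)+

lemma dbX_odd: "odd q ==> dbX B p q m = wt B q (2 * p) m"
proof -
  assume "odd q"
  then have "q \<noteq> 0" "q \<noteq> N" using even_len odd_pos[of q] by auto
  then show ?thesis by (simp add: dbX_def)
qed

lemma dbX_0: "dbX B p 0 m = (\<lambda>x. tate p *\<^sub>C x) ` (wt B 0 (2 * p) m \<inter> rat B m)"
  by (simp add: dbX_def)

lemma dbX_len: "dbX B p N m = hdg B p m \<inter> wt B N (2 * p) m"
  using len2 by (auto simp: dbX_def)

lemma dbX_0E:
  assumes "x \<in> dbX B p 0 m" obtains r where "r \<in> wt B 0 (2 * p) m" "r \<in> rat B m" "x = tate p *\<^sub>C r"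
  using assms unfolding dbX_0 by blast

lemma dbX_W: "i \<le> N ==> x \<in> dbX B p i m ==> x \<in> wt B i (2 * p) m"
  using W_scale[of 0] by (auto simp: dbX_def split: if_splits)

lemma dbX_V: "i \<le> N ==> x \<in> dbX B p i m ==> x \<in> cpt B i m"
  using W_V dbX_W by blast

lemma tate_grp: "add_subgroup S ==> add_subgroup ((\<lambda>x. tate p *\<^sub>C x) ` S)"
proof (rule add_subgroupI)
  assume S: "add_subgroup S"
  show "0 \<in> (\<lambda>x. tate p *\<^sub>C x) ` S" using grp_zero[OF S] by force
  fix x y assume "x \<in> (\<lambda>x. tate p *\<^sub>C x) ` S" "y \<in> (\<lambda>x. tate p *\<^sub>C x) ` S"
  then obtain a b where "a \<in> S" "b \<in> S" "x = tate p *\<^sub>C a" "y = tate p *\<^sub>C b" by blast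
  then show "x - y \<in> (\<lambda>x. tate p *\<^sub>C x) ` S"
    using grp_diff[OF S, of a b] by (intro image_eqI[of _ _ "a - b"]) (auto simp: scaleC.scale_right_diff_distrib)
qed

lemma grp_WR: "add_subgroup (wt B 0 k m \<inter> rat B m)"
  by (rule grp_Int[OF grp_W[OF le0] ksub_grp[OF K R_ksub]])

lemma grp_dbX: "i \<le> N ==> add_subgroup (dbX B p i m)"
  unfolding dbX_def using tate_grp[OF grp_WR] grp_Int[OF grp_F grp_W] grp_W by auto

lemmas dbX_zero = grp_zero[OF grp_dbX] and dbX_diff = grp_diff[OF grp_dbX] and dbX_add = grp_add[OF grp_dbX]

lemma dbX_scale: "i \<le> N ==> c \<in> K ==> x \<in> dbX B p i m ==> c *\<^sub>C x \<in> dbX B p i m"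
proof (cases "i = 0")
  case True
  assume "c \<in> K" "x \<in> dbX B p i m"
  then obtain r where "r \<in> wt B 0 (2 * p) m" "r \<in> rat B m" "x = tate p *\<^sub>C r" unfolding True by (elim dbX_0E)
  then show ?thesis unfolding True dbX_0 using ksub_scale[OF R_ksub \<open>c \<in> K\<close>] W_scale[of 0]
    by (intro image_eqI[of _ _ "c *\<^sub>C r"]) (auto simp: mult.commute)
qed (auto simp: dbX_def W_scale F_scale)

lemma dbX_d: "i \<le> N ==> x \<in> dbX B p i m ==> dif B i m x \<in> dbX B p i (m + 1)"
proof (cases "i = 0")
  case True
  assume "x \<in> dbX B p i m"
  then obtain r where r: "r \<in> wt B 0 (2 * p) m" "r \<in> rat B m" "x = tate p *\<^sub>C r" unfolding True by (elim dbX_0E)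
  have "dif B 0 m x = tate p *\<^sub>C dif B 0 m r" using d_scale[OF le0 W_V[OF le0 r(1)]] r(3) by simp
  then show ?thesis unfolding True dbX_0 using d_W[OF le0 r(1)] rat_dif[of m] r(2) by blast
qed (auto simp: dbX_def d_W F_d)

text \<open>Each kind of term is a strict subcomplex. For the rational one the Tate twist is divided
  out, \<open>rat_strict\<close> is applied, and the twist is restored.\<close>

lemma dbX_strict:
  assumes i: "i \<le> N" and x: "x \<in> dbX B p i m" "x \<in> cobd B i m"
  shows "x \<in> dif B i (m - 1) ` dbX B p i (m - 1)"
proof -
  consider "i = 0" | "i = N" | "i \<noteq> 0" "i \<noteq> N" by blast
  then show ?thesis
  proof cases
    case 1
    obtain r where r: "r \<in> wt B 0 (2 * p) m" "r \<in> rat B m" "x = tate p *\<^sub>C r"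
      using x(1) unfolding 1 by (rule dbX_0E)
    obtain y where y: "y \<in> cpt B 0 (m - 1)" "x = dif B 0 (m - 1) y" using x(2) unfolding 1 by (rule BE)
    have "r = inverse (tate p) *\<^sub>C x" using r(3) tate_nonzero[of p] by simp
    also have "\<dots> = dif B 0 (m - 1) (inverse (tate p) *\<^sub>C y)" using d_scale[OF le0 y(1)] y(2) by simp
    finally have "r \<in> cobd B 0 m" by (rule BI[OF V_scale[OF le0 y(1)]])
    then have "r \<in> dif B 0 (m - 1) ` wt B 0 (2 * p) (m - 1)" using W_strict[OF le0 r(1)] by blast
    then obtain u where u: "u \<in> wt B 0 (2 * p) (m - 1)" "u \<in> rat B (m - 1)" "r = dif B 0 (m - 1) u"
      using rat_strict[OF r(2)] by blast
    have "x = dif B 0 (m - 1) (tate p *\<^sub>C u)" using d_scale[OF le0 W_V[OF le0 u(1)]] u(3) r(3) by simp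
    then show ?thesis unfolding 1 dbX_0 using u(1,2) by blast
  next
    case 2
    then show ?thesis using FW_strict x unfolding 2 dbX_len by blast
  next
    case 3
    then show ?thesis using W_strict[OF i] x by (auto simp: dbX_def)
  qed
qed

lemma dbD_even: "even i ==> i \<le> N ==> dbD B m a i = dif B i m (a i)"
  and dbD_odd: "odd q ==> q < N ==>
    dbD B m a q = cmp B (q - 1) q m (a (q - 1)) - cmp B (Suc q) q m (a (Suc q)) - dif B q (m - 1) (a q)"
  and dbD_out: "i > N ==> dbD B m a i = 0"
  by (auto simp: dbD_def)

lemma dbC_even: "a \<in> dbC B p m ==> even i ==> i \<le> N ==> a i \<in> dbX B p i m"
  and dbC_out: "a \<in> dbC B p m ==> i > N ==> a i = 0"
  by (auto simp: dbC_def)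

lemma dbC_odd:
  assumes "a \<in> dbC B p m" "odd q" "q < N" shows "a q \<in> wt B q (2 * p) (m - 1)"
proof -
  have "\<forall>i\<le>N. a i \<in> dbX B p i (if even i then m else m - 1)" using assms(1) by (simp add: dbC_def)
  then have "a q \<in> dbX B p q (if even q then m else m - 1)" using assms(3) by simp
  then show ?thesis using dbX_odd[OF assms(2)] assms(2) by simp
qed

lemma dbCI:
  assumes "\<And>i. even i ==> i \<le> N ==> a i \<in> dbX B p i m"
    "\<And>q. odd q ==> q < N ==> a q \<in> wt B q (2 * p) (m - 1)" "\<And>i. i > N ==> a i = 0"
  shows "a \<in> dbC B p m"
  using assms odd_lt dbX_odd by (auto simp: dbC_def)

lemma db_ext:
  assumes "\<And>i. even i ==> i \<le> N ==> a i = b i" "\<And>q. odd q ==> q < N ==> a q = b q"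
    "\<And>i. i > N ==> a i = b i"
  shows "a = b"
  using assms odd_lt by (metis ext not_le_imp_less)

lemma mk_even [simp]: "even i ==> i \<le> N ==> mk_cochain B u t i = u i"
  and mk_odd [simp]: "odd q ==> q < N ==> mk_cochain B u t q = t q"
  and mk_out [simp]: "i > N ==> mk_cochain B u t i = 0"
  by (auto simp: mk_cochain_def)

lemma odd_nb:
  assumes "odd q" "q < N"
  shows "even (q - 1)" "q - 1 \<le> N" "even (Suc q)" "Suc q \<le> N" "q \<le> N"
  using assms by auto

lemma cmp_left_V: "odd q ==> q < N ==> x \<in> cpt B (q - 1) m ==> cmp B (q - 1) q m x \<in> cpt B q m"
  and cmp_right_V: "odd q ==> q < N ==> x \<in> cpt B (Suc q) m ==> cmp B (Suc q) q m x \<in> cpt B q m"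
  and cmp_left_W: "odd q ==> q < N ==> x \<in> wt B (q - 1) k m ==> cmp B (q - 1) q m x \<in> wt B q k m"
  and cmp_right_W: "odd q ==> q < N ==> x \<in> wt B (Suc q) k m ==> cmp B (Suc q) q m x \<in> wt B q k m"
  using cmp_V[OF arrow_left] cmp_V[OF arrow_right] cmp_W[OF arrow_left] cmp_W[OF arrow_right] by blast+

lemma cmp_left_zero: "odd q ==> q < N ==> cmp B (q - 1) q m 0 = 0"
  and cmp_right_zero: "odd q ==> q < N ==> cmp B (Suc q) q m 0 = 0"
  using lin_zero[OF cmp_lin[OF arrow_left] csub_V] lin_zero[OF cmp_lin[OF arrow_right] csub_V] odd_nb by blast+

lemma cmp_left_X: "odd q ==> q < N ==> x \<in> dbX B p (q - 1) m ==> cmp B (q - 1) q m x \<in> wt B q (2 * p) m"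
  and cmp_right_X: "odd q ==> q < N ==> x \<in> dbX B p (Suc q) m ==> cmp B (Suc q) q m x \<in> wt B q (2 * p) m"
  using cmp_left_W cmp_right_W dbX_W odd_nb by blast+

lemma grp_dbC: "add_subgroup (dbC B p m)"
proof (rule add_subgroupI)
  show "0 \<in> dbC B p m" by (rule dbCI) (auto simp: dbX_zero W_zero)
  show "a - b \<in> dbC B p m" if "a \<in> dbC B p m" "b \<in> dbC B p m" for a b
    by (rule dbCI)
      (use dbC_even[OF that(1)] dbC_even[OF that(2)] dbC_odd[OF that(1)] dbC_odd[OF that(2)]
        dbC_out[OF that(1)] dbC_out[OF that(2)] dbX_diff W_diff in auto)
qed

lemma dbC_scale:
  assumes c: "c \<in> K" and a: "a \<in> dbC B p m" shows "(\<lambda>i. c *\<^sub>C a i) \<in> dbC B p m"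
  by (rule dbCI) (use dbC_even[OF a] dbC_odd[OF a] dbC_out[OF a] dbX_scale[OF _ c] W_scale in auto)


lemma dbC_V_even: "a \<in> dbC B p m ==> even i ==> i \<le> N ==> a i \<in> cpt B i m"
  and dbC_V_odd: "a \<in> dbC B p m ==> odd q ==> q < N ==> a q \<in> cpt B q (m - 1)"
  using dbX_V[OF _ dbC_even] W_V[OF _ dbC_odd] by auto

lemma dbD_C: "a \<in> dbC B p m ==> dbD B m a \<in> dbC B p (m + 1)"
proof (rule dbCI)
  assume a: "a \<in> dbC B p m"
  show "dbD B m a i \<in> dbX B p i (m + 1)" if "even i" "i \<le> N" for i
    using dbX_d[OF that(2) dbC_even[OF a that]] dbD_even[OF that] by simp
  show "dbD B m a q \<in> wt B q (2 * p) (m + 1 - 1)" if q: "odd q" "q < N" for q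
    unfolding dbD_odd[OF q] add_diff_cancel_right'
    using cmp_left_X[OF q dbC_even[OF a odd_nb(1,2)[OF q]]] cmp_right_X[OF q dbC_even[OF a odd_nb(3,4)[OF q]]]
      d_W'[OF odd_nb(5)[OF q] dbC_odd[OF a q]] W_diff[OF odd_nb(5)[OF q]] by blast
qed (auto simp: dbD_out)

lemma dbD_diff: "a \<in> dbC B p m ==> b \<in> dbC B p m ==> dbD B m (a - b) = dbD B m a - dbD B m b"
proof (rule db_ext)
  assume a: "a \<in> dbC B p m" and b: "b \<in> dbC B p m"
  show "dbD B m (a - b) i = (dbD B m a - dbD B m b) i" if i: "even i" "i \<le> N" for i
    using d_diff[OF i(2) dbC_V_even[OF a i] dbC_V_even[OF b i]] by (simp add: dbD_even[OF i])
  show "dbD B m (a - b) q = (dbD B m a - dbD B m b) q" if q: "odd q" "q < N" for q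
    using d_diff[OF odd_nb(5)[OF q] dbC_V_odd[OF a q] dbC_V_odd[OF b q]]
      cmp_diff[OF arrow_left[OF q] dbC_V_even[OF a odd_nb(1,2)[OF q]] dbC_V_even[OF b odd_nb(1,2)[OF q]]]
      cmp_diff[OF arrow_right[OF q] dbC_V_even[OF a odd_nb(3,4)[OF q]] dbC_V_even[OF b odd_nb(3,4)[OF q]]]
    by (simp add: dbD_odd[OF q])
qed (auto simp: dbD_out)

lemma dbD_zero: "dbD B m 0 = 0"
  using dbD_diff[of 0 p m 0] grp_zero[OF grp_dbC, of p m] by simp

lemma dbD_scale: "c \<in> K ==> a \<in> dbC B p m ==> dbD B m (\<lambda>i. c *\<^sub>C a i) = (\<lambda>i. c *\<^sub>C dbD B m a i)"
proof (rule db_ext)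
  assume a: "a \<in> dbC B p m"
  show "dbD B m (\<lambda>i. c *\<^sub>C a i) i = c *\<^sub>C dbD B m a i" if i: "even i" "i \<le> N" for i
    using d_scale[OF i(2) dbC_V_even[OF a i]] by (simp add: dbD_even[OF i])
  show "dbD B m (\<lambda>i. c *\<^sub>C a i) q = c *\<^sub>C dbD B m a q" if q: "odd q" "q < N" for q
    using d_scale[OF odd_nb(5)[OF q] dbC_V_odd[OF a q]]
      cmp_scale[OF arrow_left[OF q] dbC_V_even[OF a odd_nb(1,2)[OF q]]]
      cmp_scale[OF arrow_right[OF q] dbC_V_even[OF a odd_nb(3,4)[OF q]]]
    by (simp add: dbD_odd[OF q] scaleC.scale_right_diff_distrib)
qed (auto simp: dbD_out)

lemma dbD_dbD: "a \<in> dbC B p m ==> dbD B (m + 1) (dbD B m a) = 0"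
proof (rule db_ext)
  assume a: "a \<in> dbC B p m"
  show "dbD B (m + 1) (dbD B m a) i = 0 i" if i: "even i" "i \<le> N" for i
    using d_d[OF i(2) dbC_V_even[OF a i]] by (simp add: dbD_even[OF i])
  show "dbD B (m + 1) (dbD B m a) q = 0 q" if q: "odd q" "q < N" for q
  proof -
    note nb = odd_nb[OF q]
    have V: "a (q - 1) \<in> cpt B (q - 1) m" "a (Suc q) \<in> cpt B (Suc q) m" "a q \<in> cpt B q (m - 1)"
      using dbC_V_even[OF a] dbC_V_odd[OF a q] nb by auto
    note V2 = cmp_left_V[OF q V(1)] cmp_right_V[OF q V(2)] d_V'[OF nb(5) V(3)]
    have "dif B q m (cmp B (q - 1) q m (a (q - 1)) - cmp B (Suc q) q m (a (Suc q)) - dif B q (m - 1) (a q))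
      = dif B q m (cmp B (q - 1) q m (a (q - 1))) - dif B q m (cmp B (Suc q) q m (a (Suc q)))"
      using d_diff[OF nb(5) V_diff[OF nb(5) V2(1,2)] V2(3)] d_diff[OF nb(5) V2(1,2)] d_d'[OF nb(5) V(3)] by simp
    then show ?thesis
      using cmp_d[OF arrow_left[OF q] V(1)] cmp_d[OF arrow_right[OF q] V(2)]
      by (simp add: dbD_odd[OF q] dbD_even[OF nb(1,2)] dbD_even[OF nb(3,4)])
  qed
qed (auto simp: dbD_out)

lemma dZ_C: "a \<in> dZ B p m ==> a \<in> dbC B p m" by (simp add: dZ_def)

lemma grp_dZ: "add_subgroup (dZ B p m)"
  by (rule add_subgroupI) (auto simp: dZ_def grp_zero[OF grp_dbC] dbD_zero grp_diff[OF grp_dbC] dbD_diff)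

lemma grp_dB: "add_subgroup (dB B p m)"
proof (rule add_subgroupI)
  show "0 \<in> dB B p m" unfolding dB_def using grp_zero[OF grp_dbC] dbD_zero by (intro image_eqI[of _ _ 0]) auto
  fix x y assume "x \<in> dB B p m" "y \<in> dB B p m"
  then obtain a b where "a \<in> dbC B p (m - 1)" "b \<in> dbC B p (m - 1)" "x = dbD B (m - 1) a" "y = dbD B (m - 1) b"
    unfolding dB_def by blast
  then show "x - y \<in> dB B p m" unfolding dB_def
    using grp_diff[OF grp_dbC, of a p "m - 1" b] dbD_diff[of a p "m - 1" b] by (intro image_eqI[of _ _ "a - b"]) auto
qed

lemma dB_dZ: "dB B p m \<subseteq> dZ B p m"
  using dbD_C[of _ p "m - 1"] dbD_dbD[of _ p "m - 1"] by (auto simp: dB_def dZ_def)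

lemma dZ_scale: "c \<in> K ==> a \<in> dZ B p m ==> (\<lambda>i. c *\<^sub>C a i) \<in> dZ B p m"
  using dbC_scale dbD_scale by (auto simp: dZ_def fun_eq_iff)

lemma dB_scale: "c \<in> K ==> a \<in> dB B p m ==> (\<lambda>i. c *\<^sub>C a i) \<in> dB B p m"
proof -
  assume c: "c \<in> K" and "a \<in> dB B p m"
  then obtain b where b: "b \<in> dbC B p (m - 1)" "a = dbD B (m - 1) b" unfolding dB_def by blast
  show ?thesis unfolding dB_def b(2)
    by (rule image_eqI[OF _ dbC_scale[OF c b(1)]]) (simp add: dbD_scale[OF c b(1)])
qed

lemma dZ_even: "a \<in> dZ B p m ==> even i ==> i \<le> N ==> dif B i m (a i) = 0"
  using dbD_even[of i m a] by (simp add: dZ_def)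

lemma dZ_odd: "a \<in> dZ B p m ==> odd q ==> q < N ==>
    cmp B (q - 1) q m (a (q - 1)) - cmp B (Suc q) q m (a (Suc q)) = dif B q (m - 1) (a q)"
  using dbD_odd[of q m a] by (simp add: dZ_def)

lemma dZI:
  assumes "a \<in> dbC B p m" "\<And>i. even i ==> i \<le> N ==> dif B i m (a i) = 0"
    "\<And>q. odd q ==> q < N ==> cmp B (q - 1) q m (a (q - 1)) - cmp B (Suc q) q m (a (Suc q)) = dif B q (m - 1) (a q)"
  shows "a \<in> dZ B p m"
proof -
  have "dbD B m a = 0" by (rule db_ext) (auto simp: dbD_even dbD_odd dbD_out assms(2,3))
  then show ?thesis using assms(1) by (simp add: dZ_def)
qed

lemma dZ_cocyc:
  assumes "a \<in> dZ B p m" "even i" "i \<le> N" shows "a i \<in> cocyc B i m"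
  by (rule ZI[OF dbC_V_even[OF dZ_C[OF assms(1)] assms(2,3)] dZ_even[OF assms]])

lemma mk_C:
  assumes "\<And>i. even i ==> i \<le> N ==> u i \<in> dbX B p i m" "\<And>q. odd q ==> q < N ==> t q \<in> wt B q (2 * p) (m - 1)"
  shows "mk_cochain B u t \<in> dbC B p m"
  by (rule dbCI) (use assms in auto)

text \<open>Filling the odd places with the images of their left neighbours makes the left links
  exact equalities; the right links are then, up to sign, the assumption on the tops.\<close>

lemma corresponds_if_tops:
  assumes u: "\<And>i. even i ==> i \<le> N ==> u i \<in> cocyc B i m"
    and t: "\<And>q. odd q ==> q < N ==> cmp B (q - 1) q m (u (q - 1)) - cmp B (Suc q) q m (u (Suc q)) \<in> cobd B q m"
  shows "ZB m (u 0) (u N)"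
proof -
  let ?z = "\<lambda>i. if even i then u i else cmp B (i - 1) i m (u (i - 1))"
  have "?z i \<in> cocyc B i m" if "i \<le> N" for i
  proof (cases "even i")
    case False
    then have q: "odd i" "i < N" using that odd_lt by auto
    then show ?thesis
      using quotient_isoD(1)[OF zig_familyD(5)[OF zig_total arrow_left[OF q]] u[OF odd_nb(1,2)[OF q]]] by simp
  qed (use u that in auto)
  moreover have "zlink B m (\<lambda>i. cobd B i m) i (?z i) (?z (Suc i))" if i: "i < N" for i
  proof (cases "even i")
    case True
    then show ?thesis using grp_zero[OF grp_B, of "Suc i"] i by (simp add: zlink_def)
  next
    case False
    then have "cmp B (i - 1) i m (u (i - 1)) - cmp B (Suc i) i m (u (Suc i)) \<in> cobd B i m" using t i by blast
    then have "- (cmp B (i - 1) i m (u (i - 1)) - cmp B (Suc i) i m (u (Suc i))) \<in> cobd B i m"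
      by (rule grp_minus[OF grp_B[OF less_imp_le[OF i]]])
    then show ?thesis using False by (simp add: zlink_def)
  qed
  ultimately have "zchain B m (\<lambda>i. cocyc B i m) (\<lambda>i. cobd B i m) ?z" unfolding zchain_def by blast
  then show ?thesis unfolding corresponds_iff_zchain using even_len by (intro exI[of _ ?z]) auto
qed

text \<open>The top equations are solved from left to right. At an odd place the left neighbour is
  already known, and the right comparison morphism is an isomorphism on the cohomology of weight
  \<open>k\<close>, so a right neighbour exists up to a boundary whose primitive becomes the top
  component. Nonzero right-hand sides occur in \<open>kernel_rep\<close>.\<close>

lemma zigzag_solve:
  assumes x: "x \<in> wt B 0 k m" "x \<in> cocyc B 0 m"
    and t: "\<And>q. odd q ==> q < N ==> t q \<in> wt B q k m \<and> t q \<in> cocyc B q m"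
  shows "\<exists>c. c 0 = x \<and> (\<forall>i. even i \<and> i \<le> N \<longrightarrow> c i \<in> wt B i k m \<and> c i \<in> cocyc B i m) \<and>
    (\<forall>q. odd q \<and> q < N \<longrightarrow> c q \<in> wt B q k (m - 1) \<and>
      cmp B (q - 1) q m (c (q - 1)) - cmp B (Suc q) q m (c (Suc q)) - dif B q (m - 1) (c q) = t q)"
proof -
  have "2 * j \<le> N ==> \<exists>c. c 0 = x \<and> (\<forall>i. even i \<and> i \<le> 2 * j \<longrightarrow> c i \<in> wt B i k m \<and> c i \<in> cocyc B i m) \<and>
    (\<forall>q. odd q \<and> q < 2 * j \<longrightarrow> c q \<in> wt B q k (m - 1) \<and>
      cmp B (q - 1) q m (c (q - 1)) - cmp B (Suc q) q m (c (Suc q)) - dif B q (m - 1) (c q) = t q)" for j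
  proof (induction j)
    case 0
    then show ?case using x by (intro exI[of _ "\<lambda>_. x"]) auto
  next
    case (Suc j)
    then obtain c where c: "c 0 = x" "\<And>i. even i ==> i \<le> 2 * j ==> c i \<in> wt B i k m \<and> c i \<in> cocyc B i m"
      "\<And>q. odd q ==> q < 2 * j ==> c q \<in> wt B q k (m - 1) \<and>
        cmp B (q - 1) q m (c (q - 1)) - cmp B (Suc q) q m (c (Suc q)) - dif B q (m - 1) (c q) = t q"
      by auto
    define q where "q = Suc (2 * j)"
    have q: "odd q" "q < N" "q - 1 = 2 * j" using Suc.prems by (auto simp: q_def)
    note nb = odd_nb[OF q(1,2)]
    let ?y = "cmp B (2 * j) q m (c (2 * j)) - t q"
    have "cmp B (2 * j) q m (c (2 * j)) \<in> wt B q k m \<inter> cocyc B q m"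
      using quotient_isoD(1)[OF zig_familyD(5)[OF zig_W arrow_left[OF q(1,2)]], of "c (2 * j)" k m] c(2)[of "2 * j"] q(3) by simp
    then have "?y \<in> wt B q k m \<inter> cocyc B q m" using t[OF q(1,2)] W_diff[OF nb(5)] grp_diff[OF grp_Z[OF nb(5)]] by blast
    then obtain x' where x': "x' \<in> wt B (Suc q) k m \<inter> cocyc B (Suc q) m"
      "cmp B (Suc q) q m x' - ?y \<in> dif B q (m - 1) ` wt B q k (m - 1)"
      using quotient_isoD(4)[OF zig_familyD(5)[OF zig_W arrow_right[OF q(1,2)]]] by blast
    then obtain w where w: "w \<in> wt B q k (m - 1)" "cmp B (Suc q) q m x' - ?y = dif B q (m - 1) w" by blast
    \<comment> \<open>Differentials of top components enter the equation with a minus sign, hence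
      \<open>- w\<close>.\<close>
    let ?c = "c(Suc q := x', q := - w)"
    have sc: "?c q = - w" "?c (Suc q) = x'" "\<And>i. i \<le> 2 * j ==> ?c i = c i" by (auto simp: q_def)
    have dw: "dif B q (m - 1) (- w) = - dif B q (m - 1) w" using d_minus[OF nb(5) W_V[OF nb(5) w(1)]] .
    have top: "cmp B (q - 1) q m (?c (q - 1)) - cmp B (Suc q) q m (?c (Suc q)) - dif B q (m - 1) (?c q) = t q"
      unfolding q(3) sc(1,2) sc(3)[OF order_refl] dw w(2)[symmetric] by simp
    have "?c 0 = x" using c(1) by (auto simp: q_def)
    moreover have "?c i \<in> wt B i k m \<and> ?c i \<in> cocyc B i m" if "even i" "i \<le> 2 * Suc j" for i
    proof (cases "i = Suc q")
      case True
      then show ?thesis using x'(1) sc(2) by simp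
    next
      case False
      then have "i \<le> 2 * j" using that by (auto simp: q_def elim!: evenE)
      then show ?thesis using c(2) that sc(3) by simp
    qed
    moreover have "?c r \<in> wt B r k (m - 1) \<and>
        cmp B (r - 1) r m (?c (r - 1)) - cmp B (Suc r) r m (?c (Suc r)) - dif B r (m - 1) (?c r) = t r"
      if "odd r" "r < 2 * Suc j" for r
    proof (cases "r = q")
      case True
      then show ?thesis using top w(1) sc(1) W_minus[OF nb(5)] by simp
    next
      case False
      then have r: "r < 2 * j" using that by (auto simp: q_def elim!: oddE)
      then have "r - 1 \<le> 2 * j" "Suc r \<le> 2 * j" "r \<le> 2 * j" using that by auto
      then show ?thesis using c(3)[OF that(1) r] sc(3) by simp
    qed
    ultimately show ?case by blast
  qed
  moreover obtain j where "N = 2 * j" using even_len by (rule evenE)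
  ultimately show ?thesis by force
qed

text \<open>The right end of a solved zigzag differs from \<open>y\<close> by a boundary, since both
  correspond to \<open>x\<close>. Strictness makes it the boundary of some \<open>w\<close> of
  weight \<open>k\<close>; replacing the end by \<open>y\<close> is compensated in the last top
  component by the image of \<open>w\<close>.\<close>

lemma zigzag_lift:
  assumes x: "x \<in> wt B 0 k m" "x \<in> cocyc B 0 m" and y: "y \<in> wt B N k m" "y \<in> cocyc B N m"
    and xy: "ZB m x y"
  shows "\<exists>c. c 0 = x \<and> c N = y \<and> (\<forall>i. even i \<and> i \<le> N \<longrightarrow> c i \<in> wt B i k m \<and> c i \<in> cocyc B i m) \<and>
    (\<forall>q. odd q \<and> q < N \<longrightarrow> c q \<in> wt B q k (m - 1) \<and>
      cmp B (q - 1) q m (c (q - 1)) - cmp B (Suc q) q m (c (Suc q)) = dif B q (m - 1) (c q))"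
proof -
  have z: "(0::'a) \<in> wt B q k m \<and> (0::'a) \<in> cocyc B q m" if "q < N" for q
    using W_zero[of q] grp_zero[OF grp_Z, of q] that by simp
  obtain c where c: "c 0 = x" "\<And>i. even i ==> i \<le> N ==> c i \<in> wt B i k m \<and> c i \<in> cocyc B i m"
    "\<And>q. odd q ==> q < N ==> c q \<in> wt B q k (m - 1) \<and>
      cmp B (q - 1) q m (c (q - 1)) - cmp B (Suc q) q m (c (Suc q)) - dif B q (m - 1) (c q) = 0"
    using zigzag_solve[OF x, of "\<lambda>_. 0"] z by auto
  have tops: "cmp B (q - 1) q m (c (q - 1)) - cmp B (Suc q) q m (c (Suc q)) = dif B q (m - 1) (c q)"
    if "odd q" "q < N" for q using c(3)[OF that] by simp
  have "ZB m (c 0) (c N)"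
  proof (rule corresponds_if_tops)
    show "c i \<in> cocyc B i m" if "even i" "i \<le> N" for i using c(2)[OF that] by blast
    show "cmp B (q - 1) q m (c (q - 1)) - cmp B (Suc q) q m (c (Suc q)) \<in> cobd B q m" if q: "odd q" "q < N" for q
      using BI[OF W_V[OF less_imp_le[OF q(2)]] tops[OF q]] c(3)[OF q] by blast
  qed
  then have "c N - y \<in> cobd B N m" using corr_unique[OF zig_total _ xy] c(1) by simp
  moreover have cl: "c N \<in> wt B N k m" using c(2)[OF even_len] by simp
  ultimately have "c N - y \<in> dif B N (m - 1) ` wt B N k (m - 1)"
    using W_strict[OF order_refl] W_diff[OF order_refl cl y(1)] by blast
  then obtain w where w: "w \<in> wt B N k (m - 1)" "c N - y = dif B N (m - 1) w" by blast
  define s where "s = N - 1"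
  have s: "odd s" "s < N" "Suc s = N" using len2 even_len by (auto simp: s_def)
  have w1: "cmp B N s (m - 1) w \<in> wt B s k (m - 1)" using cmp_right_W[OF s(1,2)] w(1) s(3) by simp
  have V: "c N \<in> cpt B N m" "y \<in> cpt B N m" "w \<in> cpt B N (m - 1)"
    using W_V[OF order_refl] cl y(1) w(1) by blast+
  have "cmp B N s m (c N) - cmp B N s m y = cmp B N s m (dif B N (m - 1) w)"
    using cmp_diff[OF arrow_right[OF s(1,2)], of "c N" m y] V w(2) s(3) by simp
  also have "\<dots> = dif B s (m - 1) (cmp B N s (m - 1) w)"
    using cmp_d'[OF arrow_right[OF s(1,2)], of w m] V s(3) by simp
  finally have cy: "cmp B N s m y = cmp B N s m (c N) - dif B s (m - 1) (cmp B N s (m - 1) w)"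
    by (simp add: algebra_simps)
  let ?c = "c(N := y, s := c s + cmp B N s (m - 1) w)"
  have sc: "?c s = c s + cmp B N s (m - 1) w" "?c N = y" "\<And>i. i \<noteq> s ==> i \<noteq> N ==> ?c i = c i"
    using s by auto
  have "?c 0 = x" using c(1) s len2 by (auto split: if_splits)
  moreover have "?c i \<in> wt B i k m \<and> ?c i \<in> cocyc B i m" if "even i" "i \<le> N" for i
    using c(2)[OF that] y s(1) that by auto
  moreover have "?c q \<in> wt B q k (m - 1) \<and>
      cmp B (q - 1) q m (?c (q - 1)) - cmp B (Suc q) q m (?c (Suc q)) = dif B q (m - 1) (?c q)" if q: "odd q" "q < N" for q
  proof (cases "q = s")
    case True
    have "0 < s" using s(1) by (rule odd_pos)
    then have "s - 1 \<noteq> s" "s - 1 \<noteq> N" using s(2) by simp_all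
    then have p: "?c (s - 1) = c (s - 1)" using sc(3) by blast
    have cs: "c s \<in> wt B s k (m - 1)" using c(3)[OF s(1,2)] by blast
    have sl: "s \<le> N" using s by simp
    have "dif B s (m - 1) (c s + cmp B N s (m - 1) w) = dif B s (m - 1) (c s) + dif B s (m - 1) (cmp B N s (m - 1) w)"
      by (rule d_add[OF sl W_V[OF sl cs] W_V[OF sl w1]])
    then show ?thesis unfolding True s(3) sc(1,2) p cy
      using tops[OF s(1,2)] s(3) W_add[OF sl cs w1] by (simp add: algebra_simps)
  next
    case False
    have "q - 1 \<noteq> s" "q - 1 \<noteq> N" "Suc q \<noteq> s" "Suc q \<noteq> N" "q \<noteq> N" using q s False by auto
    then show ?thesis using sc(3) False c(3)[OF q] tops[OF q] by simp
  qed
  ultimately show ?thesis using sc(2) by blast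
qed

end

subsection \<open>Maps inducing isomorphisms of Deligne--Beilinson cohomology\<close>

locale db_map = X: even_core K B + Y: even_core K E
  for K and B :: "'a::complex_vector mhd" and E :: "'b::complex_vector mhd" +
  fixes G :: "nat \<Rightarrow> int \<Rightarrow> 'a \<Rightarrow> 'b"
  assumes len_eq: "len E = len B"
    and G_lin: "i \<le> len B ==> linear_between (cpt B i m) (cpt E i m) (G i m)"
    and G_d: "i \<le> len B ==> x \<in> cpt B i m ==> G i (m + 1) (dif B i m x) = dif E i m (G i m x)"
    and G_cmp: "(r, q) \<in> arrows (len B) ==> x \<in> cpt B r m ==> cmp E r q m (G r m x) = G q m (cmp B r q m x)"
    and G_X: "i \<le> len B ==> x \<in> dbX B p i m ==> G i m x \<in> dbX E p i m"
    and G_iso: "i \<le> len B ==> quotient_iso (G i m)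
      (dbX B p i m \<inter> cocyc B i m) (dif B i (m - 1) ` dbX B p i (m - 1))
      (dbX E p i m \<inter> cocyc E i m) (dif E i (m - 1) ` dbX E p i (m - 1))"
begin

definition Gc :: "int \<Rightarrow> (nat \<Rightarrow> 'a) \<Rightarrow> nat \<Rightarrow> 'b" where
  "Gc m a = (\<lambda>i. if i > len B then 0 else G i (if even i then m else m - 1) (a i))"

lemma Gc_even: "even i ==> i \<le> len B ==> Gc m a i = G i m (a i)"
  and Gc_odd: "odd i ==> i < len B ==> Gc m a i = G i (m - 1) (a i)"
  and Gc_out: "i > len B ==> Gc m a i = 0"
  by (auto simp: Gc_def)

lemma G_diff: "i \<le> len B ==> x \<in> cpt B i m ==> y \<in> cpt B i m ==> G i m (x - y) = G i m x - G i m y"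
  using lin_diff[OF G_lin X.csub_V] by blast

lemma G_add: "i \<le> len B ==> x \<in> cpt B i m ==> y \<in> cpt B i m ==> G i m (x + y) = G i m x + G i m y"
  using lin_add[OF G_lin] by blast

lemma G_d': "i \<le> len B ==> x \<in> cpt B i (m - 1) ==> G i m (dif B i (m - 1) x) = dif E i (m - 1) (G i (m - 1) x)"
  using G_d[of i x "m - 1"] by simp

lemma G_W_odd: "odd q ==> q < len B ==> x \<in> wt B q (2 * p) m ==> G q m x \<in> wt E q (2 * p) m"
  using G_X[of q x p m] X.dbX_odd[of q p m] Y.dbX_odd[of q p m] by simp

lemma G_iso_odd: "odd q ==> q < len B ==> quotient_iso (G q m)
      (wt B q (2 * p) m \<inter> cocyc B q m) (dif B q (m - 1) ` wt B q (2 * p) (m - 1))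
      (wt E q (2 * p) m \<inter> cocyc E q m) (dif E q (m - 1) ` wt E q (2 * p) (m - 1))"
  using G_iso[of q m p] X.dbX_odd[of q p] Y.dbX_odd[of q p] by simp

lemma Gc_C: "a \<in> dbC B p m ==> Gc m a \<in> dbC E p m"
  by (rule Y.dbCI) (auto simp: len_eq Gc_even Gc_odd Gc_out G_X G_W_odd X.dbC_even X.dbC_odd)

lemma Gc_D: "a \<in> dbC B p m ==> Gc (m + 1) (dbD B m a) = dbD E m (Gc m a)"
proof (rule Y.db_ext)
  assume a: "a \<in> dbC B p m"
  show "Gc (m + 1) (dbD B m a) i = dbD E m (Gc m a) i" if "even i" "i \<le> len E" for i
    using that len_eq G_d[of i "a i" m] X.dbC_V_even[OF a that(1)]
    by (simp add: Gc_even X.dbD_even Y.dbD_even)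
  show "Gc (m + 1) (dbD B m a) q = dbD E m (Gc m a) q" if "odd q" "q < len E" for q
  proof -
    have q: "odd q" "q < len B" "odd q" "q < len E" using that len_eq by auto
    note nb = X.odd_nb[OF q(1,2)]
    have V: "a (q - 1) \<in> cpt B (q - 1) m" "a (Suc q) \<in> cpt B (Suc q) m" "a q \<in> cpt B q (m - 1)"
      using X.dbC_V_even[OF a] X.dbC_V_odd[OF a q(1,2)] nb by auto
    note V2 = X.cmp_left_V[OF q(1,2) V(1)] X.cmp_right_V[OF q(1,2) V(2)] X.d_V'[OF nb(5) V(3)]
    show ?thesis
      using G_diff[OF nb(5) X.V_diff[OF nb(5) V2(1,2)] V2(3)] G_diff[OF nb(5) V2(1,2)] G_d'[OF nb(5) V(3)]
        G_cmp[OF X.arrow_left[OF q(1,2)] V(1)] G_cmp[OF X.arrow_right[OF q(1,2)] V(2)]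
      by (simp add: Gc_odd[OF q(1,2)] X.dbD_odd[OF q(1,2)] Y.dbD_odd[OF q(3,4)] Gc_even[OF nb(1,2)] Gc_even[OF nb(3,4)])
  qed
qed (auto simp: len_eq Gc_out Y.dbD_out)

lemma Gc_D': "a \<in> dbC B p (m - 1) ==> Gc m (dbD B (m - 1) a) = dbD E (m - 1) (Gc (m - 1) a)"
  using Gc_D[of a p "m - 1"] by simp

lemma Gc_diff: "a \<in> dbC B p m ==> b \<in> dbC B p m ==> Gc m (a - b) = Gc m a - Gc m b"
  by (rule Y.db_ext) (auto simp: len_eq Gc_even Gc_odd Gc_out G_diff X.dbC_V_even X.dbC_V_odd)

lemma Gc_scale: "a \<in> dbC B p m ==> Gc m (\<lambda>i. c *\<^sub>C a i) = (\<lambda>i. c *\<^sub>C Gc m a i)"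
  by (rule Y.db_ext) (auto simp: len_eq Gc_even Gc_odd Gc_out lin_scale[OF G_lin] X.dbC_V_even X.dbC_V_odd)

lemma Gc_zero: "Gc m 0 = 0"
  using Gc_diff[of 0 p m 0] grp_zero[OF X.grp_dbC, of p m] by simp

lemma Gc_Z: "a \<in> dZ B p m ==> Gc m a \<in> dZ E p m"
  using Gc_C Gc_D[of a p m] Gc_zero by (auto simp: dZ_def)

lemma Gc_B: "a \<in> dB B p m ==> Gc m a \<in> dB E p m"
  using Gc_C[of _ p "m - 1"] Gc_D' by (auto simp: dB_def)

text \<open>The injectivity half of the five lemma for the mapping cone, made explicit. The
  primitives of the bottom components cannot be taken at random: they are adjusted by cocycles until
  \<open>G\<close> sends them to the bottoms of \<open>e\<close> up to boundaries
  \<open>d v\<close>. With this adjustment the defect in each top component is mapped to a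
  boundary.\<close>

lemma Gc_inj:
  assumes a: "a \<in> dZ B p m" and ga: "Gc m a \<in> dB E p m"
  shows "a \<in> dB B p m"
proof -
  obtain e where e: "e \<in> dbC E p (m - 1)" "Gc m a = dbD E (m - 1) e" using ga unfolding dB_def by blast
  note aC = X.dZ_C[OF a]
  have "\<exists>w v. w \<in> dbX B p i (m - 1) \<and> dif B i (m - 1) w = a i \<and> v \<in> dbX E p i (m - 1 - 1) \<and>
      G i (m - 1) w - e i = dif E i (m - 1 - 1) v" if i: "even i" "i \<le> len B" for i
  proof -
    have iE: "i \<le> len E" using i len_eq by simp
    have eX: "e i \<in> dbX E p i (m - 1)" using Y.dbC_even[OF e(1) i(1) iE] .
    have Ga: "G i m (a i) = dif E i (m - 1) (e i)"
      using fun_cong[OF e(2), of i] by (simp add: Gc_even[OF i] Y.dbD_even[OF i(1) iE])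
    have "a i \<in> dif B i (m - 1) ` dbX B p i (m - 1)"
      by (rule quotient_isoD(3)[OF G_iso[OF i(2)]])
        (use X.dbC_even[OF aC i] X.dZ_cocyc[OF a i] Ga eX in auto)
    then obtain c where c: "c \<in> dbX B p i (m - 1)" "a i = dif B i (m - 1) c" by blast
    have cV: "c \<in> cpt B i (m - 1)" using X.dbX_V[OF i(2) c(1)] .
    have GcX: "G i (m - 1) c \<in> dbX E p i (m - 1)" using G_X[OF i(2) c(1)] .
    have yX: "e i - G i (m - 1) c \<in> dbX E p i (m - 1)" by (rule Y.dbX_diff[OF iE eX GcX])
    have "dif E i (m - 1) (e i - G i (m - 1) c) = 0"
      using Y.d_diff[OF iE Y.dbX_V[OF iE eX] Y.dbX_V[OF iE GcX]] G_d'[OF i(2) cV] Ga c(2) by simp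
    then have "e i - G i (m - 1) c \<in> cocyc E i (m - 1)" using Y.ZI[OF Y.dbX_V[OF iE yX]] by blast
    then obtain u where u: "u \<in> dbX B p i (m - 1) \<inter> cocyc B i (m - 1)"
      "G i (m - 1) u - (e i - G i (m - 1) c) \<in> dif E i (m - 1 - 1) ` dbX E p i (m - 1 - 1)"
      using quotient_isoD(4)[OF G_iso[OF i(2)]] yX by blast
    then obtain v where v: "v \<in> dbX E p i (m - 1 - 1)" "G i (m - 1) u - (e i - G i (m - 1) c) = dif E i (m - 1 - 1) v" by blast
    have uV: "u \<in> cpt B i (m - 1)" "dif B i (m - 1) u = 0" using u(1) X.Z_V X.Z_d by auto
    have "G i (m - 1) (c + u) - e i = dif E i (m - 1 - 1) v"
      using G_add[OF i(2) cV uV(1)] v(2) by (simp add: algebra_simps)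
    moreover have "dif B i (m - 1) (c + u) = a i" using X.d_add[OF i(2) cV uV(1)] uV(2) c(2) by simp
    moreover have "c + u \<in> dbX B p i (m - 1)" using X.dbX_add[OF i(2) c(1)] u(1) by blast
    ultimately show ?thesis using v(1) by blast
  qed
  then have "\<forall>i. \<exists>w v. even i \<and> i \<le> len B \<longrightarrow> w \<in> dbX B p i (m - 1) \<and> dif B i (m - 1) w = a i \<and>
      v \<in> dbX E p i (m - 1 - 1) \<and> G i (m - 1) w - e i = dif E i (m - 1 - 1) v" by blast
  then obtain w where "\<forall>i. \<exists>v. even i \<and> i \<le> len B \<longrightarrow> w i \<in> dbX B p i (m - 1) \<and> dif B i (m - 1) (w i) = a i \<and>
      v \<in> dbX E p i (m - 1 - 1) \<and> G i (m - 1) (w i) - e i = dif E i (m - 1 - 1) v" by (rule choice[THEN exE])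
  then obtain v where "\<forall>i. even i \<and> i \<le> len B \<longrightarrow> w i \<in> dbX B p i (m - 1) \<and> dif B i (m - 1) (w i) = a i \<and>
      v i \<in> dbX E p i (m - 1 - 1) \<and> G i (m - 1) (w i) - e i = dif E i (m - 1 - 1) (v i)" by (rule choice[THEN exE])
  then have wX: "w i \<in> dbX B p i (m - 1)" and dw: "dif B i (m - 1) (w i) = a i"
    and vX: "v i \<in> dbX E p i (m - 1 - 1)" and Gw: "G i (m - 1) (w i) = e i + dif E i (m - 1 - 1) (v i)"
    if "even i" "i \<le> len B" for i using that by (auto simp: algebra_simps)
  have "\<exists>s. s \<in> wt B q (2 * p) (m - 1 - 1) \<and>
     cmp B (q - 1) q (m - 1) (w (q - 1)) - cmp B (Suc q) q (m - 1) (w (Suc q)) - dif B q (m - 1 - 1) s = a q"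
    if q: "odd q" "q < len B" for q
  proof -
    note nb = X.odd_nb[OF q] and ql = X.arrow_left[OF q] and qr = X.arrow_right[OF q]
    have qE: "q < len E" "q \<le> len E" using q len_eq by auto
    note l = wX[OF nb(1,2)] and r = wX[OF nb(3,4)]
    have lV: "w (q - 1) \<in> cpt B (q - 1) (m - 1)" and rV: "w (Suc q) \<in> cpt B (Suc q) (m - 1)"
      using X.dbX_V l r nb by auto
    let ?L = "cmp B (q - 1) q (m - 1) (w (q - 1))" and ?R = "cmp B (Suc q) q (m - 1) (w (Suc q))"
    have LW: "?L \<in> wt B q (2 * p) (m - 1)" "?R \<in> wt B q (2 * p) (m - 1)" "a q \<in> wt B q (2 * p) (m - 1)"
      using X.cmp_left_X[OF q l] X.cmp_right_X[OF q r] X.dbC_odd[OF aC q] by auto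
    note LV = LW[THEN X.W_V[OF nb(5)]]
    \<comment> \<open>The defect of the chosen primitives in the top equation: a cocycle with exact
      image, hence exact.\<close>
    let ?t = "a q - (?L - ?R)"
    have tW: "?t \<in> wt B q (2 * p) (m - 1)" using X.W_diff[OF nb(5)] LW by blast
    have "dif B q (m - 1) ?L = cmp B (q - 1) q m (a (q - 1))" "dif B q (m - 1) ?R = cmp B (Suc q) q m (a (Suc q))"
      using X.cmp_d'[OF ql lV] X.cmp_d'[OF qr rV] dw[OF nb(1,2)] dw[OF nb(3,4)] by auto
    then have "dif B q (m - 1) ?t = 0"
      using X.d_diff[OF nb(5) LV(3) X.V_diff[OF nb(5) LV(1,2)]] X.d_diff[OF nb(5) LV(1,2)] X.dZ_odd[OF a q] by simp
    then have tZ: "?t \<in> cocyc B q (m - 1)" by (rule X.ZI[OF X.W_V[OF nb(5) tW]])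
    let ?vl = "cmp E (q - 1) q (m - 1 - 1) (v (q - 1))" and ?vr = "cmp E (Suc q) q (m - 1 - 1) (v (Suc q))"
    have nbE: "even (q - 1)" "q - 1 \<le> len E" "even (Suc q)" "Suc q \<le> len E" using Y.odd_nb[OF q(1) qE(1)] by auto
    have vV: "v (q - 1) \<in> cpt E (q - 1) (m - 1 - 1)" "v (Suc q) \<in> cpt E (Suc q) (m - 1 - 1)"
      using Y.dbX_V[OF nbE(2) vX[OF nb(1,2)]] Y.dbX_V[OF nbE(4) vX[OF nb(3,4)]] by auto
    have vW: "?vl \<in> wt E q (2 * p) (m - 1 - 1)" "?vr \<in> wt E q (2 * p) (m - 1 - 1)" "e q \<in> wt E q (2 * p) (m - 1 - 1)"
      using Y.cmp_left_X[OF q(1) qE(1) vX[OF nb(1,2)]] Y.cmp_right_X[OF q(1) qE(1) vX[OF nb(3,4)]]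
        Y.dbC_odd[OF e(1) q(1) qE(1)] by auto
    note vV2 = vW[THEN Y.W_V[OF qE(2)]]
    have eV: "e (q - 1) \<in> cpt E (q - 1) (m - 1)" "e (Suc q) \<in> cpt E (Suc q) (m - 1)"
      using Y.dbC_V_even[OF e(1)] nbE by auto
    have GL: "G q (m - 1) ?L = cmp E (q - 1) q (m - 1) (e (q - 1)) + dif E q (m - 1 - 1) ?vl"
      using G_cmp[OF ql lV] Gw[OF nb(1,2)] Y.cmp_add[OF Y.arrow_left[OF q(1) qE(1)] eV(1) Y.d_V'[OF nbE(2) vV(1)]]
        Y.cmp_d'[OF Y.arrow_left[OF q(1) qE(1)] vV(1)] by simp
    have GR: "G q (m - 1) ?R = cmp E (Suc q) q (m - 1) (e (Suc q)) + dif E q (m - 1 - 1) ?vr"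
      using G_cmp[OF qr rV] Gw[OF nb(3,4)] Y.cmp_add[OF Y.arrow_right[OF q(1) qE(1)] eV(2) Y.d_V'[OF nbE(4) vV(2)]]
        Y.cmp_d'[OF Y.arrow_right[OF q(1) qE(1)] vV(2)] by simp
    have Gaq: "G q (m - 1) (a q) = cmp E (q - 1) q (m - 1) (e (q - 1)) - cmp E (Suc q) q (m - 1) (e (Suc q)) - dif E q (m - 1 - 1) (e q)"
      using fun_cong[OF e(2), of q] by (simp only: Gc_odd[OF q] Y.dbD_odd[OF q(1) qE(1)])
    have "G q (m - 1) ?t = G q (m - 1) (a q) - (G q (m - 1) ?L - G q (m - 1) ?R)"
      using G_diff[OF nb(5) LV(3) X.V_diff[OF nb(5) LV(1,2)]] G_diff[OF nb(5) LV(1,2)] by simp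
    also have "\<dots> = dif E q (m - 1 - 1) (?vr - ?vl - e q)"
      unfolding Gaq GL GR using Y.d_diff[OF qE(2) Y.V_diff[OF qE(2) vV2(2,1)] vV2(3)] Y.d_diff[OF qE(2) vV2(2,1)]
      by simp
    finally have "G q (m - 1) ?t \<in> dif E q (m - 1 - 1) ` wt E q (2 * p) (m - 1 - 1)"
      using Y.W_diff[OF qE(2) Y.W_diff[OF qE(2) vW(2,1)] vW(3)] by blast
    then have "?t \<in> dif B q (m - 1 - 1) ` wt B q (2 * p) (m - 1 - 1)"
      using quotient_isoD(3)[OF G_iso_odd[OF q]] tW tZ by blast
    then obtain s where s: "s \<in> wt B q (2 * p) (m - 1 - 1)" "?t = dif B q (m - 1 - 1) s" by blast
    have ds: "dif B q (m - 1 - 1) (- s) = - ?t" using X.d_minus[OF nb(5) X.W_V[OF nb(5) s(1)]] s(2) by simp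
    have "?L - ?R - dif B q (m - 1 - 1) (- s) = a q" unfolding ds by simp
    then show ?thesis using X.W_minus[OF nb(5) s(1)] by blast
  qed
  then have "\<forall>q. \<exists>s. odd q \<and> q < len B \<longrightarrow> s \<in> wt B q (2 * p) (m - 1 - 1) \<and>
     cmp B (q - 1) q (m - 1) (w (q - 1)) - cmp B (Suc q) q (m - 1) (w (Suc q)) - dif B q (m - 1 - 1) s = a q" by blast
  then obtain s where s: "\<forall>q. odd q \<and> q < len B \<longrightarrow> s q \<in> wt B q (2 * p) (m - 1 - 1) \<and>
     cmp B (q - 1) q (m - 1) (w (q - 1)) - cmp B (Suc q) q (m - 1) (w (Suc q)) - dif B q (m - 1 - 1) (s q) = a q"
    by (rule choice[THEN exE])
  let ?c = "mk_cochain B w s"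
  have "?c \<in> dbC B p (m - 1)" by (rule X.mk_C) (use wX s in auto)
  moreover have "a = dbD B (m - 1) ?c"
  proof (rule X.db_ext)
    show "a i = dbD B (m - 1) ?c i" if "even i" "i \<le> len B" for i
      using that dw by (simp add: X.dbD_even)
    show "a q = dbD B (m - 1) ?c q" if q: "odd q" "q < len B" for q
      using X.odd_nb[OF q] s q by (simp add: X.dbD_odd)
    show "a i = dbD B (m - 1) ?c i" if "i > len B" for i
      using that X.dbC_out[OF aC] by (simp add: X.dbD_out)
  qed
  ultimately show ?thesis unfolding dB_def by blast
qed

text \<open>The surjectivity half. Bottom components lift up to boundaries \<open>d v\<close>; the
  mismatch of the lifts at a top place becomes exact under \<open>G\<close> and is therefore exact.
  Its primitive \<open>t\<close> is corrected by a cocycle \<open>s\<close> so that the difference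
  from \<open>e\<close> is the coboundary of the cochain built from \<open>v\<close> and
  \<open>z\<close>.\<close>

lemma Gc_surj:
  assumes e: "e \<in> dZ E p m"
  shows "\<exists>a\<in>dZ B p m. Gc m a - e \<in> dB E p m"
proof -
  note eC = Y.dZ_C[OF e]
  have "\<exists>u v. u \<in> dbX B p i m \<and> dif B i m u = 0 \<and> v \<in> dbX E p i (m - 1) \<and> G i m u - e i = dif E i (m - 1) v"
    if i: "even i" "i \<le> len B" for i
  proof -
    have iE: "i \<le> len E" using i len_eq by simp
    obtain u where u: "u \<in> dbX B p i m \<inter> cocyc B i m" "G i m u - e i \<in> dif E i (m - 1) ` dbX E p i (m - 1)"
      using quotient_isoD(4)[OF G_iso[OF i(2)], of "e i" p m] Y.dbC_even[OF eC i(1) iE] Y.dZ_cocyc[OF e i(1) iE] by blast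
    then show ?thesis using X.Z_d by blast
  qed
  then have "\<forall>i. \<exists>u v. even i \<and> i \<le> len B \<longrightarrow> u \<in> dbX B p i m \<and> dif B i m u = 0 \<and> v \<in> dbX E p i (m - 1) \<and>
      G i m u - e i = dif E i (m - 1) v" by blast
  then obtain u where "\<forall>i. \<exists>v. even i \<and> i \<le> len B \<longrightarrow> u i \<in> dbX B p i m \<and> dif B i m (u i) = 0 \<and> v \<in> dbX E p i (m - 1) \<and>
      G i m (u i) - e i = dif E i (m - 1) v" by (rule choice[THEN exE])
  then obtain v where "\<forall>i. even i \<and> i \<le> len B \<longrightarrow> u i \<in> dbX B p i m \<and> dif B i m (u i) = 0 \<and> v i \<in> dbX E p i (m - 1) \<and>
      G i m (u i) - e i = dif E i (m - 1) (v i)" by (rule choice[THEN exE])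
  then have uX: "u i \<in> dbX B p i m" and du: "dif B i m (u i) = 0" and vX: "v i \<in> dbX E p i (m - 1)"
    and Gu: "G i m (u i) = e i + dif E i (m - 1) (v i)" if "even i" "i \<le> len B" for i
    using that by (auto simp: algebra_simps)
  have "\<exists>t z. t \<in> wt B q (2 * p) (m - 1) \<and> z \<in> wt E q (2 * p) (m - 1 - 1) \<and>
     cmp B (q - 1) q m (u (q - 1)) - cmp B (Suc q) q m (u (Suc q)) = dif B q (m - 1) t \<and>
     cmp E (q - 1) q (m - 1) (v (q - 1)) - cmp E (Suc q) q (m - 1) (v (Suc q)) - dif E q (m - 1 - 1) z = G q (m - 1) t - e q"
    if q: "odd q" "q < len B" for q
  proof -
    note nb = X.odd_nb[OF q] and ql = X.arrow_left[OF q] and qr = X.arrow_right[OF q]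
    have qE: "q < len E" "q \<le> len E" using q len_eq by auto
    note l = uX[OF nb(1,2)] and r = uX[OF nb(3,4)]
    have lV: "u (q - 1) \<in> cpt B (q - 1) m" and rV: "u (Suc q) \<in> cpt B (Suc q) m" using X.dbX_V l r nb by auto
    let ?L = "cmp B (q - 1) q m (u (q - 1))" and ?R = "cmp B (Suc q) q m (u (Suc q))"
    have LW: "?L \<in> wt B q (2 * p) m" "?R \<in> wt B q (2 * p) m" using X.cmp_left_X[OF q l] X.cmp_right_X[OF q r] by auto
    note LV = LW[THEN X.W_V[OF nb(5)]]
    have "dif B q m ?L = 0" "dif B q m ?R = 0"
      using X.cmp_d[OF ql lV] X.cmp_d[OF qr rV] du[OF nb(1,2)] du[OF nb(3,4)] X.cmp_zero[OF ql] X.cmp_zero[OF qr] by auto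
    then have "dif B q m (?L - ?R) = 0" using X.d_diff[OF nb(5) LV] by simp
    then have LRZ: "?L - ?R \<in> wt B q (2 * p) m \<inter> cocyc B q m"
      using X.ZI[OF X.V_diff[OF nb(5) LV]] X.W_diff[OF nb(5) LW] by blast
    let ?vl = "cmp E (q - 1) q (m - 1) (v (q - 1))" and ?vr = "cmp E (Suc q) q (m - 1) (v (Suc q))"
    have nbE: "even (q - 1)" "q - 1 \<le> len E" "even (Suc q)" "Suc q \<le> len E" using Y.odd_nb[OF q(1) qE(1)] by auto
    have vV: "v (q - 1) \<in> cpt E (q - 1) (m - 1)" "v (Suc q) \<in> cpt E (Suc q) (m - 1)"
      using Y.dbX_V[OF nbE(2) vX[OF nb(1,2)]] Y.dbX_V[OF nbE(4) vX[OF nb(3,4)]] by auto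
    have vW: "?vl \<in> wt E q (2 * p) (m - 1)" "?vr \<in> wt E q (2 * p) (m - 1)" "e q \<in> wt E q (2 * p) (m - 1)"
      using Y.cmp_left_X[OF q(1) qE(1) vX[OF nb(1,2)]] Y.cmp_right_X[OF q(1) qE(1) vX[OF nb(3,4)]]
        Y.dbC_odd[OF eC q(1) qE(1)] by auto
    note vV2 = vW[THEN Y.W_V[OF qE(2)]]
    have eV: "e (q - 1) \<in> cpt E (q - 1) m" "e (Suc q) \<in> cpt E (Suc q) m" using Y.dbC_V_even[OF eC] nbE by auto
    have GL: "G q m ?L = cmp E (q - 1) q m (e (q - 1)) + dif E q (m - 1) ?vl"
      using G_cmp[OF ql lV] Gu[OF nb(1,2)] Y.cmp_add[OF Y.arrow_left[OF q(1) qE(1)] eV(1) Y.d_V'[OF nbE(2) vV(1)]]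
        Y.cmp_d'[OF Y.arrow_left[OF q(1) qE(1)] vV(1)] by simp
    have GR: "G q m ?R = cmp E (Suc q) q m (e (Suc q)) + dif E q (m - 1) ?vr"
      using G_cmp[OF qr rV] Gu[OF nb(3,4)] Y.cmp_add[OF Y.arrow_right[OF q(1) qE(1)] eV(2) Y.d_V'[OF nbE(4) vV(2)]]
        Y.cmp_d'[OF Y.arrow_right[OF q(1) qE(1)] vV(2)] by simp
    \<comment> \<open>The value expected for the image of the top component: that of
      \<open>e\<close>, shifted by the change made in the two neighbouring bottoms.\<close>
    let ?x = "e q + (?vl - ?vr)"
    have xW: "?x \<in> wt E q (2 * p) (m - 1)" using Y.W_add[OF qE(2) vW(3) Y.W_diff[OF qE(2) vW(1,2)]] .
    have "G q m (?L - ?R) = (cmp E (q - 1) q m (e (q - 1)) - cmp E (Suc q) q m (e (Suc q))) + (dif E q (m - 1) ?vl - dif E q (m - 1) ?vr)"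
      unfolding G_diff[OF nb(5) LV] GL GR by simp
    also have "\<dots> = dif E q (m - 1) ?x"
      unfolding Y.dZ_odd[OF e q(1) qE(1)] Y.d_add[OF qE(2) vV2(3) Y.V_diff[OF qE(2) vV2(1,2)]] Y.d_diff[OF qE(2) vV2(1,2)] by simp
    finally have Gx: "G q m (?L - ?R) = dif E q (m - 1) ?x" .
    then have "?L - ?R \<in> dif B q (m - 1) ` wt B q (2 * p) (m - 1)"
      using quotient_isoD(3)[OF G_iso_odd[OF q] LRZ] xW by blast
    then obtain t where t: "t \<in> wt B q (2 * p) (m - 1)" "?L - ?R = dif B q (m - 1) t" by blast
    have tV: "t \<in> cpt B q (m - 1)" using X.W_V[OF nb(5) t(1)] .
    let ?y = "G q (m - 1) t - ?x"
    have GtW: "G q (m - 1) t \<in> wt E q (2 * p) (m - 1)" using G_W_odd[OF q t(1)] .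
    have yW: "?y \<in> wt E q (2 * p) (m - 1)" using Y.W_diff[OF qE(2) GtW xW] .
    have "dif E q (m - 1) ?y = 0"
      using Y.d_diff[OF qE(2) Y.W_V[OF qE(2) GtW] Y.W_V[OF qE(2) xW]] G_d'[OF nb(5) tV] Gx t(2) by simp
    then have "?y \<in> cocyc E q (m - 1)" by (rule Y.ZI[OF Y.W_V[OF qE(2) yW]])
    then obtain s where s: "s \<in> wt B q (2 * p) (m - 1) \<inter> cocyc B q (m - 1)"
      "G q (m - 1) s - ?y \<in> dif E q (m - 1 - 1) ` wt E q (2 * p) (m - 1 - 1)"
      using quotient_isoD(4)[OF G_iso_odd[OF q]] yW by blast
    then obtain z where z: "z \<in> wt E q (2 * p) (m - 1 - 1)" "G q (m - 1) s - ?y = dif E q (m - 1 - 1) z" by blast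
    have sV: "s \<in> cpt B q (m - 1)" "dif B q (m - 1) s = 0" using s(1) X.Z_V X.Z_d by auto
    have "dif B q (m - 1) (t - s) = ?L - ?R" using X.d_diff[OF nb(5) tV sV(1)] sV(2) t(2) by simp
    moreover have "t - s \<in> wt B q (2 * p) (m - 1)" using X.W_diff[OF nb(5) t(1)] s(1) by blast
    moreover have "?vl - ?vr - dif E q (m - 1 - 1) z = G q (m - 1) (t - s) - e q"
      unfolding z(2)[symmetric] G_diff[OF nb(5) tV sV(1)] by simp
    ultimately show ?thesis using z(1) by metis
  qed
  then have "\<forall>q. \<exists>t z. odd q \<and> q < len B \<longrightarrow> t \<in> wt B q (2 * p) (m - 1) \<and> z \<in> wt E q (2 * p) (m - 1 - 1) \<and>
     cmp B (q - 1) q m (u (q - 1)) - cmp B (Suc q) q m (u (Suc q)) = dif B q (m - 1) t \<and>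
     cmp E (q - 1) q (m - 1) (v (q - 1)) - cmp E (Suc q) q (m - 1) (v (Suc q)) - dif E q (m - 1 - 1) z = G q (m - 1) t - e q"
    by blast
  then obtain t where "\<forall>q. \<exists>z. odd q \<and> q < len B \<longrightarrow> t q \<in> wt B q (2 * p) (m - 1) \<and> z \<in> wt E q (2 * p) (m - 1 - 1) \<and>
     cmp B (q - 1) q m (u (q - 1)) - cmp B (Suc q) q m (u (Suc q)) = dif B q (m - 1) (t q) \<and>
     cmp E (q - 1) q (m - 1) (v (q - 1)) - cmp E (Suc q) q (m - 1) (v (Suc q)) - dif E q (m - 1 - 1) z = G q (m - 1) (t q) - e q"
    by (rule choice[THEN exE])
  then obtain z where tz: "\<forall>q. odd q \<and> q < len B \<longrightarrow> t q \<in> wt B q (2 * p) (m - 1) \<and> z q \<in> wt E q (2 * p) (m - 1 - 1) \<and>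
     cmp B (q - 1) q m (u (q - 1)) - cmp B (Suc q) q m (u (Suc q)) = dif B q (m - 1) (t q) \<and>
     cmp E (q - 1) q (m - 1) (v (q - 1)) - cmp E (Suc q) q (m - 1) (v (Suc q)) - dif E q (m - 1 - 1) (z q) = G q (m - 1) (t q) - e q"
    by (rule choice[THEN exE])
  let ?a = "mk_cochain B u t" and ?c = "mk_cochain E v z"
  have aC: "?a \<in> dbC B p m" by (rule X.mk_C) (use uX tz in auto)
  have aZ: "?a \<in> dZ B p m"
  proof (rule X.dZI[OF aC])
    show "dif B i m (?a i) = 0" if "even i" "i \<le> len B" for i using that du by simp
    show "cmp B (q - 1) q m (?a (q - 1)) - cmp B (Suc q) q m (?a (Suc q)) = dif B q (m - 1) (?a q)"
      if q: "odd q" "q < len B" for q using X.odd_nb[OF q] tz q by simp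
  qed
  have cC: "?c \<in> dbC E p (m - 1)" by (rule Y.mk_C) (use vX tz len_eq in auto)
  have "Gc m ?a - e = dbD E (m - 1) ?c"
  proof (rule Y.db_ext)
    show "(Gc m ?a - e) i = dbD E (m - 1) ?c i" if "even i" "i \<le> len E" for i
      using that len_eq Gu by (simp add: Gc_even Y.dbD_even)
    show "(Gc m ?a - e) q = dbD E (m - 1) ?c q" if q: "odd q" "q < len E" for q
    proof -
      have q': "q < len B" using q len_eq by simp
      show ?thesis using Y.odd_nb[OF q] tz q q' by (simp add: Y.dbD_odd Gc_odd)
    qed
    show "(Gc m ?a - e) i = dbD E (m - 1) ?c i" if "i > len E" for i
      using that len_eq Y.dbC_out[OF eC] by (simp add: Y.dbD_out Gc_out)
  qed
  then show ?thesis using aZ cC unfolding dB_def by blast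
qed

end

section \<open>Products\<close>

text \<open>
  The parts of arity at most two of a C-infinity mixed Hodge diagram: \<open>h r q\<close> is the quadratic
  component of the morphism from component \<open>r\<close> to component \<open>q\<close>.
\<close>

locale mhc_mult = mhc_core K B for K and B :: "'a::complex_vector mhd" +
  fixes h :: "nat \<Rightarrow> nat \<Rightarrow> int \<Rightarrow> int \<Rightarrow> 'a \<Rightarrow> 'a \<Rightarrow> 'a"
  assumes mul_lin_r: "i \<le> len B ==> x \<in> cpt B i a ==> linear_between (cpt B i b) (cpt B i (a + b)) (mul B i a b x)"
    and mul_lin_l: "i \<le> len B ==> y \<in> cpt B i b ==> linear_between (cpt B i a) (cpt B i (a + b)) (\<lambda>x. mul B i a b x y)"
    and mul_W: "i \<le> len B ==> x \<in> wt B i k a ==> y \<in> wt B i l b ==> mul B i a b x y \<in> wt B i (k + l) (a + b)"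
    and mul_R: "x \<in> rat B a ==> y \<in> rat B b ==> mul B 0 a b x y \<in> rat B (a + b)"
    and mul_F: "x \<in> hdg B p a ==> y \<in> hdg B p' b ==> mul B (len B) a b x y \<in> hdg B (p + p') (a + b)"
    and mul_d: "i \<le> len B ==> x \<in> cpt B i a ==> y \<in> cpt B i b ==> n = a + b ==> dif B i n (mul B i a b x y) =
       mul B i (a + 1) b (dif B i a x) y + sgn_pow a (mul B i a (b + 1) x (dif B i b y))"
    and h_lin_r: "(r, q) \<in> arrows (len B) ==> x \<in> cpt B r a ==> linear_between (cpt B r b) (cpt B q (a + b - 1)) (h r q a b x)"
    and h_lin_l: "(r, q) \<in> arrows (len B) ==> y \<in> cpt B r b ==> linear_between (cpt B r a) (cpt B q (a + b - 1)) (\<lambda>x. h r q a b x y)"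
    and h_W: "(r, q) \<in> arrows (len B) ==> x \<in> wt B r k a ==> y \<in> wt B r l b ==> h r q a b x y \<in> wt B q (k + l) (a + b - 1)"
    and h_rel: "(r, q) \<in> arrows (len B) ==> x \<in> cpt B r a ==> y \<in> cpt B r b ==>
      cmp B r q (a + b) (mul B r a b x y) = mul B q a b (cmp B r q a x) (cmp B r q b y) + dif B q (a + b - 1) (h r q a b x y)
        + h r q (a + 1) b (dif B r a x) y + sgn_pow a (h r q a (b + 1) x (dif B r b y))"

text \<open>The product of Deligne--Beilinson cochains for comparison morphisms that are
  multiplicative only up to the homotopies \<open>h\<close>: the difference of the two homotopies at
  a top place restores the Leibniz rule. The sign exponent \<open>m\<close> has the parity of the
  cohomological degree.\<close>

definition dbM :: "real \<Rightarrow> 'a::complex_vector mhd \<Rightarrow> (nat \<Rightarrow> nat \<Rightarrow> int \<Rightarrow> int \<Rightarrow> 'a \<Rightarrow> 'a \<Rightarrow> 'a) \<Rightarrow>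
    int \<Rightarrow> int \<Rightarrow> (nat \<Rightarrow> 'a) \<Rightarrow> (nat \<Rightarrow> 'a) \<Rightarrow> nat \<Rightarrow> 'a" where
  "dbM \<alpha> B h m m' a b = (\<lambda>i. if i > len B then 0
     else if even i then mul B i m m' (a i) (b i)
     else complex_of_real \<alpha> *\<^sub>C
            (mul B i (m - 1) m' (a i) (cmp B (i - 1) i m' (b (i - 1)))
             + sgn_pow m (mul B i m (m' - 1) (cmp B (Suc i) i m (a (Suc i))) (b i)))
        + complex_of_real (1 - \<alpha>) *\<^sub>C
            (mul B i (m - 1) m' (a i) (cmp B (Suc i) i m' (b (Suc i)))
             + sgn_pow m (mul B i m (m' - 1) (cmp B (i - 1) i m (a (i - 1))) (b i)))
        + (h (i - 1) i m m' (a (i - 1)) (b (i - 1)) - h (Suc i) i m m' (a (Suc i)) (b (Suc i))))"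

text \<open>The formal content of the Leibniz rule at a top place: \<open>A\<close> and
  \<open>B\<close> come from the left neighbours, \<open>A'\<close> and \<open>B'\<close> from the
  right ones, and \<open>t\<close>, \<open>t'\<close> are the tops. The mixed products
  \<open>A'B\<close> and \<open>AB'\<close> are inserted and cancel again, which is why every
  interpolation parameter \<open>c\<close> works.\<close>

lemma leibniz_identity:
  fixes AB A'B' A'B AB' dtB dtB' tdB tdB' dA't' dAt' A'dt' Adt' H :: "'a::complex_vector"
  shows "AB - A'B' + H - (c *\<^sub>C ((dtB - sgn_pow m tdB) + sgn_pow m (dA't' + sgn_pow m A'dt'))
      + (1 - c) *\<^sub>C ((dtB' - sgn_pow m tdB') + sgn_pow m (dAt' + sgn_pow m Adt')))
    = c *\<^sub>C ((AB - A'B - dtB) - sgn_pow m dA't') + (1 - c) *\<^sub>C ((AB' - A'B' - dtB') - sgn_pow m dAt')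
      + sgn_pow m (c *\<^sub>C (tdB + sgn_pow m (A'B - A'B' - A'dt')) + (1 - c) *\<^sub>C (tdB' + sgn_pow m (AB - AB' - Adt'))) + H"
  by (cases "even m")
    (simp_all add: sgn_pow_def scaleC.scale_left_diff_distrib scaleC.scale_right_diff_distrib scaleC.scale_right_distrib algebra_simps)

lemma sgn_pow_Suc: "sgn_pow (m + 1) x = - sgn_pow m x" and sgn_pow_pred: "sgn_pow (m - 1) x = - sgn_pow m x"
  by (auto simp: sgn_pow_def)

lemma sgn_pow_diff: "sgn_pow m (x - y) = sgn_pow m x - sgn_pow m y"
  and sgn_pow_add: "sgn_pow m (x + y) = sgn_pow m x + sgn_pow m y"
  and sgn_pow_zero [simp]: "sgn_pow m 0 = 0"
  and sgn_pow_scale: "sgn_pow m (c *\<^sub>C x) = c *\<^sub>C sgn_pow m x"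
  by (auto simp: sgn_pow_def)

locale db_alg = even_core K B + mhc_mult K B h for K and B :: "'a::complex_vector mhd" and h +
  fixes \<alpha> :: real
begin

abbreviation "P \<equiv> dbM \<alpha> B h"

lemma mul_V: "i \<le> N ==> x \<in> cpt B i a ==> y \<in> cpt B i b ==> n = a + b ==> mul B i a b x y \<in> cpt B i n"
  using lin_mem[OF mul_lin_r] by simp

lemma h_V: "(r, q) \<in> arrows N ==> x \<in> cpt B r a ==> y \<in> cpt B r b ==> n = a + b - 1 ==> h r q a b x y \<in> cpt B q n"
  using lin_mem[OF h_lin_r] by simp

lemma mul_diff_r: "i \<le> N ==> x \<in> cpt B i a ==> y \<in> cpt B i b ==> z \<in> cpt B i b ==>
    mul B i a b x (y - z) = mul B i a b x y - mul B i a b x z"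
  using lin_diff[OF mul_lin_r csub_V] by blast

lemma mul_diff_l: "i \<le> N ==> x \<in> cpt B i a ==> z \<in> cpt B i a ==> y \<in> cpt B i b ==>
    mul B i a b (x - z) y = mul B i a b x y - mul B i a b z y"
  using lin_diff[OF mul_lin_l csub_V] by blast

lemma mul_zero_r: "i \<le> N ==> x \<in> cpt B i a ==> mul B i a b x 0 = 0"
  using lin_zero[OF mul_lin_r csub_V] by blast

lemma mul_zero_l: "i \<le> N ==> y \<in> cpt B i b ==> mul B i a b 0 y = 0"
  using lin_zero[OF mul_lin_l csub_V] by blast

lemma h_diff_r: "(r, q) \<in> arrows N ==> x \<in> cpt B r a ==> y \<in> cpt B r b ==> z \<in> cpt B r b ==>
    h r q a b x (y - z) = h r q a b x y - h r q a b x z"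
  using lin_diff[OF h_lin_r csub_V] arrows_le by blast

lemma h_diff_l: "(r, q) \<in> arrows N ==> x \<in> cpt B r a ==> z \<in> cpt B r a ==> y \<in> cpt B r b ==>
    h r q a b (x - z) y = h r q a b x y - h r q a b z y"
  using lin_diff[OF h_lin_l csub_V] arrows_le by blast

lemma mul_scale: "i \<le> N ==> x \<in> cpt B i a ==> y \<in> cpt B i b ==>
    mul B i a b (c *\<^sub>C x) (c' *\<^sub>C y) = (c * c') *\<^sub>C mul B i a b x y"
  using lin_scale[OF mul_lin_l, of i "c' *\<^sub>C y" b x a c] lin_scale[OF mul_lin_r, of i x a y b c'] V_scale by simp

lemma mul_X:
  assumes i: "i \<le> N" and x: "x \<in> dbX B p i a" and y: "y \<in> dbX B p' i b"
  shows "mul B i a b x y \<in> dbX B (p + p') i (a + b)"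
proof -
  have W: "mul B i a b x y \<in> wt B i (2 * (p + p')) (a + b)"
    using mul_W[OF i dbX_W[OF i x] dbX_W[OF i y]] by (simp add: distrib_left)
  consider "i = 0" | "i = N" | "i \<noteq> 0" "i \<noteq> N" by blast
  then show ?thesis
  proof cases
    case 1
    obtain r where r: "r \<in> wt B 0 (2 * p) a" "r \<in> rat B a" "x = tate p *\<^sub>C r" using x unfolding 1 by (rule dbX_0E)
    obtain s where s: "s \<in> wt B 0 (2 * p') b" "s \<in> rat B b" "y = tate p' *\<^sub>C s" using y unfolding 1 by (rule dbX_0E)
    have "mul B 0 a b x y = tate (p + p') *\<^sub>C mul B 0 a b r s"
      using mul_scale[OF le0 W_V[OF le0 r(1)] W_V[OF le0 s(1)]] r(3) s(3) by (simp add: tate_add)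
    moreover have "mul B 0 a b r s \<in> wt B 0 (2 * (p + p')) (a + b)" using mul_W[OF le0 r(1) s(1)] by (simp add: distrib_left)
    ultimately show ?thesis unfolding 1 dbX_0 using mul_R[OF r(2) s(2)] by blast
  next
    case 2
    then show ?thesis using W mul_F x y unfolding 2 dbX_len by blast
  next
    case 3
    then show ?thesis using W by (simp add: dbX_def)
  qed
qed

lemma P_even: "even i ==> i \<le> N ==> P m m' a b i = mul B i m m' (a i) (b i)"
  and P_odd: "odd i ==> i < N ==> P m m' a b i = complex_of_real \<alpha> *\<^sub>C
            (mul B i (m - 1) m' (a i) (cmp B (i - 1) i m' (b (i - 1)))
             + sgn_pow m (mul B i m (m' - 1) (cmp B (Suc i) i m (a (Suc i))) (b i)))
        + complex_of_real (1 - \<alpha>) *\<^sub>C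
            (mul B i (m - 1) m' (a i) (cmp B (Suc i) i m' (b (Suc i)))
             + sgn_pow m (mul B i m (m' - 1) (cmp B (i - 1) i m (a (i - 1))) (b i)))
        + (h (i - 1) i m m' (a (i - 1)) (b (i - 1)) - h (Suc i) i m m' (a (Suc i)) (b (Suc i)))"
  and P_out: "i > N ==> P m m' a b i = 0"
  by (auto simp: dbM_def)

lemma P_C:
  assumes a: "a \<in> dbC B p m" and b: "b \<in> dbC B p' m'"
  shows "P m m' a b \<in> dbC B (p + p') (m + m')"
proof (rule dbCI)
  show "P m m' a b i \<in> dbX B (p + p') i (m + m')" if i: "even i" "i \<le> N" for i
    unfolding P_even[OF i] by (rule mul_X[OF i(2) dbC_even[OF a i] dbC_even[OF b i]])
  show "P m m' a b q \<in> wt B q (2 * (p + p')) (m + m' - 1)" if q: "odd q" "q < N" for q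
  proof -
    note nb = odd_nb[OF q]
    have k: "2 * (p + p') = 2 * p + 2 * p'" by simp
    have W: "cmp B (q - 1) q m (a (q - 1)) \<in> wt B q (2 * p) m" "cmp B (Suc q) q m (a (Suc q)) \<in> wt B q (2 * p) m"
      "cmp B (q - 1) q m' (b (q - 1)) \<in> wt B q (2 * p') m'" "cmp B (Suc q) q m' (b (Suc q)) \<in> wt B q (2 * p') m'"
      "a q \<in> wt B q (2 * p) (m - 1)" "b q \<in> wt B q (2 * p') (m' - 1)"
      "a (q - 1) \<in> wt B (q - 1) (2 * p) m" "a (Suc q) \<in> wt B (Suc q) (2 * p) m"
      "b (q - 1) \<in> wt B (q - 1) (2 * p') m'" "b (Suc q) \<in> wt B (Suc q) (2 * p') m'"
      using cmp_left_X[OF q dbC_even[OF a nb(1,2)]] cmp_right_X[OF q dbC_even[OF a nb(3,4)]]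
        cmp_left_X[OF q dbC_even[OF b nb(1,2)]] cmp_right_X[OF q dbC_even[OF b nb(3,4)]]
        dbC_odd[OF a q] dbC_odd[OF b q] dbX_W[OF nb(2) dbC_even[OF a nb(1,2)]] dbX_W[OF nb(4) dbC_even[OF a nb(3,4)]]
        dbX_W[OF nb(2) dbC_even[OF b nb(1,2)]] dbX_W[OF nb(4) dbC_even[OF b nb(3,4)]] by blast+
    have d: "m - 1 + m' = m + m' - 1" "m + (m' - 1) = m + m' - 1" by auto
    note M1 = mul_W[OF nb(5), of _ "2 * p" "m - 1" _ "2 * p'" m', unfolded d] and M2 = mul_W[OF nb(5), of _ "2 * p" m _ "2 * p'" "m' - 1", unfolded d]
    show ?thesis
      unfolding P_odd[OF q] k
      by (intro W_add[OF nb(5)] W_diff[OF nb(5)] W_scale[OF nb(5)] grp_sgn[OF grp_W[OF nb(5)]] M1 M2 W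
          h_W[OF arrow_left[OF q]] h_W[OF arrow_right[OF q]])
  qed
qed (simp add: P_out)

lemma P_diff_l:
  assumes a: "a \<in> dbC B p m" and b: "b \<in> dbC B p' m'" and c: "c \<in> dbC B p m"
  shows "P m m' (a - c) b = P m m' a b - P m m' c b"
proof (rule db_ext)
  show "P m m' (a - c) b i = (P m m' a b - P m m' c b) i" if i: "even i" "i \<le> N" for i
    using mul_diff_l[OF i(2) dbC_V_even[OF a i] dbC_V_even[OF c i] dbC_V_even[OF b i]] by (simp add: P_even[OF i])
  show "P m m' (a - c) b q = (P m m' a b - P m m' c b) q" if q: "odd q" "q < N" for q
  proof -
    note nb = odd_nb[OF q] and ql = arrow_left[OF q] and qr = arrow_right[OF q]
    note av = dbC_V_even[OF a nb(1,2)] dbC_V_even[OF a nb(3,4)] dbC_V_odd[OF a q]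
    note cv = dbC_V_even[OF c nb(1,2)] dbC_V_even[OF c nb(3,4)] dbC_V_odd[OF c q]
    note bv = dbC_V_even[OF b nb(1,2)] dbC_V_even[OF b nb(3,4)] dbC_V_odd[OF b q]
    show ?thesis
      by (simp add: P_odd[OF q] cmp_diff[OF ql av(1) cv(1)] cmp_diff[OF qr av(2) cv(2)]
          mul_diff_l[OF nb(5) av(3) cv(3) cmp_V[OF ql bv(1)]] mul_diff_l[OF nb(5) av(3) cv(3) cmp_V[OF qr bv(2)]]
          mul_diff_l[OF nb(5) cmp_V[OF qr av(2)] cmp_V[OF qr cv(2)] bv(3)]
          mul_diff_l[OF nb(5) cmp_V[OF ql av(1)] cmp_V[OF ql cv(1)] bv(3)]
          h_diff_l[OF ql av(1) cv(1) bv(1)] h_diff_l[OF qr av(2) cv(2) bv(2)]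
          sgn_pow_diff scaleC.scale_right_diff_distrib scaleC.scale_right_distrib)
  qed
qed (simp add: P_out)

lemma P_diff_r:
  assumes a: "a \<in> dbC B p m" and b: "b \<in> dbC B p' m'" and c: "c \<in> dbC B p' m'"
  shows "P m m' a (b - c) = P m m' a b - P m m' a c"
proof (rule db_ext)
  show "P m m' a (b - c) i = (P m m' a b - P m m' a c) i" if i: "even i" "i \<le> N" for i
    using mul_diff_r[OF i(2) dbC_V_even[OF a i] dbC_V_even[OF b i] dbC_V_even[OF c i]] by (simp add: P_even[OF i])
  show "P m m' a (b - c) q = (P m m' a b - P m m' a c) q" if q: "odd q" "q < N" for q
  proof -
    note nb = odd_nb[OF q] and ql = arrow_left[OF q] and qr = arrow_right[OF q]
    note av = dbC_V_even[OF a nb(1,2)] dbC_V_even[OF a nb(3,4)] dbC_V_odd[OF a q]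
    note cv = dbC_V_even[OF c nb(1,2)] dbC_V_even[OF c nb(3,4)] dbC_V_odd[OF c q]
    note bv = dbC_V_even[OF b nb(1,2)] dbC_V_even[OF b nb(3,4)] dbC_V_odd[OF b q]
    show ?thesis
      by (simp add: P_odd[OF q] cmp_diff[OF ql bv(1) cv(1)] cmp_diff[OF qr bv(2) cv(2)]
          mul_diff_r[OF nb(5) av(3) cmp_V[OF ql bv(1)] cmp_V[OF ql cv(1)]]
          mul_diff_r[OF nb(5) av(3) cmp_V[OF qr bv(2)] cmp_V[OF qr cv(2)]]
          mul_diff_r[OF nb(5) cmp_V[OF qr av(2)] bv(3) cv(3)]
          mul_diff_r[OF nb(5) cmp_V[OF ql av(1)] bv(3) cv(3)]
          h_diff_r[OF ql av(1) bv(1) cv(1)] h_diff_r[OF qr av(2) bv(2) cv(2)]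
          sgn_pow_diff scaleC.scale_right_diff_distrib scaleC.scale_right_distrib)
  qed
qed (simp add: P_out)

lemma P_zero_l: "b \<in> dbC B p' m' ==> P m m' 0 b = 0"
  using P_diff_l[OF grp_zero[OF grp_dbC] _ grp_zero[OF grp_dbC], of b p' m' m] by simp

lemma P_zero_r: "a \<in> dbC B p m ==> P m m' a 0 = 0"
  using P_diff_r[OF _ grp_zero[OF grp_dbC] grp_zero[OF grp_dbC], of a p m m'] by simp

lemma leibniz:
  assumes a: "a \<in> dbC B p m" and b: "b \<in> dbC B p' m'"
  shows "dbD B (m + m') (P m m' a b) i = P (m + 1) m' (dbD B m a) b i + sgn_pow m (P m (m' + 1) a (dbD B m' b) i)"
proof -
  consider "even i" "i \<le> N" | "odd i" "i < N" | "i > N" using odd_lt by (meson not_le)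
  then show ?thesis
  proof cases
    case 1
    show ?thesis
      using mul_d[OF 1(2) dbC_V_even[OF a 1] dbC_V_even[OF b 1] refl] by (simp add: dbD_even[OF 1] P_even[OF 1])
  next
    case 3
    then show ?thesis by (simp add: dbD_out P_out)
  next
    case 2
    note q = 2
    note nb = odd_nb[OF q] and ql = arrow_left[OF q] and qr = arrow_right[OF q]
    note av = dbC_V_even[OF a nb(1,2)] dbC_V_even[OF a nb(3,4)] dbC_V_odd[OF a q]
    note bv = dbC_V_even[OF b nb(1,2)] dbC_V_even[OF b nb(3,4)] dbC_V_odd[OF b q]
    let ?mul = "mul B i" and ?d = "dif B i"
    let ?A = "cmp B (i - 1) i m (a (i - 1))" and ?A' = "cmp B (Suc i) i m (a (Suc i))"
    let ?B = "cmp B (i - 1) i m' (b (i - 1))" and ?B' = "cmp B (Suc i) i m' (b (Suc i))"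
    note Av = cmp_V[OF ql av(1)] cmp_V[OF qr av(2)] and Bv = cmp_V[OF ql bv(1)] cmp_V[OF qr bv(2)]
    have dA: "cmp B (i - 1) i (m + 1) (dif B (i - 1) m (a (i - 1))) = ?d m ?A"
      "cmp B (Suc i) i (m + 1) (dif B (Suc i) m (a (Suc i))) = ?d m ?A'"
      "cmp B (i - 1) i (m' + 1) (dif B (i - 1) m' (b (i - 1))) = ?d m' ?B"
      "cmp B (Suc i) i (m' + 1) (dif B (Suc i) m' (b (Suc i))) = ?d m' ?B'"
      by (rule cmp_d[OF ql av(1)] cmp_d[OF qr av(2)] cmp_d[OF ql bv(1)] cmp_d[OF qr bv(2)])+
    define h1 h2 where "h1 = h (i - 1) i" and "h2 = h (Suc i) i"
    \<comment> \<open>The terms in which the homotopies are applied to a differential; they occur on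
      both sides and are carried through unchanged.\<close>
    define H where "H = h1 (m + 1) m' (dif B (i - 1) m (a (i - 1))) (b (i - 1)) + sgn_pow m (h1 m (m' + 1) (a (i - 1)) (dif B (i - 1) m' (b (i - 1))))
      - (h2 (m + 1) m' (dif B (Suc i) m (a (Suc i))) (b (Suc i)) + sgn_pow m (h2 m (m' + 1) (a (Suc i)) (dif B (Suc i) m' (b (Suc i)))))"
    let ?h1 = "h1 m m' (a (i - 1)) (b (i - 1))" and ?h2 = "h2 m m' (a (Suc i)) (b (Suc i))"
    let ?c = "complex_of_real \<alpha>"
    define T1 where "T1 = ?mul (m - 1) m' (a i) ?B + sgn_pow m (?mul m (m' - 1) ?A' (b i))"
    define T2 where "T2 = ?mul (m - 1) m' (a i) ?B' + sgn_pow m (?mul m (m' - 1) ?A (b i))"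
    have hv: "?h1 \<in> cpt B i (m + m' - 1)" "?h2 \<in> cpt B i (m + m' - 1)"
      unfolding h1_def h2_def using h_V[OF ql av(1) bv(1) refl] h_V[OF qr av(2) bv(2) refl] by auto
    have mv: "?mul (m - 1) m' (a i) ?B \<in> cpt B i (m + m' - 1)" "?mul m (m' - 1) ?A' (b i) \<in> cpt B i (m + m' - 1)"
      "?mul (m - 1) m' (a i) ?B' \<in> cpt B i (m + m' - 1)" "?mul m (m' - 1) ?A (b i) \<in> cpt B i (m + m' - 1)"
      by (rule mul_V[OF nb(5)]; simp add: av bv Av Bv)+
    have smv: "sgn_pow m (?mul m (m' - 1) ?A' (b i)) \<in> cpt B i (m + m' - 1)" "sgn_pow m (?mul m (m' - 1) ?A (b i)) \<in> cpt B i (m + m' - 1)"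
      using grp_sgn[OF grp_V[OF nb(5)]] mv by auto
    have Tv: "T1 \<in> cpt B i (m + m' - 1)" "T2 \<in> cpt B i (m + m' - 1)"
      unfolding T1_def T2_def using V_add[OF nb(5)] mv smv by auto
    note linD = lin_d[OF nb(5), of "m + m' - 1"]
    have dT1: "?d (m + m' - 1) T1 = (?mul m m' (?d (m - 1) (a i)) ?B - sgn_pow m (?mul (m - 1) (m' + 1) (a i) (?d m' ?B)))
        + sgn_pow m (?mul (m + 1) (m' - 1) (?d m ?A') (b i) + sgn_pow m (?mul m m' ?A' (?d (m' - 1) (b i))))"
      unfolding T1_def d_add[OF nb(5) mv(1) smv(1)] lin_sgn[OF linD mv(2)]
      using mul_d[OF nb(5) av(3) Bv(1), of "m + m' - 1"] mul_d[OF nb(5) Av(2) bv(3), of "m + m' - 1"] by (simp add: sgn_pow_pred)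
    have dT2: "?d (m + m' - 1) T2 = (?mul m m' (?d (m - 1) (a i)) ?B' - sgn_pow m (?mul (m - 1) (m' + 1) (a i) (?d m' ?B')))
        + sgn_pow m (?mul (m + 1) (m' - 1) (?d m ?A) (b i) + sgn_pow m (?mul m m' ?A (?d (m' - 1) (b i))))"
      unfolding T2_def d_add[OF nb(5) mv(3) smv(2)] lin_sgn[OF linD mv(4)]
      using mul_d[OF nb(5) av(3) Bv(2), of "m + m' - 1"] mul_d[OF nb(5) Av(1) bv(3), of "m + m' - 1"] by (simp add: sgn_pow_pred)
    have Pi: "P m m' a b i = ?c *\<^sub>C T1 + complex_of_real (1 - \<alpha>) *\<^sub>C T2 + (?h1 - ?h2)"
      unfolding P_odd[OF q] T1_def T2_def h1_def h2_def ..
    have dP: "?d (m + m' - 1) (P m m' a b i) = ?c *\<^sub>C ?d (m + m' - 1) T1 + (1 - ?c) *\<^sub>C ?d (m + m' - 1) T2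
       + (?d (m + m' - 1) ?h1 - ?d (m + m' - 1) ?h2)"
      unfolding Pi d_add[OF nb(5) V_add[OF nb(5) V_scale[OF nb(5) Tv(1)] V_scale[OF nb(5) Tv(2)]] V_diff[OF nb(5) hv]]
        d_add[OF nb(5) V_scale[OF nb(5) Tv(1)] V_scale[OF nb(5) Tv(2)]] d_scale[OF nb(5) Tv(1)] d_scale[OF nb(5) Tv(2)]
        d_diff[OF nb(5) hv] by simp
    have r1: "cmp B (i - 1) i (m + m') (mul B (i - 1) m m' (a (i - 1)) (b (i - 1))) = ?mul m m' ?A ?B + ?d (m + m' - 1) ?h1
        + h1 (m + 1) m' (dif B (i - 1) m (a (i - 1))) (b (i - 1)) + sgn_pow m (h1 m (m' + 1) (a (i - 1)) (dif B (i - 1) m' (b (i - 1))))"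
      unfolding h1_def by (rule h_rel[OF ql av(1) bv(1)])
    have r2: "cmp B (Suc i) i (m + m') (mul B (Suc i) m m' (a (Suc i)) (b (Suc i))) = ?mul m m' ?A' ?B' + ?d (m + m' - 1) ?h2
        + h2 (m + 1) m' (dif B (Suc i) m (a (Suc i))) (b (Suc i)) + sgn_pow m (h2 m (m' + 1) (a (Suc i)) (dif B (Suc i) m' (b (Suc i))))"
      unfolding h2_def by (rule h_rel[OF qr av(2) bv(2)])
    have "dbD B (m + m') (P m m' a b) i = ?mul m m' ?A ?B - ?mul m m' ?A' ?B' + H - (?c *\<^sub>C ?d (m + m' - 1) T1 + (1 - ?c) *\<^sub>C ?d (m + m' - 1) T2)"
      unfolding dbD_odd[OF q] P_even[OF nb(1,2)] P_even[OF nb(3,4)] r1 r2 dP H_def by (simp add: algebra_simps)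
    also have "\<dots> = ?c *\<^sub>C ((?mul m m' ?A ?B - ?mul m m' ?A' ?B - ?mul m m' (?d (m - 1) (a i)) ?B) - sgn_pow m (?mul (m + 1) (m' - 1) (?d m ?A') (b i)))
      + (1 - ?c) *\<^sub>C ((?mul m m' ?A ?B' - ?mul m m' ?A' ?B' - ?mul m m' (?d (m - 1) (a i)) ?B') - sgn_pow m (?mul (m + 1) (m' - 1) (?d m ?A) (b i)))
      + sgn_pow m (?c *\<^sub>C (?mul (m - 1) (m' + 1) (a i) (?d m' ?B) + sgn_pow m (?mul m m' ?A' ?B - ?mul m m' ?A' ?B' - ?mul m m' ?A' (?d (m' - 1) (b i))))
         + (1 - ?c) *\<^sub>C (?mul (m - 1) (m' + 1) (a i) (?d m' ?B') + sgn_pow m (?mul m m' ?A ?B - ?mul m m' ?A ?B' - ?mul m m' ?A (?d (m' - 1) (b i))))) + H"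
      unfolding dT1 dT2 by (rule leibniz_identity)
    also have "\<dots> = P (m + 1) m' (dbD B m a) b i + sgn_pow m (P m (m' + 1) a (dbD B m' b) i)"
    proof -
      have dv: "?d (m - 1) (a i) \<in> cpt B i m" "?d (m' - 1) (b i) \<in> cpt B i m'"
        using d_V'[OF nb(5)] av(3) bv(3) by auto
      have e1: "?mul m m' (?A - ?A' - ?d (m - 1) (a i)) x = ?mul m m' ?A x - ?mul m m' ?A' x - ?mul m m' (?d (m - 1) (a i)) x"
        if "x \<in> cpt B i m'" for x
        using mul_diff_l[OF nb(5) V_diff[OF nb(5) Av] dv(1) that] mul_diff_l[OF nb(5) Av that] by simp
      have e2: "?mul m m' x (?B - ?B' - ?d (m' - 1) (b i)) = ?mul m m' x ?B - ?mul m m' x ?B' - ?mul m m' x (?d (m' - 1) (b i))"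
        if "x \<in> cpt B i m" for x
        using mul_diff_r[OF nb(5) that V_diff[OF nb(5) Bv] dv(2)] mul_diff_r[OF nb(5) that Bv] by simp
      have PDa: "P (m + 1) m' (dbD B m a) b i = ?c *\<^sub>C ((?mul m m' ?A ?B - ?mul m m' ?A' ?B - ?mul m m' (?d (m - 1) (a i)) ?B) - sgn_pow m (?mul (m + 1) (m' - 1) (?d m ?A') (b i)))
      + (1 - ?c) *\<^sub>C ((?mul m m' ?A ?B' - ?mul m m' ?A' ?B' - ?mul m m' (?d (m - 1) (a i)) ?B') - sgn_pow m (?mul (m + 1) (m' - 1) (?d m ?A) (b i)))
      + (h1 (m + 1) m' (dif B (i - 1) m (a (i - 1))) (b (i - 1)) - h2 (m + 1) m' (dif B (Suc i) m (a (Suc i))) (b (Suc i)))"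
        unfolding P_odd[OF q] dbD_odd[OF q] dbD_even[OF nb(1,2)] dbD_even[OF nb(3,4)] dA h1_def h2_def
        by (simp add: e1[OF Bv(1)] e1[OF Bv(2)] sgn_pow_Suc)
      have PDb: "P m (m' + 1) a (dbD B m' b) i = ?c *\<^sub>C (?mul (m - 1) (m' + 1) (a i) (?d m' ?B) + sgn_pow m (?mul m m' ?A' ?B - ?mul m m' ?A' ?B' - ?mul m m' ?A' (?d (m' - 1) (b i))))
         + (1 - ?c) *\<^sub>C (?mul (m - 1) (m' + 1) (a i) (?d m' ?B') + sgn_pow m (?mul m m' ?A ?B - ?mul m m' ?A ?B' - ?mul m m' ?A (?d (m' - 1) (b i))))
         + (h1 m (m' + 1) (a (i - 1)) (dif B (i - 1) m' (b (i - 1))) - h2 m (m' + 1) (a (Suc i)) (dif B (Suc i) m' (b (Suc i))))"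
        unfolding P_odd[OF q] dbD_odd[OF q] dbD_even[OF nb(1,2)] dbD_even[OF nb(3,4)] dA h1_def h2_def
        by (simp add: e2[OF Av(1)] e2[OF Av(2)])
      show ?thesis unfolding PDa PDb H_def sgn_pow_add sgn_pow_diff by (simp add: algebra_simps)
    qed
    finally show ?thesis .
  qed
qed

lemma P_Z:
  assumes a: "a \<in> dZ B p m" and b: "b \<in> dZ B p' m'"
  shows "P m m' a b \<in> dZ B (p + p') (m + m')"
proof -
  have da: "dbD B m a = 0" "dbD B m' b = 0" using a b by (auto simp: dZ_def)
  have "dbD B (m + m') (P m m' a b) = 0"
    by (rule ext) (simp only: leibniz[OF dZ_C[OF a] dZ_C[OF b]] da P_zero_l[OF dZ_C[OF b]] P_zero_r[OF dZ_C[OF a]], simp)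
  then show ?thesis using P_C[OF dZ_C[OF a] dZ_C[OF b]] by (simp add: dZ_def)
qed

lemma P_B_l:
  assumes a: "a \<in> dB B p m" and b: "b \<in> dZ B p' m'"
  shows "P m m' a b \<in> dB B (p + p') (m + m')"
proof -
  obtain c where c: "c \<in> dbC B p (m - 1)" "a = dbD B (m - 1) c" using a unfolding dB_def by blast
  have db: "dbD B m' b = 0" using b by (simp add: dZ_def)
  have d: "m - 1 + m' = m + m' - 1" by simp
  have "P m m' a b = dbD B (m + m' - 1) (P (m - 1) m' c b)"
  proof
    fix i
    have "dbD B (m - 1 + m') (P (m - 1) m' c b) i = P (m - 1 + 1) m' (dbD B (m - 1) c) b i + sgn_pow (m - 1) (P (m - 1) (m' + 1) c (dbD B m' b) i)"
      by (rule leibniz[OF c(1) dZ_C[OF b]])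
    then show "P m m' a b i = dbD B (m + m' - 1) (P (m - 1) m' c b) i"
      unfolding d db P_zero_r[OF c(1)] c(2) by simp
  qed
  moreover have "P (m - 1) m' c b \<in> dbC B (p + p') (m + m' - 1)" using P_C[OF c(1) dZ_C[OF b]] unfolding d .
  ultimately show ?thesis unfolding dB_def by blast
qed

lemma P_B_r:
  assumes a: "a \<in> dZ B p m" and b: "b \<in> dB B p' m'"
  shows "P m m' a b \<in> dB B (p + p') (m + m')"
proof -
  obtain c where c: "c \<in> dbC B p' (m' - 1)" "b = dbD B (m' - 1) c" using b unfolding dB_def by blast
  have da: "dbD B m a = 0" using a by (simp add: dZ_def)
  have d: "m + (m' - 1) = m + m' - 1" by simp
  have eq: "dbD B (m + m' - 1) (P m (m' - 1) a c) i = sgn_pow m (P m m' a b i)" for i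
  proof -
    have "dbD B (m + (m' - 1)) (P m (m' - 1) a c) i = P (m + 1) (m' - 1) (dbD B m a) c i + sgn_pow m (P m (m' - 1 + 1) a (dbD B (m' - 1) c) i)"
      by (rule leibniz[OF dZ_C[OF a] c(1)])
    then show ?thesis unfolding d da P_zero_l[OF c(1)] c(2) by simp
  qed
  have "P m (m' - 1) a c \<in> dbC B (p + p') (m + m' - 1)" using P_C[OF dZ_C[OF a] c(1)] unfolding d .
  then have "dbD B (m + m' - 1) (P m (m' - 1) a c) \<in> dB B (p + p') (m + m')" unfolding dB_def by blast
  moreover have "P m m' a b = dbD B (m + m' - 1) (P m (m' - 1) a c) \<or> P m m' a b = - dbD B (m + m' - 1) (P m (m' - 1) a c)"
    using eq by (cases "even m") (auto simp: fun_eq_iff sgn_pow_def)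
  ultimately show ?thesis using grp_minus[OF grp_dB] by metis
qed

lemma P_cong:
  assumes a: "a \<in> dZ B p m" "a' \<in> dZ B p m" "a - a' \<in> dB B p m"
    and b: "b \<in> dZ B p' m'" "b' \<in> dZ B p' m'" "b - b' \<in> dB B p' m'"
  shows "P m m' a b - P m m' a' b' \<in> dB B (p + p') (m + m')"
proof -
  have "P m m' a b - P m m' a' b' = P m m' (a - a') b + P m m' a' (b - b')"
    using P_diff_l[OF dZ_C[OF a(1)] dZ_C[OF b(1)] dZ_C[OF a(2)]] P_diff_r[OF dZ_C[OF a(2)] dZ_C[OF b(1)] dZ_C[OF b(2)]] by simp
  then show ?thesis using grp_add[OF grp_dB P_B_l[OF a(3) b(1)] P_B_r[OF a(2) b(3)]] by simp
qed

end

subsection \<open>Multiplicative splittings\<close>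

text \<open>
  \<open>S p m\<close> is the preimage in the cocycles of the image of a multiplicative section of the projection to
  Hodge classes.  Stated this way, without choosing a section, the notion is transported along
  isomorphisms of Deligne--Beilinson cohomology in both directions.
\<close>

definition db_splitting :: "complex set \<Rightarrow> 'a::complex_vector mhd \<Rightarrow>
    (int \<Rightarrow> int \<Rightarrow> (nat \<Rightarrow> 'a) \<Rightarrow> (nat \<Rightarrow> 'a) \<Rightarrow> (nat \<Rightarrow> 'a)) \<Rightarrow> (int \<Rightarrow> int \<Rightarrow> (nat \<Rightarrow> 'a) set) \<Rightarrow> bool" where
  "db_splitting K B P S \<longleftrightarrow>
     (\<forall>p m. add_subgroup (S p m) \<and> S p m \<subseteq> dZ B p m \<and> dB B p m \<subseteq> S p m \<and>
        (\<forall>c\<in>K. \<forall>a\<in>S p m. (\<lambda>i. c *\<^sub>C a i) \<in> S p m) \<and>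
        (\<forall>a\<in>dZ B p m. \<exists>s\<in>S p m. a (len B) - s (len B) \<in> cobd B (len B) m) \<and>
        (\<forall>a\<in>S p m. a (len B) \<in> cobd B (len B) m \<longrightarrow> a \<in> dB B p m)) \<and>
     (\<forall>p m p' m'. \<forall>a\<in>S p m. \<forall>b\<in>S p' m'. P m m' a b \<in> S (p + p') (m + m'))"

lemma db_splittingI:
  assumes "\<And>p m. add_subgroup (S p m)" "\<And>p m. S p m \<subseteq> dZ B p m" "\<And>p m. dB B p m \<subseteq> S p m"
    "\<And>p m c a. c \<in> K ==> a \<in> S p m ==> (\<lambda>i. c *\<^sub>C a i) \<in> S p m"
    "\<And>p m a. a \<in> dZ B p m ==> \<exists>s\<in>S p m. a (len B) - s (len B) \<in> cobd B (len B) m"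
    "\<And>p m a. a \<in> S p m ==> a (len B) \<in> cobd B (len B) m ==> a \<in> dB B p m"
    "\<And>p m p' m' a b. a \<in> S p m ==> b \<in> S p' m' ==> P m m' a b \<in> S (p + p') (m + m')"
  shows "db_splitting K B P S"
  unfolding db_splitting_def using assms by (intro conjI allI ballI impI; simp)

lemma db_splittingD:
  assumes "db_splitting K B P S"
  shows "add_subgroup (S p m)" "S p m \<subseteq> dZ B p m" "dB B p m \<subseteq> S p m"
    "c \<in> K ==> a \<in> S p m ==> (\<lambda>i. c *\<^sub>C a i) \<in> S p m"
    "a \<in> dZ B p m ==> \<exists>s\<in>S p m. a (len B) - s (len B) \<in> cobd B (len B) m"
    "a \<in> S p m ==> a (len B) \<in> cobd B (len B) m ==> a \<in> dB B p m"
    "a \<in> S p m ==> b \<in> S p' m' ==> P m m' a b \<in> S (p + p') (m + m')"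
  using assms unfolding db_splitting_def by simp_all

text \<open>A cochain-level map that is an isomorphism on Deligne--Beilinson cohomology and
  multiplicative up to boundaries. The map \<open>g\<close> on last components is injective on
  cohomology, which is what compares the two projections to Hodge classes.\<close>

locale db_transfer = X: db_alg K B h \<alpha> + Y: db_alg K E h' \<alpha>
  for K and B :: "'a::complex_vector mhd" and h and E :: "'b::complex_vector mhd" and h' \<alpha> +
  fixes T :: "int \<Rightarrow> (nat \<Rightarrow> 'a) \<Rightarrow> (nat \<Rightarrow> 'b)" and g :: "int \<Rightarrow> 'a \<Rightarrow> 'b"
  assumes T_Z: "a \<in> dZ B p m ==> T m a \<in> dZ E p m"
    and T_B: "a \<in> dB B p m ==> T m a \<in> dB E p m"
    and T_diff: "a \<in> dZ B p m ==> b \<in> dZ B p m ==> T m (a - b) = T m a - T m b"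
    and T_scale: "a \<in> dZ B p m ==> T m (\<lambda>i. c *\<^sub>C a i) = (\<lambda>i. c *\<^sub>C T m a i)"
    and T_inj: "a \<in> dZ B p m ==> T m a \<in> dB E p m ==> a \<in> dB B p m"
    and T_surj: "e \<in> dZ E p m ==> \<exists>a\<in>dZ B p m. T m a - e \<in> dB E p m"
    and T_last: "a \<in> dZ B p m ==> T m a (len E) = g m (a (len B))"
    and g_diff: "x \<in> cocyc B (len B) m ==> y \<in> cocyc B (len B) m ==> g m (x - y) = g m x - g m y"
    and g_iff: "x \<in> cocyc B (len B) m ==> g m x \<in> cobd E (len E) m \<longleftrightarrow> x \<in> cobd B (len B) m"
    and T_mult: "a \<in> dZ B p m ==> b \<in> dZ B p' m' ==>
      T (m + m') (X.P m m' a b) - Y.P m m' (T m a) (T m' b) \<in> dB E (p + p') (m + m')"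
begin

lemma last_B: "e \<in> dB E p m ==> e (len E) \<in> cobd E (len E) m"
proof -
  assume "e \<in> dB E p m"
  then obtain c where c: "c \<in> dbC E p (m - 1)" "e = dbD E (m - 1) c" unfolding dB_def by blast
  show ?thesis using Y.BI[OF Y.dbC_V_even[OF c(1) Y.even_len order_refl] refl] Y.dbD_even[OF Y.even_len order_refl] c(2) by simp
qed

lemma last_Z: "a \<in> dZ B p m ==> a (len B) \<in> cocyc B (len B) m"
  using X.dZ_cocyc[OF _ X.even_len order_refl] .

text \<open>The zigzag of quasi-isomorphisms has arrows in both directions, so splittings must move
  against \<open>T\<close> as well as along it. Surjectivity modulo boundaries lifts a chosen
  element of \<open>S\<close>, and injectivity ensures that an element with exact last component is
  a boundary.\<close>

lemma pull:
  assumes S: "db_splitting K E Y.P S"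
  shows "db_splitting K B X.P (\<lambda>p m. {a \<in> dZ B p m. T m a \<in> S p m})"
proof -
  note D = db_splittingD[OF S]
  show ?thesis
  proof (rule db_splittingI)
    show "add_subgroup {a \<in> dZ B p m. T m a \<in> S p m}" for p m
    proof (rule add_subgroupI)
      have z: "(0 :: nat \<Rightarrow> 'a) \<in> dB B p m" by (rule grp_zero[OF X.grp_dB])
      show "0 \<in> {a \<in> dZ B p m. T m a \<in> S p m}" using T_B[OF z] D(3)[of p m] grp_zero[OF X.grp_dZ] by blast
      show "a - b \<in> {a \<in> dZ B p m. T m a \<in> S p m}"
        if "a \<in> {a \<in> dZ B p m. T m a \<in> S p m}" "b \<in> {a \<in> dZ B p m. T m a \<in> S p m}" for a b
        using that T_diff grp_diff[OF X.grp_dZ] grp_diff[OF D(1)] by auto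
    qed
    show "dB B p m \<subseteq> {a \<in> dZ B p m. T m a \<in> S p m}" for p m using X.dB_dZ T_B D(3) by blast
    show "(\<lambda>i. c *\<^sub>C a i) \<in> {a \<in> dZ B p m. T m a \<in> S p m}"
      if "c \<in> K" "a \<in> {a \<in> dZ B p m. T m a \<in> S p m}" for c a p m
      using that X.dZ_scale T_scale D(4) by auto
    show "\<exists>s\<in>{a \<in> dZ B p m. T m a \<in> S p m}. a (len B) - s (len B) \<in> cobd B (len B) m" if a: "a \<in> dZ B p m" for a p m
    proof -
      obtain s where s: "s \<in> S p m" "T m a (len E) - s (len E) \<in> cobd E (len E) m" using D(5)[OF T_Z[OF a]] by blast
      obtain c where c: "c \<in> dZ B p m" "T m c - s \<in> dB E p m" using T_surj[of s p m] D(2) s(1) by blast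
      have "(T m c - s) + s \<in> S p m" using grp_add[OF D(1)] c(2) s(1) D(3) by blast
      then have "T m c \<in> S p m" by simp
      moreover have "a (len B) - c (len B) \<in> cobd B (len B) m"
      proof -
        have "(T m a (len E) - s (len E)) - (T m c - s) (len E) \<in> cobd E (len E) m"
          by (rule grp_diff[OF Y.grp_B[OF order_refl] s(2) last_B[OF c(2)]])
        then have "g m (a (len B) - c (len B)) \<in> cobd E (len E) m"
          by (rule mem_eq) (simp add: T_last[OF a] T_last[OF c(1)] g_diff[OF last_Z[OF a] last_Z[OF c(1)]])
        then show ?thesis
          using g_iff[OF grp_diff[OF X.grp_Z[OF order_refl] last_Z[OF a] last_Z[OF c(1)]]] by blast
      qed
      ultimately show ?thesis using c(1) by blast
    qed
    show "a \<in> dB B p m" if a: "a \<in> {a \<in> dZ B p m. T m a \<in> S p m}" "a (len B) \<in> cobd B (len B) m" for a p m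
    proof -
      have aZ: "a \<in> dZ B p m" "T m a \<in> S p m" using a(1) by auto
      have "T m a (len E) \<in> cobd E (len E) m" using T_last[OF aZ(1)] g_iff[OF last_Z[OF aZ(1)]] a(2) by simp
      then have "T m a \<in> dB E p m" by (rule D(6)[OF aZ(2)])
      then show ?thesis by (rule T_inj[OF aZ(1)])
    qed
    show "X.P m m' a b \<in> {a \<in> dZ B (p + p') (m + m'). T (m + m') a \<in> S (p + p') (m + m')}"
      if "a \<in> {a \<in> dZ B p m. T m a \<in> S p m}" "b \<in> {a \<in> dZ B p' m'. T m' a \<in> S p' m'}" for a b p m p' m'
    proof -
      have ab: "a \<in> dZ B p m" "T m a \<in> S p m" "b \<in> dZ B p' m'" "T m' b \<in> S p' m'" using that by auto
      have "(T (m + m') (X.P m m' a b) - Y.P m m' (T m a) (T m' b)) + Y.P m m' (T m a) (T m' b) \<in> S (p + p') (m + m')"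
        by (rule grp_add[OF D(1) subsetD[OF D(3) T_mult[OF ab(1,3)]] D(7)[OF ab(2,4)]])
      then show ?thesis using X.P_Z[OF ab(1,3)] by simp
    qed
  qed blast
qed

text \<open>The image of \<open>S\<close> has to be enlarged by all boundaries, since
  \<open>T\<close> reaches every class but not every cocycle.\<close>

lemma push:
  assumes S: "db_splitting K B X.P S"
  shows "db_splitting K E Y.P (\<lambda>p m. {e \<in> dZ E p m. \<exists>a\<in>S p m. e - T m a \<in> dB E p m})"
proof -
  note D = db_splittingD[OF S]
  show ?thesis
  proof (rule db_splittingI)
    have SZ: "a \<in> dZ B p m" if "a \<in> S p m" for a p m using D(2) that by blast
    show "add_subgroup {e \<in> dZ E p m. \<exists>a\<in>S p m. e - T m a \<in> dB E p m}" for p m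
    proof (rule add_subgroupI)
      have z: "(0 :: nat \<Rightarrow> 'a) \<in> dB B p m" by (rule grp_zero[OF X.grp_dB])
      have "0 - T m 0 \<in> dB E p m" using grp_diff[OF Y.grp_dB grp_zero[OF Y.grp_dB] T_B[OF z]] .
      then show "0 \<in> {e \<in> dZ E p m. \<exists>a\<in>S p m. e - T m a \<in> dB E p m}"
        using grp_zero[OF D(1)] grp_zero[OF Y.grp_dZ] by blast
      fix e f assume "e \<in> {e \<in> dZ E p m. \<exists>a\<in>S p m. e - T m a \<in> dB E p m}" "f \<in> {e \<in> dZ E p m. \<exists>a\<in>S p m. e - T m a \<in> dB E p m}"
      then obtain a b where ab: "e \<in> dZ E p m" "f \<in> dZ E p m" "a \<in> S p m" "b \<in> S p m" "e - T m a \<in> dB E p m" "f - T m b \<in> dB E p m" by blast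
      have "(e - T m a) - (f - T m b) \<in> dB E p m" by (rule grp_diff[OF Y.grp_dB ab(5,6)])
      then have "(e - f) - T m (a - b) \<in> dB E p m" by (rule mem_eq) (simp add: T_diff[OF SZ[OF ab(3)] SZ[OF ab(4)]])
      then show "e - f \<in> {e \<in> dZ E p m. \<exists>a\<in>S p m. e - T m a \<in> dB E p m}"
        using grp_diff[OF Y.grp_dZ ab(1,2)] grp_diff[OF D(1) ab(3,4)] by blast
    qed
    show "dB E p m \<subseteq> {e \<in> dZ E p m. \<exists>a\<in>S p m. e - T m a \<in> dB E p m}" for p m
    proof
      fix e assume e: "e \<in> dB E p m"
      have "e - T m 0 \<in> dB E p m" by (rule grp_diff[OF Y.grp_dB e T_B[OF grp_zero[OF X.grp_dB]]])
      then show "e \<in> {e \<in> dZ E p m. \<exists>a\<in>S p m. e - T m a \<in> dB E p m}" using e Y.dB_dZ grp_zero[OF D(1)] by blast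
    qed
    show "(\<lambda>i. c *\<^sub>C e i) \<in> {e \<in> dZ E p m. \<exists>a\<in>S p m. e - T m a \<in> dB E p m}"
      if c: "c \<in> K" and e: "e \<in> {e \<in> dZ E p m. \<exists>a\<in>S p m. e - T m a \<in> dB E p m}" for c e p m
    proof -
      obtain a where a: "e \<in> dZ E p m" "a \<in> S p m" "e - T m a \<in> dB E p m" using e by blast
      have "(\<lambda>i. c *\<^sub>C (e - T m a) i) \<in> dB E p m" by (rule Y.dB_scale[OF c a(3)])
      then have "(\<lambda>i. c *\<^sub>C e i) - T m (\<lambda>i. c *\<^sub>C a i) \<in> dB E p m"
        by (rule mem_eq) (simp add: T_scale[OF SZ[OF a(2)]] fun_eq_iff scaleC.scale_right_diff_distrib)
      then show ?thesis using Y.dZ_scale[OF c a(1)] D(4)[OF c a(2)] by blast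
    qed
    show "\<exists>s\<in>{e \<in> dZ E p m. \<exists>a\<in>S p m. e - T m a \<in> dB E p m}. e (len E) - s (len E) \<in> cobd E (len E) m"
      if e: "e \<in> dZ E p m" for e p m
    proof -
      obtain a where a: "a \<in> dZ B p m" "T m a - e \<in> dB E p m" using T_surj[OF e] by blast
      obtain s where s: "s \<in> S p m" "a (len B) - s (len B) \<in> cobd B (len B) m" using D(5)[OF a(1)] by blast
      note sZ = SZ[OF s(1)]
      have "g m (a (len B) - s (len B)) \<in> cobd E (len E) m"
        using g_iff[OF grp_diff[OF X.grp_Z[OF order_refl] last_Z[OF a(1)] last_Z[OF sZ]]] s(2) by blast
      then have "g m (a (len B) - s (len B)) - (T m a - e) (len E) \<in> cobd E (len E) m"
        using grp_diff[OF Y.grp_B[OF order_refl] _ last_B[OF a(2)]] by blast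
      then have "e (len E) - T m s (len E) \<in> cobd E (len E) m"
        by (rule mem_eq) (simp add: T_last[OF a(1)] T_last[OF sZ] g_diff[OF last_Z[OF a(1)] last_Z[OF sZ]])
      moreover have "T m s - T m s \<in> dB E p m" using grp_zero[OF Y.grp_dB] by simp
      ultimately show ?thesis using T_Z[OF sZ] s(1) by blast
    qed
    show "e \<in> dB E p m" if e: "e \<in> {e \<in> dZ E p m. \<exists>a\<in>S p m. e - T m a \<in> dB E p m}" "e (len E) \<in> cobd E (len E) m" for e p m
    proof -
      obtain a where a: "a \<in> S p m" "e - T m a \<in> dB E p m" using e(1) by blast
      have "e (len E) - (e - T m a) (len E) \<in> cobd E (len E) m"
        by (rule grp_diff[OF Y.grp_B[OF order_refl] e(2) last_B[OF a(2)]])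
      then have "g m (a (len B)) \<in> cobd E (len E) m" by (rule mem_eq) (simp add: T_last[OF SZ[OF a(1)]])
      then have "a (len B) \<in> cobd B (len B) m" using g_iff[OF last_Z[OF SZ[OF a(1)]]] by blast
      then have "T m a \<in> dB E p m" using T_B D(6)[OF a(1)] by blast
      then have "(e - T m a) + T m a \<in> dB E p m" using grp_add[OF Y.grp_dB a(2)] by blast
      then show ?thesis by simp
    qed
    show "Y.P m m' e f \<in> {e \<in> dZ E (p + p') (m + m'). \<exists>a\<in>S (p + p') (m + m'). e - T (m + m') a \<in> dB E (p + p') (m + m')}"
      if ef: "e \<in> {e \<in> dZ E p m. \<exists>a\<in>S p m. e - T m a \<in> dB E p m}" "f \<in> {e \<in> dZ E p' m'. \<exists>a\<in>S p' m'. e - T m' a \<in> dB E p' m'}" for e f p m p' m'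
    proof -
      obtain a b where ab: "e \<in> dZ E p m" "f \<in> dZ E p' m'" "a \<in> S p m" "b \<in> S p' m'" "e - T m a \<in> dB E p m" "f - T m' b \<in> dB E p' m'"
        using ef by blast
      note aZ = SZ[OF ab(3)] and bZ = SZ[OF ab(4)]
      have "(Y.P m m' e f - Y.P m m' (T m a) (T m' b)) - (T (m + m') (X.P m m' a b) - Y.P m m' (T m a) (T m' b)) \<in> dB E (p + p') (m + m')"
        by (rule grp_diff[OF Y.grp_dB Y.P_cong[OF ab(1) T_Z[OF aZ] ab(5) ab(2) T_Z[OF bZ] ab(6)] T_mult[OF aZ bZ]])
      then have "Y.P m m' e f - T (m + m') (X.P m m' a b) \<in> dB E (p + p') (m + m')" by (rule mem_eq) simp
      then show ?thesis using Y.P_Z[OF ab(1,2)] D(7)[OF ab(3,4)] by blast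
    qed
  qed blast
qed

end

subsection \<open>Morphisms that are multiplicative up to homotopy\<close>

text \<open>The two brackets without the \<open>X\<close> terms both sum to
  \<open>ab - a'b'\<close>, whatever the weight \<open>c\<close>, and this cancels against the last
  summand. What survives is the top component of a coboundary.\<close>

lemma homotopy_identity:
  fixes X1 X2 X3 X4 ab a'b a'b' ab' L R :: "'a::complex_vector"
  shows "c *\<^sub>C (X1 + (ab - a'b) + sgn_pow m (X2 + sgn_pow m (a'b - a'b')))
     + (1 - c) *\<^sub>C (X3 + (ab' - a'b') + sgn_pow m (X4 + sgn_pow m (ab - ab'))) + ((L - ab) - (R - a'b'))
   = L - R + (c *\<^sub>C (X1 + sgn_pow m X2) + (1 - c) *\<^sub>C (X3 + sgn_pow m X4))"
  by (cases "even m")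
    (simp_all add: sgn_pow_def scaleC.scale_left_diff_distrib scaleC.scale_right_diff_distrib scaleC.scale_right_distrib algebra_simps)

text \<open>\<open>G2_rel\<close> is the arity-two relation of an infinity-morphism, and
  \<open>G2_comm\<close> is the arity-two part of its compatibility with the comparison
  morphisms.\<close>

locale db_alg_map = db_map K B E G + XA: db_alg K B h \<alpha> + YA: db_alg K E h' \<alpha>
  for K and B :: "'a::complex_vector mhd" and E :: "'b::complex_vector mhd" and G h h' \<alpha> +
  fixes G2 :: "nat \<Rightarrow> int \<Rightarrow> int \<Rightarrow> 'a \<Rightarrow> 'a \<Rightarrow> 'b"
  assumes G2_lin_r: "i \<le> len B ==> x \<in> cpt B i a ==> linear_between (cpt B i b) (cpt E i (a + b - 1)) (G2 i a b x)"
    and G2_lin_l: "i \<le> len B ==> y \<in> cpt B i b ==> linear_between (cpt B i a) (cpt E i (a + b - 1)) (\<lambda>x. G2 i a b x y)"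
    and G2_X: "i \<le> len B ==> x \<in> dbX B p i a ==> y \<in> dbX B p' i b ==> G2 i a b x y \<in> dbX E (p + p') i (a + b - 1)"
    and G2_W: "i \<le> len B ==> x \<in> wt B i k a ==> y \<in> wt B i l b ==> n = a + b - 1 ==> G2 i a b x y \<in> wt E i (k + l) n"
    and G2_rel: "i \<le> len B ==> x \<in> cpt B i a ==> y \<in> cpt B i b ==> n = a + b ==>
      G i n (mul B i a b x y) = mul E i a b (G i a x) (G i b y) + dif E i (n - 1) (G2 i a b x y)
        + G2 i (a + 1) b (dif B i a x) y + sgn_pow a (G2 i a (b + 1) x (dif B i b y))"
    and G2_comm: "(r, q) \<in> arrows (len B) ==> x \<in> cpt B r a ==> y \<in> cpt B r b ==>
      cmp E r q (a + b - 1) (G2 r a b x y) + h' r q a b (G r a x) (G r b y) =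
      G q (a + b - 1) (h r q a b x y) + G2 q a b (cmp B r q a x) (cmp B r q b y)"
    and G_last: "x \<in> cocyc B (len B) m ==> G (len B) m x \<in> cobd E (len B) m \<longleftrightarrow> x \<in> cobd B (len B) m"
begin

lemma G2_zero: "i \<le> len B ==> x \<in> cpt B i a ==> G2 i a b x 0 = 0" "i \<le> len B ==> y \<in> cpt B i b ==> G2 i a b 0 y = 0"
  using lin_zero[OF G2_lin_r X.csub_V] lin_zero[OF G2_lin_l X.csub_V] by blast+

lemma G2_diff_r: "i \<le> len B ==> x \<in> cpt B i a ==> y \<in> cpt B i b ==> z \<in> cpt B i b ==> G2 i a b x (y - z) = G2 i a b x y - G2 i a b x z"
  using lin_diff[OF G2_lin_r X.csub_V] by blast

lemma G2_diff_l: "i \<le> len B ==> x \<in> cpt B i a ==> z \<in> cpt B i a ==> y \<in> cpt B i b ==> G2 i a b (x - z) y = G2 i a b x y - G2 i a b z y"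
  using lin_diff[OF G2_lin_l X.csub_V] by blast

lemma G2_V: "i \<le> len B ==> x \<in> cpt B i a ==> y \<in> cpt B i b ==> n = a + b - 1 ==> G2 i a b x y \<in> cpt E i n"
  using lin_mem[OF G2_lin_r] by simp

text \<open>The failure of multiplicativity is the coboundary of an explicit cochain: its bottoms
  are \<open>G2\<close> of the bottoms, and its tops are \<open>- T\<close>, where \<open>T\<close>
  is the product formula for top components with the multiplication replaced by
  \<open>G2\<close>.\<close>

lemma Gc_mult:
  assumes a: "a \<in> dZ B p m" and b: "b \<in> dZ B p' m'"
  shows "Gc (m + m') (XA.P m m' a b) - YA.P m m' (Gc m a) (Gc m' b) \<in> dB E (p + p') (m + m')"
proof -
  note aC = X.dZ_C[OF a] and bC = X.dZ_C[OF b]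
  let ?c = "complex_of_real \<alpha>"
  define T where "T q = ?c *\<^sub>C (G2 q (m - 1) m' (a q) (cmp B (q - 1) q m' (b (q - 1))) + sgn_pow m (G2 q m (m' - 1) (cmp B (Suc q) q m (a (Suc q))) (b q)))
     + (1 - ?c) *\<^sub>C (G2 q (m - 1) m' (a q) (cmp B (Suc q) q m' (b (Suc q))) + sgn_pow m (G2 q m (m' - 1) (cmp B (q - 1) q m (a (q - 1))) (b q)))" for q
  let ?U = "\<lambda>i. G2 i m m' (a i) (b i)"
  let ?G = "mk_cochain E ?U (\<lambda>q. - T q)"
  have le: "i \<le> len E \<longleftrightarrow> i \<le> len B" "i < len E \<longleftrightarrow> i < len B" for i using len_eq by auto
  have k: "2 * (p + p') = 2 * p + 2 * p'" by simp
  have TW: "T q \<in> wt E q (2 * (p + p')) (m + m' - 1 - 1)" if q: "odd q" "q < len B" for q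
  proof -
    note nb = X.odd_nb[OF q]
    have qE: "q \<le> len E" using nb(5) le by simp
    have W: "cmp B (q - 1) q m (a (q - 1)) \<in> wt B q (2 * p) m" "cmp B (Suc q) q m (a (Suc q)) \<in> wt B q (2 * p) m"
      "cmp B (q - 1) q m' (b (q - 1)) \<in> wt B q (2 * p') m'" "cmp B (Suc q) q m' (b (Suc q)) \<in> wt B q (2 * p') m'"
      "a q \<in> wt B q (2 * p) (m - 1)" "b q \<in> wt B q (2 * p') (m' - 1)"
      using X.cmp_left_X[OF q X.dbC_even[OF aC nb(1,2)]] X.cmp_right_X[OF q X.dbC_even[OF aC nb(3,4)]]
        X.cmp_left_X[OF q X.dbC_even[OF bC nb(1,2)]] X.cmp_right_X[OF q X.dbC_even[OF bC nb(3,4)]]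
        X.dbC_odd[OF aC q] X.dbC_odd[OF bC q] by blast+
    have d: "m + m' - 1 - 1 = m - 1 + m' - 1" "m + m' - 1 - 1 = m + (m' - 1) - 1" by auto
    show ?thesis unfolding T_def k
      by (intro Y.W_add[OF qE] Y.W_scale[OF qE] grp_sgn[OF Y.grp_W[OF qE]] G2_W[OF nb(5)] W d)
  qed
  have GC: "?G \<in> dbC E (p + p') (m + m' - 1)"
  proof (rule Y.mk_C)
    show "?U i \<in> dbX E (p + p') i (m + m' - 1)" if "even i" "i \<le> len E" for i
      using that le by (intro G2_X X.dbC_even[OF aC] X.dbC_even[OF bC]) auto
    show "- T q \<in> wt E q (2 * (p + p')) (m + m' - 1 - 1)" if "odd q" "q < len E" for q
      using Y.W_minus[OF less_imp_le[OF that(2)] TW[of q]] that le by simp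
  qed
  have "Gc (m + m') (XA.P m m' a b) - YA.P m m' (Gc m a) (Gc m' b) = dbD E (m + m' - 1) ?G"
  proof (rule Y.db_ext)
    fix i assume "even i" "i \<le> len E"
    then have i: "even i" "i \<le> len B" "i \<le> len E" using le by auto
    show "(Gc (m + m') (XA.P m m' a b) - YA.P m m' (Gc m a) (Gc m' b)) i = dbD E (m + m' - 1) ?G i"
      using G2_rel[OF i(2) X.dbC_V_even[OF aC i(1,2)] X.dbC_V_even[OF bC i(1,2)] refl] X.dZ_even[OF a i(1,2)] X.dZ_even[OF b i(1,2)]
        G2_zero(1)[OF i(2) X.dbC_V_even[OF aC i(1,2)]] G2_zero(2)[OF i(2) X.dbC_V_even[OF bC i(1,2)]]
      by (simp add: Gc_even[OF i(1,2)] XA.P_even[OF i(1,2)] YA.P_even[OF i(1,3)] Y.dbD_even[OF i(1,3)] i)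
  next
    fix q assume "odd q" "q < len E"
    then have q: "odd q" "q < len B" and qE: "q < len E" "q \<le> len E" using le by auto
    note nb = X.odd_nb[OF q] and ql = X.arrow_left[OF q] and qr = X.arrow_right[OF q]
    note nbE = Y.odd_nb[OF q(1) qE(1)]
    note av = X.dbC_V_even[OF aC nb(1,2)] X.dbC_V_even[OF aC nb(3,4)] X.dbC_V_odd[OF aC q]
    note bv = X.dbC_V_even[OF bC nb(1,2)] X.dbC_V_even[OF bC nb(3,4)] X.dbC_V_odd[OF bC q]
    let ?A = "cmp B (q - 1) q m (a (q - 1))" and ?A' = "cmp B (Suc q) q m (a (Suc q))"
    let ?B = "cmp B (q - 1) q m' (b (q - 1))" and ?B' = "cmp B (Suc q) q m' (b (Suc q))"
    note Av = X.cmp_V[OF ql av(1)] X.cmp_V[OF qr av(2)] and Bv = X.cmp_V[OF ql bv(1)] X.cmp_V[OF qr bv(2)]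
    have dA: "dif B q m ?A = 0" "dif B q m ?A' = 0" "dif B q m' ?B = 0" "dif B q m' ?B' = 0"
      using X.cmp_d[OF ql av(1)] X.cmp_d[OF qr av(2)] X.cmp_d[OF ql bv(1)] X.cmp_d[OF qr bv(2)]
        X.dZ_even[OF a nb(1,2)] X.dZ_even[OF a nb(3,4)] X.dZ_even[OF b nb(1,2)] X.dZ_even[OF b nb(3,4)]
        X.cmp_zero[OF ql] X.cmp_zero[OF qr] by auto
    have dt: "dif B q (m - 1) (a q) = ?A - ?A'" "dif B q (m' - 1) (b q) = ?B - ?B'"
      using X.dZ_odd[OF a q] X.dZ_odd[OF b q] by auto
    let ?d = "dif E q (m + m' - 1 - 1)"
    let ?t = "G q (m - 1) (a q)" and ?t' = "G q (m' - 1) (b q)"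
    have g1: "G q (m + m' - 1) (mul B q (m - 1) m' (a q) x) = mul E q (m - 1) m' ?t (G q m' x) + ?d (G2 q (m - 1) m' (a q) x)
        + (G2 q m m' ?A x - G2 q m m' ?A' x)"
      if x: "x \<in> cpt B q m'" "dif B q m' x = 0" for x
      using G2_rel[OF nb(5) av(3) x(1), of "m + m' - 1"] G2_zero(1)[OF nb(5) av(3)] G2_diff_l[OF nb(5) Av x(1)] x(2) dt(1) by simp
    have g2: "G q (m + m' - 1) (mul B q m (m' - 1) x (b q)) = mul E q m (m' - 1) (G q m x) ?t' + ?d (G2 q m (m' - 1) x (b q))
        + sgn_pow m (G2 q m m' x ?B - G2 q m m' x ?B')"
      if x: "x \<in> cpt B q m" "dif B q m x = 0" for x
      using G2_rel[OF nb(5) x(1) bv(3), of "m + m' - 1"] G2_zero(2)[OF nb(5) bv(3)] G2_diff_r[OF nb(5) x(1) Bv] x(2) dt(2) by simp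
    have mv: "mul B q (m - 1) m' (a q) ?B \<in> cpt B q (m + m' - 1)" "mul B q m (m' - 1) ?A' (b q) \<in> cpt B q (m + m' - 1)"
      "mul B q (m - 1) m' (a q) ?B' \<in> cpt B q (m + m' - 1)" "mul B q m (m' - 1) ?A (b q) \<in> cpt B q (m + m' - 1)"
      by (rule XA.mul_V[OF nb(5)]; simp add: av bv Av Bv)+
    have smv: "sgn_pow m (mul B q m (m' - 1) ?A' (b q)) \<in> cpt B q (m + m' - 1)" "sgn_pow m (mul B q m (m' - 1) ?A (b q)) \<in> cpt B q (m + m' - 1)"
      using grp_sgn[OF X.grp_V[OF nb(5)]] mv by auto
    note Sv = X.V_add[OF nb(5) mv(1) smv(1)] X.V_add[OF nb(5) mv(3) smv(2)]
    let ?h1 = "h (q - 1) q m m' (a (q - 1)) (b (q - 1))" and ?h2 = "h (Suc q) q m m' (a (Suc q)) (b (Suc q))"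
    let ?h1' = "h' (q - 1) q m m' (G (q - 1) m (a (q - 1))) (G (q - 1) m' (b (q - 1)))"
    let ?h2' = "h' (Suc q) q m m' (G (Suc q) m (a (Suc q))) (G (Suc q) m' (b (Suc q)))"
    have hv: "?h1 \<in> cpt B q (m + m' - 1)" "?h2 \<in> cpt B q (m + m' - 1)"
      using XA.h_V[OF ql av(1) bv(1) refl] XA.h_V[OF qr av(2) bv(2) refl] by auto
    note linG = G_lin[OF nb(5), of "m + m' - 1"]
    let ?L = "cmp E (q - 1) q (m + m' - 1) (G2 (q - 1) m m' (a (q - 1)) (b (q - 1)))"
    let ?R = "cmp E (Suc q) q (m + m' - 1) (G2 (Suc q) m m' (a (Suc q)) (b (Suc q)))"
    have Gh: "G q (m + m' - 1) ?h1 - ?h1' = ?L - G2 q m m' ?A ?B" "G q (m + m' - 1) ?h2 - ?h2' = ?R - G2 q m m' ?A' ?B'"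
      using G2_comm[OF ql av(1) bv(1)] G2_comm[OF qr av(2) bv(2)] by (simp_all add: algebra_simps)
    define Y1 where "Y1 = mul E q (m - 1) m' ?t (G q m' ?B) + sgn_pow m (mul E q m (m' - 1) (G q m ?A') ?t')"
    define Y2 where "Y2 = mul E q (m - 1) m' ?t (G q m' ?B') + sgn_pow m (mul E q m (m' - 1) (G q m ?A) ?t')"
    let ?X1 = "?d (G2 q (m - 1) m' (a q) ?B)" and ?X2 = "?d (G2 q m (m' - 1) ?A' (b q))"
    let ?X3 = "?d (G2 q (m - 1) m' (a q) ?B')" and ?X4 = "?d (G2 q m (m' - 1) ?A (b q))"
    have GS1: "G q (m + m' - 1) (mul B q (m - 1) m' (a q) ?B + sgn_pow m (mul B q m (m' - 1) ?A' (b q)))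
       = Y1 + (?X1 + (G2 q m m' ?A ?B - G2 q m m' ?A' ?B) + sgn_pow m (?X2 + sgn_pow m (G2 q m m' ?A' ?B - G2 q m m' ?A' ?B')))"
      unfolding G_add[OF nb(5) mv(1) smv(1)] lin_sgn[OF linG mv(2)] g1[OF Bv(1) dA(3)] g2[OF Av(2) dA(2)] Y1_def sgn_pow_add
      by simp
    have GS2: "G q (m + m' - 1) (mul B q (m - 1) m' (a q) ?B' + sgn_pow m (mul B q m (m' - 1) ?A (b q)))
       = Y2 + (?X3 + (G2 q m m' ?A ?B' - G2 q m m' ?A' ?B') + sgn_pow m (?X4 + sgn_pow m (G2 q m m' ?A ?B - G2 q m m' ?A ?B')))"
      unfolding G_add[OF nb(5) mv(3) smv(2)] lin_sgn[OF linG mv(4)] g1[OF Bv(2) dA(4)] g2[OF Av(1) dA(1)] Y2_def sgn_pow_add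
      by simp
    have Pa: "XA.P m m' a b q = ?c *\<^sub>C (mul B q (m - 1) m' (a q) ?B + sgn_pow m (mul B q m (m' - 1) ?A' (b q)))
       + (1 - ?c) *\<^sub>C (mul B q (m - 1) m' (a q) ?B' + sgn_pow m (mul B q m (m' - 1) ?A (b q))) + (?h1 - ?h2)"
      unfolding XA.P_odd[OF q] by simp
    have GP: "G q (m + m' - 1) (XA.P m m' a b q) = ?c *\<^sub>C (Y1 + (?X1 + (G2 q m m' ?A ?B - G2 q m m' ?A' ?B) + sgn_pow m (?X2 + sgn_pow m (G2 q m m' ?A' ?B - G2 q m m' ?A' ?B'))))
       + (1 - ?c) *\<^sub>C (Y2 + (?X3 + (G2 q m m' ?A ?B' - G2 q m m' ?A' ?B') + sgn_pow m (?X4 + sgn_pow m (G2 q m m' ?A ?B - G2 q m m' ?A ?B'))))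
       + (G q (m + m' - 1) ?h1 - G q (m + m' - 1) ?h2)"
      unfolding Pa G_add[OF nb(5) X.V_add[OF nb(5) X.V_scale[OF nb(5) Sv(1)] X.V_scale[OF nb(5) Sv(2)]] X.V_diff[OF nb(5) hv]]
        G_add[OF nb(5) X.V_scale[OF nb(5) Sv(1)] X.V_scale[OF nb(5) Sv(2)]] lin_scale[OF linG Sv(1)] lin_scale[OF linG Sv(2)]
        G_diff[OF nb(5) hv] GS1 GS2 ..
    have PG: "YA.P m m' (Gc m a) (Gc m' b) q = ?c *\<^sub>C Y1 + (1 - ?c) *\<^sub>C Y2 + (?h1' - ?h2')"
      unfolding YA.P_odd[OF q(1) qE(1)] Gc_odd[OF q] Gc_even[OF nb(1,2)] Gc_even[OF nb(3,4)]
        G_cmp[OF ql av(1)] G_cmp[OF qr av(2)] G_cmp[OF ql bv(1)] G_cmp[OF qr bv(2)] Y1_def Y2_def by simp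
    have tv: "G2 q (m - 1) m' (a q) ?B \<in> cpt E q (m + m' - 1 - 1)" "G2 q m (m' - 1) ?A' (b q) \<in> cpt E q (m + m' - 1 - 1)"
      "G2 q (m - 1) m' (a q) ?B' \<in> cpt E q (m + m' - 1 - 1)" "G2 q m (m' - 1) ?A (b q) \<in> cpt E q (m + m' - 1 - 1)"
      by (rule G2_V[OF nb(5)]; simp add: av bv Av Bv)+
    have stv: "sgn_pow m (G2 q m (m' - 1) ?A' (b q)) \<in> cpt E q (m + m' - 1 - 1)" "sgn_pow m (G2 q m (m' - 1) ?A (b q)) \<in> cpt E q (m + m' - 1 - 1)"
      using grp_sgn[OF Y.grp_V[OF qE(2)]] tv by auto
    note tSv = Y.V_add[OF qE(2) tv(1) stv(1)] Y.V_add[OF qE(2) tv(3) stv(2)]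
    note linD = Y.lin_d[OF qE(2), of "m + m' - 1 - 1"]
    have dT: "?d (T q) = ?c *\<^sub>C (?X1 + sgn_pow m ?X2) + (1 - ?c) *\<^sub>C (?X3 + sgn_pow m ?X4)"
      unfolding T_def Y.d_add[OF qE(2) Y.V_scale[OF qE(2) tSv(1)] Y.V_scale[OF qE(2) tSv(2)]] Y.d_scale[OF qE(2) tSv(1)] Y.d_scale[OF qE(2) tSv(2)]
        Y.d_add[OF qE(2) tv(1) stv(1)] Y.d_add[OF qE(2) tv(3) stv(2)] lin_sgn[OF linD tv(2)] lin_sgn[OF linD tv(4)] ..
    have dmT: "?d (- T q) = - ?d (T q)" using Y.d_minus[OF qE(2) Y.W_V[OF qE(2) TW[OF q]]] .
    have "(Gc (m + m') (XA.P m m' a b) - YA.P m m' (Gc m a) (Gc m' b)) q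
      = ?c *\<^sub>C (?X1 + (G2 q m m' ?A ?B - G2 q m m' ?A' ?B) + sgn_pow m (?X2 + sgn_pow m (G2 q m m' ?A' ?B - G2 q m m' ?A' ?B')))
       + (1 - ?c) *\<^sub>C (?X3 + (G2 q m m' ?A ?B' - G2 q m m' ?A' ?B') + sgn_pow m (?X4 + sgn_pow m (G2 q m m' ?A ?B - G2 q m m' ?A ?B')))
       + ((G q (m + m' - 1) ?h1 - ?h1') - (G q (m + m' - 1) ?h2 - ?h2'))"
      unfolding minus_apply Gc_odd[OF q] GP PG by (simp add: scaleC.scale_right_distrib)
    also have "\<dots> = ?L - ?R + ?d (T q)" unfolding Gh dT by (rule homotopy_identity)
    also have "\<dots> = dbD E (m + m' - 1) ?G q"
      unfolding Y.dbD_odd[OF q(1) qE(1)] Y.mk_even[OF nbE(1,2)] Y.mk_even[OF nbE(3,4)] Y.mk_odd[OF q(1) qE(1)] dmT by simp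
    finally show "(Gc (m + m') (XA.P m m' a b) - YA.P m m' (Gc m a) (Gc m' b)) q = dbD E (m + m' - 1) ?G q" .
  qed (simp add: Gc_out YA.P_out Y.dbD_out len_eq)
  then show ?thesis unfolding dB_def using GC by blast
qed

lemma transfer: "db_transfer K B h E h' \<alpha> Gc (G (len B))"
proof (intro db_transfer.intro db_transfer_axioms.intro XA.db_alg_axioms YA.db_alg_axioms)
  show "Gc m a \<in> dZ E p m" if "a \<in> dZ B p m" for a p m by (rule Gc_Z[OF that])
  show "Gc m a \<in> dB E p m" if "a \<in> dB B p m" for a p m by (rule Gc_B[OF that])
  show "Gc m (a - b) = Gc m a - Gc m b" if "a \<in> dZ B p m" "b \<in> dZ B p m" for a b p m
    by (rule Gc_diff[OF X.dZ_C[OF that(1)] X.dZ_C[OF that(2)]])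
  show "Gc m (\<lambda>i. c *\<^sub>C a i) = (\<lambda>i. c *\<^sub>C Gc m a i)" if "a \<in> dZ B p m" for a p m c
    by (rule Gc_scale[OF X.dZ_C[OF that]])
  show "a \<in> dB B p m" if "a \<in> dZ B p m" "Gc m a \<in> dB E p m" for a p m by (rule Gc_inj[OF that])
  show "\<exists>a\<in>dZ B p m. Gc m a - e \<in> dB E p m" if "e \<in> dZ E p m" for e p m by (rule Gc_surj[OF that])
  show "Gc m a (len E) = G (len B) m (a (len B))" for a m
    unfolding len_eq by (rule Gc_even[OF X.even_len order_refl])
  show "G (len B) m (x - y) = G (len B) m x - G (len B) m y" if "x \<in> cocyc B (len B) m" "y \<in> cocyc B (len B) m" for x y m
    using that X.Z_V by (intro G_diff) auto
  show "G (len B) m x \<in> cobd E (len E) m \<longleftrightarrow> x \<in> cobd B (len B) m" if "x \<in> cocyc B (len B) m" for x m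
    unfolding len_eq by (rule G_last[OF that])
  show "Gc (m + m') (XA.P m m' a b) - YA.P m m' (Gc m a) (Gc m' b) \<in> dB E (p + p') (m + m')"
    if "a \<in> dZ B p m" "b \<in> dZ B p' m'" for a b p p' m m' by (rule Gc_mult[OF that])
qed

end

subsection \<open>Insertion of identities\<close>

lemma pad_sel [simp]:
  "len (pad_mhd N A) = N" "cpt (pad_mhd N A) i = cpt A (min i (len A))" "rat (pad_mhd N A) = rat A"
  "wt (pad_mhd N A) i = wt A (min i (len A))" "hdg (pad_mhd N A) = hdg A" "dif (pad_mhd N A) i = dif A (min i (len A))"
  "cmp (pad_mhd N A) r q n x = (if r \<le> len A \<and> q \<le> len A then cmp A r q n x else x)"
  "mul (pad_mhd N A) i = mul A (min i (len A))" "unt (pad_mhd N A) i = unt A (min i (len A))"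
  by (simp_all add: pad_mhd_def pad_mhc_def)

lemma arrows_pad:
  assumes "(r, q) \<in> arrows N"
  shows "r \<le> L \<and> q \<le> L \<and> (r, q) \<in> arrows L \<or> \<not> (r \<le> L \<and> q \<le> L) \<and> min r L = L \<and> min q L = L"
  using assms by (auto simp: arrows_def)

lemma linear_between_id: "linear_between V V (\<lambda>x. x)"
  by (auto simp: linear_between_def)

lemma quotient_iso_id: "add_subgroup B ==> quotient_iso (\<lambda>x. x) Z B Z B"
  using grp_zero by (intro quotient_isoI) force+

lemma (in filtered_cx) filtered_quasi_iso_id: "filtered_quasi_iso V d G V d G (\<lambda>n x. x)"
  unfolding filtered_quasi_iso_def using linear_between_id quotient_iso_id[OF grp_gr_coboundaries] by auto

text \<open>An inserted identity is strictly multiplicative, so the homotopies are continued by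
  zero.\<close>

definition pad_h :: "nat \<Rightarrow> (nat \<Rightarrow> nat \<Rightarrow> int \<Rightarrow> int \<Rightarrow> 'a \<Rightarrow> 'a \<Rightarrow> 'a::zero) \<Rightarrow> nat \<Rightarrow> nat \<Rightarrow> int \<Rightarrow> int \<Rightarrow> 'a \<Rightarrow> 'a \<Rightarrow> 'a" where
  "pad_h L h = (\<lambda>r q a b x y. if r \<le> L \<and> q \<le> L then h r q a b x y else 0)"

lemma mhc_core_pad:
  assumes "mhc_core K A" "len A \<le> N"
  shows "mhc_core K (pad_mhd N A)"
proof -
  interpret A: mhc_core K A by (rule assms(1))
  have ml: "min N (len A) = len A" using assms(2) by simp
  have m: "min i (len A) \<le> len A" for i by simp
  show ?thesis
  proof (rule mhc_core.intro, unfold pad_sel ml)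
    show "real_subfield K" by (rule A.K)
    show "1 \<le> N" using A.len_pos assms(2) by simp
    show "filtered_complex (cpt A (min i (len A))) (\<lambda>a. dif A (min i (len A)) a) (wt A (min i (len A)))" for i
      using A.filt[OF m] .
    show "\<exists>k. wt A (min i (len A)) k n = {0}" for i n by (rule A.reg[OF m])
    show "K_structure K (cpt A (min 0 (len A)) n) (rat A n)" for n using A.K_str by simp
    show "dif A (min 0 (len A)) n ` rat A n \<subseteq> rat A (n + 1)" for n using A.rat_dif by simp
    show "span_over UNIV (wt A (min 0 (len A)) k n \<inter> rat A n) = wt A (min 0 (len A)) k n" for k n using A.wt_span by simp
    show "filtered_complex (cpt A (len A)) (dif A (len A)) (\<lambda>p. hdg A (- p))" by (rule A.hdg_filt)
    show "\<exists>p. hdg A p n = {0}" "\<exists>p. hdg A p n = cpt A (len A) n" for n by (rule A.hdg_low A.hdg_up)+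
    show "filtered_quasi_iso (cpt A (min r (len A))) (dif A (min r (len A))) (wt A (min r (len A)))
        (cpt A (min q (len A))) (dif A (min q (len A))) (wt A (min q (len A)))
        (\<lambda>n x. if r \<le> len A \<and> q \<le> len A then cmp A r q n x else x)"
      if rq: "(r, q) \<in> arrows N" for r q
    proof (cases "r \<le> len A \<and> q \<le> len A")
      case True
      have "(r, q) \<in> arrows (len A)" using arrows_pad[OF rq, of "len A"] True by blast
      then show ?thesis using A.qi True by (simp add: min_absorb1)
    next
      case False
      have "min r (len A) = len A" "min q (len A) = len A" using arrows_pad[OF rq, of "len A"] False by auto
      then show ?thesis using filtered_cx.filtered_quasi_iso_id[OF A.cx[OF order_refl]]
        by (simp only: if_not_P[OF False])
    qed
    show "strict_mod (dif A (len A)) (cpt A (len A)) (wt A (len A)) (\<lambda>n. {0})" by (rule A.W_str)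
    show "strict_mod (dif A (len A)) (wt A (len A) k) (\<lambda>p n. hdg A p n \<inter> wt A (len A) k n) (wt A (len A) (k - 1))" for k
      by (rule A.gr_str)
  qed
qed

lemma mhc_mult_pad:
  assumes "mhc_mult K A h" "len A \<le> N"
  shows "mhc_mult K (pad_mhd N A) (pad_h (len A) h)"
proof -
  interpret A: mhc_mult K A h by (rule assms(1))
  have ml: "min N (len A) = len A" using assms(2) by simp
  have m: "min i (len A) \<le> len A" for i by simp
  have z: "linear_between V V' (\<lambda>x. 0)" if "subspace_over UNIV V'" for V :: "'a set" and V' :: "'a set"
    using that by (auto simp: linear_between_def subspace_over_def)
  show ?thesis
  proof (intro mhc_mult.intro mhc_core_pad[OF A.mhc_core_axioms assms(2)] mhc_mult_axioms.intro, unfold pad_sel ml)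
    fix i k l and a b n p p' :: int and x y :: 'a
    show "linear_between (cpt A (min i (len A)) b) (cpt A (min i (len A)) (a + b)) (mul A (min i (len A)) a b x)"
      if "x \<in> cpt A (min i (len A)) a" by (rule A.mul_lin_r[OF m that])
    show "linear_between (cpt A (min i (len A)) a) (cpt A (min i (len A)) (a + b)) (\<lambda>x. mul A (min i (len A)) a b x y)"
      if "y \<in> cpt A (min i (len A)) b" by (rule A.mul_lin_l[OF m that])
    show "mul A (min i (len A)) a b x y \<in> wt A (min i (len A)) (k + l) (a + b)"
      if "x \<in> wt A (min i (len A)) k a" "y \<in> wt A (min i (len A)) l b" by (rule A.mul_W[OF m that])
    show "mul A (min 0 (len A)) a b x y \<in> rat A (a + b)" if "x \<in> rat A a" "y \<in> rat A b" using A.mul_R[OF that] by simp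
    show "mul A (len A) a b x y \<in> hdg A (p + p') (a + b)" if "x \<in> hdg A p a" "y \<in> hdg A p' b" by (rule A.mul_F[OF that])
    show "dif A (min i (len A)) n (mul A (min i (len A)) a b x y) =
       mul A (min i (len A)) (a + 1) b (dif A (min i (len A)) a x) y + sgn_pow a (mul A (min i (len A)) a (b + 1) x (dif A (min i (len A)) b y))"
      if "x \<in> cpt A (min i (len A)) a" "y \<in> cpt A (min i (len A)) b" "n = a + b" by (rule A.mul_d[OF m that])
    fix r q assume rq: "(r, q) \<in> arrows N"
    note ap = arrows_pad[OF rq, of "len A"]
    show "linear_between (cpt A (min r (len A)) b) (cpt A (min q (len A)) (a + b - 1)) (pad_h (len A) h r q a b x)"
      if "x \<in> cpt A (min r (len A)) a"
    proof (cases "r \<le> len A \<and> q \<le> len A")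
      case True
      then show ?thesis using A.h_lin_r[of r q x a b] that ap by (simp add: pad_h_def min_absorb1)
    next
      case False
      then show ?thesis using z[OF A.csub_V[OF m]] by (simp add: pad_h_def if_not_P[OF False])
    qed
    show "linear_between (cpt A (min r (len A)) a) (cpt A (min q (len A)) (a + b - 1)) (\<lambda>x. pad_h (len A) h r q a b x y)"
      if "y \<in> cpt A (min r (len A)) b"
    proof (cases "r \<le> len A \<and> q \<le> len A")
      case True
      then show ?thesis using A.h_lin_l[of r q y b a] that ap by (simp add: pad_h_def min_absorb1)
    next
      case False
      then show ?thesis using z[OF A.csub_V[OF m]] by (simp add: pad_h_def if_not_P[OF False])
    qed
    show "pad_h (len A) h r q a b x y \<in> wt A (min q (len A)) (k + l) (a + b - 1)"
      if "x \<in> wt A (min r (len A)) k a" "y \<in> wt A (min r (len A)) l b"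
    proof (cases "r \<le> len A \<and> q \<le> len A")
      case True
      then show ?thesis using A.h_W[of r q x k a y l b] that ap by (simp add: pad_h_def min_absorb1)
    next
      case False
      then show ?thesis using A.W_zero[OF m] by (simp add: pad_h_def if_not_P[OF False])
    qed
    show "(if r \<le> len A \<and> q \<le> len A then cmp A r q (a + b) (mul A (min r (len A)) a b x y) else mul A (min r (len A)) a b x y) =
       mul A (min q (len A)) a b (if r \<le> len A \<and> q \<le> len A then cmp A r q a x else x) (if r \<le> len A \<and> q \<le> len A then cmp A r q b y else y)
       + dif A (min q (len A)) (a + b - 1) (pad_h (len A) h r q a b x y)
        + pad_h (len A) h r q (a + 1) b (dif A (min r (len A)) a x) y + sgn_pow a (pad_h (len A) h r q a (b + 1) x (dif A (min r (len A)) b y))"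
      if "x \<in> cpt A (min r (len A)) a" "y \<in> cpt A (min r (len A)) b"
    proof (cases "r \<le> len A \<and> q \<le> len A")
      case True
      then show ?thesis using A.h_rel[of r q x a y b] that ap by (simp add: pad_h_def min_absorb1)
    next
      case False
      then have "min r (len A) = len A" "min q (len A) = len A" using ap by auto
      then show ?thesis using False A.d_zero[OF order_refl] by (simp add: pad_h_def if_not_P[OF False])
    qed
  qed
qed

text \<open>
  The inclusion of cochains repeats the last bottom component and puts zero in the new top component;
  it is compatible with products on the nose.
\<close>

lemma pad_two_transfer:
  assumes A: "mhc_mult K A h" and N: "len A \<le> N" "even N"
  shows "db_transfer K (pad_mhd N A) (pad_h (len A) h) (pad_mhd (Suc (Suc N)) A) (pad_h (len A) h) \<alpha>
    (\<lambda>m a i. if i \<le> N then a i else if i = Suc (Suc N) then a N else 0) (\<lambda>m x. x)"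
proof -
  let ?B = "pad_mhd N A" and ?E = "pad_mhd (Suc (Suc N)) A"
  let ?T = "\<lambda>m a i. if i \<le> N then a i else if i = Suc (Suc N) then a N else 0"
  let ?L = "len A" and ?h = "pad_h (len A) h"
  have mB: "mhc_mult K ?B ?h" and mE: "mhc_mult K ?E ?h" using mhc_mult_pad[OF A] N(1) by auto
  interpret X: db_alg K ?B ?h \<alpha>
    using mB N by (intro db_alg.intro even_core.intro even_core_axioms.intro) (auto simp: mhc_mult_def)
  interpret Y: db_alg K ?E ?h \<alpha>
    using mE N by (intro db_alg.intro even_core.intro even_core_axioms.intro) (auto simp: mhc_mult_def)
  have N2: "2 \<le> N" using X.len2 by simp
  have mN: "min N ?L = ?L" "min (Suc N) ?L = ?L" "min (Suc (Suc N)) ?L = ?L" using N by auto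
  have Xlow: "dbX ?E p i m = dbX ?B p i m" if "i < N" for p i m using that by (simp add: dbX_def)
  have XN: "dbX ?E p N m = wt A ?L (2 * p) m" for p m using N2 mN by (simp add: dbX_def)
  have XBN: "dbX ?B p N m = hdg A p m \<inter> wt A ?L (2 * p) m" for p m using N2 mN by (simp add: dbX_def)
  have XEN: "dbX ?E p (Suc (Suc N)) m = hdg A p m \<inter> wt A ?L (2 * p) m" for p m using N2 mN by (simp add: dbX_def)
  have cmpBE: "cmp ?E r q n x = cmp ?B r q n x" for r q n x by simp
  have cmpid: "cmp ?E N (Suc N) n x = x" "cmp ?E (Suc (Suc N)) (Suc N) n x = x" for n x using N by auto
  have difBE: "dif ?E i = dif ?B i" "mul ?E i = mul ?B i" for i by auto
  define s where "s = N - 1"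
  have s: "odd s" "s < N" "Suc s = N" using N2 N(2) by (auto simp: s_def)
  have cases_even: "i < N \<or> i = N \<or> i = Suc (Suc N)" if "even i" "i \<le> Suc (Suc N)" for i
    using that N(2) by (metis even_Suc le_SucE le_neq_implies_less)
  have cases_odd: "q < N \<or> q = Suc N" if "odd q" "q < Suc (Suc N)" for q
    using that N(2) by (metis less_antisym)
  have T_C: "?T m a \<in> dbC ?E p m" if a: "a \<in> dbC ?B p m" for a p m
  proof (rule Y.dbCI)
    have aN: "a N \<in> hdg A p m \<inter> wt A ?L (2 * p) m" using X.dbC_even[OF a N(2)] by (simp add: XBN)
    show "?T m a i \<in> dbX ?E p i m" if "even i" "i \<le> len ?E" for i
      using cases_even[of i] that X.dbC_even[OF a that(1)] aN by (auto simp: Xlow XN XEN)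
    show "?T m a q \<in> wt ?E q (2 * p) (m - 1)" if "odd q" "q < len ?E" for q
      using cases_odd[of q] that X.dbC_odd[OF a that(1)] Y.W_zero[of q] by auto
  qed auto
  have T_D: "dbD ?E m (?T m a) = ?T m (dbD ?B m a)" if a: "a \<in> dbC ?B p m" for a p m
  proof (rule Y.db_ext)
    show "dbD ?E m (?T m a) i = ?T m (dbD ?B m a) i" if i: "even i" "i \<le> len ?E" for i
      using cases_even[of i] i N(2) by (auto simp: Y.dbD_even[OF i] X.dbD_even mN)
    show "dbD ?E m (?T m a) q = ?T m (dbD ?B m a) q" if q: "odd q" "q < len ?E" for q
    proof (cases "q = Suc N")
      case True
      have qN: "odd (Suc N)" "Suc N < len ?E" using N(2) by auto
      show ?thesis using Y.d_zero[of "Suc N"] unfolding True Y.dbD_odd[OF qN]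
        by (simp add: cmpid del: pad_sel(7))
    next
      case False
      then have "q < N" using cases_odd q by auto
      then have "q < N" "q - 1 \<le> N" by auto
      then show ?thesis using q by (simp add: Y.dbD_odd[OF q] X.dbD_odd)
    qed
  qed (auto simp: Y.dbD_out)
  have T_zero: "?T m 0 = 0" by auto
  have T_Z: "?T m a \<in> dZ ?E p m" if a: "a \<in> dZ ?B p m" for a p m
  proof -
    have da: "dbD ?B m a = 0" using a by (simp add: dZ_def)
    have "dbD ?E m (?T m a) = 0" unfolding T_D[OF X.dZ_C[OF a]] da by (rule T_zero)
    then show ?thesis using T_C[OF X.dZ_C[OF a]] by (simp add: dZ_def)
  qed
  have arr: "(N, s) \<in> arrows (len ?B)" using X.arrow_right[of s] s by simp
  have psi_d: "cmp ?B N s m (dif A ?L (m - 1) x) = dif ?B s (m - 1) (cmp ?B N s (m - 1) x)" if "x \<in> cpt A ?L (m - 1)" for x m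
    using X.cmp_d'[OF arr, of x m] that mN by (simp del: pad_sel(7))
  have psi_W: "cmp ?B N s m x \<in> wt ?B s k m" if "x \<in> wt A ?L k m" for x k m
    using X.cmp_W[OF arr, of x k m] that mN by (simp del: pad_sel(7))
  have psi_add: "cmp ?B N s m (x + y) = cmp ?B N s m x + cmp ?B N s m y" if "x \<in> cpt A ?L m" "y \<in> cpt A ?L m" for x y m
    using X.cmp_add[OF arr, of x m y] that mN by (simp del: pad_sel(7))
  have wB: "wt ?B N = wt A ?L" "cpt ?B N = cpt A ?L" "dif ?B N = dif A ?L" "dif ?E (Suc N) = dif A ?L"
    "dif ?E N = dif A ?L" "dif ?E (Suc (Suc N)) = dif A ?L" "wt ?E (Suc N) = wt A ?L" using mN by auto
  have s_le: "s \<le> len ?B" using s by simp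
  \<comment> \<open>The inverse of the inclusion up to coboundaries: the extra top component is
    carried through the last old comparison morphism into the last old top component, and the new
    right end becomes the end of the shorter zigzag.\<close>
  have fold: "\<exists>b\<in>dbC ?B p m. (\<forall>i\<le>N. i \<noteq> s \<longrightarrow> i \<noteq> N \<longrightarrow> b i = c i) \<and> b s = c s + cmp ?B N s (m - 1) (c (Suc N)) \<and> b N = c (Suc (Suc N))"
    if c: "c \<in> dbC ?E p m" for c p m
  proof -
    let ?b = "\<lambda>i. if i > N then 0 else if i = N then c (Suc (Suc N)) else if i = s then c s + cmp ?B N s (m - 1) (c (Suc N)) else c i"
    have cN: "c (Suc N) \<in> wt A ?L (2 * p) (m - 1)" using Y.dbC_odd[OF c, of "Suc N"] N(2) wB by simp
    have cs: "c s \<in> wt ?B s (2 * p) (m - 1)" using Y.dbC_odd[OF c s(1)] s(2) by simp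
    have "?b \<in> dbC ?B p m"
    proof (rule X.dbCI)
      show "?b i \<in> dbX ?B p i m" if "even i" "i \<le> len ?B" for i
        using that Y.dbC_even[OF c that(1)] Y.dbC_even[OF c, of "Suc (Suc N)"] N(2) s(1) Xlow[of i]
        by (cases "i = N") (auto simp: XBN XEN)
      show "?b q \<in> wt ?B q (2 * p) (m - 1)" if q: "odd q" "q < len ?B" for q
      proof (cases "q = s")
        case True
        then show ?thesis using X.W_add[OF s_le cs psi_W[OF cN]] s by (simp del: pad_sel(7))
      next
        case False
        then show ?thesis using Y.dbC_odd[OF c q(1)] q by simp
      qed
    qed simp
    moreover have "?b s = c s + cmp ?B N s (m - 1) (c (Suc N))" using s by (simp del: pad_sel(7))
    ultimately show ?thesis by (intro bexI[of _ ?b]) (auto simp del: pad_sel(7))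
  qed
  have sp: "s - 1 \<le> N" "s - 1 \<noteq> s" "s - 1 \<noteq> N" "even (s - 1)" using s odd_pos[OF s(1)] by auto
  have T_inj: "a \<in> dB ?B p m" if a: "a \<in> dZ ?B p m" "?T m a \<in> dB ?E p m" for a p m
  proof -
    obtain c where c: "c \<in> dbC ?E p (m - 1)" "?T m a = dbD ?E (m - 1) c" using a(2) unfolding dB_def by blast
    obtain b where b: "b \<in> dbC ?B p (m - 1)" "\<And>i. i \<le> N ==> i \<noteq> s ==> i \<noteq> N ==> b i = c i"
      "b s = c s + cmp ?B N s (m - 1 - 1) (c (Suc N))" "b N = c (Suc (Suc N))" using fold[OF c(1)] by blast
    have cV: "c (Suc N) \<in> cpt A ?L (m - 1 - 1)" "c (Suc (Suc N)) \<in> cpt A ?L (m - 1)"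
      using Y.dbC_V_odd[OF c(1), of "Suc N"] Y.dbC_V_even[OF c(1), of "Suc (Suc N)"] N(2) mN by auto
    have cs: "c s \<in> cpt ?B s (m - 1 - 1)" using Y.dbC_V_odd[OF c(1) s(1)] s(2) by simp
    have dcV: "dif A ?L (m - 1 - 1) (c (Suc N)) \<in> cpt A ?L (m - 1)" using X.d_V'[of N "c (Suc N)" "m - 1"] cV(1) wB by simp
    have pV: "cmp ?B N s (m - 1 - 1) (c (Suc N)) \<in> cpt ?B s (m - 1 - 1)"
      using X.cmp_V[OF arr, of "c (Suc N)"] cV(1) unfolding wB .
    \<comment> \<open>At the new top place the included cochain vanishes, which ties the two bottoms
      of \<open>c\<close> around it together up to a differential.\<close>
    have eqN1: "c N = c (Suc (Suc N)) + dif A ?L (m - 1 - 1) (c (Suc N))"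
    proof -
      have "0 = dbD ?E (m - 1) c (Suc N)" using fun_cong[OF c(2), of "Suc N"] by simp
      also have "\<dots> = c N - c (Suc (Suc N)) - dif A ?L (m - 1 - 1) (c (Suc N))"
        using Y.dbD_odd[of "Suc N" "m - 1" c] N(2) by (simp add: cmpid mN del: pad_sel(7))
      finally show ?thesis by (simp add: algebra_simps)
    qed
    have "a = dbD ?B (m - 1) b"
    proof (rule X.db_ext)
      fix i assume i: "even i" "i \<le> len ?B"
      have "a i = dbD ?E (m - 1) c i" if "i < N" using fun_cong[OF c(2), of i] that by simp
      moreover have "i \<noteq> s" using i(1) s(1) by blast
      moreover have "a N = dbD ?E (m - 1) c (Suc (Suc N))" using fun_cong[OF c(2), of "Suc (Suc N)"] by simp
      ultimately have *: "i < N ==> a i = dbD ?E (m - 1) c i" "i \<noteq> s" "a N = dbD ?E (m - 1) c (Suc (Suc N))" by blast+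
      show "a i = dbD ?B (m - 1) b i"
      proof (cases "i = N")
        case True
        have "even (Suc (Suc N))" "Suc (Suc N) \<le> len ?E" using N(2) by auto
        then have "a N = dif A ?L (m - 1) (c (Suc (Suc N)))" unfolding *(3) using Y.dbD_even[of "Suc (Suc N)" "m - 1" c] wB by (simp del: pad_sel(6))
        then show ?thesis unfolding X.dbD_even[OF i] unfolding True wB b(4) .
      next
        case False
        then have "i < N" "i \<le> len ?E" "i \<le> N" using i(2) by auto
        then show ?thesis using *(1) Y.dbD_even[OF i(1), of "m - 1" c] b(2)[OF _ *(2) False] by (simp add: X.dbD_even[OF i])
      qed
    next
      fix q assume q: "odd q" "q < len ?B"
      have aq: "a q = dbD ?E (m - 1) c q" using fun_cong[OF c(2), of q] q by simp
      have qE: "q < len ?E" using q by simp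
      show "a q = dbD ?B (m - 1) b q"
      proof (cases "q = s")
        case True
        have "cmp ?B N s (m - 1) (c N) = cmp ?B N s (m - 1) (c (Suc (Suc N))) + dif ?B s (m - 1 - 1) (cmp ?B N s (m - 1 - 1) (c (Suc N)))"
          unfolding eqN1 psi_add[OF cV(2) dcV] psi_d[OF cV(1)] ..
        moreover have "dif ?B s (m - 1 - 1) (b s) = dif ?B s (m - 1 - 1) (c s) + dif ?B s (m - 1 - 1) (cmp ?B N s (m - 1 - 1) (c (Suc N)))"
          unfolding b(3) by (rule X.d_add[OF s_le cs pV])
        moreover have "a s = cmp ?B (s - 1) s (m - 1) (c (s - 1)) - cmp ?B N s (m - 1) (c N) - dif ?B s (m - 1 - 1) (c s)"
          using aq unfolding Y.dbD_odd[OF q(1) qE] cmpBE difBE unfolding True s(3) .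
        moreover have "dbD ?B (m - 1) b s = cmp ?B (s - 1) s (m - 1) (c (s - 1)) - cmp ?B N s (m - 1) (c (Suc (Suc N))) - dif ?B s (m - 1 - 1) (b s)"
          using X.dbD_odd[OF q, of "m - 1" b] unfolding True s(3) b(2)[OF sp(1-3)] b(4) .
        ultimately show ?thesis unfolding True by (simp only: diff_diff_eq add.assoc add.commute add.left_commute)
      next
        case False
        have "Suc q \<noteq> N" using False s(3) by auto
        moreover have "Suc q \<noteq> s" "q - 1 \<noteq> s" using X.odd_nb(1,3)[OF q] s(1) by metis+
        moreover have "q - 1 \<noteq> N" "q \<noteq> N" "Suc q \<le> N" "q - 1 \<le> N" "q \<le> N" using q(2) by simp_all
        ultimately show ?thesis using False
          unfolding aq Y.dbD_odd[OF q(1) qE] X.dbD_odd[OF q] cmpBE difBE by (simp add: b(2) del: pad_sel)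
      qed
    next
      show "a i = dbD ?B (m - 1) b i" if "i > len ?B" for i using X.dbC_out[OF X.dZ_C[OF a(1)] that] X.dbD_out[OF that] by simp
    qed
    then show ?thesis unfolding dB_def using b(1) by blast
  qed
  have T_surj: "\<exists>a\<in>dZ ?B p m. ?T m a - e \<in> dB ?E p m" if e: "e \<in> dZ ?E p m" for e p m
  proof -
    note eC = Y.dZ_C[OF e]
    obtain b where b: "b \<in> dbC ?B p m" "\<And>i. i \<le> N ==> i \<noteq> s ==> i \<noteq> N ==> b i = e i"
      "b s = e s + cmp ?B N s (m - 1) (e (Suc N))" "b N = e (Suc (Suc N))" using fold[OF eC] by blast
    have eW: "e (Suc N) \<in> wt A ?L (2 * p) (m - 1)" using Y.dbC_odd[OF eC, of "Suc N"] N(2) wB by simp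
    have eV: "e (Suc N) \<in> cpt A ?L (m - 1)" "e (Suc (Suc N)) \<in> cpt A ?L m" "e N \<in> cpt A ?L m"
      using Y.dbC_V_odd[OF eC, of "Suc N"] Y.dbC_V_even[OF eC, of "Suc (Suc N)"] Y.dbC_V_even[OF eC N(2)] N(2) mN by auto
    have es: "e s \<in> cpt ?B s (m - 1)" using Y.dbC_V_odd[OF eC s(1)] s(2) by simp
    have deV: "dif A ?L (m - 1) (e (Suc N)) \<in> cpt A ?L m" using X.d_V'[of N "e (Suc N)" m] eV(1) wB by simp
    have pV: "cmp ?B N s (m - 1) (e (Suc N)) \<in> cpt ?B s (m - 1)"
      using X.cmp_V[OF arr, of "e (Suc N)"] eV(1) unfolding wB .
    have "e N - e (Suc (Suc N)) = dif A ?L (m - 1) (e (Suc N))"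
      using Y.dZ_odd[OF e, of "Suc N"] N(2) by (simp add: cmpid mN del: pad_sel(7))
    then have eqN: "e N = e (Suc (Suc N)) + dif A ?L (m - 1) (e (Suc N))" by (simp add: algebra_simps)
    have bZ: "b \<in> dZ ?B p m"
    proof (rule X.dZI[OF b(1)])
      show "dif ?B i m (b i) = 0" if i: "even i" "i \<le> len ?B" for i
      proof -
        have "i \<noteq> s" using i(1) s(1) by blast
        then show ?thesis
          using i b(2)[of i] b(4) N(2) Y.dZ_even[OF e, of i] Y.dZ_even[OF e, of "Suc (Suc N)"]
          by (cases "i = N") (auto simp: wB mN)
      qed
      show "cmp ?B (q - 1) q m (b (q - 1)) - cmp ?B (Suc q) q m (b (Suc q)) = dif ?B q (m - 1) (b q)" if q: "odd q" "q < len ?B" for q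
      proof -
        have qE: "q < len ?E" using q by simp
        note eq = Y.dZ_odd[OF e q(1) qE, unfolded cmpBE difBE]
        show ?thesis
        proof (cases "q = s")
          case True
          have "cmp ?B N s m (e N) = cmp ?B N s m (e (Suc (Suc N))) + dif ?B s (m - 1) (cmp ?B N s (m - 1) (e (Suc N)))"
            unfolding eqN psi_add[OF eV(2) deV] psi_d[OF eV(1)] ..
          moreover have "dif ?B s (m - 1) (b s) = dif ?B s (m - 1) (e s) + dif ?B s (m - 1) (cmp ?B N s (m - 1) (e (Suc N)))"
            unfolding b(3) by (rule X.d_add[OF s_le es pV])
          ultimately show ?thesis using eq unfolding True s(3) b(2)[OF sp(1-3)] b(4) by (simp add: algebra_simps del: pad_sel)
        next
          case False
          have "Suc q \<noteq> N" using False s(3) by auto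
          moreover have "Suc q \<noteq> s" "q - 1 \<noteq> s" using X.odd_nb(1,3)[OF q] s(1) by metis+
        moreover have "q - 1 \<noteq> N" "q \<noteq> N" "Suc q \<le> N" "q - 1 \<le> N" "q \<le> N" using q(2) by simp_all
          ultimately show ?thesis using False eq by (simp add: b(2) del: pad_sel)
        qed
      qed
    qed
    \<comment> \<open>Contracting and including again changes \<open>e\<close> by a coboundary
      supported near the old end: there \<open>e N\<close> differs from the new end by the
      differential of \<open>e (Suc N)\<close>.\<close>
    let ?c = "\<lambda>i. if i = N then - e (Suc N) else 0"
    have cC: "?c \<in> dbC ?E p (m - 1)"
    proof (rule Y.dbCI)
      show "?c i \<in> dbX ?E p i (m - 1)" if "even i" "i \<le> len ?E" for i
        using Y.dbX_zero[OF that(2)] X.W_minus[of N "e (Suc N)" "2 * p" "m - 1"] eW wB by (auto simp: XN)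
      show "?c q \<in> wt ?E q (2 * p) (m - 1 - 1)" if "odd q" "q < len ?E" for q
        using Y.W_zero[OF less_imp_le[OF that(2)]] that N(2) by auto
    qed auto
    have "?T m b - e = dbD ?E (m - 1) ?c"
    proof (rule Y.db_ext)
      fix i assume i: "even i" "i \<le> len ?E"
      have "i < N \<or> i = N \<or> i = Suc (Suc N)" using cases_even i by simp
      then show "(?T m b - e) i = dbD ?E (m - 1) ?c i"
      proof (elim disjE)
        assume "i < N"
        then show ?thesis using i b(2)[of i] s(1) Y.d_zero[OF i(2)] by (auto simp: Y.dbD_even[OF i] simp del: pad_sel)
      next
        assume "i = N"
        then show ?thesis unfolding Y.dbD_even[OF i]
          using i b(4) eqN X.d_minus[of N "e (Suc N)" "m - 1"] eV(1) wB by (simp del: pad_sel(2,6))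
      next
        assume "i = Suc (Suc N)"
        then show ?thesis unfolding Y.dbD_even[OF i] using i b(4) Y.d_zero[OF i(2)] by (simp del: pad_sel(6))
      qed
    next
      fix q assume q: "odd q" "q < len ?E"
      note nb = Y.odd_nb[OF q]
      have "q < s \<or> q = s \<or> q = Suc N" using cases_odd[of q] q s by auto
      then show "(?T m b - e) q = dbD ?E (m - 1) ?c q"
      proof (elim disjE)
        assume qs: "q < s"
        then have "Suc q \<noteq> N" "q - 1 \<noteq> N" "q \<noteq> N" "q \<noteq> s" "q \<le> N" using s by auto
        then show ?thesis using b(2)[of q] Y.d_zero[OF nb(5)] Y.cmp_zero[OF Y.arrow_left[OF q]] Y.cmp_zero[OF Y.arrow_right[OF q]]
          by (simp add: Y.dbD_odd[OF q] del: pad_sel)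
      next
        assume qs: "q = s"
        have "cmp ?E N s (m - 1) (- e (Suc N)) = - cmp ?E N s (m - 1) (e (Suc N))"
          using Y.cmp_minus[OF Y.arrow_right[OF q], of "e (Suc N)" "m - 1"] qs s(3) eV(1) mN by (simp del: pad_sel(7))
        moreover have "cmp ?E (s - 1) s (m - 1) 0 = 0" "dif ?E s (m - 1 - 1) 0 = 0"
          using Y.d_zero[OF nb(5)] Y.cmp_zero[OF Y.arrow_left[OF q]] qs by auto
        ultimately show ?thesis
          unfolding Y.dbD_odd[OF q] unfolding qs s(3) using s(2) sp(3) by (simp add: b(3) cmpBE[symmetric] del: pad_sel)
      next
        assume qs: "q = Suc N"
        then show ?thesis using Y.d_zero[OF nb(5)] unfolding Y.dbD_odd[OF q] unfolding qs by (simp add: cmpid del: pad_sel)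
      qed
    next
      show "(?T m b - e) i = dbD ?E (m - 1) ?c i" if "i > len ?E" for i using that Y.dbC_out[OF eC that] Y.dbD_out[OF that] by simp
    qed
    then show ?thesis unfolding dB_def using bZ cC by blast
  qed
  have T_mult: "?T (m + m') (X.P m m' a b) = Y.P m m' (?T m a) (?T m' b)" if a: "a \<in> dZ ?B p m" and b: "b \<in> dZ ?B p' m'" for a b p p' m m'
  proof (rule Y.db_ext)
    show "?T (m + m') (X.P m m' a b) i = Y.P m m' (?T m a) (?T m' b) i" if i: "even i" "i \<le> len ?E" for i
      using cases_even[of i] i N(2) by (auto simp: Y.P_even[OF i] X.P_even mN)
    show "?T (m + m') (X.P m m' a b) q = Y.P m m' (?T m a) (?T m' b) q" if q: "odd q" "q < len ?E" for q
    proof (cases "q = Suc N")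
      case True
      have V: "a N \<in> cpt ?E (Suc N) m" "b N \<in> cpt ?E (Suc N) m'"
        using X.dbC_V_even[OF X.dZ_C[OF a] N(2)] X.dbC_V_even[OF X.dZ_C[OF b] N(2)] mN by auto
      have qle: "Suc N \<le> len ?E" by simp
      have "?h N (Suc N) m m' x y = 0" "?h (Suc (Suc N)) (Suc N) m m' x y = 0" for x y using N by (auto simp: pad_h_def)
      then show ?thesis unfolding Y.P_odd[OF q] unfolding True
        using Y.mul_zero_l[OF qle V(2)] Y.mul_zero_r[OF qle V(1)] by (simp add: cmpid del: pad_sel)
    next
      case False
      then have "q < N" using cases_odd q by auto
      then have "q < N" "q - 1 \<le> N" by auto
      then show ?thesis using q by (simp add: Y.P_odd[OF q] X.P_odd)
    qed
  qed (auto simp: Y.P_out)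
  have T_diff: "?T m (a - b) = ?T m a - ?T m b" for m and a b :: "nat \<Rightarrow> 'a" by (auto simp: fun_eq_iff)
  show ?thesis
  proof (intro db_transfer.intro db_transfer_axioms.intro X.db_alg_axioms Y.db_alg_axioms)
    show "?T m a \<in> dB ?E p m" if aB: "a \<in> dB ?B p m" for a p m
    proof -
      obtain c where c: "c \<in> dbC ?B p (m - 1)" "a = dbD ?B (m - 1) c" using aB unfolding dB_def by blast
      have "dbD ?E (m - 1) (?T m c) \<in> dB ?E p m" unfolding dB_def by (rule imageI[OF T_C[OF c(1)]])
      then show ?thesis unfolding T_D[OF c(1)] c(2) .
    qed
    show "x \<in> cobd ?E (len ?E) m \<longleftrightarrow> x \<in> cobd ?B (len ?B) m" for x m
      using mN by (simp add: cobd_def)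
    show "?T (m + m') (X.P m m' a b) - Y.P m m' (?T m a) (?T m' b) \<in> dB ?E (p + p') (m + m')"
      if "a \<in> dZ ?B p m" "b \<in> dZ ?B p' m'" for a b p p' m m'
      unfolding T_mult[OF that] using grp_zero[OF Y.grp_dB] by simp
    show "?T m a \<in> dZ ?E p m" if "a \<in> dZ ?B p m" for a p m by (rule T_Z[OF that])
    show "?T m (a - b) = ?T m a - ?T m b" for a b :: "nat \<Rightarrow> 'a" and m :: int by (rule T_diff)
    show "(\<lambda>i. if i \<le> N then c *\<^sub>C a i else if i = Suc (Suc N) then c *\<^sub>C a N else 0) = (\<lambda>i. c *\<^sub>C ?T m a i)"
      for a :: "nat \<Rightarrow> 'a" and c and m :: int by (rule ext) simp
    show "a \<in> dB ?B p m" if "a \<in> dZ ?B p m" "?T m a \<in> dB ?E p m" for a p m by (rule T_inj[OF that])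
    show "\<exists>a\<in>dZ ?B p m. ?T m a - e \<in> dB ?E p m" if "e \<in> dZ ?E p m" for e p m by (rule T_surj[OF that])
    show "?T m a (len ?E) = a (len ?B)" for a :: "nat \<Rightarrow> 'a" and m :: int by simp
  qed simp
qed

section \<open>C-infinity mixed Hodge diagrams\<close>

lemma blocks_1: "{yss. concat yss = [u] \<and> [] \<notin> set yss} = {[[u]]}"
proof -
  have "yss = [[u]]" if "concat yss = [u]" "[] \<notin> set yss" for yss :: "'a list list"
    using that by (cases yss; cases "hd yss"; cases "tl yss"; cases "hd (tl yss)") auto
  then show ?thesis by auto
qed

lemma blocks_2: "{yss. concat yss = [u, v] \<and> [] \<notin> set yss} = {[[u, v]], [[u], [v]]}"
proof -
  have "yss = [[u, v]] \<or> yss = [[u], [v]]" if 0: "concat yss = [u, v]" "[] \<notin> set yss" for yss :: "'a list list"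
  proof (cases yss)
    case Nil
    then show ?thesis using 0 by simp
  next
    case (Cons ys zss)
    then obtain w ws where ys: "ys = w # ws" using 0(2) by (cases ys) auto
    then have 1: "w = u" "ws @ concat zss = [v]" "[] \<notin> set zss" using 0 Cons by auto
    show ?thesis
    proof (cases ws)
      case Nil
      then have "zss \<in> {yss. concat yss = [v] \<and> [] \<notin> set yss}" using 1 by simp
      then have "zss = [[v]]" unfolding blocks_1 by simp
      then show ?thesis using Cons ys 1 Nil by simp
    next
      case (Cons c cs)
      then have "ws = [v]" "concat zss = []" using 1(2) by auto
      then have "zss = []" using 1(3) by (cases zss) auto
      then show ?thesis using \<open>yss = ys # zss\<close> ys 1(1) \<open>ws = [v]\<close> by simp
    qed
  qed
  then show ?thesis by auto
qed

lemma compose_op_1: "compose_op g f [(a, x)] = g [(a, f [(a, x)])]"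
  unfolding compose_op_def blocks_1 by (simp add: deg_def sgn_pow_def)

lemma compose_op_2:
  "compose_op g f [(a, x), (b, y)] = g [(a + b - 1, f [(a, x), (b, y)])] + g [(a, f [(a, x)]), (b, f [(b, y)])]"
  unfolding compose_op_def blocks_2 by (simp add: deg_def sgn_pow_def)

lemma insert_op_1: "insert_op f m [(a, x)] = f [(a + 1, m [(a, x)])]"
  by (simp add: insert_op_def deg_def sgn_pow_def add.commute)

lemma insert_op_2: "insert_op f m [(a, x), (b, y)] = f [(a + b, m [(a, x), (b, y)])]
   - f [(a + 1, m [(a, x)]), (b, y)] - sgn_pow a (f [(a, x), (b + 1, m [(b, y)])])"
proof -
  have 1: "(\<Sum>r<length [(a, x), (b, y)]. F r) = F 0 + F 1" for F :: "nat \<Rightarrow> 'c::ab_group_add"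
    by (simp add: lessThan_Suc One_nat_def add.commute)
  have 2: "(\<Sum>s=1..length [(a, x), (b, y)] - 0. F s) = F 1 + F 2"
    "(\<Sum>s=1..length [(a, x), (b, y)] - 1. F s) = F 1" for F :: "nat \<Rightarrow> 'c::ab_group_add"
    by (simp_all add: One_nat_def numeral_2_eq_2)
  show ?thesis unfolding insert_op_def 1 2
    by (simp add: deg_def sgn_pow_def Let_def One_nat_def numeral_2_eq_2 add.commute)
qed

lemma multilinear_1:
  assumes "multilinear V V' e f" "e' = n + e - 1"
  shows "linear_between (V n) (V' e') (\<lambda>x. f [(n, x)])"
proof -
  have h: "[] \<in> homog V" by (simp add: homog_def)
  have lin: "f [(n, x + y)] = f [(n, x)] + f [(n, y)] \<and> f [(n, c *\<^sub>C x)] = c *\<^sub>C f [(n, x)]" if "x \<in> V n" "y \<in> V n" for x y c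
    using assms(1)[unfolded multilinear_def, THEN conjunct2, rule_format, OF h h that, of c] by simp
  have "f [(n, x)] \<in> V' e'" if "x \<in> V n" for x
    using assms(1)[unfolded multilinear_def maps_into_def, THEN conjunct1, rule_format, of "[(n, x)]"] that assms(2)
    by (simp add: homog_def deg_def)
  then show ?thesis using lin unfolding linear_between_def by blast
qed

lemma maps_into_2:
  assumes "maps_into V V' e f" "x \<in> V a" "y \<in> V b" "e' = a + b + e - 2"
  shows "f [(a, x), (b, y)] \<in> V' e'"
  using assms(1)[unfolded maps_into_def, rule_format, of "[(a, x), (b, y)]"] assms(2-) by (simp add: homog_def deg_def)

lemma maps_into_1:
  assumes "maps_into V V' e f" "x \<in> V a" "e' = a + e - 1"
  shows "f [(a, x)] \<in> V' e'"
  using assms(1)[unfolded maps_into_def, rule_format, of "[(a, x)]"] assms(2-) by (simp add: homog_def deg_def)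

lemma multilinear_2r:
  assumes "multilinear V V' e f" "x \<in> V a" "e' = a + b + e - 2"
  shows "linear_between (V b) (V' e') (\<lambda>y. f [(a, x), (b, y)])"
proof -
  have h: "[(a, x)] \<in> homog V" "[] \<in> homog V" using assms(2) by (auto simp: homog_def)
  have lin: "f [(a, x), (b, y + z)] = f [(a, x), (b, y)] + f [(a, x), (b, z)] \<and> f [(a, x), (b, c *\<^sub>C y)] = c *\<^sub>C f [(a, x), (b, y)]"
    if "y \<in> V b" "z \<in> V b" for y z c
    using assms(1)[unfolded multilinear_def, THEN conjunct2, rule_format, OF h that, of c] by simp
  have "f [(a, x), (b, y)] \<in> V' e'" if "y \<in> V b" for y
    using maps_into_2[of V V' e f x a y b e'] assms that unfolding multilinear_def by blast
  then show ?thesis using lin unfolding linear_between_def by blast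
qed

lemma multilinear_2l:
  assumes "multilinear V V' e f" "y \<in> V b" "e' = a + b + e - 2"
  shows "linear_between (V a) (V' e') (\<lambda>x. f [(a, x), (b, y)])"
proof -
  have h: "[] \<in> homog V" "[(b, y)] \<in> homog V" using assms(2) by (auto simp: homog_def)
  have lin: "f [(a, x + z), (b, y)] = f [(a, x), (b, y)] + f [(a, z), (b, y)] \<and> f [(a, c *\<^sub>C x), (b, y)] = c *\<^sub>C f [(a, x), (b, y)]"
    if "x \<in> V a" "z \<in> V a" for x z c
    using assms(1)[unfolded multilinear_def, THEN conjunct2, rule_format, OF h that, of c] by simp
  have "f [(a, x), (b, y)] \<in> V' e'" if "x \<in> V a" for x
    using maps_into_2[of V V' e f x a y b e'] assms that unfolding multilinear_def by blast
  then show ?thesis using lin unfolding linear_between_def by blast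
qed

lemma filtration_1:
  assumes "filtration_preserving G G' e f" "x \<in> G k n" "e' = n + e - 1"
  shows "f [(n, x)] \<in> G' k e'"
  using assms(1)[unfolded filtration_preserving_def, rule_format, of "[(k, n, x)]"] assms(2-) by (simp add: deg_def)

lemma filtration_2:
  assumes "filtration_preserving G G' e f" "x \<in> G k a" "y \<in> G l b" "e' = a + b + e - 2"
  shows "f [(a, x), (b, y)] \<in> G' (k + l) e'"
  using assms(1)[unfolded filtration_preserving_def, rule_format, of "[(k, a, x), (l, b, y)]"] assms(2-) by (simp add: deg_def)

lemma Cinf_morphism_rel_1:
  assumes "Cinf_morphism V m V' m' f" "x \<in> V a"
  shows "f [(a + 1, m [(a, x)])] = m' [(a, f [(a, x)])]"
proof -
  have "insert_op f m [(a, x)] = compose_op m' f [(a, x)]"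
    using assms unfolding Cinf_morphism_def by (simp add: homog_def)
  then show ?thesis unfolding insert_op_1 compose_op_1 .
qed

text \<open>Solved for the image of the product, the relation shows the linear part to be
  multiplicative up to the homotopy given by the quadratic part. This is the shape required by
  \<open>h_rel\<close> and \<open>G2_rel\<close>.\<close>

lemma Cinf_morphism_rel_2:
  assumes "Cinf_morphism V m V' m' f" "x \<in> V a" "y \<in> V b"
  shows "f [(a + b, m [(a, x), (b, y)])] = m' [(a, f [(a, x)]), (b, f [(b, y)])] + m' [(a + b - 1, f [(a, x), (b, y)])]
    + f [(a + 1, m [(a, x)]), (b, y)] + sgn_pow a (f [(a, x), (b + 1, m [(b, y)])])"
proof -
  have "insert_op f m [(a, x), (b, y)] = compose_op m' f [(a, x), (b, y)]"
    using assms unfolding Cinf_morphism_def by (simp add: homog_def)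
  then show ?thesis unfolding insert_op_2 compose_op_2 by (simp add: algebra_simps)
qed

lemma Cinf_algebra_rel_2:
  assumes "Cinf_algebra V m" "x \<in> V a" "y \<in> V b"
  shows "m [(a + b, m [(a, x), (b, y)])] = m [(a + 1, m [(a, x)]), (b, y)] + sgn_pow a (m [(a, x), (b + 1, m [(b, y)])])"
proof -
  have "insert_op m m [(a, x), (b, y)] = 0"
    using assms unfolding Cinf_algebra_def by (simp add: homog_def)
  then show ?thesis unfolding insert_op_2 by (simp add: algebra_simps)
qed

text \<open>Truncation to arities one and two. The record \<open>cinf\<close> carries no unit, so 0
  fills that field.\<close>

definition mhd_of :: "'a::complex_vector cinf \<Rightarrow> 'a mhd" where
  "mhd_of D = \<lparr> len = len D, cpt = cpt D, rat = rat D, wt = wt D, hdg = hdg D, dif = dif D, cmp = cmp D,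
     mul = (\<lambda>i a b x y. opr D i [(a, x), (b, y)]), unt = (\<lambda>_. 0) \<rparr>"

definition quadratic_part :: "'a::complex_vector cinf \<Rightarrow> nat \<Rightarrow> nat \<Rightarrow> int \<Rightarrow> int \<Rightarrow> 'a \<Rightarrow> 'a \<Rightarrow> 'a" where
  "quadratic_part D = (\<lambda>r q a b x y. hmor D r q [(a, x), (b, y)])"

lemma mhd_of_sel [simp]:
  "len (mhd_of D) = len D" "cpt (mhd_of D) = cpt D" "rat (mhd_of D) = rat D" "wt (mhd_of D) = wt D"
  "hdg (mhd_of D) = hdg D" "dif (mhd_of D) = dif D" "cmp (mhd_of D) = cmp D"
  "mul (mhd_of D) = (\<lambda>i a b x y. opr D i [(a, x), (b, y)])" "unt (mhd_of D) = (\<lambda>_. 0)"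
  by (simp_all add: mhd_of_def)

lemma Cinf_mixed_hodge_diagramD:
  assumes "Cinf_mixed_hodge_diagram K D"
  shows "mixed_hodge_complex K D" "i \<le> len D ==> Cinf_algebra (cpt D i) (opr D i)"
    "i \<le> len D ==> x \<in> cpt D i n ==> opr D i [(n, x)] = dif D i n x"
    "i \<le> len D ==> filtration_preserving (wt D i) (wt D i) 2 (opr D i)"
    "maps_into (rat D) (rat D) 2 (opr D 0)" "filtration_preserving (hdg D) (hdg D) 2 (opr D (len D))"
    "(r, q) \<in> arrows (len D) ==> Cinf_morphism (cpt D r) (opr D r) (cpt D q) (opr D q) (hmor D r q)"
    "(r, q) \<in> arrows (len D) ==> x \<in> cpt D r n ==> hmor D r q [(n, x)] = cmp D r q n x"
    "(r, q) \<in> arrows (len D) ==> filtration_preserving (wt D r) (wt D q) 1 (hmor D r q)"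
  using assms unfolding Cinf_mixed_hodge_diagram_def by (blast | simp)+

lemma mhc_core_mhd_of: "mhc_core K D ==> mhc_core K (mhd_of D)"
  unfolding mhc_core_def by simp

lemma mhc_mult_mhd_of:
  assumes K: "real_subfield K" and D: "Cinf_mixed_hodge_diagram K D"
  shows "mhc_mult K (mhd_of D) (quadratic_part D)"
proof -
  note CD = Cinf_mixed_hodge_diagramD[OF D]
  interpret C: mhc_core K D by (rule mhc_core_if_mixed_hodge_complex[OF K CD(1)])
  have ml: "multilinear (cpt D i) (cpt D i) 2 (opr D i)" if "i \<le> len D" for i
    using CD(2)[OF that] by (simp add: Cinf_algebra_def)
  have mlh: "multilinear (cpt D r) (cpt D q) 1 (hmor D r q)" if "(r, q) \<in> arrows (len D)" for r q
    using CD(7)[OF that] by (simp add: Cinf_morphism_def)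
  show ?thesis
  proof (intro mhc_mult.intro mhc_core_mhd_of[OF C.mhc_core_axioms] mhc_mult_axioms.intro, unfold mhd_of_sel quadratic_part_def)
    fix i and a b n k l p p' :: int and x y :: 'a
    show "linear_between (cpt D i b) (cpt D i (a + b)) (\<lambda>y. opr D i [(a, x), (b, y)])" if "i \<le> len D" "x \<in> cpt D i a"
      by (rule multilinear_2r[OF ml[OF that(1)] that(2)]) simp
    show "linear_between (cpt D i a) (cpt D i (a + b)) (\<lambda>x. opr D i [(a, x), (b, y)])" if "i \<le> len D" "y \<in> cpt D i b"
      by (rule multilinear_2l[OF ml[OF that(1)] that(2)]) simp
    show "opr D i [(a, x), (b, y)] \<in> wt D i (k + l) (a + b)" if "i \<le> len D" "x \<in> wt D i k a" "y \<in> wt D i l b"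
      by (rule filtration_2[OF CD(4)[OF that(1)] that(2,3)]) simp
    show "opr D 0 [(a, x), (b, y)] \<in> rat D (a + b)" if "x \<in> rat D a" "y \<in> rat D b"
      by (rule maps_into_2[OF CD(5) that]) simp
    show "opr D (len D) [(a, x), (b, y)] \<in> hdg D (p + p') (a + b)" if "x \<in> hdg D p a" "y \<in> hdg D p' b"
      by (rule filtration_2[OF CD(6) that]) simp
    show "dif D i n (opr D i [(a, x), (b, y)]) =
       opr D i [(a + 1, dif D i a x), (b, y)] + sgn_pow a (opr D i [(a, x), (b + 1, dif D i b y)])"
      if i: "i \<le> len D" and xy: "x \<in> cpt D i a" "y \<in> cpt D i b" and n: "n = a + b"
    proof -
      have "opr D i [(a, x), (b, y)] \<in> cpt D i (a + b)"
        using maps_into_2[of "cpt D i" "cpt D i" 2 "opr D i" x a y b "a + b"] ml[OF i] xy by (simp add: multilinear_def)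
      then show ?thesis using Cinf_algebra_rel_2[OF CD(2)[OF i] xy] CD(3)[OF i] xy n by simp
    qed
    fix r q assume rq: "(r, q) \<in> arrows (len D)"
    note le = arrows_le[OF rq]
    show "linear_between (cpt D r b) (cpt D q (a + b - 1)) (\<lambda>y. hmor D r q [(a, x), (b, y)])" if "x \<in> cpt D r a"
      by (rule multilinear_2r[OF mlh[OF rq] that]) simp
    show "linear_between (cpt D r a) (cpt D q (a + b - 1)) (\<lambda>x. hmor D r q [(a, x), (b, y)])" if "y \<in> cpt D r b"
      by (rule multilinear_2l[OF mlh[OF rq] that]) simp
    show "hmor D r q [(a, x), (b, y)] \<in> wt D q (k + l) (a + b - 1)" if "x \<in> wt D r k a" "y \<in> wt D r l b"
      by (rule filtration_2[OF CD(9)[OF rq] that]) simp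
    show "cmp D r q (a + b) (opr D r [(a, x), (b, y)]) = opr D q [(a, cmp D r q a x), (b, cmp D r q b y)]
        + dif D q (a + b - 1) (hmor D r q [(a, x), (b, y)])
        + hmor D r q [(a + 1, dif D r a x), (b, y)] + sgn_pow a (hmor D r q [(a, x), (b + 1, dif D r b y)])"
      if xy: "x \<in> cpt D r a" "y \<in> cpt D r b"
    proof -
      have m: "opr D r [(a, x), (b, y)] \<in> cpt D r (a + b)"
        using maps_into_2[of "cpt D r" "cpt D r" 2 "opr D r" x a y b "a + b"] ml[of r] le xy by (simp add: multilinear_def)
      have h: "hmor D r q [(a, x), (b, y)] \<in> cpt D q (a + b - 1)"
        using maps_into_2[of "cpt D r" "cpt D q" 1 "hmor D r q" x a y b "a + b - 1"] mlh[OF rq] xy by (simp add: multilinear_def)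
      show ?thesis
        using Cinf_morphism_rel_2[OF CD(7)[OF rq] xy] CD(8)[OF rq m] CD(8)[OF rq xy(1)] CD(8)[OF rq xy(2)]
          CD(3)[of q _ "a + b - 1"] CD(3)[of r x a] CD(3)[of r y b] le xy h by simp
    qed
  qed
qed

text \<open>Padding to a common even length \<open>N\<close> makes diagrams of different lengths
  comparable.\<close>

definition has_splitting :: "complex set \<Rightarrow> real \<Rightarrow> nat \<Rightarrow> 'a::complex_vector mhd \<Rightarrow>
    (nat \<Rightarrow> nat \<Rightarrow> int \<Rightarrow> int \<Rightarrow> 'a \<Rightarrow> 'a \<Rightarrow> 'a) \<Rightarrow> bool" where
  "has_splitting K \<alpha> N A h \<longleftrightarrow>
     (\<exists>S. db_splitting K (pad_mhd N A) (dbM \<alpha> (pad_mhd N A) (pad_h (len A) h)) S)"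

lemma db_alg_pad: "mhc_mult K A h ==> len A \<le> N ==> even N ==> db_alg K (pad_mhd N A) (pad_h (len A) h)"
  using mhc_mult_pad[of K A h N]
  by (intro db_alg.intro even_core.intro even_core_axioms.intro) (auto simp: mhc_mult_def)

text \<open>Applied with \<open>c = tate p\<close>, it turns \<open>iso_R\<close> into the statement
  about the twisted rational terms of the cochain complex.\<close>

lemma quotient_iso_scale:
  assumes q: "quotient_iso f (S \<inter> Z) (d ` T) (S' \<inter> Z') (d' ` T')" and c: "c \<noteq> 0"
    and f: "\<And>x. x \<in> S ==> f (c *\<^sub>C x) = c *\<^sub>C f x" and d: "\<And>x. x \<in> T ==> d (c *\<^sub>C x) = c *\<^sub>C d x"
    and d': "\<And>x. x \<in> T' ==> d' (c *\<^sub>C x) = c *\<^sub>C d' x" and dT: "d ` T \<subseteq> S"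
    and Z: "\<And>x e. x \<in> Z ==> e *\<^sub>C x \<in> Z" "\<And>x e. x \<in> Z' ==> e *\<^sub>C x \<in> Z'"
  shows "quotient_iso f ((\<lambda>x. c *\<^sub>C x) ` S \<inter> Z) (d ` (\<lambda>x. c *\<^sub>C x) ` T) ((\<lambda>x. c *\<^sub>C x) ` S' \<inter> Z') (d' ` (\<lambda>x. c *\<^sub>C x) ` T')"
proof -
  have dc: "d ` (\<lambda>x. c *\<^sub>C x) ` T = (\<lambda>x. c *\<^sub>C x) ` d ` T" "d' ` (\<lambda>x. c *\<^sub>C x) ` T' = (\<lambda>x. c *\<^sub>C x) ` d' ` T'"
    using d d' by (auto simp: image_iff)
  have inv: "inverse c *\<^sub>C c *\<^sub>C x = x" for x :: "'z::complex_vector" using c by simp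
  have Zc: "c *\<^sub>C x \<in> Z \<longleftrightarrow> x \<in> Z" for x using Z(1)[of "c *\<^sub>C x" "inverse c"] Z(1)[of x c] inv[of x] by metis
  have Zc': "c *\<^sub>C x \<in> Z' \<longleftrightarrow> x \<in> Z'" for x using Z(2)[of "c *\<^sub>C x" "inverse c"] Z(2)[of x c] inv[of x] by metis
  show ?thesis unfolding dc
  proof (rule quotient_isoI)
    fix x assume "x \<in> (\<lambda>x. c *\<^sub>C x) ` S \<inter> Z"
    then obtain s where s: "s \<in> S" "x = c *\<^sub>C s" "s \<in> Z" using Zc by blast
    have "f s \<in> S' \<inter> Z'" by (rule quotient_isoD(1)[OF q]) (use s in blast)
    then show "f x \<in> (\<lambda>x. c *\<^sub>C x) ` S' \<inter> Z'" unfolding s(2) f[OF s(1)] using Zc' by blast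
    assume "f x \<in> (\<lambda>x. c *\<^sub>C x) ` d' ` T'"
    then obtain t where t: "t \<in> d' ` T'" "c *\<^sub>C f s = c *\<^sub>C t" unfolding s(2) f[OF s(1)] by blast
    then have "f s = t" using inv by metis
    then have "s \<in> d ` T" using quotient_isoD(3)[OF q, of s] s t(1) by blast
    then show "x \<in> (\<lambda>x. c *\<^sub>C x) ` d ` T" using s(2) by blast
  next
    fix x assume "x \<in> (\<lambda>x. c *\<^sub>C x) ` d ` T"
    then obtain s where s: "s \<in> d ` T" "x = c *\<^sub>C s" by blast
    then show "f x \<in> (\<lambda>x. c *\<^sub>C x) ` d' ` T'" using quotient_isoD(2)[OF q s(1)] f[of s] dT by blast
  next
    fix y assume "y \<in> (\<lambda>x. c *\<^sub>C x) ` S' \<inter> Z'"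
    then obtain t where t: "t \<in> S'" "y = c *\<^sub>C t" "t \<in> Z'" using Zc' by blast
    then obtain s where s: "s \<in> S" "s \<in> Z" "f s - t \<in> d' ` T'" using quotient_isoD(4)[OF q, of t] by blast
    have "f (c *\<^sub>C s) - y = c *\<^sub>C (f s - t)" unfolding f[OF s(1)] t(2) by (simp add: scaleC.scale_right_diff_distrib)
    then show "\<exists>x\<in>(\<lambda>x. c *\<^sub>C x) ` S \<inter> Z. f x - y \<in> (\<lambda>x. c *\<^sub>C x) ` d' ` T'" using s Zc by (metis IntI imageI)
  qed
qed

lemma mhc_pure_if_mixed_hodge_complex: "real_subfield K ==> mixed_hodge_complex K D ==> mhc_pure K D"
  using mhc_core_if_mixed_hodge_complex[of K D]
  by (intro mhc_pure.intro mhc_pure_axioms.intro) (simp_all add: mixed_hodge_complex_def Let_def)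

text \<open>The linear part of \<open>g\<close> is an instance of \<open>mhc_map\<close>, hence an
  isomorphism on the cohomology of all filtered terms; the quadratic part serves as
  \<open>G2\<close>. Both are continued along the inserted identities by the value at the last
  component.\<close>

lemma inf_quasi_iso_transfer:
  assumes K: "real_subfield K" and D: "Cinf_mixed_hodge_diagram K D" and E: "Cinf_mixed_hodge_diagram K E"
    and g: "inf_quasi_iso D E g" and N: "len D \<le> N" "even N"
  shows "\<exists>T G. db_transfer K (pad_mhd N (mhd_of D)) (pad_h (len D) (quadratic_part D))
     (pad_mhd N (mhd_of E)) (pad_h (len E) (quadratic_part E)) \<alpha> T G"
proof -
  note CD = Cinf_mixed_hodge_diagramD[OF D] and CE = Cinf_mixed_hodge_diagramD[OF E]
  have gm: "inf_morphism D E g" using g by (simp add: inf_quasi_iso_def)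
  have le: "len E = len D" using gm by (simp add: inf_morphism_def)
  have gC: "Cinf_morphism (cpt D i) (opr D i) (cpt E i) (opr E i) (g i)"
    and gW: "filtration_preserving (wt D i) (wt E i) 1 (g i)" if "i \<le> len D" for i
    using gm that by (simp_all add: inf_morphism_def)
  have gR: "maps_into (rat D) (rat E) 1 (g 0)" and gF: "filtration_preserving (hdg D) (hdg E) 1 (g (len D))"
    using gm unfolding inf_morphism_def by blast+
  have comm: "compose_op (hmor E r q) (g r) xs = compose_op (g q) (hmor D r q) xs"
    if "(r, q) \<in> arrows (len D)" "xs \<in> homog (cpt D r)" "xs \<noteq> []" for r q xs
    using gm that unfolding inf_morphism_def by blast
  have gml: "multilinear (cpt D i) (cpt E i) 1 (g i)" if "i \<le> len D" for i using gC[OF that] by (simp add: Cinf_morphism_def)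
  have iso: "quotient_iso (\<lambda>x. g i [(n, x)]) (cocyc D i n) (cobd D i n) (cocyc E i n) (cobd E i n)" if "i \<le> len D" for i n
    using g that by (simp add: inf_quasi_iso_def)
  have isoR: "quotient_iso (\<lambda>x. g 0 [(n, x)])
        (cocycles (rat D) (dif D 0) n) (coboundaries (rat D) (dif D 0) n)
        (cocycles (rat E) (dif E 0) n) (coboundaries (rat E) (dif E 0) n)" for n
    using g by (simp add: inf_quasi_iso_def)
  have g1: "linear_between (cpt D i n) (cpt E i n) (\<lambda>x. g i [(n, x)])" if "i \<le> len D" for i n
    by (rule multilinear_1[OF gml[OF that]]) simp
  have g1V: "g i [(n, x)] \<in> cpt E i n" if "i \<le> len D" "x \<in> cpt D i n" for i n x
    using lin_mem[OF g1[OF that(1)] that(2)] .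
  have g2V: "g i [(a, x), (b, y)] \<in> cpt E i (a + b - 1)" if "i \<le> len D" "x \<in> cpt D i a" "y \<in> cpt D i b" for i a b x y
    using lin_mem[OF multilinear_2r[OF gml[OF that(1)] that(2), of "a + b - 1" b] that(3)] by simp
  have gd: "g i [(n + 1, dif D i n x)] = dif E i n (g i [(n, x)])" if "i \<le> len D" "x \<in> cpt D i n" for i n x
    using Cinf_morphism_rel_1[OF gC[OF that(1)] that(2)] CD(3)[OF that] CE(3)[OF _ g1V[OF that]] that(1) le by simp
  have gcmp: "cmp E r q n (g r [(n, x)]) = g q [(n, cmp D r q n x)]" if rq: "(r, q) \<in> arrows (len D)" and x: "x \<in> cpt D r n" for r q n x
  proof -
    have "hmor E r q [(n, g r [(n, x)])] = g q [(n, hmor D r q [(n, x)])]"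
      using comm[OF rq, of "[(n, x)]"] x by (simp add: homog_def compose_op_1)
    then show ?thesis using CD(8)[OF rq x] CE(8)[of r q "g r [(n, x)]" n] rq le g1V[of r x n] arrows_le[OF rq] x by simp
  qed
  note pureD = mhc_pure_if_mixed_hodge_complex[OF K CD(1)] and pureE = mhc_pure_if_mixed_hodge_complex[OF K CE(1)]
  interpret M: mhc_map K D E "\<lambda>i n x. g i [(n, x)]"
  proof (intro mhc_map.intro mhc_map_axioms.intro pureD pureE le g1 gd gcmp iso isoR)
    show "g i [(n, x)] \<in> wt E i k n" if "i \<le> len D" "x \<in> wt D i k n" for i x k n
      by (rule filtration_1[OF gW[OF that(1)] that(2)]) simp
    show "g 0 [(n, x)] \<in> rat E n" if "x \<in> rat D n" for x n by (rule maps_into_1[OF gR that]) simp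
    show "g (len D) [(n, x)] \<in> hdg E p n" if "x \<in> hdg D p n" for x p n by (rule filtration_1[OF gF that]) simp
  qed
  let ?B = "pad_mhd N (mhd_of D)" and ?E = "pad_mhd N (mhd_of E)" and ?L = "len D"
  let ?hD = "pad_h (len D) (quadratic_part D)" and ?hE = "pad_h (len E) (quadratic_part E)"
  define G where "G i m x = g (min i ?L) [(m, x)]" for i m x
  define G2 where "G2 i a b x y = g (min i ?L) [(a, x), (b, y)]" for i a b x y
  interpret XA: db_alg K ?B ?hD \<alpha>
    using db_alg_pad[OF mhc_mult_mhd_of[OF K D], of N] N by simp
  interpret YA: db_alg K ?E ?hE \<alpha>
    using db_alg_pad[OF mhc_mult_mhd_of[OF K E], of N] N le by simp
  have mL: "min i ?L \<le> ?L" for i by simp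
  have mN: "min N ?L = ?L" using N by simp
  have G_X: "G i m x \<in> dbX ?E p i m" if x: "x \<in> dbX ?B p i m" for i m x p
  proof -
    consider "i = 0" | "i = N" "i \<noteq> 0" | "i \<noteq> 0" "i \<noteq> N" by blast
    then show ?thesis
    proof cases
      case 1
      then obtain r where r: "r \<in> wt D 0 (2 * p) m" "r \<in> rat D m" "x = tate p *\<^sub>C r" using x by (auto simp: dbX_def)
      have "G i m x = tate p *\<^sub>C g 0 [(m, r)]"
        using lin_scale[OF g1[OF le0] M.X.W_V[OF le0 r(1)]] r(3) 1 by (simp add: G_def)
      then show ?thesis using M.g_W[OF le0 r(1)] M.g_R[OF r(2)] 1 by (auto simp: dbX_def)
    next
      case 2
      then show ?thesis using x M.g_W[OF order_refl] M.g_F by (auto simp: dbX_def G_def mN le)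
    next
      case 3
      then show ?thesis using x M.g_W[OF mL] by (simp add: dbX_def G_def le)
    qed
  qed
  have G_iso: "quotient_iso (G i m) (dbX ?B p i m \<inter> cocyc ?B i m) (dif ?B i (m - 1) ` dbX ?B p i (m - 1))
      (dbX ?E p i m \<inter> cocyc ?E i m) (dif ?E i (m - 1) ` dbX ?E p i (m - 1))" if i: "i \<le> N" for i m p
  proof -
    have cc: "cocyc ?B i m = cocyc D (min i ?L) m" "cocyc ?E i m = cocyc E (min i ?L) m"
      by (simp_all add: cocyc_def le)
    have Geq: "G i m = (\<lambda>x. g (min i ?L) [(m, x)])" by (rule ext) (simp add: G_def)
    consider "i = 0" | "i = N" "i \<noteq> 0" | "i \<noteq> 0" "i \<noteq> N" by blast
    then show ?thesis
    proof cases
      case 1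
      have "quotient_iso (\<lambda>x. g 0 [(m, x)]) ((\<lambda>x. tate p *\<^sub>C x) ` (wt D 0 (2 * p) m \<inter> rat D m) \<inter> cocyc D 0 m)
        (dif D 0 (m - 1) ` (\<lambda>x. tate p *\<^sub>C x) ` (wt D 0 (2 * p) (m - 1) \<inter> rat D (m - 1)))
        ((\<lambda>x. tate p *\<^sub>C x) ` (wt E 0 (2 * p) m \<inter> rat E m) \<inter> cocyc E 0 m)
        (dif E 0 (m - 1) ` (\<lambda>x. tate p *\<^sub>C x) ` (wt E 0 (2 * p) (m - 1) \<inter> rat E (m - 1)))"
      proof (rule quotient_iso_scale[OF M.iso_R tate_nonzero])
        show "g 0 [(m, tate p *\<^sub>C x)] = tate p *\<^sub>C g 0 [(m, x)]" if "x \<in> wt D 0 (2 * p) m \<inter> rat D m" for x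
          using lin_scale[OF g1[OF le0]] M.X.W_V[OF le0] that by blast
        show "dif D 0 (m - 1) (tate p *\<^sub>C x) = tate p *\<^sub>C dif D 0 (m - 1) x" if "x \<in> wt D 0 (2 * p) (m - 1) \<inter> rat D (m - 1)" for x
          using M.X.d_scale[OF le0] M.X.W_V[OF le0] that by blast
        show "dif E 0 (m - 1) (tate p *\<^sub>C x) = tate p *\<^sub>C dif E 0 (m - 1) x" if "x \<in> wt E 0 (2 * p) (m - 1) \<inter> rat E (m - 1)" for x
          using M.Y.d_scale[OF le0] M.Y.W_V[OF le0] that by blast
        show "dif D 0 (m - 1) ` (wt D 0 (2 * p) (m - 1) \<inter> rat D (m - 1)) \<subseteq> wt D 0 (2 * p) m \<inter> rat D m"
          using M.X.d_W'[OF le0] M.X.rat_dif' by blast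
        show "e *\<^sub>C x \<in> cocyc D 0 m" if "x \<in> cocyc D 0 m" for x e
        proof -
          have xV: "x \<in> cpt D 0 m" using that M.X.Z_V by blast
          show ?thesis using M.X.d_scale[OF le0 xV] M.X.Z_d[OF that] by (intro M.X.ZI[OF M.X.V_scale[OF le0 xV]]) simp
        qed
        show "e *\<^sub>C x \<in> cocyc E 0 m" if "x \<in> cocyc E 0 m" for x e
        proof -
          have xV: "x \<in> cpt E 0 m" using that M.Y.Z_V by blast
          show ?thesis using M.Y.d_scale[OF le0 xV] M.Y.Z_d[OF that] by (intro M.Y.ZI[OF M.Y.V_scale[OF le0 xV]]) simp
        qed
      qed
      then show ?thesis unfolding Geq cc unfolding 1 by (simp add: dbX_def)
    next
      case 2
      have "dbX ?B p i m' = hdg D p m' \<inter> wt D ?L (2 * p) m'" "dbX ?E p i m' = hdg E p m' \<inter> wt E ?L (2 * p) m'" for m'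
        using 2 mN le by (auto simp: dbX_def)
      moreover have "min i ?L = ?L" "dif ?B i = dif D ?L" "dif ?E i = dif E ?L" using 2 mN le by auto
      ultimately show ?thesis unfolding Geq cc using M.iso_F by simp
    next
      case 3
      have "dbX ?B p i m' = wt D (min i ?L) (2 * p) m'" "dbX ?E p i m' = wt E (min i ?L) (2 * p) m'" for m'
        using 3 le by (auto simp: dbX_def)
      moreover have "dif ?B i = dif D (min i ?L)" "dif ?E i = dif E (min i ?L)" using le by auto
      ultimately show ?thesis unfolding Geq cc using M.iso_W[OF mL] by simp
    qed
  qed
  have "db_alg_map K ?B ?E G ?hD ?hE G2"
  proof (intro db_alg_map.intro db_map.intro db_map_axioms.intro db_alg_map_axioms.intro
      XA.db_alg_axioms YA.db_alg_axioms XA.even_core_axioms YA.even_core_axioms)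
    show "len ?E = len ?B" by simp
    fix i and m n a b k l p p' :: int and x y :: 'a
    show "linear_between (cpt ?B i m) (cpt ?E i m) (G i m)" using g1[OF mL] by (simp add: G_def[abs_def] le)
    show "G i (m + 1) (dif ?B i m x) = dif ?E i m (G i m x)" if "x \<in> cpt ?B i m"
      using gd[OF mL] that by (simp add: G_def le)
    show "G i m x \<in> dbX ?E p i m" if "x \<in> dbX ?B p i m" by (rule G_X[OF that])
    show "quotient_iso (G i m) (dbX ?B p i m \<inter> cocyc ?B i m) (dif ?B i (m - 1) ` dbX ?B p i (m - 1))
      (dbX ?E p i m \<inter> cocyc ?E i m) (dif ?E i (m - 1) ` dbX ?E p i (m - 1))" if "i \<le> len ?B"
      using G_iso that by simp
    show "linear_between (cpt ?B i b) (cpt ?E i (a + b - 1)) (G2 i a b x)" if "x \<in> cpt ?B i a"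
      using multilinear_2r[OF gml[OF mL], of x i a "a + b - 1" b] that by (simp add: G2_def[abs_def] le)
    show "linear_between (cpt ?B i a) (cpt ?E i (a + b - 1)) (\<lambda>x. G2 i a b x y)" if "y \<in> cpt ?B i b"
      using multilinear_2l[OF gml[OF mL], of y i b "a + b - 1" a] that by (simp add: G2_def[abs_def] le)
    show G2W: "G2 i a b x y \<in> wt ?E i (k + l) n" if "x \<in> wt ?B i k a" "y \<in> wt ?B i l b" "n = a + b - 1" for i k l x y n
      using filtration_2[OF gW[OF mL], of x i k a y l b n] that by (simp add: G2_def le)
    show "G2 i a b x y \<in> dbX ?E (p + p') i (a + b - 1)" if x: "x \<in> dbX ?B p i a" and y: "y \<in> dbX ?B p' i b" and i: "i \<le> len ?B"
    proof -
      have W: "G2 i a b x y \<in> wt ?E i (2 * (p + p')) (a + b - 1)"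
        using G2W[OF XA.dbX_W[OF i x] XA.dbX_W[OF i y] refl] by (simp add: distrib_left)
      consider "i = 0" | "i = N" "i \<noteq> 0" | "i \<noteq> 0" "i \<noteq> N" by blast
      then show ?thesis
      proof cases
        case 1
        obtain r where r: "r \<in> wt D 0 (2 * p) a" "r \<in> rat D a" "x = tate p *\<^sub>C r" using x 1 by (auto simp: dbX_def)
        obtain s where s: "s \<in> wt D 0 (2 * p') b" "s \<in> rat D b" "y = tate p' *\<^sub>C s" using y 1 by (auto simp: dbX_def)
        note rV = M.X.W_V[OF le0 r(1)] and sV = M.X.W_V[OF le0 s(1)]
        have "g 0 [(a, x), (b, y)] = tate p *\<^sub>C g 0 [(a, r), (b, y)]"
          using lin_scale[OF multilinear_2l[OF gml[OF le0], of y b "a + b - 1" a] rV] M.X.V_scale[OF le0 sV] r(3) s(3) by simp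
        also have "g 0 [(a, r), (b, y)] = tate p' *\<^sub>C g 0 [(a, r), (b, s)]"
          using lin_scale[OF multilinear_2r[OF gml[OF le0] rV, of "a + b - 1" b] sV] s(3) by simp
        finally have eq: "G2 i a b x y = tate (p + p') *\<^sub>C g 0 [(a, r), (b, s)]" using 1 by (simp add: G2_def tate_add)
        have "g 0 [(a, r), (b, s)] \<in> wt E 0 (2 * (p + p')) (a + b - 1)"
          using filtration_2[OF gW[OF le0] r(1) s(1), of "a + b - 1"] by (simp add: distrib_left)
        moreover have "g 0 [(a, r), (b, s)] \<in> rat E (a + b - 1)" by (rule maps_into_2[OF gR r(2) s(2)]) simp
        ultimately show ?thesis unfolding eq using 1 by (simp add: dbX_def) (rule imageI, simp)
      next
        case 2
        have xF: "x \<in> hdg D p a" "y \<in> hdg D p' b" using x y 2 by (auto simp: dbX_def)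
        have "g ?L [(a, x), (b, y)] \<in> hdg E (p + p') (a + b - 1)"
          by (rule filtration_2[OF gF xF]) simp
        then show ?thesis using W 2 mN by (simp add: dbX_def G2_def)
      next
        case 3
        then show ?thesis using W by (simp add: dbX_def)
      qed
    qed
    show "G i n (mul ?B i a b x y) = mul ?E i a b (G i a x) (G i b y) + dif ?E i (n - 1) (G2 i a b x y)
        + G2 i (a + 1) b (dif ?B i a x) y + sgn_pow a (G2 i a (b + 1) x (dif ?B i b y))"
      if xy: "x \<in> cpt ?B i a" "y \<in> cpt ?B i b" and n: "n = a + b"
    proof -
      have V: "x \<in> cpt D (min i ?L) a" "y \<in> cpt D (min i ?L) b" using xy by auto
      have "min i ?L \<le> len E" using le by simp
      then show ?thesis
        using Cinf_morphism_rel_2[OF gC[OF mL] V] CD(3)[OF mL V(1)] CD(3)[OF mL V(2)] CE(3)[of "min i ?L" _ "a + b - 1"]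
          g2V[OF mL V] n by (simp add: G_def G2_def le)
    qed
    show "G (len ?B) m x \<in> cobd ?E (len ?B) m \<longleftrightarrow> x \<in> cobd ?B (len ?B) m" if x: "x \<in> cocyc ?B (len ?B) m"
    proof -
      have c: "cobd ?E N m = cobd E ?L m" "cobd ?B N m = cobd D ?L m" "cocyc ?B N m = cocyc D ?L m"
        using mN le by (simp_all add: cobd_def cocyc_def)
      have x': "x \<in> cocyc D ?L m" using x c(3) by simp
      have "g ?L [(m, x)] \<in> cobd E ?L m \<longleftrightarrow> x \<in> cobd D ?L m"
        using quotient_isoD(2,3)[OF iso[OF order_refl]] x' by blast
      then show ?thesis using c mN by (simp add: G_def)
    qed
    fix r q assume rq: "(r, q) \<in> arrows (len ?B)"
    then have rqN: "(r, q) \<in> arrows N" by simp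
    note ap = arrows_pad[OF rqN, of ?L]
    show "cmp ?E r q m (G r m x) = G q m (cmp ?B r q m x)" if "x \<in> cpt ?B r m"
    proof (cases "r \<le> ?L \<and> q \<le> ?L")
      case True
      then show ?thesis using gcmp[of r q x m] that ap by (simp add: G_def le min_absorb1)
    next
      case False
      then have "min r ?L = ?L" "min q ?L = ?L" using ap by auto
      then show ?thesis using False by (auto simp: G_def le)
    qed
    show "cmp ?E r q (a + b - 1) (G2 r a b x y) + ?hE r q a b (G r a x) (G r b y) =
      G q (a + b - 1) (?hD r q a b x y) + G2 q a b (cmp ?B r q a x) (cmp ?B r q b y)"
      if xy: "x \<in> cpt ?B r a" "y \<in> cpt ?B r b"
    proof (cases "r \<le> ?L \<and> q \<le> ?L")
      case True
      then have ar: "(r, q) \<in> arrows ?L" "(r, q) \<in> arrows (len E)" using ap le by auto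
      have V: "x \<in> cpt D r a" "y \<in> cpt D r b" using xy True by (auto simp: min_absorb1)
      have rle: "r \<le> ?L" using True by blast
      have "compose_op (hmor E r q) (g r) [(a, x), (b, y)] = compose_op (g q) (hmor D r q) [(a, x), (b, y)]"
        using comm[OF ar(1), of "[(a, x), (b, y)]"] V by (simp add: homog_def)
      then have "cmp E r q (a + b - 1) (g r [(a, x), (b, y)]) + hmor E r q [(a, g r [(a, x)]), (b, g r [(b, y)])]
        = g q [(a + b - 1, hmor D r q [(a, x), (b, y)])] + g q [(a, cmp D r q a x), (b, cmp D r q b y)]"
        unfolding compose_op_2 CE(8)[OF ar(2) g2V[OF rle V]] CD(8)[OF ar(1) V(1)] CD(8)[OF ar(1) V(2)] .
      then show ?thesis using True le by (simp add: G_def G2_def pad_h_def quadratic_part_def min_absorb1)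
    next
      case False
      then have m: "min r ?L = ?L" "min q ?L = ?L" using ap by auto
      have z: "g ?L [(a + b - 1, 0)] = 0" using lin_zero[OF g1[OF order_refl] M.X.csub_V[OF order_refl]] .
      have h: "?hD r q a b x y = 0" "?hE r q a b (G r a x) (G r b y) = 0" using False le by (auto simp: pad_h_def)
      show ?thesis unfolding h using False le z m by (auto simp: G_def G2_def)
    qed
  qed
  then show ?thesis using db_alg_map.transfer by blast
qed

lemma has_splitting_transfer:
  assumes "db_transfer K (pad_mhd N A) (pad_h (len A) h) (pad_mhd N' E) (pad_h (len E) h') \<alpha> T G"
  shows "has_splitting K \<alpha> N A h \<longleftrightarrow> has_splitting K \<alpha> N' E h'"
  using db_transfer.pull[OF assms] db_transfer.push[OF assms] unfolding has_splitting_def by blast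

lemma quasi_iso_step_len: "quasi_iso_step K D E ==> len E = len D"
  by (auto simp: quasi_iso_step_def inf_quasi_iso_def inf_morphism_def)

lemma quasi_iso_step_splitting:
  assumes K: "real_subfield K" and s: "quasi_iso_step K D E" and N: "len D \<le> N" "even N"
  shows "has_splitting K \<alpha> N (mhd_of D) (quadratic_part D) \<longleftrightarrow> has_splitting K \<alpha> N (mhd_of E) (quadratic_part E)"
proof -
  have DE: "Cinf_mixed_hodge_diagram K D" "Cinf_mixed_hodge_diagram K E" "(\<exists>g. inf_quasi_iso D E g) \<or> (\<exists>g. inf_quasi_iso E D g)"
    using s by (simp_all add: quasi_iso_step_def)
  note l = quasi_iso_step_len[OF s]
  show ?thesis
    using DE(3)
  proof
    assume "\<exists>g. inf_quasi_iso D E g"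
    then obtain g where g: "inf_quasi_iso D E g" ..
    obtain T G where "db_transfer K (pad_mhd N (mhd_of D)) (pad_h (len D) (quadratic_part D))
     (pad_mhd N (mhd_of E)) (pad_h (len E) (quadratic_part E)) \<alpha> T G"
      using inf_quasi_iso_transfer[OF K DE(1,2) g N] by blast
    then show ?thesis using has_splitting_transfer[of K N "mhd_of D" _ N "mhd_of E"] by simp
  next
    assume "\<exists>g. inf_quasi_iso E D g"
    then obtain g where g: "inf_quasi_iso E D g" ..
    have NE: "len E \<le> N" using N l by simp
    obtain T G where "db_transfer K (pad_mhd N (mhd_of E)) (pad_h (len E) (quadratic_part E))
     (pad_mhd N (mhd_of D)) (pad_h (len D) (quadratic_part D)) \<alpha> T G"
      using inf_quasi_iso_transfer[OF K DE(2,1) g NE N(2)] by blast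
    then show ?thesis using has_splitting_transfer[of K N "mhd_of E" _ N "mhd_of D"] by simp
  qed
qed

section \<open>Splitting the formal model\<close>

lemma lin_cong:
  "linear_between V V' f ==> subspace_over UNIV V ==> (\<And>x. x \<in> V ==> f x = g x) ==> linear_between V V' g"
  by (auto simp: linear_between_def subspace_over_def)

lemma lin_sum:
  assumes f: "linear_between V V' f" and V: "subspace_over UNIV V" and z: "\<And>j::nat. j < n ==> z j \<in> V"
  shows "f (\<Sum>j<n. z j) = (\<Sum>j<n. f (z j))"
proof -
  have "(\<Sum>j<k. z j) \<in> V \<and> f (\<Sum>j<k. z j) = (\<Sum>j<k. f (z j))" if "k \<le> n" for k
    using that
  proof (induction k)
    case (Suc k)
    then show ?case using lin_add[OF f, of _ "z k"] grp_add[OF csub_grp[OF V], of _ "z k"] z[of k] by simp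
  qed (simp add: lin_zero[OF f V] grp_zero[OF csub_grp[OF V]])
  then show ?thesis by blast
qed

text \<open>The padded model: one graded space \<open>V\<close> in all components, and a homotopy on
  the arrow \<open>(0, 1)\<close> alone. The equation \<open>h_eq\<close> is the third component of
  a relation in the Harrison cone, spelled out on two arguments.\<close>

locale formal_model = db_alg K B h \<alpha> for K and B :: "'a::complex_vector mhd" and h \<alpha> +
  fixes V :: "'a graded" and W :: "'a filtered" and \<mu> f g :: "int \<Rightarrow> int \<Rightarrow> 'a \<Rightarrow> 'a \<Rightarrow> 'a" and e :: "int \<Rightarrow> 'a \<Rightarrow> 'a"
  assumes cpt_V: "i \<le> len B ==> cpt B i = V"
    and wt_W: "i \<le> len B ==> wt B i = W"
    and dif_zero: "i \<le> len B ==> x \<in> V n ==> dif B i n x = 0"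
    and cmp_id: "(r, q) \<in> arrows (len B) ==> x \<in> V n ==> cmp B r q n x = x"
    and mul_\<mu>: "i \<le> len B ==> x \<in> V a ==> y \<in> V b ==> mul B i a b x y = \<mu> a b x y"
    and h_zero: "(r, q) \<in> arrows (len B) ==> (r, q) \<noteq> (0, 1) ==> h r q a b x y = 0"
    and h_eq: "x \<in> V a ==> y \<in> V b ==> h 0 1 a b x y =
      f a b x y - g a b x y - (sgn_pow a (\<mu> a (b - 1) x (e b y)) - e (a + b) (\<mu> a b x y) + \<mu> (a - 1) b (e a x) y)"
    and e_lin: "linear_between (V n) (V (n - 1)) (e n)"
    and e_W: "x \<in> W k n ==> e n x \<in> W k (n - 1)"
    and f_X: "x \<in> dbX B p 0 a ==> y \<in> dbX B p' 0 b ==> f a b x y \<in> dbX B (p + p') 0 (a + b - 1)"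
    and g_X: "x \<in> dbX B p (len B) a ==> y \<in> dbX B p' (len B) b ==> g a b x y \<in> dbX B (p + p') (len B) (a + b - 1)"
begin

text \<open>With identities as comparison morphisms, a coboundary changes each top component by the
  difference of the neighbouring bottoms, so the sum of all tops changes only by the difference of
  the two ends.\<close>

definition tot :: "(nat \<Rightarrow> 'a) \<Rightarrow> 'a" where
  "tot a = (\<Sum>j<N div 2. a (Suc (2 * j)))"

lemma odd_j: "j < N div 2 ==> odd (Suc (2 * j)) \<and> Suc (2 * j) < N"
  using even_len by auto

lemma odd_jE:
  assumes "odd q" "q < N" obtains j where "j < N div 2" "q = Suc (2 * j)"
proof
  show "q = Suc (2 * (q div 2))" using assms(1) by (auto elim!: oddE)
  then show "q div 2 < N div 2" using assms(2) even_len by (auto elim!: evenE)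
qed

lemma wt_V: "i \<le> N ==> x \<in> W k n ==> x \<in> V n"
  using W_V[of i x k n] cpt_V wt_W by simp

lemma gV: "add_subgroup (V n)" and gW: "add_subgroup (W k n)"
  using csub_grp[OF csub_V[OF le0]] csub_grp[OF csub_W[OF le0]] cpt_V[OF le0] wt_W[OF le0] by simp_all

lemma csub: "subspace_over UNIV (V n)" using csub_V[OF le0] cpt_V[OF le0] by simp

lemma \<mu>_lin_l: "y \<in> V b ==> linear_between (V a) (V (a + b)) (\<lambda>x. \<mu> a b x y)"
  using mul_lin_l[OF le0, of y b a] by (intro lin_cong[OF _ csub mul_\<mu>[OF le0]]) (simp_all add: cpt_V)

lemma \<mu>_lin_r: "x \<in> V a ==> linear_between (V b) (V (a + b)) (\<mu> a b x)"
  using mul_lin_r[OF le0, of x a b] by (intro lin_cong[OF _ csub mul_\<mu>[OF le0]]) (simp_all add: cpt_V)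

lemma X_W: "i \<le> N ==> x \<in> dbX B p i n ==> x \<in> W (2 * p) n" using dbX_W wt_W by simp

lemma X_V: "i \<le> N ==> x \<in> dbX B p i n ==> x \<in> V n" using dbX_V cpt_V by simp

lemma cobd_zero: "i \<le> N ==> cobd B i n = {0}"
  using dif_zero[of i _ "n - 1"] cpt_V grp_zero[OF gV] by (auto simp: cobd_def coboundaries_def image_iff)

lemma tot_diff: "tot (a - b) = tot a - tot b" by (simp add: tot_def sum_subtractf)

lemma tot_scale: "tot (\<lambda>i. c *\<^sub>C a i) = c *\<^sub>C tot a" by (simp add: tot_def scaleC.scale_sum_right)

lemma sum_W: "a \<in> dbC B p m ==> n \<le> N div 2 ==> (\<Sum>j<n. a (Suc (2 * j))) \<in> W (2 * p) (m - 1)"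
proof (induction n)
  case 0
  show ?case using grp_zero[OF gW] by simp
next
  case (Suc n)
  have q: "odd (Suc (2 * n))" "Suc (2 * n) < N" using odd_j[of n] Suc.prems(2) by auto
  have "a (Suc (2 * n)) \<in> W (2 * p) (m - 1)" using dbC_odd[OF Suc.prems(1) q] wt_W q by simp
  moreover have "(\<Sum>j<n. a (Suc (2 * j))) \<in> W (2 * p) (m - 1)" using Suc by simp
  ultimately show ?case using grp_add[OF gW] by simp
qed

lemma bottoms:
  assumes a: "a \<in> dZ B p m" shows "even i ==> i \<le> N ==> a i = a 0"
proof -
  have "2 * j \<le> N ==> a (2 * j) = a 0" for j
  proof (induction j)
    case (Suc j)
    have q: "odd (Suc (2 * j))" "Suc (2 * j) < N" using Suc.prems by auto
    have V: "a (2 * j) \<in> V m" "a (Suc (Suc (2 * j))) \<in> V m" "a (Suc (2 * j)) \<in> V (m - 1)"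
      using X_V[OF _ dbC_even[OF dZ_C[OF a]], of "2 * j"] X_V[OF _ dbC_even[OF dZ_C[OF a]], of "Suc (Suc (2 * j))"]
        wt_V[of "Suc (2 * j)"] dbC_odd[OF dZ_C[OF a] q] wt_W q by auto
    have "a (2 * j) - a (Suc (Suc (2 * j))) = 0"
      using dZ_odd[OF a q] cmp_id[OF arrow_left[OF q]] cmp_id[OF arrow_right[OF q]] V dif_zero[OF _ V(3)] q by simp
    then show ?case using Suc by simp
  qed simp
  then show "even i ==> i \<le> N ==> a i = a 0" by (auto elim!: evenE)
qed

text \<open>Modulo coboundaries, a cocycle is determined by its bottom \<open>a 0\<close> and the
  class of \<open>tot a\<close> in the Jacobian. Fixing the latter to be \<open>e\<close> of the
  former makes \<open>S\<close> the graph of a section.\<close>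

definition S :: "int \<Rightarrow> int \<Rightarrow> (nat \<Rightarrow> 'a) set" where
  "S p m = {a \<in> dZ B p m. \<exists>u\<in>dbX B p 0 (m - 1). \<exists>v\<in>dbX B p N (m - 1). tot a - e m (a 0) = u - v}"

lemma SI: "a \<in> dZ B p m ==> u \<in> dbX B p 0 (m - 1) ==> v \<in> dbX B p N (m - 1) ==> tot a - e m (a 0) = u - v ==> a \<in> S p m"
  unfolding S_def by blast

lemma SE:
  assumes "a \<in> S p m" obtains u v where "a \<in> dZ B p m" "u \<in> dbX B p 0 (m - 1)" "v \<in> dbX B p N (m - 1)" "tot a - e m (a 0) = u - v"
  using assms unfolding S_def by blast

lemma e_zero: "e n 0 = 0" using lin_zero[OF e_lin] csub_V[OF le0] cpt_V[OF le0] by metis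

lemma a0_V: "a \<in> dZ B p m ==> a 0 \<in> V m" by (rule X_V[OF le0 dbC_even[OF dZ_C]]) simp_all

lemma S_sub: "add_subgroup (S p m)"
  unfolding add_subgroup_def
proof (intro conjI ballI)
  show "0 \<in> S p m"
    by (rule SI[OF grp_zero[OF grp_dZ] dbX_zero[OF le0] dbX_zero[OF order_refl]]) (simp add: tot_def e_zero)
  fix a b assume "a \<in> S p m" "b \<in> S p m"
  then obtain u v u' v' where a: "a \<in> dZ B p m" "u \<in> dbX B p 0 (m - 1)" "v \<in> dbX B p N (m - 1)" "tot a - e m (a 0) = u - v"
    and b: "b \<in> dZ B p m" "u' \<in> dbX B p 0 (m - 1)" "v' \<in> dbX B p N (m - 1)" "tot b - e m (b 0) = u' - v'"
    using SE by metis
  have "e m (a 0 - b 0) = e m (a 0) - e m (b 0)"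
    using lin_diff[OF e_lin] csub_V[OF le0] cpt_V[OF le0] a0_V[OF a(1)] a0_V[OF b(1)] by metis
  then have "tot (a - b) - e m ((a - b) 0) = (tot a - e m (a 0)) - (tot b - e m (b 0))" by (simp add: tot_diff)
  also have "\<dots> = (u - u') - (v - v')" unfolding a(4) b(4) by simp
  finally show "a - b \<in> S p m"
    by (rule SI[OF grp_diff[OF grp_dZ a(1) b(1)] dbX_diff[OF le0 a(2) b(2)] dbX_diff[OF order_refl a(3) b(3)]])
qed

text \<open>The sum of the tops of a coboundary telescopes to \<open>c 0 - c N\<close>, a rational
  element minus one in \<open>F\<close>, and its bottoms vanish because all differentials
  do.\<close>

lemma S_B: "dB B p m \<subseteq> S p m"
proof
  fix a assume aB: "a \<in> dB B p m"
  then obtain c where c: "c \<in> dbC B p (m - 1)" "a = dbD B (m - 1) c" by (auto simp: dB_def)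
  have cX: "even i ==> i \<le> N ==> c i \<in> dbX B p i (m - 1)" for i by (rule dbC_even[OF c(1)])
  have a0: "a 0 = 0" unfolding c(2) using dbD_even[of 0] dif_zero[OF le0 X_V[OF le0 cX[of 0]]] by simp
  have "a (Suc (2 * j)) = c (2 * j) - c (2 * Suc j)" if "j < N div 2" for j
  proof -
    have q: "odd (Suc (2 * j))" "Suc (2 * j) < N" using odd_j[OF that] by auto
    have "c (2 * j) \<in> V (m - 1)" "c (Suc (Suc (2 * j))) \<in> V (m - 1)" "c (Suc (2 * j)) \<in> V (m - 1 - 1)"
      using X_V[OF _ cX, of "2 * j"] X_V[OF _ cX, of "Suc (Suc (2 * j))"] wt_V[of "Suc (2 * j)"] dbC_odd[OF c(1) q] wt_W q by auto
    then show ?thesis unfolding c(2) dbD_odd[OF q]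
      using cmp_id[OF arrow_left[OF q]] cmp_id[OF arrow_right[OF q]] dif_zero q by simp
  qed
  then have "tot a = (\<Sum>j<N div 2. c (2 * j) - c (2 * Suc j))" by (simp add: tot_def)
  also have "\<dots> = c 0 - c N" using sum_lessThan_telescope'[of "\<lambda>j. c (2 * j)" "N div 2"] even_len by simp
  finally have "tot a - e m (a 0) = c 0 - c N" using a0 e_zero by simp
  then show "a \<in> S p m" using SI[OF _ cX[of 0] cX[of "N"]] dB_dZ aB even_len by blast
qed

lemma S_scale:
  assumes c: "c \<in> K" and "a \<in> S p m" shows "(\<lambda>i. c *\<^sub>C a i) \<in> S p m"
proof -
  obtain u v where a: "a \<in> dZ B p m" "u \<in> dbX B p 0 (m - 1)" "v \<in> dbX B p N (m - 1)" "tot a - e m (a 0) = u - v"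
    using SE[OF assms(2)] .
  have "tot (\<lambda>i. c *\<^sub>C a i) - e m (c *\<^sub>C a 0) = c *\<^sub>C (tot a - e m (a 0))"
    using lin_scale[OF e_lin a0_V[OF a(1)]] by (simp add: tot_scale scaleC.scale_right_diff_distrib)
  also have "\<dots> = c *\<^sub>C u - c *\<^sub>C v" unfolding a(4) by (simp add: scaleC.scale_right_diff_distrib)
  finally show ?thesis
    by (rule SI[OF dZ_scale[OF c a(1)] dbX_scale[OF le0 c a(2)] dbX_scale[OF order_refl c a(3)]])
qed

lemma S_ex:
  assumes a: "a \<in> dZ B p m" shows "\<exists>s\<in>S p m. a N - s N \<in> cobd B N m"
proof -
  note aC = dZ_C[OF a]
  define y where "y = tot a - e m (a 0)"
  have yW: "y \<in> W (2 * p) (m - 1)"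
    unfolding y_def tot_def by (intro grp_diff[OF gW] sum_W[OF aC] e_W X_W[OF le0] dbC_even[OF aC]) auto
  \<comment> \<open>The excess over \<open>e\<close> is taken out of the first top component. With
    zero differentials the result is still a cocycle, and only the sum of the tops is
    prescribed.\<close>
  define s where "s = a(1 := a 1 - y)"
  have s: "even i ==> s i = a i" for i by (auto simp: s_def)
  have sW: "s q \<in> W (2 * p) (m - 1)" if "odd q" "q < N" for q
    using grp_diff[OF gW _ yW] dbC_odd[OF aC that] wt_W that by (auto simp: s_def)
  have sC: "s \<in> dbC B p m"
  proof (rule dbCI)
    show "s i \<in> dbX B p i m" if "even i" "i \<le> N" for i using dbC_even[OF aC that] s that by simp
    show "s q \<in> wt B q (2 * p) (m - 1)" if "odd q" "q < N" for q using sW[OF that] wt_W that by simp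
    show "s i = 0" if "i > N" for i using dbC_out[OF aC that] that len2 by (simp add: s_def)
  qed
  have sZ: "s \<in> dZ B p m"
  proof (rule dZI[OF sC])
    show "dif B i m (s i) = 0" if "even i" "i \<le> N" for i using dZ_even[OF a that] s that by simp
    fix q assume q: "odd q" "q < N"
    have V: "a q \<in> V (m - 1)" "s q \<in> V (m - 1)" using wt_V[of q] dbC_odd[OF aC q] sW[OF q] wt_W q by auto
    have "dif B q (m - 1) (s q) = dif B q (m - 1) (a q)" using dif_zero V q by simp
    then show "cmp B (q - 1) q m (s (q - 1)) - cmp B (Suc q) q m (s (Suc q)) = dif B q (m - 1) (s q)"
      using dZ_odd[OF a q] s q by simp
  qed
  have n: "N div 2 = Suc (N div 2 - 1)" using len2 by simp
  have "s (Suc (2 * j)) = a (Suc (2 * j)) - (if j = 0 then y else 0)" for j by (simp add: s_def One_nat_def)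
  then have "tot s = tot a - (\<Sum>j<N div 2. if j = 0 then y else 0)" by (simp add: tot_def sum_subtractf)
  also have "(\<Sum>j<N div 2. if j = 0 then y else 0) = y" using len2 by (simp add: sum.delta)
  finally have "tot s - e m (s 0) = 0 - 0" using s[of 0] by (simp add: y_def)
  then have "s \<in> S p m" by (rule SI[OF sZ dbX_zero[OF le0] dbX_zero[OF order_refl]])
  moreover have "a N - s N \<in> cobd B N m" using s[OF even_len] cobd_zero by simp
  ultimately show ?thesis by blast
qed

lemma S_inj:
  assumes "a \<in> S p m" and aN: "a N \<in> cobd B N m" shows "a \<in> dB B p m"
proof -
  obtain u v where a: "a \<in> dZ B p m" and u: "u \<in> dbX B p 0 (m - 1)" and v: "v \<in> dbX B p N (m - 1)"
    and uv: "tot a - e m (a 0) = u - v"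
    using SE[OF assms(1)] .
  note aC = dZ_C[OF a]
  have "a 0 = 0" using bottoms[OF a even_len order_refl] aN cobd_zero[OF order_refl] by simp
  then have az: "even i ==> i \<le> N ==> a i = 0" for i using bottoms[OF a] by metis
  have tv: "u - tot a = v" using uv \<open>a 0 = 0\<close> e_zero by simp
  \<comment> \<open>A primitive of \<open>a\<close>: start with \<open>u\<close> at the left end and
    subtract the tops one after the other. The right end is then \<open>u - tot a = v\<close>, which
    lies in the required step of \<open>F\<close>.\<close>
  define w where "w i = u - (\<Sum>j<i div 2. a (Suc (2 * j)))" for i
  define c where "c = mk_cochain B w (\<lambda>q. 0)"
  have wW: "w i \<in> W (2 * p) (m - 1)" if "i \<le> N" for i
    unfolding w_def using that by (intro grp_diff[OF gW] X_W[OF le0 u] sum_W[OF aC]) auto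
  have wX: "w i \<in> dbX B p i (m - 1)" if "even i" "i \<le> N" for i
  proof -
    consider "i = 0" | "i = N" | "i \<noteq> 0" "i \<noteq> N" by blast
    then show ?thesis
    proof cases
      case 1
      then show ?thesis using u by (simp add: w_def)
    next
      case 2
      then show ?thesis using tv v by (simp add: w_def tot_def)
    next
      case 3
      then show ?thesis using wW[OF that(2)] wt_W that by (simp add: dbX_def)
    qed
  qed
  have cC: "c \<in> dbC B p (m - 1)"
    unfolding c_def using grp_zero[OF gW] wt_W by (intro mk_C wX) auto
  have "dbD B (m - 1) c = a"
  proof (rule db_ext)
    show "dbD B (m - 1) c i = a i" if "even i" "i \<le> N" for i
      using dbD_even[OF that] dif_zero[OF _ X_V[OF that(2) wX[OF that]]] that az by (simp add: c_def)
    show "dbD B (m - 1) c i = a i" if "i > N" for i using dbD_out[OF that] dbC_out[OF aC that] by simp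
    fix q assume q: "odd q" "q < N"
    then obtain j where j: "j < N div 2" "q = Suc (2 * j)" using odd_jE by blast
    have 1: "c (q - 1) = w (q - 1)" "c (Suc q) = w (Suc q)" "c q = 0" using q odd_nb[OF q] by (simp_all add: c_def)
    have V: "w (q - 1) \<in> V (m - 1)" "w (Suc q) \<in> V (m - 1)" using wt_V[OF _ wW] odd_nb[OF q] by blast+
    have "dbD B (m - 1) c q = w (q - 1) - w (Suc q)"
      unfolding dbD_odd[OF q] 1 cmp_id[OF arrow_left[OF q] V(1)] cmp_id[OF arrow_right[OF q] V(2)]
      using dif_zero[of q 0 "m - 1 - 1"] grp_zero[OF gV] q by simp
    also have "\<dots> = a q" unfolding w_def j(2) by simp
    finally show "dbD B (m - 1) c q = a q" .
  qed
  then show ?thesis using cC unfolding dB_def by blast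
qed

text \<open>On cocycles \<open>tot\<close> is a derivation up to the value of \<open>h\<close> on
  the bottoms. Writing each \<open>tot\<close> as \<open>e\<close> plus an admissible error, the
  terms in \<open>e\<close> combine with the part \<open>- \<delta>e\<close> of \<open>h\<close> to
  \<open>e\<close> of the product. The term \<open>f\<close> joins the rational errors and
  \<open>g\<close> those in \<open>F\<close>.\<close>

lemma S_mult:
  assumes "a \<in> S p m" "b \<in> S p' m'" shows "P m m' a b \<in> S (p + p') (m + m')"
proof -
  obtain u v where a: "a \<in> dZ B p m" and u: "u \<in> dbX B p 0 (m - 1)" and v: "v \<in> dbX B p N (m - 1)"
    and uv: "tot a - e m (a 0) = u - v"
    using SE[OF assms(1)] .
  obtain u' v' where b: "b \<in> dZ B p' m'" and u': "u' \<in> dbX B p' 0 (m' - 1)" and v': "v' \<in> dbX B p' N (m' - 1)"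
    and uv': "tot b - e m' (b 0) = u' - v'"
    using SE[OF assms(2)] .
  define x y where "x = a 0" and "y = b 0"
  have xV: "x \<in> V m" and yV: "y \<in> V m'" using a0_V a b by (auto simp: x_def y_def)
  have x0: "x \<in> dbX B p 0 m" and y0: "y \<in> dbX B p' 0 m'" using dbC_even[OF dZ_C] a b by (auto simp: x_def y_def)
  have xN: "x \<in> dbX B p N m" and yN: "y \<in> dbX B p' N m'"
    using dbC_even[OF dZ_C[OF a] even_len order_refl] dbC_even[OF dZ_C[OF b] even_len order_refl]
    unfolding bottoms[OF a even_len order_refl] bottoms[OF b even_len order_refl] x_def y_def by blast+
  have aV: "a q \<in> V (m - 1)" and bV: "b q \<in> V (m' - 1)" if q: "odd q" "q < N" for q
    using wt_V[of q] dbC_odd[OF dZ_C[OF a] q] dbC_odd[OF dZ_C[OF b] q] wt_W q by auto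
  \<comment> \<open>Both neighbours of a top place carry the same bottom, so the two interpolated
    products coincide and \<open>\<alpha>\<close> drops out.\<close>
  have mid: "complex_of_real \<alpha> *\<^sub>C z + complex_of_real (1 - \<alpha>) *\<^sub>C z = z" for z :: 'a
    by (simp add: scaleC_add_left[symmetric] scaleC_one)
  have Pq: "P m m' a b (Suc (2 * j)) = \<mu> (m - 1) m' (a (Suc (2 * j))) y + sgn_pow m (\<mu> m (m' - 1) x (b (Suc (2 * j))))
      + (if j = 0 then h 0 1 m m' x y else 0)" if j: "j < N div 2" for j
  proof -
    define q where "q = Suc (2 * j)"
    have q: "odd q" "q < N" using odd_j[OF j] by (auto simp: q_def)
    note ar = arrow_left[OF q] arrow_right[OF q] and qN = less_imp_le[OF q(2)]
    have bot: "a (q - 1) = x" "a (Suc q) = x" "b (q - 1) = y" "b (Suc q) = y"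
      unfolding x_def y_def by (rule bottoms[OF a] bottoms[OF b]; use odd_nb[OF q] in simp)+
    have hh: "h (q - 1) q m m' x y = (if j = 0 then h 0 1 m m' x y else 0)" "h (Suc q) q m m' x y = 0"
      using h_zero[OF ar(1)] h_zero[OF ar(2)] by (auto simp: q_def One_nat_def)
    have "P m m' a b q = \<mu> (m - 1) m' (a q) y + sgn_pow m (\<mu> m (m' - 1) x (b q)) + (if j = 0 then h 0 1 m m' x y else 0)"
      unfolding P_odd[OF q] bot hh cmp_id[OF ar(1) yV] cmp_id[OF ar(2) yV] cmp_id[OF ar(1) xV] cmp_id[OF ar(2) xV]
        mul_\<mu>[OF qN aV[OF q] yV] mul_\<mu>[OF qN xV bV[OF q]] mid by simp
    then show ?thesis by (simp add: q_def)
  qed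
  have sgn_sum: "(\<Sum>j<n. sgn_pow m (z j)) = sgn_pow m (\<Sum>j<n. z j)" for z :: "nat \<Rightarrow> 'a" and n
    by (simp add: sgn_pow_def sum_negf)
  have sum_l: "(\<Sum>j<N div 2. \<mu> (m - 1) m' (a (Suc (2 * j))) y) = \<mu> (m - 1) m' (tot a) y"
    unfolding tot_def by (rule lin_sum[OF \<mu>_lin_l[OF yV] csub, symmetric]) (use aV odd_j in blast)
  have sum_r: "(\<Sum>j<N div 2. \<mu> m (m' - 1) x (b (Suc (2 * j)))) = \<mu> m (m' - 1) x (tot b)"
    unfolding tot_def by (rule lin_sum[OF \<mu>_lin_r[OF xV] csub, symmetric]) (use bV odd_j in blast)
  have n0: "0 < N div 2" using len2 by simp
  have "tot (P m m' a b) = (\<Sum>j<N div 2. \<mu> (m - 1) m' (a (Suc (2 * j))) y + sgn_pow m (\<mu> m (m' - 1) x (b (Suc (2 * j))))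
      + (if j = 0 then h 0 1 m m' x y else 0))" unfolding tot_def by (rule sum.cong) (simp_all add: Pq)
  also have "\<dots> = \<mu> (m - 1) m' (tot a) y + sgn_pow m (\<mu> m (m' - 1) x (tot b)) + h 0 1 m m' x y"
    unfolding sum.distrib sgn_sum sum_l sum_r using n0 by (simp add: sum.delta)
  finally have T: "tot (P m m' a b) = \<mu> (m - 1) m' (tot a) y + sgn_pow m (\<mu> m (m' - 1) x (tot b)) + h 0 1 m m' x y" .
  have eV: "e m x \<in> V (m - 1)" "e m' y \<in> V (m' - 1)" using lin_mem[OF e_lin] xV yV by blast+
  note uV = X_V[OF le0 u] and vV = X_V[OF order_refl v] and uV' = X_V[OF le0 u'] and vV' = X_V[OF order_refl v']
  have ta: "tot a = e m x + (u - v)" and tb: "tot b = e m' y + (u' - v')"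
    using uv uv' by (simp_all add: x_def y_def algebra_simps)
  have ta': "\<mu> (m - 1) m' (tot a) y = \<mu> (m - 1) m' (e m x) y + (\<mu> (m - 1) m' u y - \<mu> (m - 1) m' v y)"
    unfolding ta lin_add[OF \<mu>_lin_l[OF yV] eV(1) grp_diff[OF gV uV vV]] lin_diff[OF \<mu>_lin_l[OF yV] csub uV vV] ..
  have tb': "\<mu> m (m' - 1) x (tot b) = \<mu> m (m' - 1) x (e m' y) + (\<mu> m (m' - 1) x u' - \<mu> m (m' - 1) x v')"
    unfolding tb lin_add[OF \<mu>_lin_r[OF xV] eV(2) grp_diff[OF gV uV' vV']] lin_diff[OF \<mu>_lin_r[OF xV] csub uV' vV'] ..
  define U where "U = \<mu> (m - 1) m' u y + sgn_pow m (\<mu> m (m' - 1) x u') + f m m' x y"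
  define V' where "V' = \<mu> (m - 1) m' v y + sgn_pow m (\<mu> m (m' - 1) x v') + g m m' x y"
  have P0: "P m m' a b 0 = \<mu> m m' x y" using P_even[of 0 m m' a b] mul_\<mu>[OF le0 xV yV] by (simp add: x_def y_def)
  have "tot (P m m' a b) - e (m + m') (P m m' a b 0) = U - V'"
    unfolding T P0 ta' tb' h_eq[OF xV yV] U_def V'_def by (simp add: sgn_pow_def algebra_simps)
  moreover have "U \<in> dbX B (p + p') 0 (m + m' - 1)"
  proof -
    have "\<mu> (m - 1) m' u y \<in> dbX B (p + p') 0 (m + m' - 1)"
      using mul_X[OF le0 u y0] mul_\<mu>[OF le0 uV yV] by (simp add: algebra_simps)
    moreover have "\<mu> m (m' - 1) x u' \<in> dbX B (p + p') 0 (m + m' - 1)"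
      using mul_X[OF le0 x0 u'] mul_\<mu>[OF le0 xV uV'] by (simp add: algebra_simps)
    ultimately show ?thesis unfolding U_def
      by (intro dbX_add[OF le0] grp_sgn[OF grp_dbX[OF le0]] f_X[OF x0 y0])
  qed
  moreover have "V' \<in> dbX B (p + p') N (m + m' - 1)"
  proof -
    have "\<mu> (m - 1) m' v y \<in> dbX B (p + p') N (m + m' - 1)"
      using mul_X[OF order_refl v yN] mul_\<mu>[OF order_refl vV yV] by (simp add: algebra_simps)
    moreover have "\<mu> m (m' - 1) x v' \<in> dbX B (p + p') N (m + m' - 1)"
      using mul_X[OF order_refl xN v'] mul_\<mu>[OF order_refl xV vV'] by (simp add: algebra_simps)
    ultimately show ?thesis unfolding V'_def
      by (intro dbX_add[OF order_refl] grp_sgn[OF grp_dbX[OF order_refl]] g_X[OF xN yN])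
  qed
  ultimately show ?thesis using SI[OF P_Z[OF a b]] by blast
qed

lemma splitting: "db_splitting K B P S"
proof (rule db_splittingI)
  show "S p m \<subseteq> dZ B p m" for p m by (auto simp: S_def)
qed (fact S_sub S_B S_scale S_ex S_inj S_mult)+

end


section \<open>From the trivial obstruction class to the splitting of the model\<close>

lemma harr_diff_1:
  assumes "x \<in> hsp H a" "y \<in> hsp H b"
  shows "harr_diff H 1 (- 1) e [(a, x), (b, y)] =
    sgn_pow a (hmul H a (b - 1) x (e [(b, y)])) - e [(a + b, hmul H a b x y)] + hmul H (a - 1) b (e [(a, x)]) y"
  using assms by (simp add: harr_diff_def arity_part_def homog_def deg_def sgn_pow_def)

lemma zero_harr_db_cochain:
  fixes H :: "'a::complex_vector mhs_algebra"
  assumes "\<And>n. 0 \<in> hsp H n" "\<And>n. 0 \<in> hrat H n" "\<And>k n. 0 \<in> hwt H k n" "\<And>p n. 0 \<in> hhdg H p n"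
  shows "(\<lambda>_. 0, \<lambda>_. 0, \<lambda>_. 0) \<in> harr_db_cochains H k e"
proof -
  have z: "(\<Sum>(j, zs)\<leftarrow>l. 0 :: 'a) = 0" for l :: "(int \<times> 'a hlist) list"
    by (induction l) auto
  have "(\<lambda>_. 0) \<in> harr_cochains H k e" for k
    using assms(1) by (simp add: harr_cochains_def vanishes_on_shuffles_def multilinear_def maps_into_def arity_part_def z)
  then show ?thesis using assms(2-)
    by (simp add: harr_db_cochains_def harr_W0_rat_def harr_W0_F0_def harr_W0_def filtration_preserving_def maps_into_def)
qed

lemma formal_model_splitting:
  fixes H :: "'a::complex_vector mhs_algebra"
  assumes K: "real_subfield K" and M: "Cinf_structure_on K H M"
    and theta: "theta3 H M = harr_db_coboundaries H 3 (- 1)" and N: "2 \<le> N" "even N"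
  shows "has_splitting K \<alpha> N (mhd_of M) (quadratic_part M)"
proof -
  have MD: "Cinf_mixed_hodge_diagram K M" and lM: "len M = 1" and ratM: "rat M = hrat H" and hdgM: "hdg M = hhdg H"
    and cptM: "\<And>i. i \<le> 1 ==> cpt M i = hsp H" and wtM: "\<And>i. i \<le> 1 ==> wt M i = hwt H"
    and difM: "\<And>i n x. i \<le> 1 ==> x \<in> hsp H n ==> dif M i n x = 0"
    and oprM: "\<And>i a b x y. i \<le> 1 ==> x \<in> hsp H a ==> y \<in> hsp H b ==> opr M i [(a, x), (b, y)] = hmul H a b x y"
    and cmpM: "\<And>n x. x \<in> hsp H n ==> cmp M 0 1 n x = x"
    using M unfolding Cinf_structure_on_def by simp_all
  note CD = Cinf_mixed_hodge_diagramD[OF MD]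
  interpret C: mhc_core K M by (rule mhc_core_if_mixed_hodge_complex[OF K CD(1)])
  have csub: "subspace_over UNIV (hsp H n)" and csubW: "subspace_over UNIV (hwt H k n)" for n k
    using C.csub_V[of 0] C.csub_W[of 0] cptM[of 0] wtM[of 0] by simp_all
  have zF: "0 \<in> hhdg H p n" for p n
    using grp_zero[OF filtered_cx.grp_G[OF C.hdg_cx], of "- p" n] hdgM by simp
  have zR: "0 \<in> hrat H n" for n using C.R_ksub ratM by (simp add: subspace_over_def)
  \<comment> \<open>The zero cochain shows that some coboundary \<open>c\<close> exists. Evaluating
    the equality of cosets at \<open>c\<close> writes the obstruction cocycle as a difference of two
    coboundaries, without any closure property of the set of coboundaries.\<close>
  have "(\<lambda>_. 0, \<lambda>_. 0, \<lambda>_. 0) \<in> harr_db_cochains H (3 - 1) (- 1)"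
    by (rule zero_harr_db_cochain[OF grp_zero[OF csub_grp[OF csub]] zR grp_zero[OF csub_grp[OF csubW]] zF])
  then obtain c where c: "c \<in> harr_db_coboundaries H 3 (- 1)" unfolding harr_db_coboundaries_def by blast
  let ?t = "(arity_part (hsp H) 3 (opr M 0), arity_part (hsp H) 3 (opr M 1), arity_part (hsp H) 2 (hmor M 0 1))"
  have c': "?t + c \<in> harr_db_coboundaries H 3 (- 1)" using set_plus_intro2[OF c] theta unfolding theta3_def by blast
  obtain f1 g1 e1 where 1: "(f1, g1, e1) \<in> harr_db_cochains H 2 (- 1)" "c = harr_db_diff H 2 (- 1) (f1, g1, e1)"
    using c unfolding harr_db_coboundaries_def by auto
  obtain f2 g2 e2 where 2: "(f2, g2, e2) \<in> harr_db_cochains H 2 (- 1)" "?t + c = harr_db_diff H 2 (- 1) (f2, g2, e2)"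
    using c' unfolding harr_db_coboundaries_def by auto
  \<comment> \<open>The third component of the cone differential expresses the quadratic part of the
    comparison morphism as \<open>f - g - \<delta>e\<close>, where \<open>f\<close>,
    \<open>g\<close>, \<open>e\<close> are the differences of the two primitives.\<close>
  have third: "arity_part (hsp H) 2 (hmor M 0 1) + (f1 - g1 - harr_diff H 1 (- 1) e1) = f2 - g2 - harr_diff H 1 (- 1) e2"
    using 2(2) unfolding 1(2) harr_db_diff_def by (simp add: One_nat_def)
  have m: "f1 \<in> harr_W0_rat H 2 (- 1)" "g1 \<in> harr_W0_F0 H 2 (- 1)" "e1 \<in> harr_W0 H 1 (- 1)"
    "f2 \<in> harr_W0_rat H 2 (- 1)" "g2 \<in> harr_W0_F0 H 2 (- 1)" "e2 \<in> harr_W0 H 1 (- 1)"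
    using 1(1) 2(1) by (simp_all add: harr_db_cochains_def One_nat_def)
  define f where "f a b x y = f2 [(a, x), (b, y)] - f1 [(a, x), (b, y)]" for a b x y
  define g where "g a b x y = g2 [(a, x), (b, y)] - g1 [(a, x), (b, y)]" for a b x y
  define e where "e n x = e2 [(n, x)] - e1 [(n, x)]" for n x
  have fml: "multilinear (hsp H) (hsp H) 1 f'" "filtration_preserving (hwt H) (hwt H) 1 f'" "maps_into (hrat H) (hrat H) 1 f'"
    if "f' \<in> harr_W0_rat H 2 (- 1)" for f'
    using that by (simp_all add: harr_W0_rat_def harr_W0_def harr_cochains_def)
  have gml: "filtration_preserving (hwt H) (hwt H) 1 g'" "filtration_preserving (hhdg H) (hhdg H) 1 g'"
    if "g' \<in> harr_W0_F0 H 2 (- 1)" for g'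
    using that by (simp_all add: harr_W0_F0_def harr_W0_def)
  have eml: "multilinear (hsp H) (hsp H) 0 e'" "filtration_preserving (hwt H) (hwt H) 0 e'"
    if "e' \<in> harr_W0 H 1 (- 1)" for e'
    using that by (simp_all add: harr_W0_def harr_cochains_def)
  have elin: "linear_between (hsp H n) (hsp H (n - 1)) (\<lambda>x. e' [(n, x)])" if "e' \<in> harr_W0 H 1 (- 1)" for e' n
    by (rule multilinear_1[OF eml(1)[OF that]]) simp
  have oml: "multilinear (hsp H) (hsp H) 2 (opr M 0)" using CD(2)[of 0] cptM[of 0] by (simp add: Cinf_algebra_def)
  have hmul_r: "hmul H a b x (y - z) = hmul H a b x y - hmul H a b x z" if "x \<in> hsp H a" "y \<in> hsp H b" "z \<in> hsp H b" for a b x y z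
    using lin_diff[OF multilinear_2r[OF oml that(1) refl] csub that(2,3)] oprM[OF le0 that(1)]
      grp_diff[OF csub_grp[OF csub] that(2,3)] that by simp
  have hmul_l: "hmul H a b (x - z) y = hmul H a b x y - hmul H a b z y" if "x \<in> hsp H a" "z \<in> hsp H a" "y \<in> hsp H b" for a b x y z
    using lin_diff[OF multilinear_2l[OF oml that(3) refl] csub that(1,2)] oprM[OF le0 _ that(3)]
      grp_diff[OF csub_grp[OF csub] that(1,2)] that by simp
  have hmul_V: "hmul H a b x y \<in> hsp H (a + b)" if "x \<in> hsp H a" "y \<in> hsp H b" for a b x y
    using lin_mem[OF multilinear_2r[OF oml that(1), of "a + b" b] that(2)] oprM[OF le0 that] by simp
  have eq: "hmor M 0 1 [(a, x), (b, y)] = f a b x y - g a b x y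
      - (sgn_pow a (hmul H a (b - 1) x (e b y)) - e (a + b) (hmul H a b x y) + hmul H (a - 1) b (e a x) y)"
    if x: "x \<in> hsp H a" and y: "y \<in> hsp H b" for a b x y
  proof -
    have "arity_part (hsp H) 2 (hmor M 0 1) [(a, x), (b, y)] = hmor M 0 1 [(a, x), (b, y)]"
      using x y by (simp add: arity_part_def homog_def)
    moreover have "arity_part (hsp H) 2 (hmor M 0 1) [(a, x), (b, y)]
        + (f1 [(a, x), (b, y)] - g1 [(a, x), (b, y)] - harr_diff H 1 (- 1) e1 [(a, x), (b, y)])
      = f2 [(a, x), (b, y)] - g2 [(a, x), (b, y)] - harr_diff H 1 (- 1) e2 [(a, x), (b, y)]"
      using fun_cong[OF third, of "[(a, x), (b, y)]"] by simp
    moreover have eV: "e1 [(a, x)] \<in> hsp H (a - 1)" "e2 [(a, x)] \<in> hsp H (a - 1)" "e1 [(b, y)] \<in> hsp H (b - 1)" "e2 [(b, y)] \<in> hsp H (b - 1)"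
      using lin_mem[OF elin] m x y by blast+
    ultimately show ?thesis
      unfolding f_def g_def e_def harr_diff_1[OF x y] hmul_r[OF x eV(4,3)] hmul_l[OF eV(2,1) y]
      by (simp add: sgn_pow_diff algebra_simps)
  qed
  have lN: "len (mhd_of M) \<le> N" using lM N by simp
  let ?B = "pad_mhd N (mhd_of M)" and ?h = "pad_h (len (mhd_of M)) (quadratic_part M)"
  have mi: "min i (len M) \<le> 1" for i using lM by simp
  interpret B: db_alg K ?B ?h \<alpha> by (rule db_alg_pad[OF mhc_mult_mhd_of[OF K MD] lN N(2)])
  have N0: "N \<noteq> 0" using N by simp
  have rq: "(r, q) = (0, 1)" if "(r, q) \<in> arrows (len ?B)" "r \<le> len M" "q \<le> len M" for r q
    using that unfolding lM arrows_def by (auto simp: One_nat_def le_Suc_eq)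
  have X0: "\<exists>r. r \<in> hwt H (2 * p) n \<and> r \<in> hrat H n \<and> x = tate p *\<^sub>C r \<and> r \<in> hsp H n" if "x \<in> dbX ?B p 0 n" for x p n
    using that C.W_V[of 0] cptM[of 0] wtM[of 0] ratM by (auto simp: dbX_def)
  have "formal_model K ?B ?h (hsp H) (hwt H) (hmul H) f g e"
  proof (intro formal_model.intro formal_model_axioms.intro B.db_alg_axioms, unfold mhd_of_sel pad_sel)
    show "cpt M (min i (len M)) = hsp H" "wt M (min i (len M)) = hwt H" for i using cptM[OF mi] wtM[OF mi] by simp_all
    show "dif M (min i (len M)) n x = 0" if "x \<in> hsp H n" for i n x by (rule difM[OF mi that])
    show "(if r \<le> len M \<and> q \<le> len M then cmp M r q n x else x) = x" if ar: "(r, q) \<in> arrows N" and x: "x \<in> hsp H n" for r q n x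
    proof (cases "r \<le> len M \<and> q \<le> len M")
      case True
      then have "r = 0" "q = 1" using rq[of r q] ar by auto
      then show ?thesis using cmpM[OF x] by simp
    qed auto
    show "opr M (min i (len M)) [(a, x), (b, y)] = hmul H a b x y" if "x \<in> hsp H a" "y \<in> hsp H b" for i a b x y
      by (rule oprM[OF mi that])
    show "pad_h (len M) (quadratic_part M) r q a b x y = 0" if "(r, q) \<in> arrows N" "(r, q) \<noteq> (0, 1)" for r q a b x y
      using rq[of r q] that by (auto simp: pad_h_def)
    show "pad_h (len M) (quadratic_part M) 0 1 a b x y = f a b x y - g a b x y
      - (sgn_pow a (hmul H a (b - 1) x (e b y)) - e (a + b) (hmul H a b x y) + hmul H (a - 1) b (e a x) y)"
      if "x \<in> hsp H a" "y \<in> hsp H b" for a b x y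
      using eq[OF that] lM by (simp add: pad_h_def quadratic_part_def)
    show "linear_between (hsp H n) (hsp H (n - 1)) (e n)" for n
      using elin[OF m(3)] elin[OF m(6)] grp_diff[OF csub_grp[OF csub]]
      unfolding e_def[abs_def] linear_between_def by (simp add: algebra_simps scaleC.scale_right_diff_distrib)
    show "e n x \<in> hwt H k (n - 1)" if "x \<in> hwt H k n" for k n x
      unfolding e_def by (intro grp_diff[OF csub_grp[OF csubW]] filtration_1[OF eml(2)[OF m(3)] that] filtration_1[OF eml(2)[OF m(6)] that]) simp_all
    show "f a b x y \<in> dbX ?B (p + p') 0 (a + b - 1)" if x: "x \<in> dbX ?B p 0 a" and y: "y \<in> dbX ?B p' 0 b" for a b p p' x y
    proof -
      obtain r where r: "r \<in> hwt H (2 * p) a" "r \<in> hrat H a" "x = tate p *\<^sub>C r" "r \<in> hsp H a" using X0[OF x] by blast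
      obtain s where s: "s \<in> hwt H (2 * p') b" "s \<in> hrat H b" "y = tate p' *\<^sub>C s" "s \<in> hsp H b" using X0[OF y] by blast
      have yV: "y \<in> hsp H b" using s(3,4) csub by (simp add: subspace_over_def)
      have "f' [(a, x), (b, y)] \<in> dbX ?B (p + p') 0 (a + b - 1)" if f': "f' \<in> harr_W0_rat H 2 (- 1)" for f'
      proof -
        have "f' [(a, x), (b, y)] = tate (p + p') *\<^sub>C f' [(a, r), (b, s)]"
          using lin_scale[OF multilinear_2l[OF fml(1)[OF f'] yV refl] r(4)] lin_scale[OF multilinear_2r[OF fml(1)[OF f'] r(4) refl] s(4)]
            r(3) s(3) by (simp add: tate_add)
        moreover have "f' [(a, r), (b, s)] \<in> hwt H (2 * (p + p')) (a + b - 1)"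
          using filtration_2[OF fml(2)[OF f'] r(1) s(1), of "a + b - 1"] by (simp add: distrib_left)
        moreover have "f' [(a, r), (b, s)] \<in> hrat H (a + b - 1)" by (rule maps_into_2[OF fml(3)[OF f'] r(2) s(2)]) simp
        ultimately show ?thesis using wtM[of 0] ratM by (auto simp: dbX_def)
      qed
      then show ?thesis unfolding f_def using m by (intro B.dbX_diff[OF le0])
    qed
    show "g a b x y \<in> dbX ?B (p + p') N (a + b - 1)" if x: "x \<in> dbX ?B p N a" and y: "y \<in> dbX ?B p' N b" for a b p p' x y
    proof -
      have X: "dbX ?B p N n = hhdg H p n \<inter> hwt H (2 * p) n" for p n using N0 wtM[OF mi] hdgM by (simp add: dbX_def)
      have "g' [(a, x), (b, y)] \<in> dbX ?B (p + p') N (a + b - 1)" if g': "g' \<in> harr_W0_F0 H 2 (- 1)" for g'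
      proof -
        have "g' [(a, x), (b, y)] \<in> hwt H (2 * p + 2 * p') (a + b - 1)" "g' [(a, x), (b, y)] \<in> hhdg H (p + p') (a + b - 1)"
          using x y unfolding X by (auto intro!: filtration_2[OF gml(1)[OF g']] filtration_2[OF gml(2)[OF g']])
        then show ?thesis unfolding X by (simp add: distrib_left)
      qed
      then show ?thesis unfolding g_def using m by (intro B.dbX_diff) simp_all
    qed
  qed
  then show ?thesis unfolding has_splitting_def using formal_model.splitting by blast
qed

section \<open>The exact sequence of Deligne--Beilinson cohomology\<close>

lemma coset_eq_iff: "add_subgroup C ==> x +o C = y +o C \<longleftrightarrow> x - y \<in> C" for x :: "'x::ab_group_add"
proof
  assume C: "add_subgroup C" and "x +o C = y +o C"
  then have "x \<in> y +o C" using grp_zero[OF C] by (metis add.right_neutral set_plus_intro2)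
  then obtain c where "c \<in> C" "x = y + c" unfolding elt_set_plus_def by blast
  then show "x - y \<in> C" by simp
next
  have sub: "x +o C \<subseteq> y +o C" if C: "add_subgroup C" and "x - y \<in> C" for x y :: 'x
  proof
    fix z assume "z \<in> x +o C"
    then obtain c where "c \<in> C" "z = x + c" unfolding elt_set_plus_def by blast
    then show "z \<in> y +o C"
      using grp_add[OF C that(2)] unfolding elt_set_plus_def by (intro CollectI bexI[of _ "(x - y) + c"]) simp_all
  qed
  assume C: "add_subgroup C" and xy: "x - y \<in> C"
  have "y - x \<in> C" using grp_minus[OF C xy] by simp
  then show "x +o C = y +o C" using sub[OF C xy] sub[OF C, of y x] by blast
qed

lemma coset_self: "add_subgroup C ==> x \<in> x +o C" for x :: "'x::ab_group_add"
  using grp_zero set_plus_intro2[of 0 C x] by fastforce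

lemma coset_mem: "y \<in> x +o C \<longleftrightarrow> y - x \<in> C" for x :: "'x::ab_group_add"
  unfolding elt_set_plus_def by (auto intro: bexI[of _ "y - x"])

lemma coset_trivial: "add_subgroup C ==> x \<in> C ==> x +o C = C" for x :: "'x::ab_group_add"
  using coset_eq_iff[of C x 0] by simp

lemma coset_add: "add_subgroup C ==> (x +o C) + (y +o C) = (x + y) +o C" for x :: "'x::ab_group_add"
proof -
  assume C: "add_subgroup C"
  have "C + C = C"
    using grp_add[OF C] grp_zero[OF C] by (auto elim!: set_plus_elim intro: set_plus_intro[of 0 C _ C, simplified])
  then show ?thesis by (metis set_plus_rearrange)
qed

lemma coset_image:
  assumes C: "add_subgroup C" and D: "add_subgroup D" and f: "\<And>z. z \<in> x +o C ==> f z - f x \<in> D"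
  shows "f ` (x +o C) + D = f x +o D"
proof
  show "f ` (x +o C) + D \<subseteq> f x +o D"
  proof
    fix w assume "w \<in> f ` (x +o C) + D"
    then obtain z d where z: "z \<in> x +o C" "d \<in> D" "w = f z + d" by (auto elim!: set_plus_elim)
    have "w - f x \<in> D" by (rule mem_eq[OF grp_add[OF D f[OF z(1)] z(2)]]) (simp add: z(3))
    then show "w \<in> f x +o D" unfolding coset_mem .
  qed
  show "f x +o D \<subseteq> f ` (x +o C) + D"
    using coset_self[OF C, of x] unfolding elt_set_plus_def set_plus_def by blast
qed

lemma UN_const: "A \<noteq> {} ==> (\<And>x. x \<in> A ==> f x = c) ==> (\<Union>x\<in>A. f x) = c"
  by auto

text \<open>The comparison morphisms are strictly multiplicative here, so the homotopies are zero,
  and the unit is available again.\<close>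

locale db_mhd = db_alg K B "\<lambda>_ _ _ _ _ _. 0" \<alpha> for K and B :: "'a::complex_vector mhd" and \<alpha> +
  assumes unt_W: "i \<le> len B ==> unt B i \<in> wt B i 0 0"
    and unt_d: "i \<le> len B ==> dif B i 0 (unt B i) = 0"
    and unt_R: "unt B 0 \<in> rat B 0" and unt_F: "unt B (len B) \<in> hdg B 0 0"
    and unt_cmp: "(r, q) \<in> arrows (len B) ==> cmp B r q 0 (unt B r) = unt B q"
    and unt_l: "i \<le> len B ==> x \<in> cpt B i a ==> mul B i 0 a (unt B i) x = x"
    and unt_r: "i \<le> len B ==> x \<in> cpt B i a ==> mul B i a 0 x (unt B i) = x"
begin

text \<open>The exponents \<open>n\<close> and \<open>2 * p + n\<close> of the signs have the same
  parity.\<close>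

lemma db_mult_eq: "db_mult \<alpha> B p n p' n' = P (2 * p + n) (2 * p' + n')"
  by (intro ext) (simp add: db_mult_def dbM_def Let_def sgn_pow_def Suc_eq_plus1)

abbreviation "ZN \<equiv> cocyc B N"
abbreviation "BN \<equiv> cobd B N"
abbreviation "WN \<equiv> wt B N"
abbreviation "VN \<equiv> cpt B N"
abbreviation "mulN \<equiv> mul B N"
abbreviation "cl p m a \<equiv> a +o dB B p m"
abbreviation "hc m y \<equiv> y +o BN m"

lemma last_B: "e \<in> dB B p m ==> e N \<in> BN m"
  unfolding dB_def using dbD_even[OF even_len order_refl] dbC_V_even[OF _ even_len order_refl] BI by auto

lemma last_Z: "a \<in> dZ B p m ==> a N \<in> ZN m"
  by (rule dZ_cocyc[OF _ even_len order_refl])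

lemma grpN: "add_subgroup (BN m)" by (rule grp_B[OF order_refl])

lemma H_piece: "piece (H_DB \<alpha> B) p n = cl p (2 * p + n) ` dZ B p (2 * p + n)"
  by (simp add: H_DB_def db_coboundaries_eq db_cocycles_eq)

lemma H_scal: "c \<in> K ==> scal (H_DB \<alpha> B) p n c (cl p (2 * p + n) a) = cl p (2 * p + n) (\<lambda>i. c *\<^sub>C a i)"
proof -
  assume c: "c \<in> K"
  have "(\<lambda>i. c *\<^sub>C z i) - (\<lambda>i. c *\<^sub>C a i) \<in> dB B p (2 * p + n)" if "z \<in> cl p (2 * p + n) a" for z
    using dB_scale[OF c that[unfolded coset_mem]] by (rule mem_eq) (simp add: fun_eq_iff scaleC.scale_right_diff_distrib)
  then show ?thesis
    using coset_image[OF grp_dB grp_dB, of a p "2 * p + n" "\<lambda>z i. c *\<^sub>C z i" p "2 * p + n"]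
    by (simp add: H_DB_def db_coboundaries_eq)
qed

lemma H_times:
  assumes a: "a \<in> dZ B p (2 * p + n)" and b: "b \<in> dZ B p' (2 * p' + n')"
  shows "times_of (H_DB \<alpha> B) p n p' n' (cl p (2 * p + n) a) (cl p' (2 * p' + n') b) =
    cl (p + p') (2 * p + n + (2 * p' + n')) (P (2 * p + n) (2 * p' + n') a b)"
proof -
  let ?m = "2 * p + n" and ?m' = "2 * p' + n'"
  have e: "2 * (p + p') + (n + n') = ?m + ?m'" by simp
  have eq: "P ?m ?m' a' b' +o dB B (p + p') (?m + ?m') = cl (p + p') (?m + ?m') (P ?m ?m' a b)"
    if "a' \<in> cl p ?m a" "b' \<in> cl p' ?m' b" for a' b'
  proof -
    have d: "a' - a \<in> dB B p ?m" "b' - b \<in> dB B p' ?m'" using that unfolding coset_mem by blast+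
    have "a' \<in> dZ B p ?m" by (rule mem_eq[OF grp_add[OF grp_dZ a subsetD[OF dB_dZ d(1)]]]) simp
    moreover have "b' \<in> dZ B p' ?m'" by (rule mem_eq[OF grp_add[OF grp_dZ b subsetD[OF dB_dZ d(2)]]]) simp
    ultimately show ?thesis using P_cong[OF _ a d(1) _ b d(2)] coset_eq_iff[OF grp_dB] by blast
  qed
  show ?thesis
    unfolding H_DB_def bigraded_algebra.select_convs db_mult_eq db_coboundaries_eq e
    using coset_self[OF grp_dB, of a p ?m] coset_self[OF grp_dB, of b p' ?m'] eq by (intro UN_const) blast+
qed

definition HZ :: "int \<Rightarrow> int \<Rightarrow> 'a set" where
  "HZ p m = rat_classes B p m \<inter> (F_classes B p m \<inter> W_classes B (2 * p) m)"

lemma Hdg_piece: "piece (Hdg B) p n = hc (2 * p + n) ` HZ p (2 * p + n)"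
  by (simp add: Hdg_def HZ_def Let_def)

lemma Hdg_scal:
  "scal (Hdg B) p n c (hc (2 * p + n) y) = hc (2 * p + n) (c *\<^sub>C y)"
proof -
  have "c *\<^sub>C z - c *\<^sub>C y \<in> BN (2 * p + n)" if z: "z \<in> hc (2 * p + n) y" for z
  proof -
    obtain v where v: "v \<in> VN (2 * p + n - 1)" "z - y = dif B N (2 * p + n - 1) v"
      using z unfolding coset_mem by (rule BE)
    have "c *\<^sub>C z - c *\<^sub>C y = dif B N (2 * p + n - 1) (c *\<^sub>C v)"
      using d_scale[OF order_refl v(1)] v(2) by (simp add: scaleC.scale_right_diff_distrib[symmetric])
    then show ?thesis by (rule BI[OF V_scale[OF order_refl v(1)]])
  qed
  then show ?thesis
    using coset_image[OF grpN grpN, of y "2 * p + n" "\<lambda>y. c *\<^sub>C y" "2 * p + n"] by (simp add: Hdg_def Let_def)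
qed

lemma mul_B_l: "x \<in> BN m ==> y \<in> ZN m' ==> mulN m m' x y \<in> BN (m + m')"
proof -
  assume x: "x \<in> BN m" and y: "y \<in> ZN m'"
  obtain v where v: "v \<in> VN (m - 1)" "x = dif B N (m - 1) v" using x by (rule BE)
  have yV: "y \<in> VN m'" using y Z_V by blast
  have "mulN (m - 1) (m' + 1) v (dif B N m' y) = 0"
    using Z_d[OF y] mul_zero_r[OF order_refl v(1)] by simp
  then have "mulN m m' x y = dif B N (m + m' - 1) (mulN (m - 1) m' v y)"
    using mul_d[OF order_refl v(1) yV, of "m + m' - 1"] v(2) by (simp add: sgn_pow_def)
  moreover have "mulN (m - 1) m' v y \<in> VN (m + m' - 1)"
    by (rule mul_V[OF order_refl v(1) yV]) simp
  ultimately show ?thesis by (rule BI[rotated])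
qed

lemma mul_B_r: "x \<in> ZN m ==> y \<in> BN m' ==> mulN m m' x y \<in> BN (m + m')"
proof -
  assume x: "x \<in> ZN m" and y: "y \<in> BN m'"
  obtain v where v: "v \<in> VN (m' - 1)" "y = dif B N (m' - 1) v" using y by (rule BE)
  have xV: "x \<in> VN m" using x Z_V by blast
  have "mulN (m + 1) (m' - 1) (dif B N m x) v = 0"
    using Z_d[OF x] mul_zero_l[OF order_refl v(1)] by simp
  then have 1: "dif B N (m + m' - 1) (mulN m (m' - 1) x v) = sgn_pow m (mulN m m' x y)"
    using mul_d[OF order_refl xV v(1), of "m + m' - 1"] v(2) by simp
  have "mulN m (m' - 1) x v \<in> VN (m + m' - 1)"
    by (rule mul_V[OF order_refl xV v(1)]) simp
  then have "sgn_pow m (mulN m m' x y) \<in> BN (m + m')" using 1 by (intro BI) auto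
  then have "sgn_pow m (sgn_pow m (mulN m m' x y)) \<in> BN (m + m')" by (rule grp_sgn[OF grpN])
  then show ?thesis by (rule mem_eq) (simp add: sgn_pow_def)
qed

lemma mul_cong:
  assumes "x \<in> ZN m" "y \<in> ZN m'" "x' - x \<in> BN m" "y' - y \<in> BN m'"
  shows "mulN m m' x' y' - mulN m m' x y \<in> BN (m + m')"
proof -
  have x': "x' \<in> ZN m"
    by (rule mem_eq[OF grp_add[OF grp_Z[OF order_refl] assms(1) subsetD[OF B_Z[OF order_refl] assms(3)]]]) simp
  have y': "y' \<in> ZN m'"
    by (rule mem_eq[OF grp_add[OF grp_Z[OF order_refl] assms(2) subsetD[OF B_Z[OF order_refl] assms(4)]]]) simp
  note V = subsetD[OF Z_V assms(1)] subsetD[OF Z_V assms(2)] subsetD[OF Z_V x'] subsetD[OF Z_V y']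
  show ?thesis
    by (rule mem_eq[OF grp_add[OF grpN mul_B_l[OF assms(3) y'] mul_B_r[OF assms(1,4)]]])
      (simp add: mul_diff_l[OF order_refl V(3,1,4)] mul_diff_r[OF order_refl V(1,4,2)])
qed

lemma Hdg_times:
  assumes x: "x \<in> ZN (2 * p + n)" and y: "y \<in> ZN (2 * p' + n')"
  shows "times_of (Hdg B) p n p' n' (hc (2 * p + n) x) (hc (2 * p' + n') y) =
    hc (2 * p + n + (2 * p' + n')) (mulN (2 * p + n) (2 * p' + n') x y)"
proof -
  let ?m = "2 * p + n" and ?m' = "2 * p' + n'"
  have e: "2 * (p + p') + (n + n') = ?m + ?m'" by simp
  have eq: "hc (?m + ?m') (mulN ?m ?m' x' y') = hc (?m + ?m') (mulN ?m ?m' x y)"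
    if "x' \<in> hc ?m x" "y' \<in> hc ?m' y" for x' y'
    using mul_cong[OF x y] that unfolding coset_mem coset_eq_iff[OF grpN] by blast
  show ?thesis
    unfolding Hdg_def Let_def bigraded_algebra.select_convs e
    using coset_self[OF grpN, of x ?m] coset_self[OF grpN, of y ?m'] eq by (intro UN_const) blast+
qed

lemma proj_cl: "db_proj B p n (cl p (2 * p + n) a) = hc (2 * p + n) (a N)"
  unfolding db_proj_def
  using coset_image[OF grp_dB grpN, of a p "2 * p + n" "\<lambda>a. a N" "2 * p + n"] last_B[of _ p "2 * p + n"]
  by (metis coset_mem fun_diff_def)

section \<open>Hodge classes and the surjectivity of the projection\<close>

lemma tops_B:
  assumes "a \<in> dZ B p m" "odd q" "q < N" shows "cmp B (q - 1) q m (a (q - 1)) - cmp B (Suc q) q m (a (Suc q)) \<in> cobd B q m"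
  by (rule BI[OF W_V[OF less_imp_le[OF assms(3)] dbC_odd[OF dZ_C[OF assms(1)] assms(2,3)]] dZ_odd[OF assms]])

lemma rat_classesI:
  assumes x: "x \<in> dbX B p 0 m" "dif B 0 m x = 0" and y: "ZB m x y"
  shows "y \<in> rat_classes B p m"
proof -
  obtain r where r: "r \<in> wt B 0 (2 * p) m" "r \<in> rat B m" "x = tate p *\<^sub>C r" using x(1) by (rule dbX_0E)
  have "tate p *\<^sub>C dif B 0 m r = 0" using x(2) d_scale[OF le0 W_V[OF le0 r(1)]] r(3) by simp
  then have "dif B 0 m r = 0" using tate_nonzero by (simp add: scaleC.scale_eq_0_iff)
  then show ?thesis using r y unfolding rat_classes_def by blast
qed

lemma rat_classesE:
  assumes "y \<in> rat_classes B p m"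
  obtains x where "x \<in> dbX B p 0 m" "x \<in> cocyc B 0 m" "ZB m x y"
proof -
  obtain r where r: "r \<in> wt B 0 (2 * p) m" "r \<in> rat B m" "dif B 0 m r = 0" "ZB m (tate p *\<^sub>C r) y"
    using assms unfolding rat_classes_def by blast
  have x: "tate p *\<^sub>C r \<in> dbX B p 0 m" using r unfolding dbX_0 by blast
  have "dif B 0 m (tate p *\<^sub>C r) = 0" using d_scale[OF le0 W_V[OF le0 r(1)]] r(3) by simp
  then show ?thesis using that[OF x ZI[OF dbX_V[OF le0 x]] r(4)] by blast
qed

lemma FW_classesI: "f \<in> dbX B p N m ==> f \<in> ZN m ==> f \<in> F_classes B p m \<inter> W_classes B (2 * p) m"
  unfolding W_classes_wcl dbX_len using F_classesI[of f p m f] WZ_wcl[OF order_refl] grp_zero[OF grpN] by auto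

lemma last_HZ:
  assumes a: "a \<in> dZ B p m" shows "a N \<in> HZ p m"
proof -
  have "a N \<in> rat_classes B p m"
    by (rule rat_classesI[OF dbC_even[OF dZ_C[OF a], of 0] dZ_even[OF a, of 0] corresponds_if_tops[of a m]])
      (use dZ_cocyc[OF a] tops_B[OF a] in auto)
  then show ?thesis
    unfolding HZ_def using FW_classesI[OF dbC_even[OF dZ_C[OF a] even_len order_refl] last_Z[OF a]] by blast
qed

lemma FW_ex:
  assumes "y \<in> F_classes B p m \<inter> W_classes B (2 * p) m"
  obtains f where "f \<in> dbX B p N m" "f \<in> ZN m" "y - f \<in> BN m"
  using assms FW_classesE[of y p m "2 * p"] unfolding W_classes_wcl dbX_len by blast

text \<open>The two conditions on a Hodge class are met by different representatives, a rational one
  in component 0 and one in \<open>F\<close> of the right weight in the last component.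
  \<open>zigzag_lift\<close> joins them into a cocycle.\<close>

lemma HZ_lift:
  assumes y: "y \<in> HZ p m" obtains a where "a \<in> dZ B p m" "y - a N \<in> BN m"
proof -
  obtain x where x: "x \<in> dbX B p 0 m" "x \<in> cocyc B 0 m" "ZB m x y" using y rat_classesE unfolding HZ_def by blast
  obtain f where f: "f \<in> dbX B p N m" "f \<in> ZN m" "y - f \<in> BN m"
    using y FW_ex unfolding HZ_def by blast
  have "ZB m x f" by (rule corr_modify[OF zig_total x(3) f(3)])
  then obtain c where c: "c 0 = x" "c N = f" and ce: "\<And>i. even i ==> i \<le> N ==> c i \<in> wt B i (2 * p) m \<and> c i \<in> cocyc B i m"
    and co: "\<And>q. odd q ==> q < N ==> c q \<in> wt B q (2 * p) (m - 1) \<and>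
      cmp B (q - 1) q m (c (q - 1)) - cmp B (Suc q) q m (c (Suc q)) = dif B q (m - 1) (c q)"
    using zigzag_lift[OF dbX_W[OF le0 x(1)] x(2) dbX_W[OF order_refl f(1)] f(2)] by blast
  have cX: "c i \<in> dbX B p i m" if "even i" "i \<le> N" for i
    using ce[OF that] c x(1) f(1) by (cases "i = 0"; cases "i = N") (auto simp: dbX_def)
  let ?a = "mk_cochain B c c"
  have "?a \<in> dZ B p m"
  proof (rule dZI[OF mk_C])
    show "dif B i m (?a i) = 0" if "even i" "i \<le> N" for i using ce[OF that] Z_d that by simp
    show "cmp B (q - 1) q m (?a (q - 1)) - cmp B (Suc q) q m (?a (Suc q)) = dif B q (m - 1) (?a q)" if "odd q" "q < N" for q
      using co[OF that] odd_nb[OF that] that by simp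
  qed (use cX co in auto)
  moreover have "?a N = f" using c(2) even_len by simp
  ultimately show ?thesis using that f(3) by metis
qed

lemma proj_hom: "bigraded_algebra_hom K (H_DB \<alpha> B) (Hdg B) (db_proj B)"
  unfolding bigraded_algebra_hom_def
proof (intro conjI allI ballI)
  fix p n p' n' :: int and X Y c
  let ?m = "2 * p + n" and ?m' = "2 * p' + n'"
  assume "X \<in> piece (H_DB \<alpha> B) p n"
  then obtain a where a: "a \<in> dZ B p ?m" "X = cl p ?m a" unfolding H_piece by blast
  show "db_proj B p n X \<in> piece (Hdg B) p n" unfolding a(2) proj_cl Hdg_piece using last_HZ[OF a(1)] by blast
  show "db_proj B p n (scal (H_DB \<alpha> B) p n c X) = scal (Hdg B) p n c (db_proj B p n X)" if "c \<in> K"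
    unfolding a(2) H_scal[OF that] proj_cl Hdg_scal ..
  show "db_proj B p n (X + Y) = db_proj B p n X + db_proj B p n Y" if "Y \<in> piece (H_DB \<alpha> B) p n"
  proof -
    obtain b where b: "b \<in> dZ B p ?m" "Y = cl p ?m b" using \<open>Y \<in> piece (H_DB \<alpha> B) p n\<close> unfolding H_piece by blast
    show ?thesis unfolding a(2) b(2) coset_add[OF grp_dB] proj_cl coset_add[OF grpN] by simp
  qed
  show "db_proj B (p + p') (n + n') (times_of (H_DB \<alpha> B) p n p' n' X Y) =
      times_of (Hdg B) p n p' n' (db_proj B p n X) (db_proj B p' n' Y)" if "Y \<in> piece (H_DB \<alpha> B) p' n'"
  proof -
    obtain b where b: "b \<in> dZ B p' ?m'" "Y = cl p' ?m' b" using \<open>Y \<in> piece (H_DB \<alpha> B) p' n'\<close> unfolding H_piece by blast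
    have e: "?m + ?m' = 2 * (p + p') + (n + n')" by simp
    show ?thesis
      unfolding a(2) b(2) H_times[OF a(1) b(1)] proj_cl Hdg_times[OF last_Z[OF a(1)] last_Z[OF b(1)]]
      unfolding e proj_cl P_even[OF even_len order_refl] ..
  qed
next
  have "db_proj B 0 0 (cl 0 (2 * 0 + 0) (db_unit B)) = hc (2 * 0 + 0) (db_unit B N)" by (rule proj_cl)
  then show "db_proj B 0 0 (unit_of (H_DB \<alpha> B)) = unit_of (Hdg B)"
    using even_len by (simp add: H_DB_def Hdg_def Let_def db_coboundaries_eq db_unit_def)
qed

lemma proj_surj: "db_proj B p n ` piece (H_DB \<alpha> B) p n = piece (Hdg B) p n"
proof
  show "db_proj B p n ` piece (H_DB \<alpha> B) p n \<subseteq> piece (Hdg B) p n"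
    using proj_hom unfolding bigraded_algebra_hom_def by blast
  show "piece (Hdg B) p n \<subseteq> db_proj B p n ` piece (H_DB \<alpha> B) p n"
  proof
    fix Y assume "Y \<in> piece (Hdg B) p n"
    then obtain y where y: "y \<in> HZ p (2 * p + n)" "Y = hc (2 * p + n) y" unfolding Hdg_piece by blast
    obtain a where a: "a \<in> dZ B p (2 * p + n)" "y - a N \<in> BN (2 * p + n)" using y(1) by (rule HZ_lift)
    have "Y = db_proj B p n (cl p (2 * p + n) a)" unfolding proj_cl y(2) coset_eq_iff[OF grpN] by (rule a(2))
    then show "Y \<in> db_proj B p n ` piece (H_DB \<alpha> B) p n" using a(1) unfolding H_piece by blast
  qed
qed

subsection \<open>The intermediate Jacobian\<close>

definition inc :: "int \<Rightarrow> 'a \<Rightarrow> nat \<Rightarrow> 'a" where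
  "inc m y = (\<lambda>i. if i = N - 1 then cmp B N (N - 1) m y else 0)"

lemma top: "odd (N - 1)" "N - 1 < N" "Suc (N - 1) = N"
  using even_len len2 by auto

lemma inc_even: "even i ==> inc m y i = 0" using top(1) by (auto simp: inc_def)

lemma inc_top: "inc m y (N - 1) = cmp B N (N - 1) m y" by (simp add: inc_def)

lemma inc_other: "q \<noteq> N - 1 ==> inc m y q = 0" by (simp add: inc_def)

lemma inc_diff: "x \<in> VN m ==> y \<in> VN m ==> inc m (x - y) = inc m x - inc m y"
  using cmp_diff[OF arrow_right[OF top(1,2)], unfolded top(3)] by (auto simp: inc_def fun_eq_iff)

lemma inc_add: "x \<in> VN m ==> y \<in> VN m ==> inc m (x + y) = inc m x + inc m y"
  using cmp_add[OF arrow_right[OF top(1,2)], unfolded top(3)] by (auto simp: inc_def fun_eq_iff)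

lemma inc_scale: "x \<in> VN m ==> inc m (c *\<^sub>C x) = (\<lambda>i. c *\<^sub>C inc m x i)"
  using lin_scale[OF cmp_lin[OF arrow_right[OF top(1,2)]], unfolded top(3)] by (auto simp: inc_def fun_eq_iff)

lemma inc_Z:
  assumes y: "y \<in> WN (2 * p) m" "y \<in> ZN m" shows "inc m y \<in> dZ B p (m + 1)"
proof (rule dZI)
  note ar = arrow_right[OF top(1,2), unfolded top(3)]
  have W: "cmp B N (N - 1) m y \<in> wt B (N - 1) (2 * p) m"
    using cmp_right_W[OF top(1,2), unfolded top(3), OF y(1)] .
  show "inc m y \<in> dbC B p (m + 1)"
  proof (rule dbCI)
    show "inc m y i \<in> dbX B p i (m + 1)" if "even i" "i \<le> N" for i using dbX_zero[OF that(2)] inc_even[OF that(1)] by simp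
    show "inc m y q \<in> wt B q (2 * p) (m + 1 - 1)" if "odd q" "q < N" for q
      using W grp_zero[OF grp_W[OF less_imp_le[OF that(2)]]] by (auto simp: inc_def)
    show "inc m y i = 0" if "i > N" for i using that inc_other[of i m y] by simp
  qed
  show "dif B i (m + 1) (inc m y i) = 0" if "even i" "i \<le> N" for i
    using inc_even[OF that(1)] d_zero[OF that(2)] by simp
  fix q assume q: "odd q" "q < N"
  have "dif B q m (inc m y q) = 0"
  proof (cases "q = N - 1")
    case True
    have "cmp B N (N - 1) m y \<in> cocyc B (N - 1) m"
      by (rule quotient_isoD(1)[OF zig_familyD(5)[OF zig_total ar] y(2)])
    then show ?thesis using Z_d True inc_top by simp
  qed (use d_zero[of q m] q inc_other in simp)
  then show "cmp B (q - 1) q (m + 1) (inc m y (q - 1)) - cmp B (Suc q) q (m + 1) (inc m y (Suc q)) = dif B q (m + 1 - 1) (inc m y q)"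
    using inc_even odd_nb[OF q] cmp_left_zero[OF q] cmp_right_zero[OF q] by simp
qed

lemma grp_rat_classes: "add_subgroup (rat_classes B p m)"
proof (rule add_subgroupI)
  show "0 \<in> rat_classes B p m"
    by (rule rat_classesI[OF dbX_zero[OF le0] d_zero[OF le0] corr_boundary[OF zig_total grp_zero[OF grpN]]])
  fix y y' assume "y \<in> rat_classes B p m" "y' \<in> rat_classes B p m"
  then obtain x x' where x: "x \<in> dbX B p 0 m" "x \<in> cocyc B 0 m" "ZB m x y" "x' \<in> dbX B p 0 m" "x' \<in> cocyc B 0 m" "ZB m x' y'"
    using rat_classesE by metis
  show "y - y' \<in> rat_classes B p m"
    by (rule rat_classesI[OF dbX_diff[OF le0 x(1,4)] Z_d[OF grp_diff[OF grp_Z[OF le0] x(2,5)]] corr_diff[OF zig_total x(3,6)]])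
qed

lemma grp_J: "add_subgroup (J_den B p m)"
  unfolding J_den_def W_classes_wcl
  by (intro grp_plus grp_Int grp_rat_classes grp_F_classes grp_wcl order_refl)

lemma B_J: "BN m \<subseteq> J_den B p m"
  unfolding J_den_def W_classes_wcl using B_F_classes B_wcl[OF order_refl]
  by (intro subset_trans[OF _ subset_plus2[OF grp_rat_classes]] Int_greatest) auto

lemma rat_classes_W: "rat_classes B p m \<subseteq> W_classes B (2 * p) m"
proof
  fix y assume "y \<in> rat_classes B p m"
  then obtain x where x: "x \<in> dbX B p 0 m" "x \<in> cocyc B 0 m" "ZB m x y" by (rule rat_classesE)
  obtain z where z: "zchain B m (\<lambda>i. cocyc B i m) (\<lambda>i. cobd B i m) z" "z 0 = x" "z N = y"
    using x(3) unfolding corresponds_iff_zchain by blast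
  have "z 0 \<in> wcl 0 (2 * p) m" using WZ_wcl[OF le0] dbX_W[OF le0 x(1)] x(2) z(2) by blast
  then show "y \<in> W_classes B (2 * p) m" using zchain_wcl_iff[OF z(1) le0 order_refl] z(3) W_classes_wcl by simp
qed

lemma J_W: "J_den B p m \<subseteq> W_classes B (2 * p) m"
proof
  fix y assume "y \<in> J_den B p m"
  then obtain r f where rf: "r \<in> rat_classes B p m" "f \<in> W_classes B (2 * p) m" "y = r + f"
    unfolding J_den_def by (auto elim!: plus_memE)
  then show "y \<in> W_classes B (2 * p) m"
    using rat_classes_W grp_add[OF grp_wcl[OF order_refl]] unfolding W_classes_wcl by blast
qed

lemma W_classesE:
  assumes "y \<in> W_classes B (2 * p) m"
  obtains w where "w \<in> WN (2 * p) m" "w \<in> ZN m" "y - w \<in> BN m"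
  using assms unfolding W_classes_wcl by (elim wclE) auto

text \<open>If \<open>inc m y\<close> is the coboundary of \<open>c\<close>, moving \<open>y\<close>
  from the top place into the last bottom component turns \<open>c\<close> into a zigzag from the
  rational \<open>c 0\<close> to \<open>c N + y\<close>, so \<open>y\<close> is a rational class
  minus one in \<open>F\<close>. Conversely, such a decomposition gives a zigzag ending in
  \<open>y - f'\<close>, and replacing this end by \<open>- f'\<close> yields the primitive.\<close>

lemma inc_B_iff:
  assumes y: "y \<in> WN (2 * p) m" "y \<in> ZN m"
  shows "inc m y \<in> dB B p (m + 1) \<longleftrightarrow> y \<in> J_den B p m"
proof
  have yV: "y \<in> VN m" using y(2) Z_V by blast
  note ar = arrow_right[OF top(1,2), unfolded top(3)]
  have cases: "q = N - 1 \<longleftrightarrow> Suc q = N" for q using len2 by auto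
  {
    assume "inc m y \<in> dB B p (m + 1)"
    then obtain c where c: "c \<in> dbC B p m" "inc m y = dbD B m c" unfolding dB_def by auto
    have cd: "dif B i m (c i) = 0" if "even i" "i \<le> N" for i
      using dbD_even[OF that, of m c] inc_even[OF that(1), of m y] c(2) by simp
    have cZ: "c i \<in> cocyc B i m" if "even i" "i \<le> N" for i
      by (rule ZI[OF dbC_V_even[OF c(1) that] cd[OF that]])
    define u where "u i = (if i = N then c i + y else c i)" for i
    have "ZB m (u 0) (u N)"
    proof (rule corresponds_if_tops)
      show "u i \<in> cocyc B i m" if "even i" "i \<le> N" for i
        using cZ[OF that] grp_add[OF grp_Z[OF order_refl] _ y(2)] by (auto simp: u_def)
      fix q assume q: "odd q" "q < N"
      have "cmp B (q - 1) q m (u (q - 1)) - cmp B (Suc q) q m (u (Suc q)) = dif B q (m - 1) (c q)"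
      proof (cases "q = N - 1")
        case True
        have qs: "Suc q = N" "q - 1 \<noteq> N" using True top(3) q by auto
        have cV: "c N \<in> VN m" by (rule dbC_V_even[OF c(1) even_len order_refl])
        have ar': "(N, q) \<in> arrows N" using ar True by simp
        have "cmp B N q m y = cmp B (q - 1) q m (c (q - 1)) - cmp B (Suc q) q m (c (Suc q)) - dif B q (m - 1) (c q)"
          using fun_cong[OF c(2), of q] inc_top[of m y] dbD_odd[OF q] True by simp
        then show ?thesis using qs cmp_add[OF ar' cV yV] by (simp add: u_def algebra_simps)
      next
        case False
        then have qs: "Suc q \<noteq> N" "q - 1 \<noteq> N" using cases q by auto
        show ?thesis using fun_cong[OF c(2), of q] inc_other[OF False, of m y] dbD_odd[OF q, of m c] qs by (simp add: u_def)
      qed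
      then show "cmp B (q - 1) q m (u (q - 1)) - cmp B (Suc q) q m (u (Suc q)) \<in> cobd B q m"
        by (rule BI[OF W_V[OF less_imp_le[OF q(2)] dbC_odd[OF c(1) q]]])
    qed
    moreover have "u 0 = c 0" using len2 by (simp add: u_def)
    ultimately have "c N + y \<in> rat_classes B p m"
      using rat_classesI[OF dbC_even[OF c(1), of 0] cd[of 0], of "c N + y"] by (simp add: u_def)
    moreover have "- c N \<in> F_classes B p m \<inter> W_classes B (2 * p) m"
      by (rule grp_minus[OF _ FW_classesI[OF dbC_even[OF c(1) even_len order_refl] cZ[OF even_len order_refl]]])
        (auto simp: W_classes_wcl intro: grp_Int grp_F_classes grp_wcl)
    ultimately show "y \<in> J_den B p m" unfolding J_den_def by (intro plus_memI[of "c N + y"]) simp_all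
  }
  assume "y \<in> J_den B p m"
  then obtain r f where rf: "r \<in> rat_classes B p m" "f \<in> F_classes B p m \<inter> W_classes B (2 * p) m" "y = r + f"
    unfolding J_den_def by (auto elim!: plus_memE)
  obtain x where x: "x \<in> dbX B p 0 m" "x \<in> cocyc B 0 m" "ZB m x r" using rf(1) by (rule rat_classesE)
  obtain f' where f': "f' \<in> dbX B p N m" "f' \<in> ZN m" "f - f' \<in> BN m" using rf(2) by (rule FW_ex)
  have f'V: "f' \<in> VN m" using f'(2) Z_V by blast
  have "r - (y - f') \<in> BN m" by (rule mem_eq[OF grp_minus[OF grpN f'(3)]]) (simp add: rf(3))
  then have "ZB m x (y - f')" by (rule corr_modify[OF zig_total x(3)])
  then obtain c where c: "c 0 = x" "c N = y - f'" and ce: "\<And>i. even i ==> i \<le> N ==> c i \<in> wt B i (2 * p) m \<and> c i \<in> cocyc B i m"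
    and co: "\<And>q. odd q ==> q < N ==> c q \<in> wt B q (2 * p) (m - 1) \<and>
      cmp B (q - 1) q m (c (q - 1)) - cmp B (Suc q) q m (c (Suc q)) = dif B q (m - 1) (c q)"
    using zigzag_lift[OF dbX_W[OF le0 x(1)] x(2) grp_diff[OF grp_W[OF order_refl] y(1) dbX_W[OF order_refl f'(1)]] grp_diff[OF grp_Z[OF order_refl] y(2) f'(2)]] by blast
  define u where "u i = (if i = N then - f' else c i)" for i
  let ?c = "mk_cochain B u c"
  have uX: "u i \<in> dbX B p i m" if "even i" "i \<le> N" for i
    using ce[OF that] c(1) x(1) len2 grp_minus[OF grp_dbX[OF order_refl] f'(1)] by (cases "i = 0") (auto simp: dbX_def u_def)
  have uZ: "dif B i m (u i) = 0" if "even i" "i \<le> N" for i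
    using Z_d[of "c i" i m] ce[OF that] Z_d[OF grp_minus[OF grp_Z[OF order_refl] f'(2)]] by (auto simp: u_def)
  have cC: "?c \<in> dbC B p m" by (rule mk_C) (use uX co in auto)
  have "inc m y = dbD B m ?c"
  proof (rule db_ext)
    show "inc m y i = dbD B m ?c i" if "even i" "i \<le> N" for i
      using dbD_even[OF that] uZ[OF that] inc_even[OF that(1)] that by simp
    show "inc m y i = dbD B m ?c i" if "i > N" for i using dbD_out[OF that, of m] that inc_other[of i m y] by simp
    fix q assume q: "odd q" "q < N"
    note nb = odd_nb[OF q]
    have D: "dbD B m ?c q = cmp B (q - 1) q m (u (q - 1)) - cmp B (Suc q) q m (u (Suc q)) - dif B q (m - 1) (c q)"
      using dbD_odd[OF q] nb q by simp
    show "inc m y q = dbD B m ?c q"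
    proof (cases "q = N - 1")
      case True
      have qs: "Suc q = N" "q - 1 \<noteq> N" using True top(3) q by auto
      have ar': "(N, q) \<in> arrows N" using ar True by simp
      have "cmp B N q m (- f') = - cmp B N q m f'" "cmp B N q m (y - f') = cmp B N q m y - cmp B N q m f'"
        using lin_minus[OF cmp_lin[OF ar'] f'V] cmp_diff[OF ar' yV f'V] by auto
      then show ?thesis using D co[OF q] qs c(2) inc_top[of m y] True by (simp add: u_def algebra_simps)
    next
      case False
      then have qs: "Suc q \<noteq> N" "q - 1 \<noteq> N" using cases q by auto
      show ?thesis using D co[OF q] qs inc_other[OF False] by (simp add: u_def)
    qed
  qed
  then show "inc m y \<in> dB B p (m + 1)" using cC unfolding dB_def by auto
qed

text \<open>Exactness of the last bottom component spreads to the left through the comparison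
  isomorphisms.\<close>

lemma bottoms_B:
  assumes a: "a \<in> dZ B p m" "a N \<in> BN m" and i: "even i" "i \<le> N"
  shows "a i \<in> cobd B i m"
proof -
  have "2 * j \<le> N ==> a (N - 2 * j) \<in> cobd B (N - 2 * j) m" for j
  proof (induction j)
    case 0
    then show ?case using a(2) by simp
  next
    case (Suc j)
    define q where "q = N - 2 * j - 1"
    have q: "odd q" "q < N" "Suc q = N - 2 * j" "q - 1 = N - 2 * Suc j"
      using Suc.prems even_len by (auto simp: q_def)
    note ql = less_imp_le[OF q(2)]
    have "a (Suc q) \<in> cobd B (Suc q) m" using Suc q(3) by simp
    then have "cmp B (Suc q) q m (a (Suc q)) \<in> cobd B q m"
      by (rule quotient_isoD(2)[OF zig_familyD(5)[OF zig_total arrow_right[OF q(1,2)]]])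
    then have "cmp B (q - 1) q m (a (q - 1)) \<in> cobd B q m"
      by (rule mem_eq[OF grp_add[OF grp_B[OF ql] tops_B[OF a(1) q(1,2)]]]) simp
    then have "a (q - 1) \<in> cobd B (q - 1) m"
      by (rule quotient_isoD(3)[OF zig_familyD(5)[OF zig_total arrow_left[OF q(1,2)]] dZ_cocyc[OF a(1) odd_nb(1,2)[OF q(1,2)]]])
    then show ?case using q(4) by simp
  qed
  from this[of "(N - i) div 2"] show ?thesis using i even_len by (auto elim!: evenE)
qed

text \<open>Strictness first removes the bottom components inside their filtered terms. The tops
  that remain are cocycles, and solving the zigzag from 0 at the left end pushes all of them to the
  right, where they accumulate in \<open>c N\<close>; the representative is
  \<open>- c N\<close>.\<close>

lemma kernel_rep:
  assumes a: "a \<in> dZ B p (m + 1)" "a N \<in> BN (m + 1)"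
  obtains w where "w \<in> WN (2 * p) m" "w \<in> ZN m" "a - inc m w \<in> dB B p (m + 1)"
proof -
  have "\<exists>v. even i \<and> i \<le> N \<longrightarrow> v \<in> dbX B p i m \<and> a i = dif B i m v" for i
    using dbX_strict[OF _ dbC_even[OF dZ_C[OF a(1)]] bottoms_B[OF a]] by fastforce
  then obtain v where v: "\<And>i. even i ==> i \<le> N ==> v i \<in> dbX B p i m \<and> a i = dif B i m (v i)" by metis
  let ?c0 = "mk_cochain B v (\<lambda>_. 0)"
  have c0: "?c0 \<in> dbC B p m" using v grp_zero[OF grp_W] by (intro mk_C) auto
  define a' where "a' = a - dbD B m ?c0"
  have B0: "dbD B m ?c0 \<in> dB B p (m + 1)" using c0 unfolding dB_def by auto
  have a'Z: "a' \<in> dZ B p (m + 1)" unfolding a'_def by (rule grp_diff[OF grp_dZ a(1) subsetD[OF dB_dZ B0]])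
  have a'0: "a' i = 0" if "even i" "i \<le> N" for i
    using v[OF that] dbD_even[OF that, of m ?c0] that by (simp add: a'_def)
  have t: "a' q \<in> wt B q (2 * p) m \<and> a' q \<in> cocyc B q m" if q: "odd q" "q < N" for q
  proof -
    have W: "a' q \<in> wt B q (2 * p) m" using dbC_odd[OF dZ_C[OF a'Z] q] by simp
    have "dif B q m (a' q) = 0" using dZ_odd[OF a'Z q] a'0 odd_nb[OF q] cmp_left_zero[OF q] cmp_right_zero[OF q] by simp
    then show ?thesis using W ZI[OF W_V[OF less_imp_le[OF q(2)] W]] by blast
  qed
  obtain c where c0': "c 0 = 0" and ce: "\<And>i. even i ==> i \<le> N ==> c i \<in> wt B i (2 * p) m \<and> c i \<in> cocyc B i m"
    and co: "\<And>q. odd q ==> q < N ==> c q \<in> wt B q (2 * p) (m - 1) \<and>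
      cmp B (q - 1) q m (c (q - 1)) - cmp B (Suc q) q m (c (Suc q)) - dif B q (m - 1) (c q) = a' q"
    using zigzag_solve[OF grp_zero[OF grp_W[OF le0]] grp_zero[OF grp_Z[OF le0]] t] by blast
  let ?w = "c N"
  note wN = ce[OF even_len order_refl]
  have wV: "?w \<in> VN m" using wN Z_V by blast
  define u where "u i = (if i = N then 0 else c i)" for i
  let ?c = "mk_cochain B u c"
  have uX: "u i \<in> dbX B p i m" if "even i" "i \<le> N" for i
    using ce[OF that] c0' dbX_zero[OF that(2)] dbX_zero[OF le0] by (cases "i = 0"; cases "i = N") (auto simp: dbX_def u_def)
  have uZ: "dif B i m (u i) = 0" if "even i" "i \<le> N" for i
    using Z_d[of "c i" i m] ce[OF that] d_zero[OF that(2)] by (auto simp: u_def)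
  have cC: "?c \<in> dbC B p m" by (rule mk_C) (use uX co in auto)
  have D: "dbD B m ?c = a' + inc m ?w"
  proof (rule db_ext)
    show "dbD B m ?c i = (a' + inc m ?w) i" if "even i" "i \<le> N" for i
      using dbD_even[OF that] uZ[OF that] inc_even[OF that(1)] a'0[OF that] that by simp
    show "dbD B m ?c i = (a' + inc m ?w) i" if "i > N" for i
      using dbD_out[OF that, of m] dbC_out[OF dZ_C[OF a'Z] that] that inc_other[of i m ?w] by simp
    fix q assume q: "odd q" "q < N"
    note nb = odd_nb[OF q]
    have D: "dbD B m ?c q = cmp B (q - 1) q m (u (q - 1)) - cmp B (Suc q) q m (u (Suc q)) - dif B q (m - 1) (c q)"
      using dbD_odd[OF q] nb q by simp
    show "dbD B m ?c q = (a' + inc m ?w) q"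
    proof (cases "q = N - 1")
      case True
      have qs: "Suc q = N" "q - 1 \<noteq> N" using True top(3) q by auto
      show ?thesis using cmp_right_zero[OF q] D co[OF q] qs inc_top[of m ?w] True by (simp add: u_def algebra_simps)
    next
      case False
      then have qs: "Suc q \<noteq> N" "q - 1 \<noteq> N" using q by auto
      show ?thesis using D co[OF q] qs inc_other[OF False] by (simp add: u_def)
    qed
  qed
  have DB: "dbD B m ?c \<in> dB B p (m + 1)" using cC unfolding dB_def by auto
  have neg: "inc m (- ?w) = - inc m ?w" using inc_scale[OF wV, of "-1"] by (simp add: fun_eq_iff)
  have "a - inc m (- ?w) \<in> dB B p (m + 1)"
    by (rule mem_eq[OF grp_add[OF grp_dB B0 DB]]) (simp add: neg D a'_def)
  then show ?thesis using that grp_minus[OF grp_W[OF order_refl]] grp_minus[OF grp_Z[OF order_refl]] wN by blast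
qed

lemma JH_E:
  assumes "X \<in> JH B p n"
  obtains w where "w \<in> WN (2 * p) (2 * p + n - 1)" "w \<in> ZN (2 * p + n - 1)" "X = w +o J_den B p (2 * p + n - 1)"
proof -
  obtain y where y: "y \<in> W_classes B (2 * p) (2 * p + n - 1)" "X = y +o J_den B p (2 * p + n - 1)" using assms unfolding JH_def by blast
  obtain w where w: "w \<in> WN (2 * p) (2 * p + n - 1)" "w \<in> ZN (2 * p + n - 1)" "y - w \<in> BN (2 * p + n - 1)"
    using y(1) by (rule W_classesE)
  have "X = w +o J_den B p (2 * p + n - 1)" unfolding y(2) coset_eq_iff[OF grp_J] using w(3) B_J by blast
  then show ?thesis using that w by blast
qed

lemma JH_I:
  "w \<in> WN (2 * p) (2 * p + n - 1) ==> w \<in> ZN (2 * p + n - 1) ==> w +o J_den B p (2 * p + n - 1) \<in> JH B p n"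
  unfolding JH_def W_classes_wcl using WZ_wcl[OF order_refl] by blast

lemma J_incl_eq:
  assumes w: "w \<in> WN (2 * p) (2 * p + n - 1)" "w \<in> ZN (2 * p + n - 1)"
  shows "J_incl B p n (w +o J_den B p (2 * p + n - 1)) = cl p (2 * p + n) (inc (2 * p + n - 1) w)"
proof -
  let ?m = "2 * p + n - 1"
  have eq: "cl p (2 * p + n) (inc ?m y) = cl p (2 * p + n) (inc ?m w)"
    if y: "y \<in> (w +o J_den B p ?m) \<inter> WN (2 * p) ?m" for y
  proof -
    have yJ: "y - w \<in> J_den B p ?m" and yW: "y - w \<in> WN (2 * p) ?m"
      using y grp_diff[OF grp_W[OF order_refl] _ w(1)] coset_mem[of y w] by auto
    have yZ: "y - w \<in> ZN ?m" using yJ J_W wcl_Z[OF order_refl] unfolding W_classes_wcl by blast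
    have "y \<in> VN ?m" "w \<in> VN ?m" using y w W_V[OF order_refl] by blast+
    then have "inc ?m y - inc ?m w \<in> dB B p (2 * p + n)" using inc_B_iff[OF yW yZ] yJ inc_diff by simp
    then show ?thesis unfolding coset_eq_iff[OF grp_dB] .
  qed
  have ne: "(w +o J_den B p ?m) \<inter> WN (2 * p) ?m \<noteq> {}" using coset_self[OF grp_J] w(1) by blast
  show ?thesis unfolding J_incl_def Let_def db_coboundaries_eq inc_def[symmetric] by (rule UN_const[OF ne eq])
qed

lemma kernel_eq: "db_kernel \<alpha> B p n = {cl p (2 * p + n) a | a. a \<in> dZ B p (2 * p + n) \<and> a N \<in> BN (2 * p + n)}"
proof -
  have "hc (2 * p + n) y = BN (2 * p + n) \<longleftrightarrow> y \<in> BN (2 * p + n)" for y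
    using coset_eq_iff[OF grpN, of y "2 * p + n" 0] by simp
  then show ?thesis unfolding db_kernel_def H_piece using proj_cl[of p n] by auto
qed

lemma kernel_E:
  assumes "X \<in> db_kernel \<alpha> B p n"
  obtains w where "w \<in> WN (2 * p) (2 * p + n - 1)" "w \<in> ZN (2 * p + n - 1)"
    "X = cl p (2 * p + n) (inc (2 * p + n - 1) w)"
proof -
  obtain a where a: "a \<in> dZ B p (2 * p + n)" "a N \<in> BN (2 * p + n)" "X = cl p (2 * p + n) a"
    using assms unfolding kernel_eq by blast
  obtain w where w: "w \<in> WN (2 * p) (2 * p + n - 1)" "w \<in> ZN (2 * p + n - 1)"
    "a - inc (2 * p + n - 1) w \<in> dB B p (2 * p + n - 1 + 1)"
    by (rule kernel_rep[of a p "2 * p + n - 1"]) (use a in simp_all)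
  have "X = cl p (2 * p + n) (inc (2 * p + n - 1) w)" unfolding a(3) coset_eq_iff[OF grp_dB] using w(3) by simp
  then show ?thesis using that w by blast
qed

lemma J_bij: "bij_betw (J_incl B p n) (JH B p n) (db_kernel \<alpha> B p n)"
proof (rule bij_betw_imageI)
  let ?m = "2 * p + n - 1"
  show "inj_on (J_incl B p n) (JH B p n)"
  proof (rule inj_onI)
    fix X Y assume "X \<in> JH B p n" "Y \<in> JH B p n" and eq: "J_incl B p n X = J_incl B p n Y"
    then obtain w w' where w: "w \<in> WN (2 * p) ?m" "w \<in> ZN ?m" "X = w +o J_den B p ?m"
      and w': "w' \<in> WN (2 * p) ?m" "w' \<in> ZN ?m" "Y = w' +o J_den B p ?m"
      using JH_E by metis
    note V = subsetD[OF Z_V w(2)] subsetD[OF Z_V w'(2)]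
    have "inc ?m w - inc ?m w' \<in> dB B p (2 * p + n)"
      using eq unfolding w(3) w'(3) J_incl_eq[OF w(1,2)] J_incl_eq[OF w'(1,2)] coset_eq_iff[OF grp_dB] .
    then have "inc ?m (w - w') \<in> dB B p (?m + 1)" using inc_diff[OF V] by simp
    then have "w - w' \<in> J_den B p ?m"
      using inc_B_iff[OF grp_diff[OF grp_W[OF order_refl] w(1) w'(1)] grp_diff[OF grp_Z[OF order_refl] w(2) w'(2)]] by blast
    then show "X = Y" unfolding w(3) w'(3) coset_eq_iff[OF grp_J] .
  qed
  show "J_incl B p n ` JH B p n = db_kernel \<alpha> B p n"
  proof (rule set_eqI, rule iffI)
    fix Y assume "Y \<in> J_incl B p n ` JH B p n"
    then obtain X where X: "X \<in> JH B p n" "Y = J_incl B p n X" by blast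
    obtain w where w: "w \<in> WN (2 * p) ?m" "w \<in> ZN ?m" "X = w +o J_den B p ?m" using X(1) by (rule JH_E)
    have "inc ?m w \<in> dZ B p (2 * p + n)" using inc_Z[OF w(1,2)] by simp
    moreover have "inc ?m w N \<in> BN (2 * p + n)" using inc_even[OF even_len] grp_zero[OF grpN] by simp
    ultimately show "Y \<in> db_kernel \<alpha> B p n" unfolding X(2) w(3) J_incl_eq[OF w(1,2)] kernel_eq by blast
  next
    fix Y assume "Y \<in> db_kernel \<alpha> B p n"
    then obtain w where w: "w \<in> WN (2 * p) ?m" "w \<in> ZN ?m" "Y = cl p (2 * p + n) (inc ?m w)" by (rule kernel_E)
    then show "Y \<in> J_incl B p n ` JH B p n" using J_incl_eq[OF w(1,2)] JH_I[OF w(1,2)] by blast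
  qed
qed

lemma J_add:
  assumes "X \<in> JH B p n" "Y \<in> JH B p n" shows "J_incl B p n (X + Y) = J_incl B p n X + J_incl B p n Y"
proof -
  let ?m = "2 * p + n - 1"
  obtain w where w: "w \<in> WN (2 * p) ?m" "w \<in> ZN ?m" "X = w +o J_den B p ?m" using assms(1) by (rule JH_E)
  obtain w' where w': "w' \<in> WN (2 * p) ?m" "w' \<in> ZN ?m" "Y = w' +o J_den B p ?m" using assms(2) by (rule JH_E)
  show ?thesis
    unfolding w(3) w'(3) coset_add[OF grp_J] J_incl_eq[OF w(1,2)] J_incl_eq[OF w'(1,2)] coset_add[OF grp_dB]
      J_incl_eq[OF grp_add[OF grp_W[OF order_refl] w(1) w'(1)] grp_add[OF grp_Z[OF order_refl] w(2) w'(2)]]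
      inc_add[OF subsetD[OF Z_V w(2)] subsetD[OF Z_V w'(2)]] ..
qed

lemma scale_NZ:
  assumes "w \<in> WN k m" "w \<in> ZN m"
  shows "c *\<^sub>C w \<in> WN k m" "c *\<^sub>C w \<in> ZN m"
proof -
  show "c *\<^sub>C w \<in> WN k m" using csub_W[OF order_refl] assms(1) by (simp add: subspace_over_def)
  have V: "w \<in> VN m" using assms(2) Z_V by blast
  show "c *\<^sub>C w \<in> ZN m"
    using d_scale[OF order_refl V, of c] Z_d[OF assms(2)] by (intro ZI V_scale[OF order_refl V]) simp
qed

text \<open>Read off from cochains: boundaries are stable under \<open>K\<close>, and
  \<open>inc_B_iff\<close> translates this into stability of the denominator.\<close>

lemma J_den_scale:
  assumes c: "c \<in> K" and y: "y \<in> J_den B p m" shows "c *\<^sub>C y \<in> J_den B p m"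
proof -
  obtain w where w: "w \<in> WN (2 * p) m" "w \<in> ZN m" "y - w \<in> BN m"
    using subsetD[OF J_W y] by (rule W_classesE)
  have "w \<in> J_den B p m" by (rule mem_eq[OF grp_diff[OF grp_J y subsetD[OF B_J w(3)]]]) simp
  then have "inc m w \<in> dB B p (m + 1)" using inc_B_iff[OF w(1,2)] by blast
  then have "inc m (c *\<^sub>C w) \<in> dB B p (m + 1)" using dB_scale[OF c] inc_scale[OF subsetD[OF Z_V w(2)]] by simp
  then have cw: "c *\<^sub>C w \<in> J_den B p m" using inc_B_iff[OF scale_NZ[OF w(1,2)]] by blast
  obtain v where v: "v \<in> VN (m - 1)" "y - w = dif B N (m - 1) v" using w(3) by (rule BE)
  have "c *\<^sub>C (y - w) \<in> BN m"
    using d_scale[OF order_refl v(1), of c] v(2) by (intro BI[OF V_scale[OF order_refl v(1), of c]]) simp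
  then have "c *\<^sub>C w + c *\<^sub>C (y - w) \<in> J_den B p m" using grp_add[OF grp_J cw] B_J by blast
  then show ?thesis by (rule mem_eq) (simp add: scaleC.scale_right_diff_distrib)
qed

lemma J_scale:
  assumes c: "c \<in> K" and X: "X \<in> JH B p n"
  shows "J_incl B p n ((\<lambda>y. c *\<^sub>C y) ` X + J_den B p (2 * p + n - 1)) = scal (H_DB \<alpha> B) p n c (J_incl B p n X)"
proof -
  let ?m = "2 * p + n - 1"
  obtain w where w: "w \<in> WN (2 * p) ?m" "w \<in> ZN ?m" "X = w +o J_den B p ?m" using X by (rule JH_E)
  have "(\<lambda>y. c *\<^sub>C y) ` X + J_den B p ?m = c *\<^sub>C w +o J_den B p ?m"
    unfolding w(3)
    by (rule coset_image[OF grp_J grp_J]) (use J_den_scale[OF c] in \<open>simp add: coset_mem scaleC.scale_right_diff_distrib[symmetric]\<close>)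
  then show ?thesis
    unfolding w(3) J_incl_eq[OF w(1,2)] H_scal[OF c] inc_scale[OF subsetD[OF Z_V w(2)], symmetric]
    using J_incl_eq[OF scale_NZ[OF w(1,2)]] by simp
qed

text \<open>Each term of the product formula for a top component has a bottom component as a factor,
  and each bottom component of the product is a product of bottoms.\<close>

lemma inc_mult:
  assumes a: "a \<in> dbC B p m" "\<And>i. even i ==> a i = 0" and b: "b \<in> dbC B p' m'" "\<And>i. even i ==> b i = 0"
  shows "P m m' a b = 0"
proof (rule db_ext)
  show "P m m' a b i = 0 i" if "even i" "i \<le> N" for i
    using P_even[OF that] a(2)[OF that(1)] mul_zero_l[OF that(2) dbC_V_even[OF b(1) that]] by simp
  show "P m m' a b i = 0 i" if "i > N" for i using P_out[OF that] by simp
  fix q assume q: "odd q" "q < N"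
  note ql = less_imp_le[OF q(2)]
  show "P m m' a b q = 0 q"
    unfolding P_odd[OF q] using cmp_left_zero[OF q] cmp_right_zero[OF q] a(2) b(2) odd_nb[OF q] mul_zero_r[OF ql W_V[OF ql dbC_odd[OF a(1) q]]]
      mul_zero_l[OF ql W_V[OF ql dbC_odd[OF b(1) q]]] by (simp add: sgn_pow_def)
qed

lemma kernel_mult:
  assumes a: "a \<in> dZ B p m" "a N \<in> BN m" and b: "b \<in> dZ B p' m'" "b N \<in> BN m'"
  shows "P m m' a b \<in> dB B (p + p') (m + m')"
proof -
  obtain w where w: "w \<in> WN (2 * p) (m - 1)" "w \<in> ZN (m - 1)" "a - inc (m - 1) w \<in> dB B p (m - 1 + 1)"
    by (rule kernel_rep[of a p "m - 1"]) (use a in simp_all)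
  obtain w' where w': "w' \<in> WN (2 * p') (m' - 1)" "w' \<in> ZN (m' - 1)" "b - inc (m' - 1) w' \<in> dB B p' (m' - 1 + 1)"
    by (rule kernel_rep[of b p' "m' - 1"]) (use b in simp_all)
  have Z: "inc (m - 1) w \<in> dZ B p m" "inc (m' - 1) w' \<in> dZ B p' m'" using inc_Z[OF w(1,2)] inc_Z[OF w'(1,2)] by simp_all
  have "P m m' (inc (m - 1) w) (inc (m' - 1) w') = 0" by (rule inc_mult[OF dZ_C[OF Z(1)] inc_even dZ_C[OF Z(2)] inc_even])
  then show ?thesis using P_cong[OF a(1) Z(1) _ b(1) Z(2)] w(3) w'(3) by simp
qed

lemma kernel_square_zero:
  assumes "X \<in> db_kernel \<alpha> B p n" "Y \<in> db_kernel \<alpha> B p' n'"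
  shows "times_of (H_DB \<alpha> B) p n p' n' X Y = db_coboundaries B (p + p') (n + n')"
proof -
  obtain a where a: "a \<in> dZ B p (2 * p + n)" "a N \<in> BN (2 * p + n)" "X = cl p (2 * p + n) a"
    using assms(1) unfolding kernel_eq by blast
  obtain b where b: "b \<in> dZ B p' (2 * p' + n')" "b N \<in> BN (2 * p' + n')" "Y = cl p' (2 * p' + n') b"
    using assms(2) unfolding kernel_eq by blast
  have e: "2 * (p + p') + (n + n') = 2 * p + n + (2 * p' + n')" by simp
  show ?thesis
    unfolding a(3) b(3) H_times[OF a(1) b(1)] db_coboundaries_eq e by (rule coset_trivial[OF grp_dB kernel_mult[OF a(1,2) b(1,2)]])
qed

subsection \<open>The algebra section\<close>

lemma db_unit_even: "even i ==> i \<le> N ==> db_unit B i = unt B i"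
  and db_unit_odd: "odd i ==> db_unit B i = 0" and db_unit_out: "i > N ==> db_unit B i = 0"
  by (simp_all add: db_unit_def)

lemma unt_V: "i \<le> N ==> unt B i \<in> cpt B i 0" using W_V[OF _ unt_W] .

lemma db_unit_Z: "db_unit B \<in> dZ B 0 0"
proof (rule dZI)
  show "db_unit B \<in> dbC B 0 0"
  proof (rule dbCI)
    show "db_unit B i \<in> dbX B 0 i 0" if "even i" "i \<le> N" for i
      using db_unit_even[OF that] unt_W[OF that(2)] unt_R unt_F by (auto simp: dbX_def tate_def scaleC_one)
    show "db_unit B q \<in> wt B q (2 * 0) (0 - 1)" if "odd q" "q < N" for q
      using db_unit_odd[OF that(1)] grp_zero[OF grp_W[OF less_imp_le[OF that(2)]]] by simp
  qed (rule db_unit_out)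
  show "dif B i 0 (db_unit B i) = 0" if "even i" "i \<le> N" for i using db_unit_even[OF that] unt_d[OF that(2)] by simp
  show "cmp B (q - 1) q 0 (db_unit B (q - 1)) - cmp B (Suc q) q 0 (db_unit B (Suc q)) = dif B q (0 - 1) (db_unit B q)"
    if q: "odd q" "q < N" for q
    using odd_nb[OF q] db_unit_even unt_cmp[OF arrow_left[OF q]] unt_cmp[OF arrow_right[OF q]] db_unit_odd[OF q(1)]
      d_zero[OF less_imp_le[OF q(2)]] by simp
qed

lemma db_unit_l: assumes a: "a \<in> dZ B p m" shows "P 0 m (db_unit B) a = a"
proof (rule db_ext)
  note aC = dZ_C[OF a]
  show "P 0 m (db_unit B) a i = a i" if "even i" "i \<le> N" for i
    using P_even[OF that] db_unit_even[OF that] unt_l[OF that(2) dbC_V_even[OF aC that]] by simp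
  show "P 0 m (db_unit B) a i = a i" if "i > N" for i using P_out[OF that] dbC_out[OF aC that] by simp
  fix q assume q: "odd q" "q < N"
  note ql = less_imp_le[OF q(2)] and nb = odd_nb[OF q]
  have V: "a q \<in> cpt B q (m - 1)" "cmp B (q - 1) q m (a (q - 1)) \<in> cpt B q m" "cmp B (Suc q) q m (a (Suc q)) \<in> cpt B q m"
    using W_V[OF ql dbC_odd[OF aC q]] cmp_left_V[OF q dbC_V_even[OF aC nb(1,2)]] cmp_right_V[OF q dbC_V_even[OF aC nb(3,4)]] by blast+
  show "P 0 m (db_unit B) a q = a q"
    unfolding P_odd[OF q] db_unit_odd[OF q(1)] db_unit_even[OF nb(1,2)] db_unit_even[OF nb(3,4)]
      unt_cmp[OF arrow_left[OF q]] unt_cmp[OF arrow_right[OF q]] unt_l[OF ql V(1)] mul_zero_l[OF ql V(2)] mul_zero_l[OF ql V(3)]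
    by (simp add: sgn_pow_def scaleC_add_left[symmetric] scaleC_one)
qed

lemma db_unit_r: assumes a: "a \<in> dZ B p m" shows "P m 0 a (db_unit B) = a"
proof (rule db_ext)
  note aC = dZ_C[OF a]
  show "P m 0 a (db_unit B) i = a i" if "even i" "i \<le> N" for i
    using P_even[OF that] db_unit_even[OF that] unt_r[OF that(2) dbC_V_even[OF aC that]] by simp
  show "P m 0 a (db_unit B) i = a i" if "i > N" for i using P_out[OF that] dbC_out[OF aC that] by simp
  fix q assume q: "odd q" "q < N"
  note ql = less_imp_le[OF q(2)] and nb = odd_nb[OF q]
  have V: "a q \<in> cpt B q (m - 1)" "cmp B (q - 1) q m (a (q - 1)) \<in> cpt B q m" "cmp B (Suc q) q m (a (Suc q)) \<in> cpt B q m"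
    using W_V[OF ql dbC_odd[OF aC q]] cmp_left_V[OF q dbC_V_even[OF aC nb(1,2)]] cmp_right_V[OF q dbC_V_even[OF aC nb(3,4)]] by blast+
  show "P m 0 a (db_unit B) q = a q"
    unfolding P_odd[OF q] db_unit_odd[OF q(1)] db_unit_even[OF nb(1,2)] db_unit_even[OF nb(3,4)]
      unt_cmp[OF arrow_left[OF q]] unt_cmp[OF arrow_right[OF q]] unt_r[OF ql V(1)] mul_zero_r[OF ql V(2)] mul_zero_r[OF ql V(3)]
    by (simp add: sgn_pow_def scaleC_add_left[symmetric] scaleC_one)
qed

lemma split_section:
  assumes S: "db_splitting K B P S"
  shows "\<exists>\<sigma>. bigraded_algebra_hom K (Hdg B) (H_DB \<alpha> B) \<sigma> \<and> (\<forall>p n. \<forall>x\<in>piece (Hdg B) p n. db_proj B p n (\<sigma> p n x) = x)"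
proof -
  note SD = db_splittingD[OF S]
  \<comment> \<open>All elements of \<open>S\<close> over a given class are taken together. The
    conditions on \<open>S\<close> make this set a single coset of the coboundaries, so no
    representatives have to be chosen.\<close>
  define \<sigma> where "\<sigma> p n X = {a \<in> S p (2 * p + n). a N \<in> X}" for p n :: int and X
  have eq: "\<sigma> p n (hc (2 * p + n) (s N)) = cl p (2 * p + n) s" if s: "s \<in> S p (2 * p + n)" for p n s
  proof (rule set_eqI)
    let ?m = "2 * p + n"
    fix a
    have "a \<in> S p ?m \<and> a N - s N \<in> BN ?m \<longleftrightarrow> a - s \<in> dB B p ?m"
    proof
      assume a: "a \<in> S p ?m \<and> a N - s N \<in> BN ?m"
      show "a - s \<in> dB B p ?m" by (rule SD(6)[OF grp_diff[OF SD(1) _ s]]) (use a in simp_all)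
    next
      assume a: "a - s \<in> dB B p ?m"
      have "a \<in> S p ?m" by (rule mem_eq[OF grp_add[OF SD(1) s subsetD[OF SD(3) a]]]) simp
      then show "a \<in> S p ?m \<and> a N - s N \<in> BN ?m" using last_B[OF a] by simp
    qed
    then show "a \<in> \<sigma> p n (hc ?m (s N)) \<longleftrightarrow> a \<in> cl p ?m s" unfolding \<sigma>_def coset_mem by blast
  qed
  have rep: "\<exists>s\<in>S p (2 * p + n). X = hc (2 * p + n) (s N)" if X: "X \<in> piece (Hdg B) p n" for p n X
  proof -
    let ?m = "2 * p + n"
    obtain y where y: "y \<in> HZ p ?m" "X = hc ?m y" using X unfolding Hdg_piece by blast
    obtain a where a: "a \<in> dZ B p ?m" "y - a N \<in> BN ?m" using y(1) by (rule HZ_lift)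
    obtain s where s: "s \<in> S p ?m" "a N - s N \<in> BN ?m" using SD(5)[OF a(1)] by blast
    have "y - s N \<in> BN ?m" by (rule mem_eq[OF grp_add[OF grpN a(2) s(2)]]) simp
    then show ?thesis using s(1) unfolding y(2) coset_eq_iff[OF grpN] by blast
  qed
  have one: "\<sigma> 0 0 (unit_of (Hdg B)) = unit_of (H_DB \<alpha> B)"
  proof -
    let ?o = "db_unit B"
    obtain s where s: "s \<in> S 0 0" "?o N - s N \<in> BN 0" using SD(5)[OF db_unit_Z] by blast
    note sZ = subsetD[OF SD(2) s(1)] and oZ = db_unit_Z
    \<comment> \<open>Write \<open>s = 1 + \<epsilon>\<close>. The element \<open>s s - s\<close>
      lies in \<open>S\<close> and has exact last component, so it is a boundary;
      \<open>\<epsilon> \<epsilon>\<close> is one because the kernel has square zero; and their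
      difference is \<open>\<epsilon>\<close>.\<close>
    define \<epsilon> where "\<epsilon> = s - ?o"
    have \<epsilon>Z: "\<epsilon> \<in> dZ B 0 0" unfolding \<epsilon>_def by (rule grp_diff[OF grp_dZ sZ oZ])
    have \<epsilon>l: "\<epsilon> N \<in> BN 0" by (rule mem_eq[OF grp_minus[OF grpN s(2)]]) (simp add: \<epsilon>_def)
    have \<epsilon>\<epsilon>: "P 0 0 \<epsilon> \<epsilon> \<in> dB B 0 0" using kernel_mult[OF \<epsilon>Z \<epsilon>l \<epsilon>Z \<epsilon>l] by simp
    have uV: "unt B N \<in> ZN 0" by (rule ZI[OF unt_V[OF order_refl] unt_d[OF order_refl]])
    have so: "s N - unt B N \<in> BN 0"
      using \<epsilon>l db_unit_even[OF even_len order_refl] by (simp add: \<epsilon>_def)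
    have ss: "P 0 0 s s - s \<in> dB B 0 0"
    proof (rule SD(6))
      have "P 0 0 s s \<in> S 0 0" using SD(7)[OF s(1) s(1)] by simp
      then show "P 0 0 s s - s \<in> S 0 0" by (rule grp_diff[OF SD(1) _ s(1)])
      have "mulN 0 0 (s N) (s N) - unt B N \<in> BN 0"
        using mul_cong[OF uV uV so so] unt_l[OF order_refl unt_V[OF order_refl]] by simp
      from grp_diff[OF grpN this so] show "(P 0 0 s s - s) N \<in> BN 0"
        by (rule mem_eq) (simp add: P_even[OF even_len order_refl])
    qed
    have "P 0 0 \<epsilon> \<epsilon> = P 0 0 s \<epsilon> - P 0 0 ?o \<epsilon>"
      using P_diff_l[OF dZ_C[OF sZ] dZ_C[OF \<epsilon>Z] dZ_C[OF oZ]] by (simp add: \<epsilon>_def)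
    also have "P 0 0 s \<epsilon> = P 0 0 s s - s"
      using P_diff_r[OF dZ_C[OF sZ] dZ_C[OF sZ] dZ_C[OF oZ]] db_unit_r[OF sZ] by (simp add: \<epsilon>_def)
    also have "P 0 0 ?o \<epsilon> = \<epsilon>" by (rule db_unit_l[OF \<epsilon>Z])
    finally have "(P 0 0 s s - s) - P 0 0 \<epsilon> \<epsilon> = \<epsilon>" by (simp add: fun_eq_iff)
    then have "\<epsilon> \<in> dB B 0 0" using grp_diff[OF grp_dB ss \<epsilon>\<epsilon>] by simp
    then have 1: "cl 0 0 s = cl 0 0 ?o" unfolding coset_eq_iff[OF grp_dB] \<epsilon>_def .
    have 2: "hc 0 (unt B N) = hc 0 (s N)"
      unfolding coset_eq_iff[OF grpN] by (rule mem_eq[OF grp_minus[OF grpN so]]) simp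
    show ?thesis using eq[of s 0 0] s(1) 1 2 by (simp add: Hdg_def H_DB_def Let_def db_coboundaries_eq)
  qed
  have hom: "bigraded_algebra_hom K (Hdg B) (H_DB \<alpha> B) \<sigma>"
    unfolding bigraded_algebra_hom_def
  proof (intro conjI allI ballI one)
    fix p n p' n' :: int and X Y c
    let ?m = "2 * p + n" and ?m' = "2 * p' + n'"
    assume "X \<in> piece (Hdg B) p n"
    then obtain s where s: "s \<in> S p ?m" "X = hc ?m (s N)" using rep by blast
    note sZ = subsetD[OF SD(2) s(1)]
    show "\<sigma> p n X \<in> piece (H_DB \<alpha> B) p n" unfolding s(2) eq[OF s(1)] H_piece using sZ by blast
    show "\<sigma> p n (scal (Hdg B) p n c X) = scal (H_DB \<alpha> B) p n c (\<sigma> p n X)" if c: "c \<in> K"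
      unfolding s(2) Hdg_scal eq[OF s(1)] H_scal[OF c] by (rule eq[OF SD(4)[OF c s(1)]])
    show "\<sigma> p n (X + Y) = \<sigma> p n X + \<sigma> p n Y" if Y: "Y \<in> piece (Hdg B) p n"
    proof -
      obtain t where t: "t \<in> S p ?m" "Y = hc ?m (t N)" using rep[OF Y] by blast
      show ?thesis
        unfolding s(2) t(2) coset_add[OF grpN] eq[OF s(1)] eq[OF t(1)] coset_add[OF grp_dB]
        using eq[OF grp_add[OF SD(1) s(1) t(1)]] by simp
    qed
    show "\<sigma> (p + p') (n + n') (times_of (Hdg B) p n p' n' X Y) = times_of (H_DB \<alpha> B) p n p' n' (\<sigma> p n X) (\<sigma> p' n' Y)"
      if Y: "Y \<in> piece (Hdg B) p' n'"
    proof -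
      obtain t where t: "t \<in> S p' ?m'" "Y = hc ?m' (t N)" using rep[OF Y] by blast
      note tZ = subsetD[OF SD(2) t(1)]
      have e: "?m + ?m' = 2 * (p + p') + (n + n')" by simp
      have st: "P ?m ?m' s t \<in> S (p + p') (2 * (p + p') + (n + n'))" using SD(7)[OF s(1) t(1)] unfolding e .
      show ?thesis
        unfolding s(2) t(2) eq[OF s(1)] eq[OF t(1)] H_times[OF sZ tZ] Hdg_times[OF last_Z[OF sZ] last_Z[OF tZ]]
          P_even[OF even_len order_refl, symmetric] e by (rule eq[OF st])
    qed
  qed
  have "db_proj B p n (\<sigma> p n X) = X" if X: "X \<in> piece (Hdg B) p n" for p n X
  proof -
    obtain s where s: "s \<in> S p (2 * p + n)" "X = hc (2 * p + n) (s N)" using rep[OF X] by blast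
    show ?thesis unfolding s(2) eq[OF s(1)] proj_cl ..
  qed
  then show ?thesis using hom by blast
qed

theorem split_square_zero_extension_if_splitting:
  "db_splitting K B P S ==> split_square_zero_extension K \<alpha> B"
  unfolding split_square_zero_extension_def
  by (intro conjI allI ballI proj_hom proj_surj J_bij J_add J_scale kernel_square_zero split_section)

end

section \<open>Mixed Hodge diagrams\<close>

lemma mixed_hodge_diagramD:
  assumes "mixed_hodge_diagram K A"
  shows "mixed_hodge_complex K A" "i \<le> len A ==> cdga (cpt A i) (dif A i) (mul A i) (unt A i)"
    "i \<le> len A ==> unt A i \<in> wt A i 0 0"
    "i \<le> len A ==> x \<in> wt A i k a ==> y \<in> wt A i l b ==> mul A i a b x y \<in> wt A i (k + l) (a + b)"
    "unt A 0 \<in> rat A 0" "x \<in> rat A a ==> y \<in> rat A b ==> mul A 0 a b x y \<in> rat A (a + b)"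
    "unt A (len A) \<in> hdg A 0 0"
    "x \<in> hdg A p a ==> y \<in> hdg A q b ==> mul A (len A) a b x y \<in> hdg A (p + q) (a + b)"
    "(r, t) \<in> arrows (len A) ==> cmp A r t 0 (unt A r) = unt A t"
    "(r, t) \<in> arrows (len A) ==> x \<in> cpt A r a ==> y \<in> cpt A r b ==>
       cmp A r t (a + b) (mul A r a b x y) = mul A t a b (cmp A r t a x) (cmp A r t b y)"
  using assms unfolding mixed_hodge_diagram_def by (blast | auto)+

lemma cdgaD:
  assumes "cdga V d \<mu> u"
  shows "x \<in> V a ==> linear_between (V b) (V (a + b)) (\<mu> a b x)"
    "y \<in> V b ==> linear_between (V a) (V (a + b)) (\<lambda>x. \<mu> a b x y)"
    "x \<in> V a ==> y \<in> V b ==> \<mu> a b x y = sgn_pow (a * b) (\<mu> b a y x)"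
    "x \<in> V a ==> y \<in> V b ==> d (a + b) (\<mu> a b x y) = \<mu> (a + 1) b (d a x) y + sgn_pow a (\<mu> a (b + 1) x (d b y))"
    "u \<in> V 0" "d 0 u = 0" "x \<in> V a ==> \<mu> 0 a u x = x"
  using assms unfolding cdga_def by (blast | simp)+

lemma mhc_mult_mhd:
  assumes K: "real_subfield K" and A: "mixed_hodge_diagram K A"
  shows "mhc_mult K A (\<lambda>_ _ _ _ _ _. 0)"
proof -
  note AD = mixed_hodge_diagramD[OF A]
  interpret C: mhc_core K A by (rule mhc_core_if_mixed_hodge_complex[OF K AD(1)])
  show ?thesis
  proof (intro mhc_mult.intro C.mhc_core_axioms mhc_mult_axioms.intro)
    fix i and a b n k l p p' :: int and x y :: 'a
    note cd = cdgaD[OF AD(2)]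
    show "linear_between (cpt A i b) (cpt A i (a + b)) (mul A i a b x)" if "i \<le> len A" "x \<in> cpt A i a" by (rule cd(1)[OF that])
    show "linear_between (cpt A i a) (cpt A i (a + b)) (\<lambda>x. mul A i a b x y)" if "i \<le> len A" "y \<in> cpt A i b" by (rule cd(2)[OF that])
    show "mul A i a b x y \<in> wt A i (k + l) (a + b)" if "i \<le> len A" "x \<in> wt A i k a" "y \<in> wt A i l b" by (rule AD(4)[OF that])
    show "mul A 0 a b x y \<in> rat A (a + b)" if "x \<in> rat A a" "y \<in> rat A b" by (rule AD(6)[OF that])
    show "mul A (len A) a b x y \<in> hdg A (p + p') (a + b)" if "x \<in> hdg A p a" "y \<in> hdg A p' b" by (rule AD(8)[OF that])
    show "dif A i n (mul A i a b x y) = mul A i (a + 1) b (dif A i a x) y + sgn_pow a (mul A i a (b + 1) x (dif A i b y))"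
      if "i \<le> len A" "x \<in> cpt A i a" "y \<in> cpt A i b" "n = a + b" unfolding that(4) by (rule cd(4)[OF that(1-3)])
    fix r q assume rq: "(r, q) \<in> arrows (len A)"
    note le = arrows_le[OF rq]
    show "linear_between (cpt A r b) (cpt A q (a + b - 1)) (\<lambda>_. 0)" "linear_between (cpt A r a) (cpt A q (a + b - 1)) (\<lambda>_. 0)"
      using C.V_zero[of q] le by (auto simp: linear_between_def)
    show "0 \<in> wt A q (k + l) (a + b - 1)" using grp_zero[OF C.grp_W] le by blast
    show "cmp A r q (a + b) (mul A r a b x y) = mul A q a b (cmp A r q a x) (cmp A r q b y) + dif A q (a + b - 1) 0 + 0 + sgn_pow a 0"
      if "x \<in> cpt A r a" "y \<in> cpt A r b"
      using AD(10)[OF rq that] C.d_zero[of q] le by (simp add: sgn_pow_def)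
  qed
qed

lemma db_splitting_unt:
  "db_splitting K (B\<lparr>unt := u\<rparr>) (dbM \<alpha> (B\<lparr>unt := u\<rparr>) h) S \<longleftrightarrow> db_splitting K B (dbM \<alpha> B h) S"
proof -
  have X: "dbX (B\<lparr>unt := u\<rparr>) = dbX B" by (simp add: dbX_def fun_eq_iff)
  have C: "dbC (B\<lparr>unt := u\<rparr>) = dbC B" by (simp add: dbC_def fun_eq_iff X)
  have D: "dbD (B\<lparr>unt := u\<rparr>) = dbD B" by (simp add: dbD_def fun_eq_iff)
  have "dZ (B\<lparr>unt := u\<rparr>) = dZ B" "dB (B\<lparr>unt := u\<rparr>) = dB B" by (simp_all add: dZ_def dB_def fun_eq_iff C D)
  moreover have "dbM \<alpha> (B\<lparr>unt := u\<rparr>) h = dbM \<alpha> B h" by (simp add: dbM_def fun_eq_iff)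
  moreover have "cobd (B\<lparr>unt := u\<rparr>) = cobd B" by (simp add: cobd_def fun_eq_iff)
  ultimately show ?thesis by (simp add: db_splitting_def)
qed

text \<open>Padding to \<open>L\<close> and then to \<open>N\<close> is padding to \<open>N\<close>,
  and the two diagrams differ only in the unit field.\<close>

lemma has_splitting_Cinf_of_mhd:
  assumes "len A \<le> L" "L \<le> N"
  shows "has_splitting K \<alpha> N (mhd_of (Cinf_of_mhd (pad_mhd L A))) (quadratic_part (Cinf_of_mhd (pad_mhd L A))) \<longleftrightarrow>
    has_splitting K \<alpha> N A (\<lambda>_ _ _ _ _ _. 0)"
proof -
  let ?D = "Cinf_of_mhd (pad_mhd L A)"
  have "pad_mhd N (mhd_of ?D) = (pad_mhd N A)\<lparr>unt := \<lambda>_. 0\<rparr>"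
    by (rule mhd.equality)
      (use assms in \<open>auto simp: pad_mhd_def pad_mhc_def mhd_of_def Cinf_of_mhd_def fun_eq_iff min.assoc min_absorb2\<close>)
  moreover have "pad_h (len (mhd_of ?D)) (quadratic_part ?D) = (\<lambda>_ _ _ _ _ _. 0)" "pad_h (len A) (\<lambda>_ _ _ _ _ _. 0 :: 'a) = (\<lambda>_ _ _ _ _ _. 0)"
    by (simp_all add: pad_h_def quadratic_part_def Cinf_of_mhd_def fun_eq_iff)
  ultimately show ?thesis by (simp add: has_splitting_def db_splitting_unt)
qed

lemma has_splitting_pad_cinf:
  assumes "len M \<le> L" "L \<le> N"
  shows "has_splitting K \<alpha> N (mhd_of (pad_cinf L M)) (quadratic_part (pad_cinf L M)) \<longleftrightarrow>
    has_splitting K \<alpha> N (mhd_of M) (quadratic_part M)"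
proof -
  have "pad_mhd N (mhd_of (pad_cinf L M)) = pad_mhd N (mhd_of M)"
    by (rule mhd.equality)
      (use assms in \<open>auto simp: pad_mhd_def pad_mhc_def mhd_of_def pad_cinf_def fun_eq_iff min.assoc min_absorb2\<close>)
  moreover have "pad_h (len (mhd_of (pad_cinf L M))) (quadratic_part (pad_cinf L M)) = pad_h (len (mhd_of M)) (quadratic_part M)"
    using assms(1) by (auto simp: pad_h_def quadratic_part_def pad_cinf_def pad_mhc_def fun_eq_iff)
  ultimately show ?thesis by (simp add: has_splitting_def)
qed

text \<open>Identities are removed two at a time by \<open>pad_two_transfer\<close>, which keeps the
  length even.\<close>

lemma has_splitting_down:
  assumes A: "mhc_mult K A h" and N: "len A \<le> N" "even N" and S: "has_splitting K \<alpha> (N + 2 * k) A h"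
  shows "has_splitting K \<alpha> N A h"
  using S
proof (induction k)
  case (Suc k)
  have "has_splitting K \<alpha> (N + 2 * k) A h \<longleftrightarrow> has_splitting K \<alpha> (Suc (Suc (N + 2 * k))) A h"
    by (rule has_splitting_transfer[OF pad_two_transfer[OF A]]) (use N in auto)
  then show ?case using Suc by simp
qed simp

text \<open>Padding to the length already present alters only values outside the index
  range.\<close>

lemma db_splitting_pad_len:
  assumes ev: "even (len A)"
  shows "db_splitting K (pad_mhd (len A) A) (dbM \<alpha> (pad_mhd (len A) A) (\<lambda>_ _ _ _ _ _. 0)) S \<longleftrightarrow>
    db_splitting K A (dbM \<alpha> A (\<lambda>_ _ _ _ _ _. 0)) S"
proof -
  let ?B = "pad_mhd (len A) A"
  have odd: "Suc i \<le> len A" if "odd i" "i \<le> len A" for i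
    using that ev by (metis Suc_leI le_neq_implies_less)
  have X: "dbX ?B p i m = dbX A p i m" if "i \<le> len A" for p i m using that by (simp add: dbX_def min_absorb1)
  have C: "dbC ?B = dbC A" by (auto simp: dbC_def fun_eq_iff X)
  have D: "dbD ?B = dbD A" using odd by (auto simp: dbD_def fun_eq_iff min_absorb1)
  have "dZ ?B = dZ A" "dB ?B = dB A" by (simp_all add: dZ_def dB_def fun_eq_iff C D)
  moreover have "dbM \<alpha> ?B (\<lambda>_ _ _ _ _ _. 0) = dbM \<alpha> A (\<lambda>_ _ _ _ _ _. 0)"
    using odd by (auto simp: dbM_def fun_eq_iff min_absorb1)
  moreover have "cobd ?B (len A) = cobd A (len A)" by (simp add: cobd_def fun_eq_iff)
  ultimately show ?thesis by (simp add: db_splitting_def)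
qed

lemma db_mhd_if_mixed_hodge_diagram:
  assumes K: "real_subfield K" and A: "mixed_hodge_diagram K A" and B: "B = A \<and> even (len A) \<or> B = pad_mhd N A \<and> len A \<le> N \<and> even N"
  shows "db_mhd K B"
proof -
  note AD = mixed_hodge_diagramD[OF A]
  interpret C: mhc_mult K A "\<lambda>_ _ _ _ _ _. 0" by (rule mhc_mult_mhd[OF K A])
  have "pad_h (len A) (\<lambda>_ _ _ _ _ _. 0 :: 'a) = (\<lambda>_ _ _ _ _ _. 0)" by (simp add: pad_h_def fun_eq_iff)
  then have "mhc_mult K B (\<lambda>_ _ _ _ _ _. 0)" "even (len B)"
    using B C.mhc_mult_axioms mhc_mult_pad[OF C.mhc_mult_axioms, of N] by auto
  then have alg: "db_alg K B (\<lambda>_ _ _ _ _ _. 0)"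
    by (intro db_alg.intro even_core.intro even_core_axioms.intro) (auto simp: mhc_mult_def)
  have r: "mul A i a 0 x (unt A i) = x" if i: "i \<le> len A" and x: "x \<in> cpt A i a" for i a x
    using cdgaD(3)[OF AD(2)[OF i] x cdgaD(5)[OF AD(2)[OF i]]] cdgaD(7)[OF AD(2)[OF i] x] by (simp add: sgn_pow_def)
  have m: "min i (len A) \<le> len A" for i by simp
  show ?thesis
    using B
  proof
    assume B: "B = A \<and> even (len A)"
    show ?thesis
      by (intro db_mhd.intro alg db_mhd_axioms.intro)
        (use B AD(3,5,7,9) cdgaD(6,7)[OF AD(2)] r in auto)
  next
    assume B: "B = pad_mhd N A \<and> len A \<le> N \<and> even N"
    have mN: "min N (len A) = len A" using B by simp
    have c: "cmp B r q 0 (unt B r) = unt B q" if "(r, q) \<in> arrows N" for r q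
      using arrows_pad[OF that, of "len A"] AD(9)[of r q] B by (auto simp: min_absorb1)
    show ?thesis
      by (intro db_mhd.intro alg db_mhd_axioms.intro)
        (use B c mN AD(5,7) AD(3)[OF m] cdgaD(6,7)[OF AD(2)[OF m]] r[OF m] in auto)
  qed
qed

theorem corollary6p3:
  fixes K :: "complex set" and \<alpha> :: real
    and A :: "'a::complex_vector mhd"
    and H :: "'b::complex_vector mhs_algebra" and \<kappa> :: "int \<Rightarrow> 'a \<Rightarrow> 'b"
    and M :: "'b cinf"
    and L :: nat and D D' :: "'c::complex_vector cinf"
  assumes K: "real_subfield K"
    and A: "mixed_hodge_diagram K A"
    and H: "is_cohomology A \<kappa> H"
    and M: "Cinf_structure_on K H M"
    and L: "len A \<le> L"
    and quasi_iso: "quasi_iso_step K (Cinf_of_mhd (pad_mhd L A)) D"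
      "(quasi_iso_step K)\<^sup>*\<^sup>* D D'"
      "quasi_iso_step K D' (pad_cinf L M)"
    and theta3_trivial: "theta3 H M = harr_db_coboundaries H 3 (- 1)"
    and \<alpha>: "0 \<le> \<alpha>" "\<alpha> \<le> 1" "complex_of_real \<alpha> \<in> K"
  shows "split_square_zero_extension K \<alpha> (even_length A)"
proof -
  note mult = mhc_mult_mhd[OF K A]
  interpret C: mhc_mult K A "\<lambda>_ _ _ _ _ _. 0" by (rule mult)
  \<comment> \<open>\<open>N\<close> is an even length that accommodates every diagram of the
    zigzag, and \<open>N0\<close> is the length of \<open>even_length A\<close>; they differ by an
    even number of identities.\<close>
  define N where "N = (if even L then L else L + 1)"
  define N0 where "N0 = (if even (len A) then len A else len A + 1)"
  have N: "L \<le> N" "even N" "2 \<le> N"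
    using L C.len_pos by (auto simp: N_def elim!: evenE)
  have N0: "len A \<le> N0" "even N0" "N0 \<le> N"
    using L by (auto simp: N0_def N_def le_less Suc_le_eq)
  have lM: "len M = 1" using M by (simp add: Cinf_structure_on_def)
  have "has_splitting K \<alpha> N (mhd_of (pad_cinf L M)) (quadratic_part (pad_cinf L M))"
    using has_splitting_pad_cinf[of M L N K \<alpha>] formal_model_splitting[OF K M theta3_trivial N(3,2)] lM C.len_pos L N(1) by simp
  moreover have "len (pad_cinf L M) = L" by (simp add: pad_cinf_def pad_mhc_def)
  ultimately have D': "len D' = L" "has_splitting K \<alpha> N (mhd_of D') (quadratic_part D')"
    using quasi_iso_step_len[OF quasi_iso(3)] quasi_iso_step_splitting[OF K quasi_iso(3), where N = N and \<alpha> = \<alpha>] N by simp_all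
  \<comment> \<open>The splitting travels from the model back towards \<open>A\<close>, so the
    induction runs from the end \<open>D'\<close> of the chain to its start
    \<open>D\<close>.\<close>
  have D: "len D = L \<and> has_splitting K \<alpha> N (mhd_of D) (quadratic_part D)"
    using quasi_iso(2)
  proof (induction rule: converse_rtranclp_induct)
    case base
    show ?case using D' by simp
  next
    case (step E E')
    then show ?case
      using quasi_iso_step_len[OF step(1)] quasi_iso_step_splitting[OF K step(1), where N = N and \<alpha> = \<alpha>] N by simp
  qed
  have "has_splitting K \<alpha> N (mhd_of (Cinf_of_mhd (pad_mhd L A))) (quadratic_part (Cinf_of_mhd (pad_mhd L A)))"
    using quasi_iso_step_len[OF quasi_iso(1)] quasi_iso_step_splitting[OF K quasi_iso(1), where N = N and \<alpha> = \<alpha>] D N by simp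
  then have "has_splitting K \<alpha> N A (\<lambda>_ _ _ _ _ _. 0)" using has_splitting_Cinf_of_mhd[OF L N(1)] by blast
  moreover obtain k where "N = N0 + 2 * k" using N0 N(2) by (metis dvd_diff_nat evenE le_add_diff_inverse)
  ultimately have "has_splitting K \<alpha> N0 A (\<lambda>_ _ _ _ _ _. 0)" using has_splitting_down[OF mult N0(1,2)] by blast
  moreover have "pad_h (len A) (\<lambda>_ _ _ _ _ _. 0 :: 'a) = (\<lambda>_ _ _ _ _ _. 0)" by (simp add: pad_h_def fun_eq_iff)
  ultimately obtain S where S: "db_splitting K (pad_mhd N0 A) (dbM \<alpha> (pad_mhd N0 A) (\<lambda>_ _ _ _ _ _. 0)) S"
    unfolding has_splitting_def by auto
  have "\<exists>S. db_splitting K (even_length A) (dbM \<alpha> (even_length A) (\<lambda>_ _ _ _ _ _. 0)) S"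
    using S db_splitting_pad_len[of A] by (auto simp: even_length_def N0_def)
  moreover have "db_mhd K (even_length A)"
    by (rule db_mhd_if_mixed_hodge_diagram[OF K A, where N = "len A + 1"]) (auto simp: even_length_def)
  ultimately show ?thesis using db_mhd.split_square_zero_extension_if_splitting by blast
qed

end
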